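(* Let $\alpha=\frac d2$, $a\in\mathbb{R}\setminus\{0\}$, $n\ge2$, and let $\beta\in\mathbb{N}^n$ satisfy $|\beta|=\beta_1+\dots+\beta_n\ge3$, $\beta_1\ne0$ and $\beta_2\ne0$. Then: (i) $$\int e^{a\int_{\mathbb{T}^d}:\Phi^\beta:(x)\,dx}\,\mu_\alpha^{\otimes n}(d\Phi)=\infty .$$ (ii) $$\int e^{a\int_{\mathbb{T}^d}:\Phi^\beta:(x)\,dx-K\left|\int_{\mathbb{T}^d}:|\Phi|^2:(x)\,dx\right|^b}\,\mu_\alpha^{\otimes n}(d\Phi)<\infty$$ holds for some $K,b>0$ if and only if either $|\beta|=3$, or both $a<0$ and $\beta=(2,2,0,\dots,0)$.
   Context: Notation. $\mathbb{N}=\{0,1,2,\dots\}$, $\mathbb{T}^d=(\mathbb{R}/\mathbb{Z})^d$, $e_l(x)=e^{2\pi\sqrt{-1}\,l\cdot x}$ and $\hat f(l)=\int_{\mathbb{T}^d}f\,\overline{e_l}\,dx$ for $l\in\mathbb{Z}^d$; $(1-\Delta)^s$ denotes the Fourier multiplier $(1+|l|^2)^s$. $\mu_\alpha$ is the centered Gaussian measure on real-valued distributions $\mathcal{D}'(\mathbb{T}^d)$ with covariance $(1-\Delta)^{-\alpha}$, i.e. the law of $\sum_{l}g_l(1+|l|^2)^{-\alpha/2}e_l$ with $g_l$ standard complex Gaussians ($E|g_l|^2=1$), $g_{-l}=\overline{g_l}$, $g_0$ real, otherwise independent. $\mu_\alpha^{\otimes n}$ is the $n$-fold product measure on $n$-tuples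 $\Phi=(\Phi_1,\dots,\Phi_n)$ of distributions. Wick renormalization. $P_Nf=\sum_{|l|\le N}\hat f(l)e_l$ (applied componentwise to $\Phi$), $\sigma_{\alpha,N}=\sum_{l\in\mathbb{Z}^d,|l|\le N}(1+|l|^2)^{-\alpha}$. The Hermite polynomials $H_j(x;\sigma)$ are defined by $e^{tx-\sigma t^2/2}=\sum_{j\ge0}\frac{t^j}{j!}H_j(x;\sigma)$, and $H_\beta(\boldsymbol{x};\sigma)=\prod_{i=1}^nH_{\beta_i}(x_i;\sigma)$. For $\alpha=\frac d2$, $\int_{\mathbb{T}^d}:\Phi^\beta:(x)\,dx$ denotes the $\mu_\alpha^{\otimes n}$-a.s. limit as $N\to\infty$ of $\int_{\mathbb{T}^d}H_\beta(P_N\Phi;\sigma_{\alpha,N})\,dx$, and $\int_{\mathbb{T}^d}:|\Phi|^2:(x)\,dx$ denotes the $\mu_\alpha^{\otimes n}$-a.s. limit of $\sum_{i=1}^n\int_{\mathbb{T}^d}H_2(P_N\Phi_i;\sigma_{\alpha,N})\,dx$. *)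

theory Defs
  imports "HOL-Probability.Probability" "HOL-Complex_Analysis.Complex_Analysis"
begin

text \<open>
  The torus \<open>(\<real>/\<int>)\<^sup>d\<close> has dimension \<open>d = CARD('d)\<close>. Functions on it are \<open>\<int>\<^sup>d\<close>-periodic functions
  on \<open>real ^ 'd\<close>, and integrals over it are integrals over the unit cube.
\<close>

definition rvec :: "int ^ 'd \<Rightarrow> real ^ 'd" where
  "rvec l = (\<chi> i. real_of_int (l $ i))"

definition torus_integral ::
    "(real ^ 'd \<Rightarrow> 'b::{banach, second_countable_topology}) \<Rightarrow> 'b" where
  "torus_integral f = (LINT x:cbox 0 1|lborel. f x)"

definition fourier_char :: "int ^ 'd \<Rightarrow> real ^ 'd \<Rightarrow> complex" where
  "fourier_char l x = cis (2 * pi * (rvec l \<bullet> x))"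

definition bracket2 :: "int ^ 'd \<Rightarrow> real" where
  "bracket2 l = 1 + (norm (rvec l))\<^sup>2"

definition lattice_ball :: "nat \<Rightarrow> (int ^ 'd) set" where
  "lattice_ball N = {l. norm (rvec l) \<le> real N}"

lemma finite_lattice_ball: "finite (lattice_ball N :: (int ^ 'd) set)"
proof -
  have "l $ i \<in> {- int N..int N}" if "l \<in> lattice_ball N" for l :: "int ^ 'd" and i
  proof -
    have "\<bar>real_of_int (l $ i)\<bar> \<le> norm (rvec l)"
      using component_le_norm_cart[of "rvec l" i] by (simp add: rvec_def)
    then have "\<bar>real_of_int (l $ i)\<bar> \<le> real N"
      using that by (simp add: lattice_ball_def)
    then show ?thesis by auto
  qed
  then have "vec_nth ` (lattice_ball N :: (int ^ 'd) set) \<subseteq> PiE UNIV (\<lambda>_. {- int N..int N})"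
    by auto
  then have "finite (vec_nth ` (lattice_ball N :: (int ^ 'd) set))"
    by (rule finite_subset) (intro finite_PiE; simp)
  moreover have "inj_on vec_nth (lattice_ball N :: (int ^ 'd) set)"
    by (auto simp: inj_on_def vec_nth_inject)
  ultimately show ?thesis by (rule finite_imageD)
qed


section \<open>Real-valued distributions on the torus\<close>

definition pdiff :: "'d \<Rightarrow> (real ^ 'd \<Rightarrow> complex) \<Rightarrow> real ^ 'd \<Rightarrow> complex" where
  "pdiff i f x = frechet_derivative f (at x) (axis i 1)"

text \<open>
  \<open>foldr pdiff is f\<close> is the iterated partial derivative of \<open>f\<close> along the list \<open>is\<close> of directions;
  \<open>f\<close> is smooth iff all of these are differentiable.
\<close>

definition test_functions :: "(real ^ 'd \<Rightarrow> complex) set" where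
  "test_functions = {f. (\<forall>l x. f (x + rvec l) = f x) \<and>
     (\<forall>is x. foldr pdiff is f differentiable (at x))}"

type_synonym 'd distribution = "(real ^ 'd \<Rightarrow> complex) \<Rightarrow> complex"

text \<open>
  A distribution is extended linearly to complex test functions; it is real-valued iff it
  commutes with complex conjugation. Continuity is the usual finite-order estimate by the
  seminorms of \<open>C\<^sup>\<infinity>\<close>. Functionals are \<open>undefined\<close> off the test functions, so that equality of
  distributions is equality of HOL functions.
\<close>

definition real_distributions :: "('d::finite) distribution set" where
  "real_distributions = {u \<in> extensional test_functions.
     (\<forall>f\<in>test_functions. \<forall>g\<in>test_functions. u (\<lambda>x. f x + g x) = u f + u g) \<and>
     (\<forall>c. \<forall>f\<in>test_functions. u (\<lambda>x. c * f x) = c * u f) \<and>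
     (\<forall>f\<in>test_functions. u (\<lambda>x. cnj (f x)) = cnj (u f)) \<and>
     (\<exists>C m. \<forall>f\<in>test_functions. \<forall>B.
        (\<forall>is x. length is \<le> m \<longrightarrow> norm (foldr pdiff is f x) \<le> B) \<longrightarrow> norm (u f) \<le> C * B)}"

text \<open>The \<open>\<sigma>\<close>-algebra on distributions is generated by the evaluations at test functions.\<close>

definition distribution_space :: "('d::finite) distribution measure" where
  "distribution_space =
     restrict_space (PiM test_functions (\<lambda>_. borel)) real_distributions"

definition fourier_coeff :: "('d::finite) distribution \<Rightarrow> int ^ 'd \<Rightarrow> complex" where
  "fourier_coeff u l = u (\<lambda>x. cnj (fourier_char l x))"

definition fourier_trunc :: "nat \<Rightarrow> ('d::finite) distribution \<Rightarrow> real ^ 'd \<Rightarrow> complex" where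
  "fourier_trunc N u x = (\<Sum>l\<in>lattice_ball N. fourier_coeff u l * fourier_char l x)"


section \<open>The Gaussian measure\<close>

definition normal_family :: "((int ^ 'd) \<times> bool \<Rightarrow> real) measure" where
  "normal_family = PiM UNIV (\<lambda>_. density lborel std_normal_density)"

text \<open>
  With \<open>X l = \<omega> (l, True)\<close> and \<open>Y l = \<omega> (l, False)\<close> independent standard real Gaussians, the
  coefficients below satisfy \<open>g (- l) = cnj (g l)\<close>, \<open>g 0 = X 0\<close>, and, for \<open>l \<noteq> 0\<close>, the real and
  imaginary parts of \<open>g l\<close> are independent with variance \<open>1/2\<close> each. Since \<open>g l\<close> depends only on
  the variables with index \<open>l\<close> or \<open>- l\<close>, the \<open>g l\<close> are otherwise independent.
\<close>

definition gauss_coeff :: "((int ^ 'd) \<times> bool \<Rightarrow> real) \<Rightarrow> int ^ 'd \<Rightarrow> complex" where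
  "gauss_coeff \<omega> l =
     Complex ((\<omega> (l, True) + \<omega> (- l, True)) / 2) ((\<omega> (l, False) - \<omega> (- l, False)) / 2)"

definition gauss_series ::
    "real \<Rightarrow> ((int ^ 'd) \<times> bool \<Rightarrow> real) \<Rightarrow> 'd distribution" where
  "gauss_series \<alpha> \<omega> = (\<lambda>f\<in>test_functions.
     \<Sum>\<^sub>\<infinity>l. gauss_coeff \<omega> l * of_real (bracket2 l powr (- \<alpha> / 2)) *
         torus_integral (\<lambda>x. fourier_char l x * f x))"

text \<open>
  The series represents a distribution for almost every \<open>\<omega>\<close>; on the exceptional null set the
  random distribution is set to zero.
\<close>

definition random_distribution ::
    "real \<Rightarrow> ((int ^ 'd) \<times> bool \<Rightarrow> real) \<Rightarrow> 'd distribution" where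
  "random_distribution \<alpha> \<omega> =
     (if gauss_series \<alpha> \<omega> \<in> real_distributions then gauss_series \<alpha> \<omega>
      else (\<lambda>f\<in>test_functions. 0))"

definition gauss_measure :: "real \<Rightarrow> ('d::finite) distribution measure" where
  "gauss_measure \<alpha> = distr normal_family distribution_space (random_distribution \<alpha>)"

text \<open>Tuples \<open>(\<Phi>\<^sub>1, \<dots>, \<Phi>\<^sub>n)\<close> are functions on the index set \<open>{1..n}\<close>.\<close>

definition gauss_measure_prod :: "real \<Rightarrow> nat \<Rightarrow> (nat \<Rightarrow> ('d::finite) distribution) measure" where
  "gauss_measure_prod \<alpha> n = PiM {1..n} (\<lambda>_. gauss_measure \<alpha>)"


section \<open>Wick renormalization\<close>

definition hermite :: "nat \<Rightarrow> real \<Rightarrow> real \<Rightarrow> real" where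
  "hermite j x \<sigma> =
     (THE h. \<forall>t. (\<lambda>k. t ^ k / fact k * h k) sums exp (t * x - \<sigma> * t\<^sup>2 / 2)) j"

lemma hermite_sums:
  "(\<lambda>k. t ^ k / fact k * hermite k x \<sigma>) sums exp (t * x - \<sigma> * t\<^sup>2 / 2)"
proof -
  define E where "E t = exp (t * x - \<sigma> * t\<^sup>2 / 2)" for t
  define a where "a k = x ^ k / fact k" for k :: nat
  define b where "b k = (if even k then (- \<sigma> / 2) ^ (k div 2) / fact (k div 2) else 0)" for k :: nat
  define h where "h k = fact k * (\<Sum>i\<le>k. a i * b (k - i))" for k
  have sums_E: "(\<lambda>k. t ^ k / fact k * h k) sums E t" for t
  proof -
    have a: "(\<lambda>k. a k * t ^ k) sums exp (t * x)"
      using exp_converges[of "t * x"]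
      by (simp add: a_def power_mult_distrib field_simps scaleR_conv_of_real)
    have na: "summable (\<lambda>k. norm (a k * t ^ k))"
      using summable_norm_exp[of "t * x"]
      by (simp add: a_def power_mult_distrib field_simps scaleR_conv_of_real abs_mult power_abs)
    have mono: "strict_mono (\<lambda>k::nat. 2 * k)"
      by (simp add: strict_mono_def)
    have odd: "k \<notin> range (\<lambda>k. 2 * k) \<Longrightarrow> b k * t ^ k = 0" for k
      by (auto simp: b_def elim!: evenE)
    have even_term: "b (2 * k) * t ^ (2 * k) = (- \<sigma> * t\<^sup>2 / 2) ^ k /\<^sub>R fact k" for k
    proof -
      have "b (2 * k) * t ^ (2 * k) = (- \<sigma> / 2) ^ k * (t\<^sup>2) ^ k / fact k"
        by (simp add: b_def power_mult)
      also have "(- \<sigma> / 2) ^ k * (t\<^sup>2) ^ k = (- \<sigma> * t\<^sup>2 / 2) ^ k"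
        by (simp flip: power_mult_distrib)
      finally show ?thesis
        by (simp only: scaleR_conv_of_real of_real_inverse of_real_fact divide_inverse mult.commute)
    qed
    have b: "(\<lambda>k. b k * t ^ k) sums exp (- \<sigma> * t\<^sup>2 / 2)"
      using exp_converges[of "- \<sigma> * t\<^sup>2 / 2"]
        sums_mono_reindex[OF mono, of "\<lambda>k. b k * t ^ k"] odd even_term by simp
    have "(\<lambda>k. norm (b (2 * k) * t ^ (2 * k))) sums (\<Sum>k. norm ((- \<sigma> * t\<^sup>2 / 2) ^ k /\<^sub>R fact k))"
      unfolding even_term by (rule summable_sums[OF summable_norm_exp])
    then have nb: "summable (\<lambda>k. norm (b k * t ^ k))"
      using sums_mono_reindex[OF mono, of "\<lambda>k. norm (b k * t ^ k)"] odd
      by (auto simp: summable_def)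
    have "(\<lambda>k. \<Sum>i\<le>k. (a i * t ^ i) * (b (k - i) * t ^ (k - i))) sums
        (exp (t * x) * exp (- \<sigma> * t\<^sup>2 / 2))"
      using Cauchy_product_sums[OF na nb] sums_unique[OF a] sums_unique[OF b] by simp
    moreover have "(\<Sum>i\<le>k. (a i * t ^ i) * (b (k - i) * t ^ (k - i))) = t ^ k / fact k * h k" for k
      unfolding h_def by (simp add: sum_distrib_left)
        (intro sum.cong refl, simp add: algebra_simps flip: power_add)
    ultimately show ?thesis
      by (simp add: E_def flip: exp_add)
  qed
  have unique: "h1 = h2"
    if h1: "\<forall>t. (\<lambda>k. t ^ k / fact k * h1 k) sums E t"
      and h2: "\<forall>t. (\<lambda>k. t ^ k / fact k * h2 k) sums E t" for h1 h2
  proof (rule ext, rule ccontr)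
    fix m assume m: "h1 m \<noteq> h2 m"
    define c where "c k = (h1 k - h2 k) / fact k" for k
    have c: "(\<lambda>k. c k * t ^ k) sums 0" for t
      using sums_diff[OF h1[rule_format, of t] h2[rule_format, of t]]
      by (simp add: c_def field_simps)
    have "c 0 = 0"
      using sums_unique2[OF c[of 0] powser_sums_zero[of c]] by simp
    moreover have "c m \<noteq> 0"
      using m by (simp add: c_def)
    ultimately have "0 < m" by (cases m) auto
    have c': "(\<lambda>k. c k * (t - 0) ^ k) sums 0" for t
      using c by simp
    show False
    proof (rule powser_0_nonzero[OF zero_less_one c' refl \<open>c m \<noteq> 0\<close> \<open>0 < m\<close>])
      fix s :: real
      assume "0 < s" and s: "\<And>z::real. z \<in> cball 0 s - {0} \<Longrightarrow> (0::real) \<noteq> 0"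
      then have "s \<in> cball 0 s - {0}" by auto
      from s[OF this] show False by simp
    qed
  qed
  have "(THE h. \<forall>t. (\<lambda>k. t ^ k / fact k * h k) sums E t) = h"
    using sums_E unique by (intro the_equality) auto
  then show ?thesis
    using sums_E[of t] by (simp add: hermite_def E_def)
qed

definition hermite_multi :: "nat \<Rightarrow> (nat \<Rightarrow> nat) \<Rightarrow> (nat \<Rightarrow> real) \<Rightarrow> real \<Rightarrow> real" where
  "hermite_multi n \<beta> x \<sigma> = (\<Prod>i=1..n. hermite (\<beta> i) (x i) \<sigma>)"

definition wick_var :: "('d::finite) itself \<Rightarrow> real \<Rightarrow> nat \<Rightarrow> real" where
  "wick_var _ \<alpha> N = (\<Sum>l\<in>(lattice_ball N :: (int ^ 'd) set). bracket2 l powr (- \<alpha>))"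

text \<open>
  The truncation of a real-valued distribution is real, so that \<open>Re\<close> below only changes types.
  The limits exist almost surely for \<open>\<alpha> = d/2\<close>.
\<close>

definition wick_integral ::
    "real \<Rightarrow> nat \<Rightarrow> (nat \<Rightarrow> nat) \<Rightarrow> (nat \<Rightarrow> ('d::finite) distribution) \<Rightarrow> real" where
  "wick_integral \<alpha> n \<beta> \<Phi> = lim (\<lambda>N. torus_integral (\<lambda>x.
     hermite_multi n \<beta> (\<lambda>i. Re (fourier_trunc N (\<Phi> i) x)) (wick_var TYPE('d) \<alpha> N)))"

definition wick_mass :: "real \<Rightarrow> nat \<Rightarrow> (nat \<Rightarrow> ('d::finite) distribution) \<Rightarrow> real" where
  "wick_mass \<alpha> n \<Phi> = lim (\<lambda>N. \<Sum>i=1..n. torus_integral (\<lambda>x.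
     hermite 2 (Re (fourier_trunc N (\<Phi> i) x)) (wick_var TYPE('d) \<alpha> N)))"

end

theory Submission
  imports Defs
begin

text \<open>
  In real coordinates a sample of the Gaussian field is a family \<open>om\<close> of independent standard
  Gaussians, indexed by component and Fourier mode. A truncated Wick integral is then a polynomial
  of degree \<open>k = |\<beta>|\<close> in finitely many of them. Averaging over the modes beyond a truncation
  reproduces the truncated integral (\<open>wickX_martingale\<close>), and its increments decay at a polynomial
  rate in the truncation level (\<open>wickX_rate\<close>). Hypercontractivity (\<open>gpoly_hypercontractive\<close>) turns
  this second-moment rate into bounds for all moments, with constants depending only on the degree and
  the order of the moment. This gives almost sure convergence and tail bounds for the remainders (locale \<open>chaos_sequence\<close>).
  The variance \<open>\<sigma>\<close> of the truncated field grows more slowly than any power of the truncation level, but without bound;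
  every part of the argument compares powers of \<open>\<sigma>\<close>.

  Integrability with a cutoff. On the event that the exponent exceeds \<open>t\<close> and the Wick mass is at
  most \<open>m\<close>, the fields are truncated at a power of \<open>t\<close>; the remainders are negligible. For \<open>k = 3\<close>
  some component enters linearly. Given the others, the truncated integral is Gaussian with
  variance at most \<open>\<sigma>\<close> times the square of their mass, which is of order \<open>m + \<sigma>\<close> (\<open>cubic_head\<close>). For \<open>a < 0\<close> and
  \<open>\<beta> = (2, 2, 0, \<dots>)\<close> the density \<open>(\<phi>\<^sub>1\<^sup>2 - \<sigma>) (\<phi>\<^sub>2\<^sup>2 - \<sigma>)\<close> is bounded below by the mass
  (\<open>quartic_head\<close>). In both cases the tail is \<open>exp (- 2 t)\<close> once \<open>t\<close> exceeds a constant times \<open>m\<^sup>4\<close>, so that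
  subtracting a large multiple of the fourth power of the mass makes the exponential integrable.

  Divergence. The integral is bounded below by its part over a small box around a chosen profile of
  finitely many modes. By Jensen's inequality and the martingale property the exponent may be
  replaced there by its truncation (\<open>box_lower_bound\<close>), and the Wick mass in the box has
  bounded moments, because its increments are independent of the box (\<open>box_mass_moment\<close>). It
  remains to choose profiles whose gain beats their Gaussian cost. A direction \<open>u\<close> with offset
  \<open>v\<close> in which \<open>a\<close> times the Hermite product grows exists with growth of order 2 always, and
  of order 4 outside the exceptional cases (\<open>growth_direction\<close>). Without a cutoff, constant
  profiles of size \<open>T\<close> gain \<open>\<sigma>\<^sup>k\<^sup>/\<^sup>2 T\<^sup>2\<close> at cost \<open>\<sigma> T\<^sup>2\<close>. With a cutoff, the mass of the profile has to
  match its renormalization \<open>n \<sigma>\<close>; concentrating it at scale \<open>1 / m\<close> gains \<open>\<sigma>\<^sup>2 m\<^sup>d\<close> at a cost of order \<open>\<sigma> m\<^sup>d\<close>.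
\<close>

section \<open>Hermite polynomials\<close>

lemma powser_sums_zero_imp_zero:
  fixes c :: "nat => real"
  assumes "\<And>t. (\<lambda>k. c k * t ^ k) sums 0"
  shows "c m = 0"
proof (rule ccontr)
  assume m: "c m ~= 0"
  have "c 0 = 0"
    using sums_unique2[OF assms[of 0] powser_sums_zero[of c]] by simp
  with m have "0 < m" by (cases m) auto
  have c': "(\<lambda>k. c k * (t - 0) ^ k) sums 0" for t
    using assms by simp
  show False
  proof (rule powser_0_nonzero[OF zero_less_one c' refl m \<open>0 < m\<close>])
    fix s :: real
    assume "0 < s" and s: "\<And>z::real. z \<in> cball 0 s - {0} ==> (0::real) ~= 0"
    then have "s \<in> cball 0 s - {0}" by auto
    from s[OF this] show False by simp
  qed
qed

lemma hermite_0 [simp]: "hermite 0 x \<sigma> = 1"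
proof -
  have "(\<lambda>k. hermite k x \<sigma> / fact k * 0 ^ k) sums 1"
    using hermite_sums[of 0 x \<sigma>] by (simp add: field_simps)
  then show ?thesis
    using sums_unique2[OF _ powser_sums_zero[of "\<lambda>k. hermite k x \<sigma> / fact k"]] by fastforce
qed

text \<open>
  The generating function \<open>E\<close> satisfies \<open>E' = (x - \<sigma> t) E\<close>; comparing coefficients
  gives the three-term recursion.
\<close>

lemma hermite_recursion:
  shows hermite_1 [simp]: "hermite (Suc 0) x \<sigma> = x"
    and hermite_Suc_Suc: "hermite (Suc (Suc k)) x \<sigma> = x * hermite (Suc k) x \<sigma> - real (Suc k) * \<sigma> * hermite k x \<sigma>"
proof -
  define c where "c k = hermite k x \<sigma> / fact k" for k
  define E where "E t = exp (t * x - \<sigma> * t\<^sup>2 / 2)" for t :: real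
  define b where "b k = (case k of 0 => 0 | Suc j => \<sigma> * c j)" for k
  have c: "(\<lambda>k. c k * t ^ k) sums E t" for t
    using hermite_sums[of t x \<sigma>] by (simp add: c_def E_def mult.commute)
  then have sm: "summable (\<lambda>k. c k * t ^ k)" for t
    by (auto simp: sums_iff)
  have "((\<lambda>t. \<Sum>n. c n * t ^ n) has_field_derivative (\<Sum>n. diffs c n * t ^ n)) (at t)" for t
    by (rule termdiffs_strong_converges_everywhere[OF sm])
  moreover have "(\<lambda>t. \<Sum>n. c n * t ^ n) = E"
    using c by (auto simp: sums_iff)
  moreover have "(E has_field_derivative (x - \<sigma> * t) * E t) (at t)" for t
    unfolding E_def by (auto intro!: derivative_eq_intros)
  ultimately have "(\<Sum>n. diffs c n * t ^ n) = (x - \<sigma> * t) * E t" for t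
    using DERIV_unique by metis
  moreover have "summable (\<lambda>n. diffs c n * t ^ n)" for t
    by (rule termdiff_converges_all[OF sm])
  ultimately have d: "(\<lambda>n. diffs c n * t ^ n) sums ((x - \<sigma> * t) * E t)" for t
    by (auto simp: sums_iff)
  have b: "(\<lambda>n. b n * t ^ n) sums (\<sigma> * t * E t)" for t
  proof -
    have "(\<lambda>n. b (Suc n) * t ^ Suc n) sums (\<sigma> * t * E t)"
      using sums_mult[OF c[of t], of "\<sigma> * t"] by (simp add: b_def mult_ac)
    then show ?thesis
      by (subst (asm) sums_Suc_iff) (simp add: b_def)
  qed
  have "(\<lambda>n. (diffs c n - x * c n + b n) * t ^ n) sums 0" for t
    using sums_add[OF sums_diff[OF d[of t] sums_mult[OF c[of t], of x]] b[of t]]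
    by (simp add: algebra_simps)
  then have "diffs c n - x * c n + b n = 0" for n
    by (rule powser_sums_zero_imp_zero)
  note * = this[of 0] this[of "Suc k"]
  show "hermite (Suc 0) x \<sigma> = x"
    using *(1) by (simp add: diffs_def b_def c_def)
  have "fact (Suc k) * (diffs c (Suc k) - x * c (Suc k) + b (Suc k)) = 0"
    using * by simp
  moreover have "fact (Suc k) * diffs c (Suc k) = hermite (Suc (Suc k)) x \<sigma>"
    by (simp add: diffs_def c_def)
  moreover have "fact (Suc k) * (x * c (Suc k)) = x * hermite (Suc k) x \<sigma>"
    by (simp add: c_def)
  moreover have "fact (Suc k) * b (Suc k) = real (Suc k) * \<sigma> * hermite k x \<sigma>"
    by (simp add: c_def b_def)
  ultimately show "hermite (Suc (Suc k)) x \<sigma> = x * hermite (Suc k) x \<sigma> - real (Suc k) * \<sigma> * hermite k x \<sigma>"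
    by (simp only: distrib_left right_diff_distrib)
qed

lemma hermite_Suc:
  "hermite (Suc k) x \<sigma> = x * hermite k x \<sigma> - real k * \<sigma> * hermite (k - 1) x \<sigma>"
  by (cases k) (simp_all add: hermite_Suc_Suc)

lemma hermite_2: "hermite 2 x \<sigma> = x\<^sup>2 - \<sigma>"
  by (simp add: numeral_2_eq_2 hermite_Suc_Suc power2_eq_square)

text \<open>The Hermite polynomials as elements of the polynomial ring.\<close>

fun hpoly :: "nat => real => real poly" where
  "hpoly 0 \<sigma> = 1"
| "hpoly (Suc 0) \<sigma> = [:0, 1:]"
| "hpoly (Suc (Suc k)) \<sigma> = [:0, 1:] * hpoly (Suc k) \<sigma> - smult (real (Suc k) * \<sigma>) (hpoly k \<sigma>)"

lemma poly_hpoly: "poly (hpoly k \<sigma>) x = hermite k x \<sigma>"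
  by (induction k \<sigma> rule: hpoly.induct) (simp_all add: hermite_Suc_Suc)

lemma pderiv_hpoly: "pderiv (hpoly k \<sigma>) = smult (real k) (hpoly (k - 1) \<sigma>)"
proof (induction k \<sigma> rule: hpoly.induct)
  case (3 k \<sigma>)
  have rec: "hpoly (Suc k) \<sigma> = [:0, 1:] * hpoly k \<sigma> - smult (real k * \<sigma>) (hpoly (k - 1) \<sigma>)"
    by (cases k) simp_all
  have "pderiv (hpoly (Suc (Suc k)) \<sigma>) =
      hpoly (Suc k) \<sigma> + [:0, 1:] * smult (real (Suc k)) (hpoly k \<sigma>) -
      smult (real (Suc k) * \<sigma>) (smult (real k) (hpoly (k - 1) \<sigma>))"
    using 3 by (simp add: pderiv_diff pderiv_mult pderiv_smult pderiv_pCons del: mult_pCons_left)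
  also have "\<dots> = hpoly (Suc k) \<sigma> + smult (real (Suc k)) ([:0, 1:] * hpoly k \<sigma> - smult (real k * \<sigma>) (hpoly (k - 1) \<sigma>))"
    by (simp add: smult_diff_right mult_ac del: mult_pCons_left)
  also have "\<dots> = smult (real (Suc (Suc k))) (hpoly (Suc k) \<sigma>)"
    unfolding rec[symmetric] of_nat_Suc[of "Suc k"] smult_add_left by simp
  finally show ?case by simp
qed (simp_all add: pderiv_pCons)

lemma DERIV_hermite: "((\<lambda>x. hermite k x \<sigma>) has_field_derivative real k * hermite (k - 1) x \<sigma>) (at x)"
  using poly_DERIV[of "hpoly k \<sigma>" x] by (simp add: poly_hpoly pderiv_hpoly)

lemma continuous_hermite: "continuous_on S (\<lambda>x. hermite k x \<sigma>)"
  using continuous_on_poly[OF continuous_on_id, of S "hpoly k \<sigma>"] by (simp add: poly_hpoly)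

lemma borel_measurable_hermite [measurable]: "(\<lambda>x. hermite k x \<sigma>) \<in> borel_measurable borel"
  by (intro borel_measurable_continuous_onI continuous_hermite)

text \<open>Rescaling the variable to unit variance makes one growth estimate serve all truncations.\<close>

lemma hermite_scale: "hermite k (s * y) (s\<^sup>2) = s ^ k * hermite k y 1"
proof (induction k rule: less_induct)
  case (less k)
  then show ?case
    by (cases k rule: nat.exhaust; cases "k - 1")
      (auto simp: hermite_Suc_Suc algebra_simps power2_eq_square)
qed

text \<open>
  At even order, the differential equation \<open>H'' = x H' - k H\<close> forces a sign change inside the unit
  interval: as long as \<open>H\<close> is positive it is decreasing and concave, hence lies above its chord, and
  integrating \<open>H'' \<le> - k H(0) (1 - x)\<close> twice gives \<open>H(1) \<le> H(0) (1 - k / 3)\<close>.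
\<close>

lemma hermite_even_neg:
  assumes "even k" "k \<ge> 2"
  shows "\<exists>\<xi>. 0 \<le> \<xi> \<and> \<xi> \<le> 1 \<and> hermite k \<xi> 1 < 0"
proof (rule ccontr)
  assume "\<not> ?thesis"
  then have nonneg: "hermite k x 1 \<ge> 0" if "0 \<le> x" "x \<le> 1" for x
    using that by force
  have nz: "hermite (2 * m) 0 1 ~= 0" and odd0: "hermite (Suc (2 * m)) 0 1 = 0" for m
    by (induction m) (simp_all add: hermite_Suc_Suc)
  obtain m where m: "k = 2 * m" using \<open>even k\<close> by blast
  have H0: "hermite k 0 1 > 0"
    using nz[of m] nonneg[of 0] m by simp
  have "k ~= 2" using H0 by (auto simp: hermite_2)
  with assms have k4: "k \<ge> 4" using m by presburger
  have d0: "hermite (k - 1) 0 1 = 0"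
    using odd0[of "m - 1"] m k4 by (simp add: Suc_diff_Suc numeral_2_eq_2)
  define H1 where "H1 x = real k * hermite (k - 1) x 1" for x
  define H2 where "H2 x = x * H1 x - real k * hermite k x 1" for x
  have D1: "((\<lambda>x. hermite k x 1) has_field_derivative H1 x) (at x)" for x
    unfolding H1_def by (rule DERIV_hermite)
  have D2: "(H1 has_field_derivative H2 x) (at x)" for x
  proof -
    obtain j where j: "k = Suc (Suc j)" using k4 by (metis add_2_eq_Suc le_Suc_ex numeral_Bit0 add.assoc)
    have "(H1 has_field_derivative real k * (real (k - 1) * hermite (k - 1 - 1) x 1)) (at x)"
      unfolding H1_def by (rule DERIV_cmult[OF DERIV_hermite])
    moreover have "real k * (real (k - 1) * hermite (k - 1 - 1) x 1) = H2 x"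
      by (simp add: H2_def H1_def j hermite_Suc_Suc algebra_simps)
    ultimately show ?thesis by simp
  qed
  have H1_neg: "H1 x \<le> 0" if x: "0 \<le> x" "x \<le> 1" for x
  proof -
    define w where "w x = exp (- x\<^sup>2 / 2) * H1 x" for x
    have "w x \<le> w 0"
    proof (rule DERIV_nonpos_imp_nonincreasing[OF x(1)])
      fix y assume y: "0 \<le> y" "y \<le> x"
      have "(w has_field_derivative - (exp (- y\<^sup>2 / 2) * (real k * hermite k y 1))) (at y)"
        unfolding w_def by (auto intro!: derivative_eq_intros D2 simp: H2_def algebra_simps)
      then show "\<exists>z. (w has_field_derivative z) (at y) \<and> z \<le> 0"
        using nonneg[of y] x y by (intro exI conjI) auto
    qed
    then have "exp (- x\<^sup>2 / 2) * H1 x \<le> 0" unfolding w_def H1_def d0 by simp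
    then show ?thesis by (simp add: mult_le_0_iff)
  qed
  have convex: "convex_on {0..1} (\<lambda>x. - hermite k x 1)"
  proof (rule f''_ge0_imp_convex)
    show "((\<lambda>x. - hermite k x 1) has_field_derivative - H1 x) (at x)" for x
      by (intro DERIV_minus D1)
    show "((\<lambda>x. - H1 x) has_field_derivative - H2 x) (at x)" for x
      by (intro DERIV_minus D2)
    show "0 \<le> - H2 x" if "x \<in> {0..1}" for x
      using that mult_nonneg_nonpos[of x "H1 x"] H1_neg[of x] mult_nonneg_nonneg[of "real k", OF _ nonneg[of x]] by (simp add: H2_def)
  qed auto
  have chord: "hermite k x 1 \<ge> hermite k 0 1 * (1 - x)" if "0 \<le> x" "x \<le> 1" for x
  proof -
    have "hermite k 0 1 * (1 - x) + x * hermite k 1 1 \<le> hermite k x 1"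
      using convex_onD[OF convex, of x 0 1] that by (simp add: algebra_simps)
    moreover have "0 \<le> x * hermite k 1 1"
      using that nonneg[of 1] by simp
    ultimately show ?thesis by linarith
  qed
  define c where "c = real k * hermite k 0 1"
  have Dneg: "H1 x + c * (x - x\<^sup>2 / 2) \<le> 0" if x: "0 \<le> x" "x \<le> 1" for x
  proof -
    define w where "w x = H1 x + c * (x - x\<^sup>2 / 2)" for x
    have "w x \<le> w 0"
    proof (rule DERIV_nonpos_imp_nonincreasing[OF x(1)])
      fix y assume y: "0 \<le> y" "y \<le> x"
      have "(w has_field_derivative H2 y + c * (1 - y)) (at y)"
        unfolding w_def by (auto intro!: derivative_eq_intros D2)
      moreover have "H2 y + c * (1 - y) \<le> 0"
        using chord[of y] H1_neg[of y] x y
        mult_left_mono[of "hermite k 0 1 * (1 - y)" "hermite k y 1" "real k"]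
        by (simp add: H2_def c_def mult_nonneg_nonpos mult.assoc) (smt (verit) mult_nonneg_nonpos)
      ultimately show "\<exists>z. (w has_field_derivative z) (at y) \<and> z \<le> 0"
        by blast
    qed
    then show ?thesis unfolding w_def H1_def d0 by simp
  qed
  define w where "w x = hermite k x 1 + c * (x\<^sup>2 / 2 - x ^ 3 / 6)" for x
  have "w 1 \<le> w 0"
  proof (rule DERIV_nonpos_imp_nonincreasing[of 0 1 w])
    fix y :: real assume y: "0 \<le> y" "y \<le> 1"
    have "(w has_field_derivative H1 y + c * (y - y\<^sup>2 / 2)) (at y)"
      unfolding w_def by (auto intro!: derivative_eq_intros D1 simp: power2_eq_square)
    then show "\<exists>z. (w has_field_derivative z) (at y) \<and> z \<le> 0"
      using Dneg[OF y] by blast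
  qed simp
  then have "hermite k 1 1 + c / 3 \<le> hermite k 0 1"
    by (simp add: w_def)
  moreover have "c \<ge> 4 * hermite k 0 1"
    using k4 H0 unfolding c_def by (intro mult_right_mono) auto
  ultimately show False using nonneg[of 1] H0 by simp
qed

section \<open>One-dimensional Gaussian integrals\<close>

definition gauss1 :: "real measure" where
  "gauss1 = density lborel std_normal_density"

lemma prob_space_gauss1: "prob_space gauss1"
  unfolding gauss1_def by (rule prob_space_normal_density) simp

interpretation gauss1: prob_space gauss1
  by (rule prob_space_gauss1)

lemma sets_gauss1 [simp, measurable_cong]: "sets gauss1 = sets borel"
  by (simp add: gauss1_def)

lemma space_gauss1 [simp]: "space gauss1 = UNIV"
  by (simp add: gauss1_def)

lemma measure_gauss1_UNIV [simp]: "measure gauss1 UNIV = 1"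
  using gauss1.prob_space by simp

lemma has_bochner_integral_gauss1_iff:
  fixes f :: "real => real"
  assumes [measurable]: "f \<in> borel_measurable borel"
  shows "has_bochner_integral gauss1 f c \<longleftrightarrow> has_bochner_integral lborel (\<lambda>x. std_normal_density x * f x) c"
proof -
  have "integrable gauss1 f \<longleftrightarrow> integrable lborel (\<lambda>x. std_normal_density x * f x)"
    unfolding gauss1_def by (subst integrable_density) auto
  moreover have "integral\<^sup>L gauss1 f = integral\<^sup>L lborel (\<lambda>x. std_normal_density x * f x)"
    unfolding gauss1_def by (subst integral_density) auto
  ultimately show ?thesis
    by (simp add: has_bochner_integral_iff)
qed

text \<open>The \<open>m\<close>-th moment of the standard Gaussian.\<close>

definition gmoment :: "nat => real" where
  "gmoment m = (if even m then fact m / (2 ^ (m div 2) * fact (m div 2)) else 0)"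

lemma has_bochner_integral_gauss1_power: "has_bochner_integral gauss1 (\<lambda>x. x ^ m) (gmoment m)"
proof (cases "even m")
  case True
  then obtain k where m: "m = 2 * k" by blast
  show ?thesis
    using normal_moment_even[of 1 0 k] by (simp add: m gmoment_def has_bochner_integral_gauss1_iff)
next
  case False
  then obtain k where m: "m = 2 * k + 1" by (metis oddE)
  show ?thesis
    using normal_moment_odd[of 1 0 k] by (simp add: m gmoment_def has_bochner_integral_gauss1_iff)
qed

lemma gmoment_Suc: "gmoment (Suc m) = real m * gmoment (m - 1)"
proof (cases "even m")
  case False
  then obtain k where m: "m = Suc (2 * k)" by (metis oddE Suc_eq_plus1)
  have "(fact (Suc (Suc (2 * k))) :: real) = (2 * real (Suc k)) * (real (Suc (2 * k)) * fact (2 * k))"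
    by (simp add: algebra_simps)
  moreover have "(2 ^ Suc k * fact (Suc k) :: real) = (2 * real (Suc k)) * (2 ^ k * fact k)"
    by simp
  ultimately show ?thesis
    by (simp add: gmoment_def m del: fact_Suc of_nat_Suc power_Suc)
next
  case True
  then show ?thesis by (cases m) (auto simp: gmoment_def)
qed

lemma has_bochner_integral_gauss1_poly:
  assumes "degree p \<le> n"
  shows "has_bochner_integral gauss1 (poly p) (\<Sum>i\<le>n. coeff p i * gmoment i)"
proof -
  have "has_bochner_integral gauss1 (\<lambda>x. \<Sum>i\<le>n. coeff p i * x ^ i) (\<Sum>i\<le>n. coeff p i * gmoment i)"
    by (intro has_bochner_integral_sum has_bochner_integral_mult_right has_bochner_integral_gauss1_power)
  moreover have "(\<lambda>x. \<Sum>i\<le>n. coeff p i * x ^ i) = poly p"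
    by (rule ext, subst poly_altdef, rule sum.mono_neutral_right)
      (use assms in \<open>auto simp: not_le coeff_eq_0\<close>)
  ultimately show ?thesis by simp
qed

lemma integrable_gauss1_poly [simp]: "integrable gauss1 (poly p)"
  using has_bochner_integral_gauss1_poly[OF order_refl] by (auto simp: has_bochner_integral_iff)

text \<open>Gaussian integration by parts.\<close>

lemma gauss1_by_parts: "(\<integral>x. x * poly p x \<partial>gauss1) = (\<integral>x. poly (pderiv p) x \<partial>gauss1)"
proof -
  define n where "n = degree p"
  have "(\<lambda>x. x * poly p x) = poly (pCons 0 p)" by auto
  then have "(\<integral>x. x * poly p x \<partial>gauss1) = (\<Sum>i\<le>Suc n. coeff (pCons 0 p) i * gmoment i)"
    using has_bochner_integral_integral_eq[OF has_bochner_integral_gauss1_poly[of "pCons 0 p" "Suc n"]]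
    by (simp add: n_def degree_pCons_le)
  also have "\<dots> = (\<Sum>i\<le>n. coeff p i * (real i * gmoment (i - 1)))"
    by (subst sum.atMost_Suc_shift) (simp add: gmoment_Suc)
  also have "\<dots> = (\<Sum>i\<le>Suc n. coeff p i * (real i * gmoment (i - 1)))"
    by (simp add: n_def coeff_eq_0)
  also have "\<dots> = (\<Sum>i\<le>n. coeff (pderiv p) i * gmoment i)"
    by (subst sum.atMost_Suc_shift) (simp add: coeff_pderiv mult_ac)
  also have "\<dots> = (\<integral>x. poly (pderiv p) x \<partial>gauss1)"
    using has_bochner_integral_integral_eq[OF has_bochner_integral_gauss1_poly[of "pderiv p" "n"]]
    by (simp add: n_def degree_pderiv)
  finally show ?thesis .
qed

lemma integrable_gauss1_poly_fun:
  assumes "\<And>x. f x = poly p x"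
  shows "integrable gauss1 f"
proof -
  have "f = poly p" using assms by auto
  then show ?thesis by simp
qed

lemma integrable_gauss1_affine_hermite:
  "integrable gauss1 (\<lambda>z. hermite k (x + c * z) \<sigma>)"
  "integrable gauss1 (\<lambda>z. z * hermite k (x + c * z) \<sigma>)"
  by (rule integrable_gauss1_poly_fun[where p = "hpoly k \<sigma> \<circ>\<^sub>p [:x, c:]"], simp add: poly_pcompose poly_hpoly mult.commute)
    (rule integrable_gauss1_poly_fun[where p = "[:0,1:] * (hpoly k \<sigma> \<circ>\<^sub>p [:x, c:])"], simp add: poly_pcompose poly_hpoly mult.commute)

text \<open>
  Averaging over an independent Gaussian summand of variance \<open>c\<^sup>2\<close> turns the Hermite polynomial of
  variance \<open>\<sigma> + c\<^sup>2\<close> into the one of variance \<open>\<sigma>\<close>. This is the martingale property of Wick powers.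
\<close>

lemma gauss1_hermite_shift:
  "(\<integral>z. hermite k (x + c * z) (\<sigma> + c\<^sup>2) \<partial>gauss1) = hermite k x \<sigma>"
proof (induction k rule: less_induct)
  case (less k)
  define I where "I j = (\<integral>z. hermite j (x + c * z) (\<sigma> + c\<^sup>2) \<partial>gauss1)" for j
  show ?case
  proof (cases k)
    case 0
    then show ?thesis by simp
  next
    case (Suc j)
    define p where "p = hpoly j (\<sigma> + c\<^sup>2) \<circ>\<^sub>p [:x, c:]"
    have p: "poly p z = hermite j (x + c * z) (\<sigma> + c\<^sup>2)" for z
      by (simp add: p_def poly_pcompose poly_hpoly mult.commute)
    have p': "poly (pderiv p) z = c * (real j * hermite (j - 1) (x + c * z) (\<sigma> + c\<^sup>2))" for z
      by (simp add: p_def pderiv_pcompose poly_pcompose poly_hpoly pderiv_hpoly pderiv_pCons mult_ac)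
    have parts: "(\<integral>z. z * hermite j (x + c * z) (\<sigma> + c\<^sup>2) \<partial>gauss1) = c * (real j * I (j - 1))"
      using gauss1_by_parts[of p] unfolding p p' by (simp add: I_def)
    have "hermite k (x + c * z) (\<sigma> + c\<^sup>2) = x * hermite j (x + c * z) (\<sigma> + c\<^sup>2)
        + c * (z * hermite j (x + c * z) (\<sigma> + c\<^sup>2))
        - real j * (\<sigma> + c\<^sup>2) * hermite (j - 1) (x + c * z) (\<sigma> + c\<^sup>2)" for z
      by (simp add: Suc hermite_Suc algebra_simps)
    then have "I k = x * I j + c * (c * (real j * I (j - 1))) - real j * (\<sigma> + c\<^sup>2) * I (j - 1)"
      by (simp add: I_def integrable_gauss1_affine_hermite parts)
    also have "\<dots> = x * I j - real j * \<sigma> * I (j - 1)"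
      by (simp add: algebra_simps power2_eq_square)
    also have "\<dots> = hermite k x \<sigma>"
      using less[of j] less[of "j - 1"] by (simp add: Suc I_def hermite_Suc)
    finally show ?thesis by (simp add: I_def)
  qed
qed

abbreviation He :: "nat => real => real" where "He k x \<equiv> hermite k x 1"

lemma integrable_gauss1_He_mult: "integrable gauss1 (\<lambda>z. He k z * poly p z)"
  by (rule integrable_gauss1_poly_fun[where p = "hpoly k 1 * p"]) (simp add: poly_hpoly)

lemma gauss1_He_Suc: "(\<integral>z. He (Suc k) z * poly q z \<partial>gauss1) = (\<integral>z. He k z * poly (pderiv q) z \<partial>gauss1)"
proof -
  have "(\<integral>z. z * poly (hpoly k 1 * q) z \<partial>gauss1) =
      (\<integral>z. real k * (He (k - 1) z * poly q z) + He k z * poly (pderiv q) z \<partial>gauss1)"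
    unfolding gauss1_by_parts
    by (rule Bochner_Integration.integral_cong) (simp_all add: pderiv_mult pderiv_hpoly poly_hpoly algebra_simps)
  also have "\<dots> = real k * (\<integral>z. He (k - 1) z * poly q z \<partial>gauss1) + (\<integral>z. He k z * poly (pderiv q) z \<partial>gauss1)"
    by (simp add: integrable_gauss1_He_mult)
  finally have *: "(\<integral>z. z * poly (hpoly k 1 * q) z \<partial>gauss1) = \<dots>" .
  have "(\<integral>z. He (Suc k) z * poly q z \<partial>gauss1) =
      (\<integral>z. z * poly (hpoly k 1 * q) z - real k * (He (k - 1) z * poly q z) \<partial>gauss1)"
    by (simp add: hermite_Suc poly_hpoly algebra_simps)
  also have "\<dots> = (\<integral>z. z * poly (hpoly k 1 * q) z \<partial>gauss1) - real k * (\<integral>z. He (k - 1) z * poly q z \<partial>gauss1)"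
    by (subst Bochner_Integration.integral_diff)
      (auto simp: integrable_gauss1_He_mult intro: integrable_gauss1_poly_fun[where p = "[:0,1:] * (hpoly k 1 * q)"])
  finally show ?thesis using * by simp
qed

text \<open>Integration by parts moves the index of one factor into derivatives of the other, and a polynomial has only finitely many derivatives.\<close>

lemma gauss1_He_orthogonal: "(\<integral>z. He i z * He j z \<partial>gauss1) = (if i = j then fact i else 0)"
proof (induction i arbitrary: j)
  case 0
  have "(\<integral>z. He j z \<partial>gauss1) = (if j = 0 then 1 else 0)"
    using gauss1_hermite_shift[of j 0 1 0] by (cases j) (auto simp: hermite_Suc)
  then show ?case by simp
next
  case (Suc i)
  have "(\<integral>z. He (Suc i) z * He j z \<partial>gauss1) = real j * (\<integral>z. He i z * He (j - 1) z \<partial>gauss1)"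
    using gauss1_He_Suc[of i "hpoly j 1"] by (simp add: poly_hpoly pderiv_hpoly mult.left_commute)
  then show ?case
    using Suc[of "j - 1"] by (cases j) auto
qed

lemma integral_mult_square_le:
  fixes f g :: "'a => real"
  assumes f: "integrable M (\<lambda>x. (f x)\<^sup>2)" and g: "integrable M (\<lambda>x. (g x)\<^sup>2)"
    and fg: "integrable M (\<lambda>x. f x * g x)"
  shows "(\<integral>x. f x * g x \<partial>M)\<^sup>2 \<le> (\<integral>x. (f x)\<^sup>2 \<partial>M) * (\<integral>x. (g x)\<^sup>2 \<partial>M)"
proof -
  define A B C where "A = (\<integral>x. (f x)\<^sup>2 \<partial>M)" and "B = (\<integral>x. (g x)\<^sup>2 \<partial>M)" and "C = (\<integral>x. f x * g x \<partial>M)"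
  have q: "0 \<le> t\<^sup>2 * A + 2 * t * s * C + s\<^sup>2 * B" for t s
  proof -
    have "0 \<le> (\<integral>x. (t * f x + s * g x)\<^sup>2 \<partial>M)" by simp
    also have "(\<lambda>x. (t * f x + s * g x)\<^sup>2) = (\<lambda>x. t\<^sup>2 * (f x)\<^sup>2 + 2 * t * s * (f x * g x) + s\<^sup>2 * (g x)\<^sup>2)"
      by (auto simp: power2_eq_square algebra_simps)
    also have "(\<integral>x. \<dots> x \<partial>M) = t\<^sup>2 * A + 2 * t * s * C + s\<^sup>2 * B"
      using f g fg by (simp add: A_def B_def C_def)
    finally show ?thesis .
  qed
  have "A \<ge> 0" "B \<ge> 0" by (auto simp: A_def B_def)
  show ?thesis unfolding A_def[symmetric] B_def[symmetric] C_def[symmetric]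
  proof (cases "B = 0")
    case True
    have "C = 0"
    proof (rule ccontr)
      assume "C ~= 0"
      then show False
        using q[of 1 "- (A + 1) / (2 * C)"] True by (simp add: field_simps)
    qed
    then show "C\<^sup>2 \<le> A * B" using \<open>A \<ge> 0\<close> \<open>B \<ge> 0\<close> by simp
  next
    case False
    then have "B > 0" using \<open>B \<ge> 0\<close> by simp
    have "0 \<le> B * (A * B - C\<^sup>2)"
      using q[of B "- C"] by (simp add: power2_eq_square algebra_simps)
    then show "C\<^sup>2 \<le> A * B"
      using \<open>B > 0\<close> by (simp add: zero_le_mult_iff)
  qed
qed

text \<open>
  Moving one factor \<open>He (k + 1)\<close> by parts and applying the Cauchy--Schwarz inequality bounds
  \<open>E He(k+1)\<^sup>4\<close> by \<open>3 (k + 1) E He(k+1)\<^sup>2 He(k)\<^sup>2\<close>.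
\<close>

lemma gauss1_He_fourth_moment: "(\<integral>z. He k z ^ 4 \<partial>gauss1) \<le> 9 ^ k * (fact k)\<^sup>2"
proof (induction k)
  case 0
  show ?case by simp
next
  case (Suc k)
  define Q where "Q j = (\<integral>z. He j z ^ 4 \<partial>gauss1)" for j
  define C where "C = (\<integral>z. (He (Suc k) z)\<^sup>2 * (He k z)\<^sup>2 \<partial>gauss1)"
  have Q0: "Q j \<ge> 0" for j by (simp add: Q_def)
  have int: "integrable gauss1 (\<lambda>z. He i z ^ a * He j z ^ b)" for i j a b
    by (rule integrable_gauss1_poly_fun[where p = "hpoly i 1 ^ a * hpoly j 1 ^ b"]) (simp add: poly_hpoly)
  have int4: "integrable gauss1 (\<lambda>z. ((He i z)\<^sup>2)\<^sup>2)" for i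
    using int[of i 4 0 0] by (simp flip: power_mult)
  have "Q (Suc k) = (\<integral>z. He (Suc k) z * poly (hpoly (Suc k) 1 ^ 3) z \<partial>gauss1)"
    by (simp add: Q_def poly_hpoly power4_eq_xxxx power3_eq_cube mult_ac)
  also have "\<dots> = 3 * real (Suc k) * C"
    unfolding gauss1_He_Suc
    by (simp add: pderiv_power pderiv_hpoly poly_hpoly C_def power2_eq_square mult_ac
        del: of_nat_Suc flip: integral_mult_right_zero)
  finally have Q: "Q (Suc k) = 3 * real (Suc k) * C" .
  have "C\<^sup>2 \<le> Q (Suc k) * Q k"
    using integral_mult_square_le[of gauss1 "\<lambda>z. (He (Suc k) z)\<^sup>2" "\<lambda>z. (He k z)\<^sup>2"] int4 int
    by (simp add: C_def Q_def flip: power_mult)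
  then have "(Q (Suc k))\<^sup>2 \<le> (3 * real (Suc k))\<^sup>2 * (Q (Suc k) * Q k)"
    unfolding Q power_mult_distrib by (intro mult_left_mono) (auto simp: Q[symmetric])
  then have "Q (Suc k) * Q (Suc k) \<le> Q (Suc k) * (9 * (real (Suc k))\<^sup>2 * Q k)"
    by (simp add: power2_eq_square algebra_simps)
  then have "Q (Suc k) \<le> 9 * (real (Suc k))\<^sup>2 * Q k"
    using Q0[of "Suc k"] Q0[of k] by (cases "Q (Suc k) = 0") (auto simp: mult_le_cancel_left)
  also have "\<dots> \<le> 9 * (real (Suc k))\<^sup>2 * (9 ^ k * (fact k)\<^sup>2)"
    using Suc by (intro mult_left_mono) (auto simp: Q_def)
  also have "\<dots> = 9 ^ Suc k * (fact (Suc k))\<^sup>2"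
    by (simp add: power_mult_distrib)
  finally show ?case by (simp add: Q_def)
qed

section \<open>Products of standard Gaussians\<close>

abbreviation gauss :: "('i => real) measure" where
  "gauss \<equiv> PiM UNIV (\<lambda>_. gauss1)"

interpretation gauss: product_prob_space "\<lambda>_::'i. gauss1" "UNIV :: 'i set"
  by unfold_locales

lemma space_gauss [simp]: "space (gauss :: ('i => real) measure) = UNIV"
  by (simp add: space_PiM PiE_UNIV_domain)

lemma measure_gauss_UNIV [simp]: "measure (gauss :: ('i => real) measure) UNIV = 1"
  using gauss.P.prob_space by simp

definition dep_on :: "'i set => (('i => real) => 'b) => bool" where
  "dep_on A f \<longleftrightarrow> (\<forall>om om'. (\<forall>i\<in>A. om i = om' i) --> f om = f om')"

lemma dep_onD: "dep_on A f ==> (\<And>i. i \<in> A ==> om i = om' i) ==> f om = f om'"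
  by (auto simp: dep_on_def)

lemma dep_on_mono: "dep_on A f ==> A \<subseteq> B ==> dep_on B f"
  unfolding dep_on_def by blast

definition splice :: "'i set => ('i => real) => ('i => real) => 'i => real" where
  "splice A om om' = (\<lambda>i. if i \<in> A then om' i else om i)"

lemma measurable_splice [measurable]:
  "(\<lambda>(om, om'). splice A om om') \<in> measurable (gauss \<Otimes>\<^sub>M gauss) (gauss :: ('i => real) measure)"
proof (rule measurable_PiM_single')
  fix i :: 'i
  show "(\<lambda>p. (case p of (om, om') => splice A om om') i) \<in> measurable (gauss \<Otimes>\<^sub>M gauss) gauss1"
    by (cases "i \<in> A") (simp_all add: splice_def split_beta')
qed (auto simp: PiE_UNIV_domain)

text \<open>The product law is invariant under resampling a set \<open>A\<close> of variables from an independent copy. This replaces Fubini for infinite products split into two blocks.\<close>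

lemma distr_splice:
  "distr (gauss \<Otimes>\<^sub>M gauss) gauss (\<lambda>(om, om'). splice A om om') = (gauss :: ('i => real) measure)"
proof (rule gauss.PiM_eq)
  fix J :: "'i set" and F :: "'i => real set"
  assume J: "finite J" "J \<subseteq> UNIV" and F: "\<And>j. j \<in> J ==> F j \<in> sets gauss1"
  let ?E = "\<lambda>J. prod_emb UNIV (\<lambda>_. gauss1) J (Pi\<^sub>E J F)"
  have E: "?E K = {om. \<forall>j\<in>K. om j \<in> F j}" for K
    by (auto simp: prod_emb_def PiE_UNIV_domain PiE_iff)
  have m: "?E K \<in> sets gauss" if "K \<subseteq> J" for K
    using that J F by (intro sets_PiM_I) (auto intro: finite_subset)
  have "(\<lambda>(om, om'). splice A om om') -` ?E J \<inter> space (gauss \<Otimes>\<^sub>M gauss) = ?E (J - A) \<times> ?E (J \<inter> A)"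
    unfolding E by (auto simp: splice_def space_pair_measure)
  then have "emeasure (distr (gauss \<Otimes>\<^sub>M gauss) gauss (\<lambda>(om, om'). splice A om om')) (?E J) =
      emeasure (gauss \<Otimes>\<^sub>M gauss) (?E (J - A) \<times> ?E (J \<inter> A))"
    using m by (subst emeasure_distr) auto
  also have "\<dots> = emeasure gauss (?E (J - A)) * emeasure gauss (?E (J \<inter> A))"
    by (rule gauss.emeasure_pair_measure_Times) (use m in auto)
  also have "\<dots> = (\<Prod>j\<in>J - A. emeasure gauss1 (F j)) * (\<Prod>j\<in>J \<inter> A. emeasure gauss1 (F j))"
    using J F by (subst (1 2) gauss.emeasure_PiM_emb) auto
  also have "\<dots> = (\<Prod>j\<in>J. emeasure gauss1 (F j))"
    using J by (subst prod.union_disjoint[symmetric]) (auto intro!: prod.cong)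
  finally show "emeasure (distr (gauss \<Otimes>\<^sub>M gauss) gauss (\<lambda>(om, om'). splice A om om')) (?E J) =
      (\<Prod>j\<in>J. emeasure gauss1 (F j))" .
qed simp

interpretation gauss2: pair_prob_space "gauss :: ('i => real) measure" "gauss :: ('i => real) measure"
  by unfold_locales

lemma gauss_splice_integral:
  fixes f :: "('i => real) => real"
  assumes f: "integrable gauss f"
  shows "integral\<^sup>L gauss f = (\<integral>om. \<integral>om'. f (splice A om om') \<partial>gauss \<partial>gauss)"
proof -
  have fm [measurable]: "f \<in> borel_measurable gauss" using f by auto
  have "integral\<^sup>L gauss f = (\<integral>p. f (case p of (om, om') => splice A om om') \<partial>(gauss \<Otimes>\<^sub>M gauss))"
    by (subst (1) distr_splice[symmetric, of A], subst integral_distr) auto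
  moreover have "integrable (gauss \<Otimes>\<^sub>M gauss) (\<lambda>p. f (case p of (om, om') => splice A om om'))"
    using f by (subst (asm) distr_splice[symmetric, of A], subst (asm) integrable_distr_eq) auto
  ultimately show ?thesis
    using gauss2.integral_fst'[of "\<lambda>p. f (case p of (om, om') => splice A om om')"] by simp
qed

lemma gauss_splice_nn_integral:
  fixes f :: "('i => real) => ennreal"
  assumes [measurable]: "f \<in> borel_measurable gauss"
  shows "integral\<^sup>N gauss f = (\<integral>\<^sup>+om. \<integral>\<^sup>+om'. f (splice A om om') \<partial>gauss \<partial>gauss)"
proof -
  have "integral\<^sup>N gauss f = (\<integral>\<^sup>+p. f (case p of (om, om') => splice A om om') \<partial>(gauss \<Otimes>\<^sub>M gauss))"
    by (subst (1) distr_splice[symmetric, of A], subst nn_integral_distr) auto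
  then show ?thesis
    by (subst (asm) gauss.nn_integral_fst[symmetric]) auto
qed

lemma distr_gauss_component: "distr gauss gauss1 (\<lambda>om. om s) = gauss1"
  by (rule gauss.PiM_component) simp

lemma integral_gauss_component:
  fixes f :: "real => real"
  assumes [measurable]: "f \<in> borel_measurable borel"
  shows "(\<integral>om. f (om s) \<partial>gauss) = integral\<^sup>L gauss1 f"
    and "integrable gauss (\<lambda>om. f (om s)) \<longleftrightarrow> integrable gauss1 f"
  by (subst (2) distr_gauss_component[symmetric, of s], subst integral_distr; simp)
    (subst (2) distr_gauss_component[symmetric, of s], subst integrable_distr_eq; simp)

lemma gauss_indep_mult:
  fixes f g :: "('i => real) => real"
  assumes "dep_on A f" "dep_on B g" "A \<inter> B = {}"
    and f: "integrable gauss f" and g: "integrable gauss g" and fg: "integrable gauss (\<lambda>om. f om * g om)"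
  shows "(\<integral>om. f om * g om \<partial>gauss) = integral\<^sup>L gauss f * integral\<^sup>L gauss g"
proof -
  have "f (splice A om om') = f om'" "g (splice A om om') = g om" for om om'
    using assms(3) by (auto intro!: dep_onD[OF assms(1)] dep_onD[OF assms(2)] simp: splice_def)
  then show ?thesis
    by (subst gauss_splice_integral[OF fg, of A]) simp
qed

text \<open>
  Closed under the algebra operations, so that integrability of every polynomial in Gaussian
  variables comes for free.
\<close>

definition all_moments :: "(('i => real) => real) => bool" where
  "all_moments f \<longleftrightarrow> f \<in> borel_measurable gauss \<and> (\<forall>m. integrable gauss (\<lambda>om. \<bar>f om\<bar> ^ m))"

lemma all_moments_measurable: "all_moments f ==> f \<in> borel_measurable gauss"
  by (simp add: all_moments_def)

lemma all_moments_integrable: "all_moments f ==> integrable gauss f"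
  unfolding all_moments_def using integrable_abs_cancel[of gauss f]
  by (auto dest: spec[of _ "1::nat"])

lemma all_moments_bounded:
  assumes [measurable]: "f \<in> borel_measurable gauss" and "\<And>om. \<bar>f om\<bar> \<le> C"
  shows "all_moments f"
  unfolding all_moments_def
proof (intro conjI allI)
  show "integrable gauss (\<lambda>om. \<bar>f om\<bar> ^ m)" for m
    by (rule gauss.integrable_const_bound[of _ "C ^ m"]) (auto intro!: power_mono assms)
qed fact

lemma all_moments_const [intro, simp]: "all_moments (\<lambda>_. c)"
  by (rule all_moments_bounded[of _ "\<bar>c\<bar>"]) auto

lemma all_moments_var [intro, simp]: "all_moments (\<lambda>om. om i)"
  unfolding all_moments_def
proof (intro conjI allI)
  fix m
  have "integrable gauss1 (\<lambda>z. \<bar>z ^ m\<bar>)"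
    using has_bochner_integral_gauss1_power[of m] by (intro integrable_abs) (auto simp: has_bochner_integral_iff)
  then show "integrable gauss (\<lambda>om. \<bar>om i\<bar> ^ m)"
    by (subst integral_gauss_component(2)[of "\<lambda>z. \<bar>z\<bar> ^ m"]) (auto simp: power_abs)
qed simp

lemma all_moments_mult [intro]:
  assumes "all_moments f" "all_moments g"
  shows "all_moments (\<lambda>om. f om * g om)"
  unfolding all_moments_def
proof (intro conjI allI)
  have [measurable]: "f \<in> borel_measurable gauss" "g \<in> borel_measurable gauss"
    using assms by (auto simp: all_moments_def)
  show "(\<lambda>om. f om * g om) \<in> borel_measurable gauss" by simp
  fix m
  have "\<bar>f om * g om\<bar> ^ m \<le> \<bar>f om\<bar> ^ (2 * m) + \<bar>g om\<bar> ^ (2 * m)" for om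
  proof -
    have "2 * (\<bar>f om\<bar> ^ m * \<bar>g om\<bar> ^ m) \<le> (\<bar>f om\<bar> ^ m)\<^sup>2 + (\<bar>g om\<bar> ^ m)\<^sup>2"
      using sum_squares_bound[of "\<bar>f om\<bar> ^ m" "\<bar>g om\<bar> ^ m"] by (simp add: mult.assoc)
    moreover have "0 \<le> \<bar>f om\<bar> ^ m * \<bar>g om\<bar> ^ m" by simp
    ultimately have "\<bar>f om\<bar> ^ m * \<bar>g om\<bar> ^ m \<le> (\<bar>f om\<bar> ^ m)\<^sup>2 + (\<bar>g om\<bar> ^ m)\<^sup>2"
      by linarith
    then show ?thesis
      by (simp add: abs_mult power_mult_distrib mult.commute[of 2 m] flip: power_mult)
  qed
  then have "AE om in gauss. norm (\<bar>f om * g om\<bar> ^ m) \<le> norm (\<bar>f om\<bar> ^ (2 * m) + \<bar>g om\<bar> ^ (2 * m))"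
    by (intro AE_I2) (smt (verit) norm_power real_norm_def abs_abs power_abs abs_ge_self)
  moreover have "integrable gauss (\<lambda>om. \<bar>f om\<bar> ^ (2 * m) + \<bar>g om\<bar> ^ (2 * m))"
    using assms unfolding all_moments_def
    by (intro integrable_mult_right Bochner_Integration.integrable_add) simp_all
  ultimately show "integrable gauss (\<lambda>om. \<bar>f om * g om\<bar> ^ m)"
    by (rule Bochner_Integration.integrable_bound[rotated 2]) measurable
qed

lemma all_moments_add [intro]:
  assumes "all_moments f" "all_moments g"
  shows "all_moments (\<lambda>om. f om + g om)"
  unfolding all_moments_def
proof (intro conjI allI)
  have [measurable]: "f \<in> borel_measurable gauss" "g \<in> borel_measurable gauss"
    using assms by (auto simp: all_moments_def)
  show "(\<lambda>om. f om + g om) \<in> borel_measurable gauss" by simp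
  fix m
  have "\<bar>f om + g om\<bar> ^ m \<le> 2 ^ m * (\<bar>f om\<bar> ^ m + \<bar>g om\<bar> ^ m)" for om
  proof -
    have "\<bar>f om + g om\<bar> ^ m \<le> (2 * max \<bar>f om\<bar> \<bar>g om\<bar>) ^ m"
      by (intro power_mono) auto
    also have "\<dots> \<le> 2 ^ m * (\<bar>f om\<bar> ^ m + \<bar>g om\<bar> ^ m)"
      unfolding power_mult_distrib by (intro mult_left_mono) (auto simp: max_def)
    finally show ?thesis .
  qed
  then have "AE om in gauss. norm (\<bar>f om + g om\<bar> ^ m) \<le> norm (2 ^ m * (\<bar>f om\<bar> ^ m + \<bar>g om\<bar> ^ m))"
    by (intro AE_I2) (smt (verit) norm_power real_norm_def abs_abs power_abs abs_ge_self)
  moreover have "integrable gauss (\<lambda>om. 2 ^ m * (\<bar>f om\<bar> ^ m + \<bar>g om\<bar> ^ m))"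
    using assms unfolding all_moments_def
    by (intro integrable_mult_right Bochner_Integration.integrable_add) simp_all
  ultimately show "integrable gauss (\<lambda>om. \<bar>f om + g om\<bar> ^ m)"
    by (rule Bochner_Integration.integrable_bound[rotated 2]) measurable
qed

lemma all_moments_diff [intro]:
  "all_moments f ==> all_moments g ==> all_moments (\<lambda>om. f om - g om)"
  using all_moments_add[of f "\<lambda>om. - 1 * g om"] all_moments_mult[of "\<lambda>_. -1" g] by simp

lemma all_moments_power [intro]: "all_moments f ==> all_moments (\<lambda>om. f om ^ m)"
  by (induction m) auto

lemma all_moments_sum [intro]:
  "(\<And>i. i \<in> I ==> all_moments (f i)) ==> all_moments (\<lambda>om. \<Sum>i\<in>I. f i om)"
  by (induction I rule: infinite_finite_induct) auto

lemma all_moments_prod [intro]: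
  "(\<And>i. i \<in> I ==> all_moments (f i)) ==> all_moments (\<lambda>om. \<Prod>i\<in>I. f i om)"
  by (induction I rule: infinite_finite_induct) auto

lemma all_moments_hermite [intro]: "all_moments f ==> all_moments (\<lambda>om. hermite k (f om) \<sigma>)"
proof (induction k rule: less_induct)
  case (less k)
  show ?case
    by (cases k) (simp_all add: hermite_Suc all_moments_diff all_moments_mult less)
qed

subsection \<open>Polynomials in Gaussian variables\<close>

inductive gpoly :: "'i set => nat => (('i => real) => real) => bool" for S :: "'i set" where
  const: "gpoly S 0 (\<lambda>_. c)"
| var: "gpoly S k f ==> i \<in> S ==> gpoly S (Suc k) (\<lambda>om. om i * f om)"
| add: "gpoly S k f ==> gpoly S k g ==> gpoly S k (\<lambda>om. f om + g om)"
| Suc: "gpoly S k f ==> gpoly S (Suc k) f"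

lemma gpoly_mono:
  assumes "gpoly S k f" "k \<le> m"
  shows "gpoly S m f"
  using assms(2) by (induction rule: dec_induct) (auto intro: assms gpoly.Suc)

lemma gpoly_const [intro, simp]: "gpoly S k (\<lambda>_. c)"
  by (rule gpoly_mono[OF gpoly.const]) simp

lemma all_moments_gpoly: "gpoly S k f ==> all_moments f"
  by (induction rule: gpoly.induct) auto

lemma dep_on_gpoly: "gpoly S k f ==> dep_on S f"
proof (induction rule: gpoly.induct)
  case (var k f i)
  show ?case unfolding dep_on_def
    using dep_onD[OF var.IH] var.hyps(2) by metis
next
  case (add k f g)
  show ?case unfolding dep_on_def
    using dep_onD[OF add.IH(1)] dep_onD[OF add.IH(2)] by metis
next
  case (Suc k f)
  show ?case by (rule Suc.IH)
qed (auto simp: dep_on_def)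

lemma gpoly_cmult [intro]: "gpoly S k f ==> gpoly S k (\<lambda>om. c * f om)"
proof (induction rule: gpoly.induct)
  case (var k f i)
  then show ?case using gpoly.var[of S k "\<lambda>om. c * f om" i] by (simp add: mult.left_commute)
qed (auto simp: distrib_left intro: gpoly.intros)

text \<open>Degrees add; the hypercontractive constants below depend on this degree only.\<close>

lemma gpoly_mult: "gpoly S k f ==> gpoly S m g ==> gpoly S (k + m) (\<lambda>om. f om * g om)"
proof (induction rule: gpoly.induct)
  case (var k f i)
  then show ?case using gpoly.var[of S "k + m" "\<lambda>om. f om * g om" i] by (simp add: mult.assoc)
qed (auto simp: distrib_right intro: gpoly.intros)

lemma gpoly_power: "gpoly S k f ==> gpoly S (m * k) (\<lambda>om. f om ^ m)"
  by (induction m) (auto simp: add.commute dest: gpoly_mult)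

lemma gpoly_sum [intro]: "(\<And>i. i \<in> I ==> gpoly S k (f i)) ==> gpoly S k (\<lambda>om. \<Sum>i\<in>I. f i om)"
  by (induction I rule: infinite_finite_induct) (auto intro: gpoly.add)

lemma gpoly_diff [intro]: "gpoly S k f ==> gpoly S k g ==> gpoly S k (\<lambda>om. f om - g om)"
  using gpoly.add[of S k f "\<lambda>om. - 1 * g om"] gpoly_cmult[of S k g "-1"] by simp

lemma gpoly_subset: "gpoly S k f ==> S \<subseteq> T ==> gpoly T k f"
  by (induction rule: gpoly.induct) (auto intro: gpoly.intros)

text \<open>Expansion of a polynomial in Hermite polynomials of one of its variables.\<close>

lemma gpoly_hermite_expansion:
  assumes "gpoly (insert s S) k f"
  shows "\<exists>F. (\<forall>j. gpoly S (k - j) (F j)) \<and> (\<forall>j>k. F j = (\<lambda>_. 0)) \<and>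
    (\<forall>om. f om = (\<Sum>j\<le>k. He j (om s) * F j om))"
  using assms
proof (induction rule: gpoly.induct)
  case (const c)
  show ?case
    by (rule exI[of _ "\<lambda>j. if j = 0 then (\<lambda>_. c) else (\<lambda>_. 0)"]) auto
next
  case (var k f i)
  then obtain F where F: "\<And>j. gpoly S (k - j) (F j)" "\<And>j. j > k ==> F j = (\<lambda>_. 0)"
    "\<And>om. f om = (\<Sum>j\<le>k. He j (om s) * F j om)" by blast
  show ?case
  proof (cases "i = s")
    case True
    define G where "G j = (\<lambda>om. (case j of 0 => 0 | Suc m => F m om) + real (Suc j) * F (Suc j) om)" for j
    have G: "gpoly S (Suc k - j) (G j)" for j
    proof (cases j)
      case 0
      then show ?thesis
        unfolding G_def using gpoly_cmult[OF gpoly_mono[OF F(1)[of 1], of "Suc k"], of 1]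
        by (auto intro!: gpoly_mono[OF F(1)[of "Suc 0"]])
    next
      case (Suc m)
      have "gpoly S (k - m) (\<lambda>om. real (Suc j) * F (Suc j) om)"
        by (intro gpoly_cmult gpoly_mono[OF F(1)[of "Suc j"]]) (use Suc in auto)
      then show ?thesis
        unfolding G_def using gpoly.add[OF F(1)[of m]] Suc by auto
    qed
    have "om i * f om = (\<Sum>j\<le>Suc k. He j (om s) * G j om)" for om
    proof -
      let ?z = "om s"
      have mult: "?z * He j ?z = He (Suc j) ?z + real j * He (j - 1) ?z" for j
        by (simp add: hermite_Suc)
      have "om i * f om = (\<Sum>j\<le>k. ?z * He j ?z * F j om)"
        by (simp add: F(3) True sum_distrib_left mult.assoc)
      also have "\<dots> = (\<Sum>j\<le>k. He (Suc j) ?z * F j om) + (\<Sum>j\<le>k. real j * He (j - 1) ?z * F j om)"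
        by (simp add: mult distrib_right sum.distrib)
      also have "(\<Sum>j\<le>k. He (Suc j) ?z * F j om) = (\<Sum>j\<le>Suc k. He j ?z * (case j of 0 => 0 | Suc m => F m om))"
        by (simp add: sum.atMost_Suc_shift del: sum.atMost_Suc)
      also have "(\<Sum>j\<le>k. real j * He (j - 1) ?z * F j om) = (\<Sum>j\<le>Suc (Suc k). real j * He (j - 1) ?z * F j om)"
        using F(2) by simp
      also have "\<dots> = (\<Sum>j\<le>Suc k. real (Suc j) * He j ?z * F (Suc j) om)"
        by (subst sum.atMost_Suc_shift) simp
      finally show ?thesis
        unfolding G_def distrib_left sum.distrib by (simp only: mult_ac)
    qed
    moreover have "\<forall>j>Suc k. G j = (\<lambda>_. 0)"
      using F(2) by (auto simp: G_def split: nat.split)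
    ultimately show ?thesis using G by blast
  next
    case False
    then have "i \<in> S" using var by simp
    have "gpoly S (Suc k - j) (\<lambda>om. om i * F j om)" for j
    proof (cases "j \<le> k")
      case True
      then show ?thesis using gpoly.var[OF F(1)[of j] \<open>i \<in> S\<close>] by (simp add: Suc_diff_le)
    qed (use F(2) in auto)
    then show ?thesis
      using F by (intro exI[of _ "\<lambda>j om. om i * F j om"]) (auto simp: sum_distrib_left mult_ac)
  qed
next
  case (add k f g)
  then obtain F G where "\<And>j. gpoly S (k - j) (F j)" "\<And>j. j > k ==> F j = (\<lambda>_. 0)"
    "\<And>om. f om = (\<Sum>j\<le>k. He j (om s) * F j om)" "\<And>j. gpoly S (k - j) (G j)" "\<And>j. j > k ==> G j = (\<lambda>_. 0)"
    "\<And>om. g om = (\<Sum>j\<le>k. He j (om s) * G j om)" by blast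
  then show ?case
    by (intro exI[of _ "\<lambda>j om. F j om + G j om"]) (auto intro: gpoly.add simp: sum.distrib distrib_left)
next
  case (Suc k f)
  then obtain F where "\<And>j. gpoly S (k - j) (F j)" "\<And>j. j > k ==> F j = (\<lambda>_. 0)"
    "\<And>om. f om = (\<Sum>j\<le>k. He j (om s) * F j om)" by blast
  then show ?case
    by (intro exI[of _ F]) (auto intro: gpoly_mono[of S "k - j" "F j" "Suc k - j" for j])
qed

subsection \<open>Hypercontractivity\<close>

lemma gauss_indep_component:
  fixes g :: "('i => real) => real"
  assumes "dep_on S g" "s \<notin> S" "all_moments g" "all_moments (\<lambda>om::'i => real. p (om s))"
    and [measurable]: "p \<in> borel_measurable borel"
  shows "(\<integral>om. p (om s) * g om \<partial>gauss) = integral\<^sup>L gauss1 p * integral\<^sup>L gauss g"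
proof -
  have "dep_on {s} (\<lambda>om. p (om s))" by (simp add: dep_on_def)
  then have "(\<integral>om. p (om s) * g om \<partial>gauss) = (\<integral>om. p (om s) \<partial>gauss) * integral\<^sup>L gauss g"
    by (rule gauss_indep_mult[OF _ assms(1)])
      (use assms(2) in \<open>auto intro!: all_moments_integrable all_moments_mult assms(3,4)\<close>)
  then show ?thesis by (simp add: integral_gauss_component(1))
qed

text \<open>The geometric weights make the constant independent of the number of terms.\<close>

lemma sum_power4_le:
  fixes x :: "nat => real"
  shows "(\<Sum>j<k. x j) ^ 4 \<le> (\<Sum>j<k. 8 ^ Suc j * x j ^ 4)"
proof (induction k arbitrary: x)
  case (Suc k)
  have two: "(a + b) ^ 4 \<le> 8 * a ^ 4 + 8 * b ^ 4" for a b :: real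
  proof -
    have "(a + b)\<^sup>2 \<le> 2 * a\<^sup>2 + 2 * b\<^sup>2"
      using sum_squares_bound[of a b] by (simp add: power2_sum)
    then have "((a + b)\<^sup>2)\<^sup>2 \<le> (2 * a\<^sup>2 + 2 * b\<^sup>2)\<^sup>2"
      by (rule power_mono) simp
    also have "\<dots> \<le> 8 * (a\<^sup>2)\<^sup>2 + 8 * (b\<^sup>2)\<^sup>2"
      using sum_squares_bound[of "a\<^sup>2" "b\<^sup>2"] by (simp add: power2_sum power_mult_distrib)
    finally show ?thesis by (simp flip: power_mult)
  qed
  have "(\<Sum>j<Suc k. x j) ^ 4 = (x 0 + (\<Sum>j<k. x (Suc j))) ^ 4"
    by (simp add: sum.lessThan_Suc_shift del: sum.lessThan_Suc)
  also have "\<dots> \<le> 8 * x 0 ^ 4 + 8 * (\<Sum>j<k. x (Suc j)) ^ 4" by (rule two)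
  also have "\<dots> \<le> 8 * x 0 ^ 4 + 8 * (\<Sum>j<k. 8 ^ Suc j * x (Suc j) ^ 4)"
    using Suc[of "\<lambda>j. x (Suc j)"] by simp
  also have "\<dots> = (\<Sum>j<Suc k. 8 ^ Suc j * x j ^ 4)"
    by (simp add: sum.lessThan_Suc_shift sum_distrib_left mult.assoc del: sum.lessThan_Suc)
  finally show ?case .
qed simp

text \<open>
  A polynomial of degree \<open>k\<close> satisfies \<open>E f\<^sup>4 \<le> 256\<^sup>k (E f\<^sup>2)\<^sup>2\<close>, by induction on the number of variables.
  In the expansion \<open>f = f\<^sub>0 + Z\<close> along a new variable, the part \<open>Z\<close> has conditional mean zero, so that
  \<open>E f\<^sub>0\<^sup>3 Z = 0\<close>; since every \<open>He\<^sub>j\<close> with \<open>j \<ge> 1\<close> lowers the degree of its coefficient, all the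
  remaining terms gain a small factor.
\<close>

lemma gpoly_fourth_moment:
  fixes f :: "('i => real) => real"
  assumes "finite S" "gpoly S k f"
  shows "(\<integral>om. f om ^ 4 \<partial>gauss) \<le> 256 ^ k * (\<integral>om. (f om)\<^sup>2 \<partial>gauss)\<^sup>2"
  using assms
proof (induction S arbitrary: k f rule: finite_induct)
  case empty
  then have "f = (\<lambda>_. f (\<lambda>_. 0))"
    using dep_onD[OF dep_on_gpoly[OF empty]] by blast
  then obtain c where c: "f = (\<lambda>_. c)" by blast
  have "1 * c ^ 4 \<le> 256 ^ k * c ^ 4"
    by (intro mult_right_mono) auto
  then show ?case by (simp add: c flip: power_mult)
next
  case (insert s S k f)
  obtain F where F: "\<And>j. gpoly S (k - j) (F j)" "\<And>j. j > k ==> F j = (\<lambda>_. 0)"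
    "\<And>om. f om = (\<Sum>j\<le>k. He j (om s) * F j om)"
    using gpoly_hermite_expansion[OF insert.prems] by blast
  have am: "all_moments (F j)" for j by (rule all_moments_gpoly[OF F(1)])
  have dep: "dep_on S (F j)" for j by (rule dep_on_gpoly[OF F(1)])
  note am_intros = am all_moments_mult all_moments_power all_moments_sum all_moments_hermite all_moments_var all_moments_add
  define h where "h i j = (\<integral>om. (F i om)\<^sup>2 * (F j om)\<^sup>2 \<partial>gauss)" for i j
  define E2 where "E2 j = (\<integral>om. (F j om)\<^sup>2 \<partial>gauss)" for j
  define b where "b j = fact j * E2 j" for j
  have E2_nonneg: "E2 j \<ge> 0" for j by (simp add: E2_def)
  then have b_nonneg: "b j \<ge> 0" for j by (simp add: b_def)
  have orth: "(\<integral>om. G om * (\<Sum>j\<in>J. He j (om s) * F j om)\<^sup>2 \<partial>gauss) = (\<Sum>j\<in>J. fact j * (\<integral>om. G om * (F j om)\<^sup>2 \<partial>gauss))"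
    if G: "dep_on S G" "all_moments G" and J: "finite J" for G J
  proof -
    have "G om * (\<Sum>j\<in>J. He j (om s) * F j om)\<^sup>2 =
        (\<Sum>i\<in>J. \<Sum>j\<in>J. (He i (om s) * He j (om s)) * (G om * (F i om * F j om)))" for om
      by (simp add: power2_eq_square sum_product sum_distrib_left mult_ac)
    then have "(\<integral>om. G om * (\<Sum>j\<in>J. He j (om s) * F j om)\<^sup>2 \<partial>gauss) =
        (\<Sum>i\<in>J. \<Sum>j\<in>J. (\<integral>om. (He i (om s) * He j (om s)) * (G om * (F i om * F j om)) \<partial>gauss))"
      by (simp add: all_moments_integrable am_intros G)
    also have "\<dots> = (\<Sum>i\<in>J. \<Sum>j\<in>J. (if i = j then fact i * (\<integral>om. G om * (F i om * F j om) \<partial>gauss) else 0))"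
    proof (intro sum.cong refl)
      fix i j
      have "dep_on S (\<lambda>om. G om * (F i om * F j om))"
        using G(1) dep[of i] dep[of j] unfolding dep_on_def by metis
      then have "(\<integral>om. (\<lambda>z. He i z * He j z) (om s) * (G om * (F i om * F j om)) \<partial>gauss) =
          (\<integral>z. He i z * He j z \<partial>gauss1) * (\<integral>om. G om * (F i om * F j om) \<partial>gauss)"
        by (rule gauss_indep_component) (use insert.hyps in \<open>auto intro!: am_intros G\<close>)
      then show "(\<integral>om. (He i (om s) * He j (om s)) * (G om * (F i om * F j om)) \<partial>gauss) =
          (if i = j then fact i * (\<integral>om. G om * (F i om * F j om) \<partial>gauss) else 0)"
        by (simp add: gauss1_He_orthogonal)
    qed
    also have "\<dots> = (\<Sum>j\<in>J. fact j * (\<integral>om. G om * (F j om)\<^sup>2 \<partial>gauss))"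
      using J by (simp add: sum.delta power2_eq_square)
    finally show ?thesis .
  qed
  define Z where "Z om = (\<Sum>j\<in>Suc ` {..<k}. He j (om s) * F j om)" for om
  have Z_alt: "Z om = (\<Sum>j<k. He (Suc j) (om s) * F (Suc j) om)" for om
    by (simp add: Z_def sum.reindex)
  have f_eq: "f om = F 0 om + Z om" for om
    by (simp add: F(3) Z_alt sum.atMost_shift lessThan_Suc_atMost[symmetric] sum.lessThan_Suc_shift del: sum.lessThan_Suc)
  have amZ: "all_moments Z" unfolding Z_def[abs_def] by (intro am_intros)
  note am_intros = am_intros amZ
  define B where "B = (\<Sum>j<k. b (Suc j))"
  have B_nonneg: "B \<ge> 0" by (simp add: B_def sum_nonneg b_nonneg)
  have Ef2: "(\<integral>om. (f om)\<^sup>2 \<partial>gauss) = E2 0 + B"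
    using orth[of "\<lambda>_. 1" "{..k}"]
    by (simp add: F(3) E2_def b_def B_def dep_on_def lessThan_Suc_atMost[symmetric] sum.lessThan_Suc_shift del: sum.lessThan_Suc)
  have IH: "(\<integral>om. F j om ^ 4 \<partial>gauss) \<le> 256 ^ (k - j) * (E2 j)\<^sup>2" for j
    using insert.IH[OF F(1)[of j]] by (simp add: E2_def)
  \<comment> \<open>the mixed term vanishes\<close>
  have mixed: "(\<integral>om. F 0 om ^ 3 * Z om \<partial>gauss) = 0"
  proof -
    have "F 0 om ^ 3 * Z om = (\<Sum>j<k. He (Suc j) (om s) * (F 0 om ^ 3 * F (Suc j) om))" for om
      by (simp add: Z_alt sum_distrib_left mult_ac)
    then have "(\<integral>om. F 0 om ^ 3 * Z om \<partial>gauss) = (\<Sum>j<k. \<integral>om. He (Suc j) (om s) * (F 0 om ^ 3 * F (Suc j) om) \<partial>gauss)"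
      by (simp add: all_moments_integrable am_intros)
    also have "\<dots> = 0"
    proof (intro sum.neutral ballI)
      fix j
      have "dep_on S (\<lambda>om. F 0 om ^ 3 * F (Suc j) om)"
        using dep[of 0] dep[of "Suc j"] unfolding dep_on_def by metis
      then have "(\<integral>om. He (Suc j) (om s) * (F 0 om ^ 3 * F (Suc j) om) \<partial>gauss) =
          integral\<^sup>L gauss1 (He (Suc j)) * (\<integral>om. F 0 om ^ 3 * F (Suc j) om \<partial>gauss)"
        by (rule gauss_indep_component) (use insert.hyps in \<open>auto intro!: am_intros\<close>)
      then show "(\<integral>om. He (Suc j) (om s) * (F 0 om ^ 3 * F (Suc j) om) \<partial>gauss) = 0"
        using gauss1_He_orthogonal[of "Suc j" 0] by simp
    qed
    finally show ?thesis .
  qed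
  have h_le: "h 0 (Suc j) \<le> 256 ^ k / 16 * (E2 0 * E2 (Suc j))" if "j < k" for j
  proof (rule power2_le_imp_le)
    have "(h 0 (Suc j))\<^sup>2 \<le> (\<integral>om. ((F 0 om)\<^sup>2)\<^sup>2 \<partial>gauss) * (\<integral>om. ((F (Suc j) om)\<^sup>2)\<^sup>2 \<partial>gauss)"
      unfolding h_def by (intro integral_mult_square_le all_moments_integrable am_intros)
    also have "\<dots> = (\<integral>om. F 0 om ^ 4 \<partial>gauss) * (\<integral>om. F (Suc j) om ^ 4 \<partial>gauss)"
      by (simp flip: power_mult)
    also have "\<dots> \<le> (256 ^ (k - 0) * (E2 0)\<^sup>2) * (256 ^ (k - Suc j) * (E2 (Suc j))\<^sup>2)"
      by (intro mult_mono IH) auto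
    also have "\<dots> \<le> (256 ^ k * (E2 0)\<^sup>2) * (256 ^ (k - 1) * (E2 (Suc j))\<^sup>2)"
      by (intro mult_mono mult_right_mono power_increasing) auto
    also have "\<dots> = (256 ^ k / 16 * (E2 0 * E2 (Suc j)))\<^sup>2"
      using that by (cases k) (auto simp: power2_eq_square field_simps)
    finally show "(h 0 (Suc j))\<^sup>2 \<le> (256 ^ k / 16 * (E2 0 * E2 (Suc j)))\<^sup>2" .
    show "0 \<le> 256 ^ k / 16 * (E2 0 * E2 (Suc j))" using E2_nonneg by simp
  qed
  have cross: "(\<integral>om. (F 0 om)\<^sup>2 * (Z om)\<^sup>2 \<partial>gauss) \<le> 256 ^ k / 16 * (E2 0 * B)"
  proof -
    have "dep_on S (\<lambda>om. (F 0 om)\<^sup>2)" using dep[of 0] unfolding dep_on_def by metis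
    then have "(\<integral>om. (F 0 om)\<^sup>2 * (Z om)\<^sup>2 \<partial>gauss) = (\<Sum>j<k. fact (Suc j) * h 0 (Suc j))"
      unfolding Z_def h_def by (subst orth) (auto intro!: am_intros simp: sum.reindex)
    also have "\<dots> \<le> (\<Sum>j<k. fact (Suc j) * (256 ^ k / 16 * (E2 0 * E2 (Suc j))))"
      by (intro sum_mono mult_left_mono h_le) auto
    also have "\<dots> = 256 ^ k / 16 * (E2 0 * B)"
      by (simp add: B_def b_def sum_distrib_left mult_ac)
    finally show ?thesis .
  qed
  have Z4: "(\<integral>om. Z om ^ 4 \<partial>gauss) \<le> 256 ^ k * (72 / 256) * B\<^sup>2"
  proof -
    have "(\<integral>om. Z om ^ 4 \<partial>gauss) \<le> (\<integral>om. (\<Sum>j<k. 8 ^ Suc j * (He (Suc j) (om s) * F (Suc j) om) ^ 4) \<partial>gauss)"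
      unfolding Z_alt by (intro integral_mono sum_power4_le all_moments_integrable am_intros all_moments_const)
    also have "\<dots> = (\<Sum>j<k. 8 ^ Suc j * (\<integral>om. He (Suc j) (om s) ^ 4 * F (Suc j) om ^ 4 \<partial>gauss))"
      by (simp add: power_mult_distrib all_moments_integrable am_intros del: power_Suc)
    also have "\<dots> = (\<Sum>j<k. 8 ^ Suc j * ((\<integral>z. He (Suc j) z ^ 4 \<partial>gauss1) * (\<integral>om. F (Suc j) om ^ 4 \<partial>gauss)))"
    proof (intro sum.cong refl arg_cong[of _ _ "\<lambda>x. 8 ^ _ * x"])
      fix j
      have "dep_on S (\<lambda>om. F (Suc j) om ^ 4)" using dep[of "Suc j"] unfolding dep_on_def by metis
      then show "(\<integral>om. He (Suc j) (om s) ^ 4 * F (Suc j) om ^ 4 \<partial>gauss) =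
          (\<integral>z. He (Suc j) z ^ 4 \<partial>gauss1) * (\<integral>om. F (Suc j) om ^ 4 \<partial>gauss)"
        by (intro gauss_indep_component[where p = "\<lambda>z. He (Suc j) z ^ 4"])
          (use insert.hyps in \<open>auto intro!: am_intros\<close>)
    qed
    also have "\<dots> \<le> (\<Sum>j<k. 8 ^ Suc j * ((9 ^ Suc j * (fact (Suc j))\<^sup>2) * (256 ^ (k - Suc j) * (E2 (Suc j))\<^sup>2)))"
      by (intro sum_mono mult_left_mono mult_mono gauss1_He_fourth_moment IH) auto
    also have "\<dots> = (\<Sum>j<k. (72 ^ Suc j * 256 ^ (k - Suc j)) * (b (Suc j))\<^sup>2)"
    proof (intro sum.cong refl)
      fix j
      have "(72 :: real) ^ Suc j = 8 ^ Suc j * 9 ^ Suc j" by (simp flip: power_mult_distrib)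
      then show "8 ^ Suc j * ((9 ^ Suc j * (fact (Suc j))\<^sup>2) * (256 ^ (k - Suc j) * (E2 (Suc j))\<^sup>2)) =
          (72 ^ Suc j * 256 ^ (k - Suc j)) * (b (Suc j))\<^sup>2"
        by (simp only: b_def power_mult_distrib mult_ac)
    qed
    also have "\<dots> \<le> (\<Sum>j<k. (256 ^ k * (72 / 256)) * (b (Suc j))\<^sup>2)"
    proof (intro sum_mono mult_right_mono)
      fix j assume "j \<in> {..<k}"
      then have "(256 :: real) ^ k = 256 ^ Suc j * 256 ^ (k - Suc j)"
        by (subst power_add[symmetric]) simp
      moreover have "(72 :: real) ^ Suc j \<le> 256 ^ Suc j * (72 / 256)"
        using power_mono[of "72 :: real" 256 j] by simp
      ultimately show "(72 :: real) ^ Suc j * 256 ^ (k - Suc j) \<le> 256 ^ k * (72 / 256)"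
        using mult_right_mono[of "(72 :: real) ^ Suc j" "256 ^ Suc j * (72 / 256)" "256 ^ (k - Suc j)"]
        by (simp only: mult_ac) simp
    qed auto
    also have "\<dots> = (256 ^ k * (72 / 256)) * (\<Sum>j<k. (b (Suc j))\<^sup>2)"
      by (simp only: sum_distrib_left)
    also have "(\<Sum>j<k. (b (Suc j))\<^sup>2) \<le> B\<^sup>2"
    proof -
      have "(\<Sum>j<k. (b (Suc j))\<^sup>2) \<le> (\<Sum>j<k. b (Suc j) * B)"
        unfolding power2_eq_square
        by (intro sum_mono mult_left_mono b_nonneg) (auto simp: B_def intro!: member_le_sum b_nonneg)
      then show ?thesis by (simp add: B_def power2_eq_square sum_distrib_right)
    qed
    finally show ?thesis by (simp add: mult_left_mono)
  qed
  have "f om ^ 4 \<le> F 0 om ^ 4 + 4 * (F 0 om ^ 3 * Z om) + 8 * ((F 0 om)\<^sup>2 * (Z om)\<^sup>2) + 3 * Z om ^ 4" for om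
  proof -
    have "0 \<le> 2 * (Z om)\<^sup>2 * (F 0 om - Z om)\<^sup>2" by simp
    then show ?thesis
      unfolding f_eq by (simp add: algebra_simps power2_eq_square power3_eq_cube power4_eq_xxxx)
  qed
  then have "(\<integral>om. f om ^ 4 \<partial>gauss) \<le>
      (\<integral>om. F 0 om ^ 4 + 4 * (F 0 om ^ 3 * Z om) + 8 * ((F 0 om)\<^sup>2 * (Z om)\<^sup>2) + 3 * Z om ^ 4 \<partial>gauss)"
    unfolding f_eq by (intro integral_mono all_moments_integrable am_intros all_moments_const)
  also have "\<dots> = (\<integral>om. F 0 om ^ 4 \<partial>gauss) + 8 * (\<integral>om. (F 0 om)\<^sup>2 * (Z om)\<^sup>2 \<partial>gauss) + 3 * (\<integral>om. Z om ^ 4 \<partial>gauss)"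
    by (simp add: all_moments_integrable am_intros mixed)
  also have "\<dots> \<le> 256 ^ k * (E2 0)\<^sup>2 + 8 * (256 ^ k / 16 * (E2 0 * B)) + 3 * (256 ^ k * (72 / 256) * B\<^sup>2)"
    using IH[of 0] cross Z4 by (intro add_mono mult_left_mono) simp_all
  also have "\<dots> = 256 ^ k * ((E2 0)\<^sup>2 + 1 / 2 * (E2 0 * B) + 216 / 256 * B\<^sup>2)"
    by (simp add: algebra_simps)
  also have "\<dots> \<le> 256 ^ k * (E2 0 + B)\<^sup>2"
  proof (intro mult_left_mono)
    have "0 \<le> E2 0 * B" "0 \<le> B\<^sup>2"
      using E2_nonneg[of 0] B_nonneg by simp_all
    then show "(E2 0)\<^sup>2 + 1 / 2 * (E2 0 * B) + 216 / 256 * B\<^sup>2 \<le> (E2 0 + B)\<^sup>2"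
      unfolding power2_sum mult.assoc by linarith
  qed simp
  finally show ?case by (simp only: Ef2)
qed

text \<open>Powers of polynomials are polynomials, so the fourth moment bound can be iterated.\<close>

lemma gpoly_hypercontractive:
  fixes f :: "('i => real) => real"
  assumes "finite S" "gpoly S k f"
  shows "(\<integral>om. f om ^ (2 * 2 ^ r) \<partial>gauss) \<le> (16 ^ (k * r) * (\<integral>om. (f om)\<^sup>2 \<partial>gauss)) ^ (2 ^ r)"
proof (induction r)
  case (Suc r)
  let ?E = "\<integral>om. (f om)\<^sup>2 \<partial>gauss"
  have "(\<integral>om. f om ^ (2 * 2 ^ Suc r) \<partial>gauss) = (\<integral>om. (f om ^ (2 ^ r)) ^ 4 \<partial>gauss)"
    by (simp add: mult.commute flip: power_mult)
  also have "\<dots> \<le> 256 ^ (2 ^ r * k) * (\<integral>om. (f om ^ (2 ^ r))\<^sup>2 \<partial>gauss)\<^sup>2"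
    by (rule gpoly_fourth_moment[OF assms(1) gpoly_power[OF assms(2)]])
  also have "(\<integral>om. (f om ^ (2 ^ r))\<^sup>2 \<partial>gauss) = (\<integral>om. f om ^ (2 * 2 ^ r) \<partial>gauss)"
    by (simp add: mult.commute flip: power_mult)
  also have "256 ^ (2 ^ r * k) * (\<integral>om. f om ^ (2 * 2 ^ r) \<partial>gauss)\<^sup>2 \<le>
      256 ^ (2 ^ r * k) * ((16 ^ (k * r) * ?E) ^ (2 ^ r))\<^sup>2"
    by (intro mult_left_mono power_mono Suc) (auto intro!: Bochner_Integration.integral_nonneg)
  also have "\<dots> = (16 ^ (k * Suc r) * ?E) ^ (2 ^ Suc r)"
  proof -
    have "(256 :: real) ^ (2 ^ r * k) = (16 ^ k) ^ (2 ^ Suc r)"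
      using power_mult[of "16 :: real" 2 "2 ^ r * k"] by (simp add: mult_ac flip: power_mult)
    then show ?thesis
      by (simp add: power_mult_distrib power_add mult_ac flip: power_mult)
  qed
  finally show ?case .
qed simp

section \<open>Fourier analysis on the torus\<close>

definition torus :: "(real ^ 'd) measure" where
  "torus = restrict_space lborel (cbox 0 1)"

lemma space_torus [simp]: "space torus = (cbox 0 1 :: (real ^ 'd) set)"
  by (simp add: torus_def space_restrict_space)

lemma torus_integral_eq: "torus_integral f = integral\<^sup>L torus f"
  unfolding torus_integral_def torus_def set_lebesgue_integral_def
  by (subst integral_restrict_space) auto

lemma prob_space_torus: "prob_space (torus :: (real ^ 'd) measure)"
proof
  have "(1 :: real ^ 'd) \<bullet> b = 1" if "b \<in> Basis" for b
    using that by (auto simp: Basis_vec_def inner_axis)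
  then have "emeasure lborel (cbox 0 1 :: (real ^ 'd) set) = 1"
    by (subst emeasure_lborel_cbox) auto
  then show "emeasure torus (space torus :: (real ^ 'd) set) = 1"
    by (simp add: torus_def emeasure_restrict_space)
qed

interpretation torus: prob_space "torus :: (real ^ 'd) measure"
  by (rule prob_space_torus)

lemma measure_torus_cbox [simp]: "measure torus (cbox 0 1 :: (real ^ 'd) set) = 1"
  using torus.prob_space by simp

lemma measurable_torus_borel: "f \<in> measurable borel M ==> f \<in> measurable torus M"
  unfolding torus_def by (intro measurable_restrict_space1) simp

lemma continuous_imp_integrable_torus:
  fixes f :: "real ^ 'd => 'b::{banach, second_countable_topology}"
  assumes "continuous_on UNIV f"
  shows "integrable torus f"
proof -
  have c: "continuous_on (cbox 0 1) f" using assms continuous_on_subset by blast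
  then have "bounded (f ` cbox 0 1)"
    by (intro compact_imp_bounded compact_continuous_image) auto
  then obtain C where "\<And>x. x \<in> cbox 0 1 ==> norm (f x) \<le> C"
    by (auto simp: bounded_iff)
  then show ?thesis
    using assms by (intro torus.integrable_const_bound[of _ C])
      (auto intro!: measurable_torus_borel borel_measurable_continuous_onI AE_I2)
qed

lemma torus_integral_HK:
  fixes f :: "real ^ 'd => 'b::euclidean_space"
  assumes "continuous_on UNIV f"
  shows "torus_integral f = integral (cbox 0 1) f"
proof -
  have "set_integrable lborel (cbox 0 1) f"
    unfolding set_integrable_def by (rule borel_integrable_compact) (auto intro: continuous_on_subset[OF assms])
  then show ?thesis
    unfolding torus_integral_def by (rule set_borel_integral_eq_integral(2))
qed

definition periodic :: "(real ^ 'd => 'b) => bool" where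
  "periodic f \<longleftrightarrow> (\<forall>l x. f (x + rvec l) = f x)"

lemma rvec_axis: "rvec (axis i 1) = axis i 1"
  by (auto simp: rvec_def axis_def vec_eq_iff)

lemma mem_slab_iff:
  "x \<in> cbox (axis i a) (1 - axis i 1 + axis i b :: real ^ 'd) \<longleftrightarrow>
    a \<le> x $ i \<and> x $ i \<le> b \<and> (\<forall>j. j ~= i --> 0 \<le> x $ j \<and> x $ j \<le> 1)" (is "?L \<longleftrightarrow> ?R")
proof
  assume ?L
  then have *: "axis i a $ j \<le> x $ j \<and> x $ j \<le> (1 - axis i 1 + axis i b :: real ^ 'd) $ j" for j
    by (simp add: mem_box_cart)
  show ?R
  proof (intro conjI allI impI)
    show "a \<le> x $ i" "x $ i \<le> b" using *[of i] by (simp_all add: axis_def)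
    show "0 \<le> x $ j" "x $ j \<le> 1" if "j ~= i" for j using *[of j] that by (simp_all add: axis_def)
  qed
next
  assume R: ?R
  have "axis i a $ j \<le> x $ j \<and> x $ j \<le> (1 - axis i 1 + axis i b :: real ^ 'd) $ j" for j
    using R by (cases "j = i") (simp_all add: axis_def)
  then show ?L by (simp add: mem_box_cart)
qed

text \<open>Periodicity: the part of the shifted cube that leaves the unit cube returns on the opposite side.\<close>

lemma torus_integral_shift:
  fixes f :: "real ^ 'd => 'b::euclidean_space"
  assumes f: "continuous_on UNIV f" and p: "periodic f" and h: "0 \<le> h" "h \<le> 1"
  shows "torus_integral (\<lambda>x. f (x + axis i h)) = torus_integral f"
proof -
  define slab where "slab a b = cbox (axis i a) (1 - axis i 1 + axis i b :: real ^ 'd)" for a b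
  let ?e = "axis i 1 :: real ^ 'd"
  have ax: "axis i (a + b) = axis i a + axis i b" for a b :: real
    by (auto simp: axis_def vec_eq_iff)
  have slab01: "cbox 0 1 = slab 0 1"
    by (simp add: slab_def axis_def vec_eq_iff flip: zero_vec_def)
  have int: "f integrable_on slab a b" for a b
    unfolding slab_def by (rule integrable_continuous) (rule continuous_on_subset[OF f], simp)
  have e: "?e \<in> Basis" by (auto simp: Basis_vec_def)
  have slab_split: "integral (slab a b) f = integral (slab a c) f + integral (slab c b) f"
    if "a \<le> c" "c \<le> b" for a b c
  proof -
    have "slab a b \<inter> {x. x \<bullet> ?e \<le> c} = slab a c" "slab a b \<inter> {x. x \<bullet> ?e \<ge> c} = slab c b"
      using that unfolding slab_def set_eq_iff by (auto simp: mem_slab_iff inner_axis)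
    then show ?thesis
      using integral_split[OF int[of a b, unfolded slab_def] e, of c] unfolding slab_def by simp
  qed
  have slab_shift: "integral (slab a b) (f \<circ> ((+) (axis i c))) = integral (slab (a + c) (b + c)) f" for a b c
    unfolding slab_def integral_shift_cbox_plus ax by (simp add: add.assoc)
  have "torus_integral (\<lambda>x. f (x + axis i h)) = integral (cbox 0 1) (\<lambda>x. f (x + axis i h))"
    by (rule torus_integral_HK) (intro continuous_on_compose2[OF f] continuous_intros, auto)
  also have "\<dots> = integral (slab 0 1) (f \<circ> ((+) (axis i h)))"
    unfolding slab01 by (rule arg_cong[of _ _ "integral _"]) (auto simp: fun_eq_iff add.commute)
  also have "\<dots> = integral (slab h (1 + h)) f"
    by (simp add: slab_shift)
  also have "\<dots> = integral (slab h 1) f + integral (slab 1 (1 + h)) f"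
    using h by (intro slab_split) auto
  also have "integral (slab 1 (1 + h)) f = integral (slab 0 h) (f \<circ> ((+) ?e))"
    by (simp add: slab_shift add.commute)
  also have "f \<circ> ((+) ?e) = f"
    using p by (auto simp: periodic_def fun_eq_iff add.commute simp flip: rvec_axis)
  also have "integral (slab h 1) f + integral (slab 0 h) f = integral (slab 0 1) f"
    using slab_split[of 0 h 1] h by simp
  also have "\<dots> = torus_integral f"
    unfolding slab01[symmetric] by (rule torus_integral_HK[OF f, symmetric])
  finally show ?thesis .
qed

lemma rvec_simps [simp]: "rvec 0 = 0" "rvec (l + m) = rvec l + rvec m" "rvec (- l) = - rvec l" "rvec (l - m) = rvec l - rvec m"
  by (auto simp: rvec_def vec_eq_iff)

lemma rvec_eq_0_iff [simp]: "rvec l = 0 \<longleftrightarrow> l = 0"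
  by (auto simp: rvec_def vec_eq_iff)

lemma inner_rvec: "rvec l \<bullet> rvec m = of_int (\<Sum>i\<in>UNIV. l $ i * m $ i)"
  by (simp add: rvec_def inner_vec_def)

lemma fourier_char_0 [simp]: "fourier_char 0 x = 1" "fourier_char l 0 = 1"
  by (simp_all add: fourier_char_def)

lemma fourier_char_add: "fourier_char (l + m) x = fourier_char l x * fourier_char m x"
  and fourier_char_add_right: "fourier_char l (x + y) = fourier_char l x * fourier_char l y"
  by (simp_all add: fourier_char_def cis_mult inner_add_left inner_add_right algebra_simps)

lemma fourier_char_uminus: "fourier_char (- l) x = cnj (fourier_char l x)"
  by (simp add: fourier_char_def cis_cnj)

lemma norm_fourier_char [simp]: "norm (fourier_char l x) = 1"
  by (simp add: fourier_char_def)

lemma fourier_char_sum: "fourier_char (sum f A) x = (\<Prod>i\<in>A. fourier_char (f i) x)"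
  by (induction A rule: infinite_finite_induct) (auto simp: fourier_char_add)

lemma continuous_fourier_char [continuous_intros]: "continuous_on S (fourier_char l)"
  unfolding fourier_char_def[abs_def] by (intro continuous_intros)

lemma measurable_fourier_char [measurable]: "fourier_char l \<in> borel_measurable borel"
  by (intro borel_measurable_continuous_onI continuous_fourier_char)

lemma periodic_fourier_char: "periodic (fourier_char l)"
proof -
  have "fourier_char l (rvec m) = 1" for m
    unfolding fourier_char_def inner_rvec by (rule cis_multiple_2pi) (auto intro!: Ints_sum Ints_mult)
  then show ?thesis by (simp add: periodic_def fourier_char_add_right)
qed

lemma torus_integral_fourier_char: "torus_integral (fourier_char l) = (if l = 0 then 1 else 0)"
proof (cases "l = 0")
  case True
  then have "fourier_char l = (\<lambda>_. 1)" by auto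
  then show ?thesis using True by (simp add: torus_integral_eq)
next
  case False
  then obtain i where i: "l $ i ~= 0" by (auto simp: vec_eq_iff)
  define h where "h = 1 / (2 * \<bar>real_of_int (l $ i)\<bar>)"
  have "1 \<le> \<bar>l $ i\<bar>" using i by simp
  then have "1 \<le> \<bar>real_of_int (l $ i)\<bar>" by linarith
  then have h: "0 \<le> h" "h \<le> 1" by (auto simp: h_def divide_simps)
  have "rvec l \<bullet> axis i h = real_of_int (l $ i) * h"
    by (simp add: inner_axis rvec_def)
  also have "\<dots> = (if l $ i > 0 then 1 / 2 else - 1 / 2)"
    using i by (auto simp: h_def field_simps)
  finally have "fourier_char l (axis i h) = -1"
    unfolding fourier_char_def by (auto simp: complex_eq_iff)
  then have "torus_integral (fourier_char l) = torus_integral (\<lambda>x. - fourier_char l x)"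
    using torus_integral_shift[OF continuous_fourier_char periodic_fourier_char h, of l i]
    by (simp add: fourier_char_add_right)
  then show ?thesis using False by (simp add: torus_integral_eq)
qed

lemma torus_integral_fourier_char_mult:
  "torus_integral (\<lambda>x. fourier_char l x * cnj (fourier_char m x)) = (if l = m then 1 else 0)"
  using torus_integral_fourier_char[of "l - m"]
  by (simp add: fourier_char_add[of l "- m", unfolded fourier_char_uminus, symmetric])

subsection \<open>Test functions\<close>

lemma test_functions_iff:
  "f \<in> test_functions \<longleftrightarrow> periodic f \<and> (\<forall>is x. foldr pdiff is f differentiable (at x))"
  by (simp add: test_functions_def periodic_def)

lemma test_function_differentiable: "f \<in> test_functions ==> foldr pdiff is f differentiable (at x)"
  by (simp add: test_functions_iff)

lemma pdiff_fourier_char: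
  "pdiff i (\<lambda>x. c * fourier_char l x) = (\<lambda>x. (c * (2 * pi * \<i> * of_int (l $ i))) * fourier_char l x)"
  "(\<lambda>x. c * fourier_char l x) differentiable (at x)"
proof -
  have D: "((\<lambda>x. c * fourier_char l x) has_derivative
      (\<lambda>v. c * ((of_real (2 * pi * (rvec l \<bullet> v)) * \<i>) * fourier_char l x))) (at x)" for x
  proof -
    have eq: "fourier_char l = (\<lambda>x. exp (of_real (2 * pi * (rvec l \<bullet> x)) * \<i>))"
      by (auto simp: fourier_char_def cis_conv_exp mult_ac)
    have g: "((\<lambda>x. of_real (2 * pi * (rvec l \<bullet> x)) * \<i>) has_derivative
        (\<lambda>v. of_real (2 * pi * (rvec l \<bullet> v)) * \<i>)) (at x)"
      by (intro derivative_eq_intros) auto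
    have "((\<lambda>x. exp (of_real (2 * pi * (rvec l \<bullet> x)) * \<i>)) has_derivative
        (\<lambda>v. exp (of_real (2 * pi * (rvec l \<bullet> x)) * \<i>) * (of_real (2 * pi * (rvec l \<bullet> v)) * \<i>))) (at x)"
      using has_derivative_compose[OF g DERIV_exp[unfolded has_field_derivative_def]] by simp
    then show ?thesis unfolding eq
      by (intro has_derivative_mult_right) (simp add: mult.commute)
  qed
  show "(\<lambda>x. c * fourier_char l x) differentiable (at x)"
    using D by (auto simp: differentiable_def)
  show "pdiff i (\<lambda>x. c * fourier_char l x) = (\<lambda>x. (c * (2 * pi * \<i> * of_int (l $ i))) * fourier_char l x)"
  proof
    fix x
    show "pdiff i (\<lambda>x. c * fourier_char l x) x = (c * (2 * pi * \<i> * of_int (l $ i))) * fourier_char l x"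
      unfolding pdiff_def frechet_derivative_at[OF D, symmetric]
      by (simp add: inner_axis rvec_def mult_ac)
  qed
qed

lemma foldr_pdiff_fourier_char:
  "\<exists>c'. foldr pdiff is (\<lambda>x. c * fourier_char l x) = (\<lambda>x. c' * fourier_char l x) \<and>
    norm c' \<le> norm c * (2 * pi * norm (rvec l)) ^ length is"
proof (induction "is")
  case (Cons i "is")
  then obtain c' where c': "foldr pdiff is (\<lambda>x. c * fourier_char l x) = (\<lambda>x. c' * fourier_char l x)"
    "norm c' \<le> norm c * (2 * pi * norm (rvec l)) ^ length is" by blast
  have "\<bar>real_of_int (l $ i)\<bar> \<le> norm (rvec l)"
    using component_le_norm_cart[of "rvec l" i] by (simp add: rvec_def)
  then have "norm (2 * pi * \<i> * of_int (l $ i)) \<le> 2 * pi * norm (rvec l)"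
    by (simp add: norm_mult)
  then have "norm (c' * (2 * pi * \<i> * of_int (l $ i))) \<le> norm c * (2 * pi * norm (rvec l)) ^ length is * (2 * pi * norm (rvec l))"
    unfolding norm_mult[of c'] using c'(2) by (intro mult_mono) auto
  then show ?case
    by (intro exI[of _ "c' * (2 * pi * \<i> * of_int (l $ i))"]) (simp add: c'(1) pdiff_fourier_char mult_ac)
qed (auto intro!: exI[of _ c])

lemma fourier_char_test [intro]: "(\<lambda>x. c * fourier_char l x) \<in> test_functions"
  unfolding test_functions_iff
proof (intro conjI allI)
  show "periodic (\<lambda>x. c * fourier_char l x)"
    using periodic_fourier_char by (auto simp: periodic_def)
  fix "is" x
  show "foldr pdiff is (\<lambda>x. c * fourier_char l x) differentiable (at x)"
  proof -
    obtain c' where "foldr pdiff is (\<lambda>x. c * fourier_char l x) = (\<lambda>x. c' * fourier_char l x)"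
      using foldr_pdiff_fourier_char[of "is" c l] by blast
    then show ?thesis by (simp only: pdiff_fourier_char(2))
  qed
qed

lemma cnj_fourier_char_test [intro, simp]: "(\<lambda>x. cnj (fourier_char l x)) \<in> test_functions"
  using fourier_char_test[of 1 "- l"] by (simp add: fourier_char_uminus)

lemma test_function_continuous:
  assumes "f \<in> test_functions"
  shows "continuous_on UNIV (foldr pdiff is f)"
  by (intro continuous_at_imp_continuous_on ballI differentiable_imp_continuous_within
      test_function_differentiable[OF assms])

lemma test_function_continuous' : "f \<in> test_functions ==> continuous_on UNIV f"
  using test_function_continuous[of f "[]"] by simp

lemma pdiff_test:
  assumes f: "f \<in> test_functions"
  shows "pdiff i f \<in> test_functions"
  unfolding test_functions_iff
proof (intro conjI allI)
  fix "is" x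
  show "foldr pdiff is (pdiff i f) differentiable (at x)"
    using test_function_differentiable[OF f, of "is @ [i]"] by simp
next
  have d: "f differentiable (at x)" for x
    using test_function_differentiable[OF f, of "[]"] by simp
  show "periodic (pdiff i f)"
    unfolding periodic_def
  proof (intro allI)
    fix l x
    have p: "f (y + rvec l) = f y" for y using f by (auto simp: test_functions_iff periodic_def)
    have "(f has_derivative frechet_derivative f (at (x + rvec l))) (at (x + rvec l))"
      using d frechet_derivative_works by blast
    moreover have "((\<lambda>y. y + rvec l) has_derivative (\<lambda>v. v)) (at x)"
      by (auto intro!: derivative_eq_intros)
    ultimately have "((\<lambda>y. f (y + rvec l)) has_derivative frechet_derivative f (at (x + rvec l))) (at x)"
      by (rule has_derivative_compose[rotated])
    then have "(f has_derivative frechet_derivative f (at (x + rvec l))) (at x)"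
      by (simp add: p)
    then show "pdiff i f (x + rvec l) = pdiff i f x"
      unfolding pdiff_def using frechet_derivative_at[of f _ x] by simp
  qed
qed

lemma foldr_pdiff_test: "f \<in> test_functions ==> foldr pdiff is f \<in> test_functions"
  by (induction "is") (auto intro: pdiff_test)

text \<open>
  Integration by parts on the torus: the integral of \<open>f(x + h) e\<^sub>l(x)\<close> is \<open>e\<^sub>l(-h)\<close> times the one of
  \<open>f e\<^sub>l\<close>; both sides are differentiated at \<open>h = 0\<close>.
\<close>

lemma torus_by_parts:
  fixes f :: "real ^ 'd => complex"
  assumes f: "f \<in> test_functions"
  shows "torus_integral (\<lambda>x. fourier_char l x * pdiff i f x) =
    - (2 * pi * \<i> * of_int (l $ i)) * torus_integral (\<lambda>x. fourier_char l x * f x)"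
proof -
  let ?I = "torus_integral (\<lambda>x. fourier_char l x * f x)"
  let ?f = "\<lambda>h x. fourier_char l x * f (x + axis i h)"
  let ?f' = "\<lambda>h x. fourier_char l x * pdiff i f (x + axis i h)"
  have cf: "continuous_on UNIV f" by (rule test_function_continuous'[OF f])
  have cf': "continuous_on UNIV (pdiff i f)" by (rule test_function_continuous'[OF pdiff_test[OF f]])
  define e where "e = (axis i 1 :: real ^ 'd)"
  have ax: "axis i h = h *\<^sub>R e" for h by (auto simp: e_def axis_def vec_eq_iff)
  have d: "f differentiable (at x)" for x
    using test_function_differentiable[OF f, of "[]"] by simp
  have per: "periodic (\<lambda>x. fourier_char l x * f x)"
    using f periodic_fourier_char[of l] by (auto simp: test_functions_iff periodic_def)
  have val: "integral (cbox 0 1) (?f h) = fourier_char l (- axis i h) * ?I" if h: "h \<in> {0..1}" for h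
  proof -
    have "integral (cbox 0 1) (?f h) = torus_integral (?f h)"
      by (subst torus_integral_HK) (auto intro!: continuous_intros continuous_on_compose2[OF cf])
    also have "torus_integral (?f h) = torus_integral (\<lambda>x. fourier_char l (- axis i h) * (fourier_char l (x + axis i h) * f (x + axis i h)))"
    proof (rule arg_cong[of _ _ torus_integral], rule ext)
      fix x
      have "fourier_char l x = fourier_char l (- axis i h) * fourier_char l (x + axis i h)"
        by (simp flip: fourier_char_add_right)
      then show "?f h x = fourier_char l (- axis i h) * (fourier_char l (x + axis i h) * f (x + axis i h))"
        by simp
    qed
    also have "\<dots> = fourier_char l (- axis i h) * torus_integral (\<lambda>x. fourier_char l (x + axis i h) * f (x + axis i h))"
      by (simp add: torus_integral_eq)
    also have "torus_integral (\<lambda>x. fourier_char l (x + axis i h) * f (x + axis i h)) = ?I"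
      using h by (intro torus_integral_shift[OF _ per]) (auto intro!: continuous_intros cf)
    finally show ?thesis .
  qed
  have "((\<lambda>h. integral (cbox 0 1) (?f h)) has_vector_derivative integral (cbox 0 1) (?f' 0)) (at 0 within {0..1})"
  proof (rule leibniz_rule_vector_derivative[where fx = ?f'])
    fix h t
    have "(f has_derivative frechet_derivative f (at (t + axis i h))) (at (t + axis i h))"
      using d frechet_derivative_works by blast
    moreover have "((\<lambda>h. t + axis i h) has_derivative (\<lambda>k. axis i k)) (at h within {0..1})"
      unfolding ax by (auto intro!: derivative_eq_intros)
    ultimately have "((\<lambda>h. f (t + axis i h)) has_derivative (\<lambda>k. frechet_derivative f (at (t + axis i h)) (axis i k))) (at h within {0..1})"
      by (rule has_derivative_compose[rotated])
    moreover have "linear (frechet_derivative f (at (t + axis i h)))"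
      by (rule linear_frechet_derivative[OF d])
    ultimately have "((\<lambda>h. f (t + axis i h)) has_vector_derivative pdiff i f (t + axis i h)) (at h within {0..1})"
      unfolding has_vector_derivative_def pdiff_def e_def[symmetric] unfolding ax by (simp add: linear_cmul)
    then show "((\<lambda>h. ?f h t) has_vector_derivative ?f' h t) (at h within {0..1})"
      by (rule has_vector_derivative_mult_right)
  next
    show "?f h integrable_on cbox 0 1" for h
      by (rule integrable_continuous) (auto intro!: continuous_intros continuous_on_compose2[OF cf])
    show "continuous_on ({0..1} \<times> cbox 0 1) (\<lambda>(x, t). ?f' x t)"
      unfolding split_beta' ax by (intro continuous_intros continuous_on_compose2[OF cf']
        continuous_on_compose2[OF continuous_fourier_char[of UNIV]]; auto)
  qed auto
  then have "((\<lambda>h. fourier_char l (- axis i h) * ?I) has_vector_derivative integral (cbox 0 1) (?f' 0)) (at 0 within {0..1})"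
    by (rule has_vector_derivative_transform[rotated 2]) (auto simp: val)
  moreover have "((\<lambda>h. fourier_char l (- axis i h) * ?I) has_vector_derivative
      - (2 * pi * \<i> * of_int (l $ i)) * ?I) (at 0 within {0..1})"
  proof -
    have eq: "(\<lambda>h. fourier_char l (- axis i h)) = (\<lambda>h. exp (of_real h * (- (2 * pi * \<i> * of_int (l $ i)))))"
      by (auto simp: fourier_char_def cis_conv_exp inner_axis rvec_def mult_ac)
    have "((\<lambda>h. exp (of_real h * (- (2 * pi * \<i> * of_int (l $ i))))) has_vector_derivative
        - (2 * pi * \<i> * of_int (l $ i))) (at 0 within {0..1})"
      using exp_scaleR_has_vector_derivative_right[of "- (2 * pi * \<i> * of_int (l $ i)) :: complex" 0 "{0..1}"]
      by (simp add: scaleR_conv_of_real)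
    then show ?thesis unfolding eq[symmetric] by (rule has_vector_derivative_mult_left)
  qed
  ultimately have "integral (cbox 0 1) (?f' 0) = - (2 * pi * \<i> * of_int (l $ i)) * ?I"
    by (intro vector_derivative_unique_within_closed_interval[of 0 1 0]) (auto simp: cbox_interval)
  moreover have "integral (cbox 0 1) (?f' 0) = torus_integral (?f' 0)"
    by (subst torus_integral_HK) (auto intro!: continuous_intros continuous_on_compose2[OF cf'])
  moreover have "axis i 0 = (0 :: real ^ 'd)" by (simp add: axis_def vec_eq_iff)
  ultimately show ?thesis by simp
qed

lemma norm_torus_integral_le:
  fixes f :: "real ^ 'd => 'b::euclidean_space"
  assumes "continuous_on UNIV f" "\<And>x. norm (f x) \<le> B"
  shows "norm (torus_integral f) \<le> B"
proof -
  have "norm (torus_integral f) \<le> (\<integral>x. norm (f x) \<partial>torus)"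
    unfolding torus_integral_eq by (rule integral_norm_bound)
  also have "\<dots> \<le> (\<integral>x. B \<partial>(torus :: (real ^ 'd) measure))"
    by (intro integral_mono integrable_norm continuous_imp_integrable_torus assms) auto
  finally show ?thesis by simp
qed

lemma torus_by_parts_iterated:
  fixes f :: "real ^ 'd => complex"
  assumes "f \<in> test_functions"
  shows "torus_integral (\<lambda>x. fourier_char l x * foldr pdiff (replicate m i) f x) =
    (- (2 * pi * \<i> * of_int (l $ i))) ^ m * torus_integral (\<lambda>x. fourier_char l x * f x)"
proof (induction m)
  case (Suc m)
  then show ?case
    using torus_by_parts[OF foldr_pdiff_test[OF assms, of "replicate m i"], of l i] by simp
qed simp

lemma bracket2_ge_1: "bracket2 l \<ge> 1"
  by (simp add: bracket2_def)

lemma bracket2_pos [simp]: "bracket2 l > 0"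
  using bracket2_ge_1[of l] by linarith

lemma bracket2_neq_0 [simp]: "bracket2 l ~= 0"
  using bracket2_ge_1[of l] by linarith

lemma bracket2_nonneg [simp]: "0 \<le> bracket2 l"
  using bracket2_ge_1[of l] by linarith

lemma bracket2_0 [simp]: "bracket2 0 = 1"
  by (simp add: bracket2_def)

lemma bracket2_uminus [simp]: "bracket2 (- l) = bracket2 l"
  by (simp add: bracket2_def)

lemma norm_rvec_square: "(norm (rvec l))\<^sup>2 = (\<Sum>i\<in>UNIV. (real_of_int (l $ i))\<^sup>2)"
  by (simp add: norm_vec_def L2_set_def rvec_def sum_nonneg)

lemma bracket2_ge_component: "1 + (real_of_int (l $ i))\<^sup>2 \<le> bracket2 l"
  unfolding bracket2_def norm_rvec_square
  by (intro add_left_mono member_le_sum) auto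

text \<open>Fourier coefficients of test functions decay faster than any power.\<close>

lemma test_function_decay:
  fixes f :: "real ^ 'd => complex"
  assumes f: "f \<in> test_functions" and B: "\<And>is x. length is \<le> 2 * q ==> norm (foldr pdiff is f x) \<le> B"
  shows "norm (torus_integral (\<lambda>x. fourier_char l x * f x)) * bracket2 l ^ q \<le> (1 + real CARD('d)) ^ q * B"
proof -
  let ?I = "norm (torus_integral (\<lambda>x. fourier_char l x * f x))"
  have B0: "0 \<le> B" using order_trans[OF norm_ge_zero B[of "[]"]] by simp
  show ?thesis
  proof (cases "l = 0")
    case True
    have "?I \<le> B"
      using True B[of "[]"] by (intro norm_torus_integral_le) (auto intro!: test_function_continuous' f)
    also have "\<dots> \<le> (1 + real CARD('d)) ^ q * B"
      using mult_right_mono[OF one_le_power B0, of "1 + real CARD('d)" q] by simp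
    finally show ?thesis using True by simp
  next
    case False
    have "Max (range (\<lambda>i. \<bar>l $ i\<bar>)) \<in> range (\<lambda>i. \<bar>l $ i\<bar>)" by (rule Max_in) auto
    then obtain i where "Max (range (\<lambda>i. \<bar>l $ i\<bar>)) = \<bar>l $ i\<bar>" by (elim imageE)
    then have i: "\<bar>l $ j\<bar> \<le> \<bar>l $ i\<bar>" for j
      using Max_ge[of "range (\<lambda>i. \<bar>l $ i\<bar>)" "\<bar>l $ j\<bar>"] by simp
    define M where "M = \<bar>real_of_int (l $ i)\<bar>"
    have "l $ i ~= 0" using i False by (auto simp: vec_eq_iff)
    then have M1: "M \<ge> 1" unfolding M_def by linarith
    have "(norm (rvec l))\<^sup>2 \<le> (\<Sum>i\<in>(UNIV :: 'd set). M\<^sup>2)"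
      unfolding norm_rvec_square
    proof (intro sum_mono)
      fix j
      have "\<bar>real_of_int (l $ j)\<bar> \<le> M" using i[of j] unfolding M_def by linarith
      then show "(real_of_int (l $ j))\<^sup>2 \<le> M\<^sup>2" using M1 by (simp add: abs_le_square_iff[symmetric])
    qed
    then have "bracket2 l \<le> M\<^sup>2 + real CARD('d) * M\<^sup>2"
      unfolding bracket2_def using M1 by (intro add_mono) (auto simp: one_le_power)
    also have "\<dots> = (1 + real CARD('d)) * M\<^sup>2" by (simp add: algebra_simps)
    finally have "bracket2 l ^ q \<le> ((1 + real CARD('d)) * M\<^sup>2) ^ q"
      by (intro power_mono) auto
    then have *: "bracket2 l ^ q \<le> (1 + real CARD('d)) ^ q * M ^ (2 * q)"
      by (simp add: power_mult_distrib power_mult)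
    have "M ^ (2 * q) * ?I \<le> (2 * pi * M) ^ (2 * q) * ?I"
      using M1 pi_gt3 by (intro mult_right_mono power_mono) auto
    also have "\<dots> = norm (torus_integral (\<lambda>x. fourier_char l x * foldr pdiff (replicate (2 * q) i) f x))"
      unfolding torus_by_parts_iterated[OF f] by (simp add: norm_mult norm_power M_def)
    also have "\<dots> \<le> B"
      by (intro norm_torus_integral_le continuous_intros test_function_continuous[OF f])
        (simp add: norm_mult B del: foldr_replicate)
    finally have "M ^ (2 * q) * ?I \<le> B" .
    then have "(1 + real CARD('d)) ^ q * (M ^ (2 * q) * ?I) \<le> (1 + real CARD('d)) ^ q * B"
      by (intro mult_left_mono) auto
    moreover have "?I * bracket2 l ^ q \<le> ?I * ((1 + real CARD('d)) ^ q * M ^ (2 * q))"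
      by (intro mult_left_mono *) auto
    moreover have "(1 + real CARD('d)) ^ q * (M ^ (2 * q) * ?I) = ?I * ((1 + real CARD('d)) ^ q * M ^ (2 * q))"
      by (simp only: mult_ac)
    ultimately show ?thesis by linarith
  qed
qed

lemma test_function_bounds:
  fixes f :: "real ^ 'd => complex"
  assumes f: "f \<in> test_functions"
  shows "\<exists>B. \<forall>is x. length is \<le> m --> norm (foldr pdiff is f x) \<le> B"
proof -
  have "\<exists>B. \<forall>x. norm (foldr pdiff is f x) \<le> B" for "is"
  proof -
    let ?g = "foldr pdiff is f"
    have "bounded (?g ` cbox 0 1)"
      by (intro compact_imp_bounded compact_continuous_image continuous_on_subset[OF test_function_continuous[OF f]]) auto
    then obtain B where B: "\<And>x. x \<in> cbox 0 1 ==> norm (?g x) \<le> B"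
      by (auto simp: bounded_iff)
    have "norm (?g x) \<le> B" for x
    proof -
      define l where "l = (\<chi> i. - \<lfloor>x $ i\<rfloor>)"
      have "x + rvec l \<in> cbox 0 1"
        by (auto simp: mem_box_cart l_def rvec_def) linarith
      then have "norm (?g (x + rvec l)) \<le> B" by (rule B)
      then show ?thesis
        using foldr_pdiff_test[OF f, of "is"] by (simp add: test_functions_iff periodic_def)
    qed
    then show ?thesis by blast
  qed
  then obtain B where B: "\<And>is x. norm (foldr pdiff is f x) \<le> B is" by metis
  let ?L = "{is :: 'd list. set is \<subseteq> UNIV \<and> length is \<le> m}"
  have fin: "finite ?L" by (rule finite_lists_length_le) simp
  have B0: "0 \<le> B is" for "is" using order_trans[OF norm_ge_zero B] by blast
  have "norm (foldr pdiff is f x) \<le> sum B ?L" if "length is \<le> m" for "is" x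
  proof (rule order_trans[OF B])
    show "B is \<le> sum B ?L" by (rule member_le_sum) (use that fin B0 in auto)
  qed
  then show ?thesis by blast
qed

subsection \<open>Lattice sums\<close>

definition lattice_cube :: "nat => (int ^ 'd) set" where
  "lattice_cube N = {l. \<forall>i. l $ i \<in> {- int N..int N}}"

lemma bij_betw_lattice_cube:
  "bij_betw vec_nth (lattice_cube N :: (int ^ 'd) set) (PiE UNIV (\<lambda>_. {- int N..int N}))"
  unfolding bij_betw_def
proof
  show "inj_on vec_nth (lattice_cube N :: (int ^ 'd) set)"
    by (auto simp: inj_on_def vec_nth_inject)
  show "vec_nth ` (lattice_cube N :: (int ^ 'd) set) = PiE UNIV (\<lambda>_. {- int N..int N})"
  proof (intro equalityI subsetI)
    fix f :: "'d => int" assume f: "f \<in> PiE UNIV (\<lambda>_. {- int N..int N})"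
    then have "vec_lambda f \<in> lattice_cube N" by (auto simp: lattice_cube_def PiE_UNIV_domain)
    then show "f \<in> vec_nth ` (lattice_cube N :: (int ^ 'd) set)"
      by (intro image_eqI[of _ _ "vec_lambda f"]) auto
  qed (auto simp: lattice_cube_def PiE_UNIV_domain)
qed

lemma finite_lattice_cube: "finite (lattice_cube N :: (int ^ 'd) set)"
  using bij_betw_finite[OF bij_betw_lattice_cube] by (metis finite_PiE finite finite_atLeastAtMost_int)

lemma card_lattice_cube: "card (lattice_cube N :: (int ^ 'd) set) = (2 * N + 1) ^ CARD('d)"
  unfolding bij_betw_same_card[OF bij_betw_lattice_cube] by (subst card_PiE) (auto simp: nat_add_distrib nat_mult_distrib)

lemma sum_prod_lattice_cube:
  fixes g :: "int => real"
  shows "(\<Sum>l\<in>(lattice_cube N :: (int ^ 'd) set). \<Prod>i\<in>UNIV. g (l $ i)) = (\<Sum>m\<in>{- int N..int N}. g m) ^ CARD('d)"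
proof -
  have "(\<Sum>l\<in>(lattice_cube N :: (int ^ 'd) set). \<Prod>i\<in>UNIV. g (l $ i)) =
      (\<Sum>f\<in>PiE (UNIV :: 'd set) (\<lambda>_. {- int N..int N}). \<Prod>i\<in>UNIV. g (f i))"
    by (rule sum.reindex_bij_betw[OF bij_betw_lattice_cube])
  also have "\<dots> = (\<Prod>i\<in>(UNIV :: 'd set). \<Sum>m\<in>{- int N..int N}. g m)"
    by (subst prod_sum_PiE) auto
  finally show ?thesis by simp
qed

lemma lattice_ball_subset_cube: "lattice_ball N \<subseteq> lattice_cube N"
proof
  fix l :: "int ^ 'd" assume l: "l \<in> lattice_ball N"
  have "l $ i \<in> {- int N..int N}" for i
  proof -
    have "\<bar>real_of_int (l $ i)\<bar> \<le> norm (rvec l)"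
      using component_le_norm_cart[of "rvec l" i] by (simp add: rvec_def)
    then have "\<bar>real_of_int (l $ i)\<bar> \<le> real N"
      using l by (simp add: lattice_ball_def)
    then show ?thesis by auto
  qed
  then show "l \<in> lattice_cube N" by (simp add: lattice_cube_def)
qed

lemma card_lattice_ball: "card (lattice_ball N :: (int ^ 'd) set) \<le> (2 * N + 1) ^ CARD('d)"
  using card_mono[OF finite_lattice_cube lattice_ball_subset_cube] by (simp add: card_lattice_cube)

lemma finite_subset_lattice_ball:
  assumes "finite (F :: (int ^ 'd) set)"
  shows "\<exists>N. F \<subseteq> lattice_ball N"
  using assms
proof (induction F rule: finite_induct)
  case (insert l F)
  then obtain N where N: "F \<subseteq> lattice_ball N" by blast
  obtain M where "norm (rvec l) \<le> real M" using real_arch_simple by blast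
  then have "insert l F \<subseteq> lattice_ball (max N M)"
    using N by (auto simp: lattice_ball_def subset_iff)
  then show ?case by blast
qed simp

lemma lattice_ball_mono: "N \<le> M ==> lattice_ball N \<subseteq> lattice_ball M"
  by (auto simp: lattice_ball_def)

lemma zero_in_lattice_ball [simp]: "0 \<in> lattice_ball N"
  by (simp add: lattice_ball_def)

lemma uminus_in_lattice_ball [simp]: "- l \<in> lattice_ball N \<longleftrightarrow> l \<in> lattice_ball N"
  by (simp add: lattice_ball_def)

lemma sum_int_bracket_bounded:
  assumes p: "p > 1 / 2"
  shows "\<exists>C. \<forall>N. (\<Sum>m\<in>{- int N..int N}. (1 + (real_of_int m)\<^sup>2) powr (- p)) \<le> C"
proof -
  define g where "g x = (1 + x\<^sup>2) powr (- p)" for x :: real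
  have sm: "summable (\<lambda>j. real j powr (- (2 * p)))"
    using p by (subst summable_real_powr_iff) auto
  have "(\<Sum>m\<in>{- int N..int N}. g (real_of_int m)) \<le> 2 * (1 + (\<Sum>j. real j powr (- (2 * p))))" for N
  proof -
    have sub: "{- int N..int N} \<subseteq> int ` {..N} \<union> (\<lambda>j. - int j) ` {..N}"
    proof
      fix m assume m: "m \<in> {- int N..int N}"
      show "m \<in> int ` {..N} \<union> (\<lambda>j. - int j) ` {..N}"
        using m by (cases m rule: int_cases2) (auto intro!: image_eqI)
    qed
    have "(\<Sum>m\<in>{- int N..int N}. g (real_of_int m)) \<le> (\<Sum>m\<in>int ` {..N} \<union> (\<lambda>j. - int j) ` {..N}. g (real_of_int m))"
      by (rule sum_mono2[OF _ sub]) (auto simp: g_def)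
    also have "\<dots> \<le> (\<Sum>m\<in>int ` {..N}. g (real_of_int m)) + (\<Sum>m\<in>(\<lambda>j. - int j) ` {..N}. g (real_of_int m))"
      by (subst sum.union_inter[symmetric]) (simp_all add: g_def sum_nonneg)
    also have "\<dots> = 2 * (\<Sum>j\<le>N. g (real j))"
      by (simp add: sum.reindex inj_on_def g_def)
    also have "(\<Sum>j\<le>N. g (real j)) \<le> 1 + (\<Sum>j\<le>N. real j powr (- (2 * p)))"
    proof -
      have "(\<Sum>j\<le>N. g (real j)) \<le> (\<Sum>j\<le>N. (if j = 0 then 1 else 0) + real j powr (- (2 * p)))"
      proof (intro sum_mono)
        fix j
        show "g (real j) \<le> (if j = 0 then 1 else 0) + real j powr (- (2 * p))"
        proof (cases "j = 0")
          case False
          have "g (real j) \<le> ((real j)\<^sup>2) powr (- p)"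
            unfolding g_def using p False by (intro powr_mono2') auto
          also have "((real j)\<^sup>2) powr (- p) = real j powr (- (2 * p))"
            using False by (simp add: powr_powr flip: powr_numeral)
          finally show ?thesis using False by simp
        qed (simp add: g_def)
      qed
      also have "\<dots> = 1 + (\<Sum>j\<le>N. real j powr (- (2 * p)))"
        by (simp add: sum.distrib)
      finally show ?thesis .
    qed
    also have "(\<Sum>j\<le>N. real j powr (- (2 * p))) \<le> (\<Sum>j. real j powr (- (2 * p)))"
      by (rule sum_le_suminf[OF sm]) auto
    finally show ?thesis by simp
  qed
  then show ?thesis unfolding g_def by blast
qed

text \<open>
  Since \<open>\<langle>l\<rangle>\<^sup>2\<close> dominates every \<open>1 + l\<^sub>i\<^sup>2\<close>, negative powers of it are dominated by products over the
  coordinates, and the lattice sum factorizes.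
\<close>

lemma sum_bracket2_bounded:
  assumes s: "s > real CARD('d) / 2"
  shows "\<exists>C. \<forall>F :: (int ^ 'd) set. finite F --> (\<Sum>l\<in>F. bracket2 l powr (- s)) \<le> C"
proof -
  define p where "p = s / real CARD('d)"
  have d: "real CARD('d) > 0" by simp
  have p: "p > 1 / 2" using s d by (simp add: p_def field_simps)
  obtain C where C: "\<And>N. (\<Sum>m\<in>{- int N..int N}. (1 + (real_of_int m)\<^sup>2) powr (- p)) \<le> C"
    using sum_int_bracket_bounded[OF p] by blast
  have le: "bracket2 l powr (- s) \<le> (\<Prod>i\<in>UNIV. (1 + (real_of_int (l $ i))\<^sup>2) powr (- p))" for l :: "int ^ 'd"
  proof -
    have "bracket2 l powr (- s) = (\<Prod>i\<in>(UNIV :: 'd set). bracket2 l powr (- p))"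
      using powr_powr[of "bracket2 l" "- p" "real CARD('d)"] powr_realpow[of "bracket2 l powr (- p)" "CARD('d)"]
      by (simp add: p_def)
    also have "\<dots> \<le> (\<Prod>i\<in>UNIV. (1 + (real_of_int (l $ i))\<^sup>2) powr (- p))"
      using p bracket2_ge_component by (intro prod_mono conjI powr_mono2') (auto simp: add_pos_nonneg)
    finally show ?thesis .
  qed
  have "(\<Sum>l\<in>F. bracket2 l powr (- s)) \<le> C ^ CARD('d)" if F: "finite F" for F :: "(int ^ 'd) set"
  proof -
    obtain N where "F \<subseteq> lattice_ball N" using finite_subset_lattice_ball[OF F] by blast
    then have N: "F \<subseteq> lattice_cube N" using lattice_ball_subset_cube by blast
    have "(\<Sum>l\<in>F. bracket2 l powr (- s)) \<le> (\<Sum>l\<in>(lattice_cube N :: (int ^ 'd) set). bracket2 l powr (- s))"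
      by (intro sum_mono2 finite_lattice_cube N) auto
    also have "\<dots> \<le> (\<Sum>l\<in>(lattice_cube N :: (int ^ 'd) set). \<Prod>i\<in>UNIV. (1 + (real_of_int (l $ i))\<^sup>2) powr (- p))"
      by (intro sum_mono le)
    also have "\<dots> = (\<Sum>m\<in>{- int N..int N}. (1 + (real_of_int m)\<^sup>2) powr (- p)) ^ CARD('d)"
      by (rule sum_prod_lattice_cube)
    also have "\<dots> \<le> C ^ CARD('d)"
      by (intro power_mono C sum_nonneg) auto
    finally show ?thesis .
  qed
  then show ?thesis by blast
qed

text \<open>
  A discrete Young inequality: in a product of \<open>k\<close> factors, the smallest one is at most the geometric
  mean of the others; it is determined by the others when the indices sum to zero.
\<close>

definition zero_sum :: "nat => 'l::ab_group_add set => (nat => 'l) set" where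
  "zero_sum k B = {s \<in> PiE {..<k} (\<lambda>_. B). (\<Sum>i<k. s i) = 0}"

lemma finite_zero_sum: "finite B ==> finite (zero_sum k B)"
  unfolding zero_sum_def by (rule finite_subset[of _ "PiE {..<k} (\<lambda>_. B)"]) (auto intro: finite_PiE)

lemma sum_zero_sum_le:
  fixes a :: "'l::ab_group_add => real"
  assumes k: "k \<ge> 2" and B: "finite B" and a: "\<And>l. a l > 0"
  shows "(\<Sum>s\<in>zero_sum k B. \<Prod>i<k. a (s i)) \<le> real k * (\<Sum>l\<in>B. a l powr (real k / real (k - 1))) ^ (k - 1)"
proof -
  define p where "p = real k / real (k - 1)"
  define b where "b l = a l powr p" for l
  have b0: "b l \<ge> 0" for l by (simp add: b_def)
  have le: "(\<Prod>i<k. a (s i)) \<le> (\<Sum>j<k. \<Prod>i\<in>{..<k} - {j}. b (s i))" for s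
  proof -
    have "finite ((\<lambda>i. a (s i)) ` {..<k})" "(\<lambda>i. a (s i)) ` {..<k} ~= {}" using k by (auto simp: lessThan_empty_iff)
    from Min_in[OF this] obtain j where j: "j < k" "a (s j) = Min ((\<lambda>i. a (s i)) ` {..<k})" by auto
    then have min: "a (s j) \<le> a (s i)" if "i < k" for i using that by simp
    define P where "P = (\<Prod>i\<in>{..<k} - {j}. a (s i))"
    have P0: "P > 0" unfolding P_def by (intro prod_pos) (auto simp: a)
    have card: "card ({..<k} - {j}) = k - 1" using j by simp
    have "a (s j) ^ (k - 1) \<le> P"
      unfolding P_def card[symmetric] prod_constant[symmetric]
      by (intro prod_mono) (use a min in \<open>auto intro: less_imp_le\<close>)
    then have "(a (s j) powr real (k - 1)) powr (1 / real (k - 1)) \<le> P powr (1 / real (k - 1))"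
      using a[of "s j"] by (intro powr_mono2) (auto simp: powr_realpow)
    then have "a (s j) \<le> P powr (1 / real (k - 1))"
      using a[of "s j"] k by (simp add: powr_powr)
    then have "a (s j) * P \<le> P powr (1 / real (k - 1)) * P powr 1"
      using P0 by (simp add: mult_right_mono)
    also have "P powr (1 / real (k - 1)) * P powr 1 = P powr p"
      unfolding powr_add[symmetric] using k by (intro arg_cong2[of _ _ _ _ "(powr)"] refl) (simp add: p_def field_simps)
    also have "\<dots> = (\<Prod>i\<in>{..<k} - {j}. b (s i))"
      unfolding P_def b_def by (rule prod_powr_distrib)
    finally have "(\<Prod>i<k. a (s i)) \<le> (\<Prod>i\<in>{..<k} - {j}. b (s i))"
      using j by (subst prod.remove[of _ j]) (auto simp: P_def)
    also have "\<dots> \<le> (\<Sum>j<k. \<Prod>i\<in>{..<k} - {j}. b (s i))"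
      by (rule member_le_sum[of j "{..<k}" "\<lambda>j. \<Prod>i\<in>{..<k} - {j}. b (s i)"]) (auto intro!: prod_nonneg b0 j)
    finally show ?thesis .
  qed
  have proj: "(\<Sum>s\<in>zero_sum k B. \<Prod>i\<in>{..<k} - {j}. b (s i)) \<le> (\<Sum>l\<in>B. b l) ^ (k - 1)" if j: "j < k" for j
  proof -
    let ?r = "\<lambda>s. restrict s ({..<k} - {j})"
    have inj: "inj_on ?r (zero_sum k B)"
    proof (rule inj_onI)
      fix s t assume s: "s \<in> zero_sum k B" and t: "t \<in> zero_sum k B" and eq: "?r s = ?r t"
      have st: "s i = t i" if "i < k" "i ~= j" for i
        using fun_cong[OF eq, of i] that by simp
      have "s j + (\<Sum>i\<in>{..<k} - {j}. s i) = t j + (\<Sum>i\<in>{..<k} - {j}. t i)"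
        using s t j by (simp add: zero_sum_def sum.remove[symmetric])
      moreover have "(\<Sum>i\<in>{..<k} - {j}. s i) = (\<Sum>i\<in>{..<k} - {j}. t i)"
        by (intro sum.cong) (auto simp: st)
      ultimately have "s j = t j" by simp
      then show "s = t"
        using s t st by (intro PiE_ext[of s "{..<k}" "\<lambda>_. B" t]) (auto simp: zero_sum_def)
    qed
    have "(\<Sum>s\<in>zero_sum k B. \<Prod>i\<in>{..<k} - {j}. b (s i)) = (\<Sum>s\<in>zero_sum k B. \<Prod>i\<in>{..<k} - {j}. b (?r s i))"
      by (intro sum.cong prod.cong) auto
    also have "\<dots> = (\<Sum>t\<in>?r ` zero_sum k B. \<Prod>i\<in>{..<k} - {j}. b (t i))"
      by (simp add: sum.reindex[OF inj])
    also have "\<dots> \<le> (\<Sum>t\<in>PiE ({..<k} - {j}) (\<lambda>_. B). \<Prod>i\<in>{..<k} - {j}. b (t i))"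
    proof (intro sum_mono2)
      show "?r ` zero_sum k B \<subseteq> PiE ({..<k} - {j}) (\<lambda>_. B)"
        by (auto simp: zero_sum_def intro!: restrict_PiE_iff[THEN iffD2])
    qed (auto intro!: finite_PiE B prod_nonneg b0)
    also have "\<dots> = (\<Prod>i\<in>{..<k} - {j}. \<Sum>l\<in>B. b l)"
      by (rule prod_sum_PiE[symmetric]) (auto simp: B)
    also have "\<dots> = (\<Sum>l\<in>B. b l) ^ (k - 1)"
      using j by simp
    finally show ?thesis .
  qed
  have "(\<Sum>s\<in>zero_sum k B. \<Prod>i<k. a (s i)) \<le> (\<Sum>s\<in>zero_sum k B. \<Sum>j<k. \<Prod>i\<in>{..<k} - {j}. b (s i))"
    by (intro sum_mono le)
  also have "\<dots> = (\<Sum>j<k. \<Sum>s\<in>zero_sum k B. \<Prod>i\<in>{..<k} - {j}. b (s i))"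
    by (rule sum.swap)
  also have "\<dots> \<le> (\<Sum>j<k. (\<Sum>l\<in>B. b l) ^ (k - 1))"
    by (intro sum_mono proj) auto
  finally show ?thesis using k by (simp add: b_def p_def of_nat_diff)
qed

section \<open>The Gaussian random distribution\<close>

lemma normal_family_eq: "normal_family = gauss"
  by (simp add: normal_family_def gauss1_def)

lemma gauss_coeff_uminus: "gauss_coeff om (- l) = cnj (gauss_coeff om l)"
  unfolding gauss_coeff_def complex_cnj minus_divide_left minus_diff_eq minus_minus
  by (simp only: add.commute)

text \<open>
  The Fourier series with coefficients \<open>g\<^sub>l \<langle>l\<rangle>\<^sup>-\<^sup>\<alpha>\<close> represents a distribution exactly when the
  coefficients grow at most polynomially. This makes the event in question measurable.
\<close>

definition tempered :: "((int ^ 'd) \<times> bool => real) => bool" where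
  "tempered om \<longleftrightarrow> (\<exists>(C::nat) (m::nat). \<forall>l. norm (gauss_coeff om l) \<le> real C * bracket2 l ^ m)"

lemma foldr_pdiff_add:
  assumes "f \<in> test_functions" "g \<in> test_functions"
  shows "foldr pdiff is (\<lambda>x. f x + g x) = (\<lambda>x. foldr pdiff is f x + foldr pdiff is g x)"
proof (induction "is")
  case (Cons i "is")
  have "pdiff i (\<lambda>x. foldr pdiff is f x + foldr pdiff is g x) x = pdiff i (foldr pdiff is f) x + pdiff i (foldr pdiff is g) x" for x
  proof -
    have "(foldr pdiff is h has_derivative frechet_derivative (foldr pdiff is h) (at x)) (at x)" if "h \<in> test_functions" for h
      using test_function_differentiable[OF that] frechet_derivative_works by blast
    from frechet_derivative_at[OF has_derivative_add[OF this[OF assms(1)] this[OF assms(2)]], symmetric]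
    show ?thesis by (simp add: pdiff_def)
  qed
  then show ?case by (simp add: Cons fun_eq_iff)
qed simp

lemma foldr_pdiff_linear:
  fixes f :: "real ^ 'd => complex"
  assumes f: "f \<in> test_functions" and L: "bounded_linear L"
  shows "foldr pdiff is (\<lambda>x. L (f x)) = (\<lambda>x. L (foldr pdiff is f x))"
proof (induction "is")
  case (Cons i "is")
  have "pdiff i (\<lambda>x. L (foldr pdiff is f x)) x = L (pdiff i (foldr pdiff is f) x)" for x
  proof -
    have "(foldr pdiff is f has_derivative frechet_derivative (foldr pdiff is f) (at x)) (at x)"
      using test_function_differentiable[OF f] frechet_derivative_works by blast
    then have "((\<lambda>x. L (foldr pdiff is f x)) has_derivative (\<lambda>v. L (frechet_derivative (foldr pdiff is f) (at x) v))) (at x)"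
      by (rule bounded_linear.has_derivative[OF L])
    from frechet_derivative_at[OF this, symmetric] show ?thesis
      by (simp add: pdiff_def)
  qed
  then show ?case by (simp add: Cons fun_eq_iff)
qed simp

lemma test_function_add: "f \<in> test_functions ==> g \<in> test_functions ==> (\<lambda>x. f x + g x) \<in> test_functions"
  using test_function_differentiable[of f] test_function_differentiable[of g]
  unfolding test_functions_iff[of "\<lambda>x. f x + g x"]
  by (auto simp: foldr_pdiff_add periodic_def test_functions_iff intro!: differentiable_add)

lemma test_function_linear:
  assumes f: "f \<in> test_functions" and L: "bounded_linear L"
  shows "(\<lambda>x. L (f x)) \<in> test_functions"
  unfolding test_functions_iff foldr_pdiff_linear[OF assms]
proof (intro conjI allI)
  show "periodic (\<lambda>x. L (f x))"
    using f by (auto simp: test_functions_iff periodic_def)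
  fix "is" x
  show "(\<lambda>x. L (foldr pdiff is f x)) differentiable (at x)"
    using bounded_linear.has_derivative[OF L] test_function_differentiable[OF f, of "is" x]
    unfolding differentiable_def by blast
qed

lemma series_term_bound:
  fixes f :: "real ^ 'd => complex"
  assumes C: "\<And>l. norm (gauss_coeff om l) \<le> C * bracket2 l ^ m" and \<alpha>: "\<alpha> \<ge> 0"
    and f: "f \<in> test_functions"
    and B: "\<And>is x. length is \<le> 2 * (m + CARD('d)) ==> norm (foldr pdiff is f x) \<le> B"
  shows "norm (gauss_coeff om l * of_real (bracket2 l powr (- \<alpha> / 2)) * torus_integral (\<lambda>x. fourier_char l x * f x))
    \<le> C * ((1 + real CARD('d)) ^ (m + CARD('d)) * B) * bracket2 l powr (- real CARD('d))"
proof -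
  let ?q = "m + CARD('d)"
  let ?I = "norm (torus_integral (\<lambda>x. fourier_char l x * f x))"
  have C0: "0 \<le> C" using C[of 0] by (metis bracket2_0 mult.right_neutral norm_ge_zero order_trans power_one)
  have p1: "bracket2 l powr (- \<alpha> / 2) \<le> 1"
    using powr_mono[of "- \<alpha> / 2" 0 "bracket2 l"] \<alpha> bracket2_ge_1[of l] by simp
  have "norm (gauss_coeff om l * of_real (bracket2 l powr (- \<alpha> / 2)) * torus_integral (\<lambda>x. fourier_char l x * f x))
      \<le> (C * bracket2 l ^ m) * 1 * ?I"
    unfolding norm_mult using C0 p1 by (intro mult_right_mono mult_mono C) auto
  also have "\<dots> = C * (?I * bracket2 l ^ ?q) * bracket2 l powr (- real CARD('d))"
    by (simp add: power_add powr_minus powr_realpow field_simps)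
  also have "\<dots> \<le> C * ((1 + real CARD('d)) ^ ?q * B) * bracket2 l powr (- real CARD('d))"
    by (intro mult_right_mono mult_left_mono test_function_decay f B C0) auto
  finally show ?thesis .
qed

lemma bracket2_summable:
  assumes "s > real CARD('d) / 2"
  shows "(\<lambda>l :: int ^ 'd. bracket2 l powr (- s)) summable_on UNIV"
proof -
  obtain C where "\<And>F :: (int ^ 'd) set. finite F ==> (\<Sum>l\<in>F. bracket2 l powr (- s)) \<le> C"
    using sum_bracket2_bounded[OF assms] by blast
  then show ?thesis
    by (intro nonneg_bdd_above_summable_on bdd_aboveI[of _ C]) auto
qed

lemma series_abs_summable:
  fixes f :: "real ^ 'd => complex"
  assumes "tempered om" "\<alpha> \<ge> 0" and f: "f \<in> test_functions"
  shows "(\<lambda>l. norm (gauss_coeff om l * of_real (bracket2 l powr (- \<alpha> / 2)) *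
    torus_integral (\<lambda>x. fourier_char l x * f x))) summable_on UNIV"
proof -
  obtain C :: nat and m :: nat where C: "\<And>l. norm (gauss_coeff om l) \<le> real C * bracket2 l ^ m"
    using assms(1) by (auto simp: tempered_def)
  obtain B where B: "\<And>is x. length is \<le> 2 * (m + CARD('d)) ==> norm (foldr pdiff is f x) \<le> B"
    using test_function_bounds[OF f] by blast
  have "(\<lambda>l :: int ^ 'd. real C * ((1 + real CARD('d)) ^ (m + CARD('d)) * B) * bracket2 l powr (- real CARD('d))) summable_on UNIV"
    by (intro summable_on_cmult_right bracket2_summable) simp
  then show ?thesis
    by (rule summable_on_comparison_test) (use series_term_bound[OF C assms(2) f B] in auto)
qed

text \<open>Tempered coefficients against the rapidly decaying Fourier coefficients of a test function, with bounds by finitely many derivatives.\<close>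

lemma gauss_series_distribution:
  assumes t: "tempered (om :: (int ^ 'd) \<times> bool => real)" and \<alpha>: "\<alpha> \<ge> 0"
  shows "gauss_series \<alpha> om \<in> real_distributions"
proof -
  define T where "T f l = gauss_coeff om l * of_real (bracket2 l powr (- \<alpha> / 2)) *
    torus_integral (\<lambda>x. fourier_char l x * f x)" for f l
  have gs: "gauss_series \<alpha> om f = infsum (T f) UNIV" if "f \<in> test_functions" for f
    using that by (simp add: gauss_series_def T_def[abs_def])
  have sm: "(\<lambda>l. norm (T f l)) summable_on UNIV" if "f \<in> test_functions" for f
    unfolding T_def by (rule series_abs_summable[OF t \<alpha> that])
  have sm': "T f summable_on UNIV" if "f \<in> test_functions" for f
    by (rule abs_summable_summable[OF sm[OF that]])
  have int: "integrable torus (\<lambda>x. fourier_char l x * f x)" if "f \<in> test_functions" for f :: "real ^ 'd => complex" and l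
    by (intro continuous_imp_integrable_torus continuous_intros test_function_continuous' that)
  have lin: "bounded_linear ((*) c)" "bounded_linear cnj" for c :: complex
    by (simp_all add: bounded_linear_mult_right bounded_linear_cnj)
  obtain C :: nat and m :: nat where C: "\<And>l. norm (gauss_coeff om l) \<le> real C * bracket2 l ^ m"
    using t by (auto simp: tempered_def)
  define S where "S = (\<Sum>\<^sub>\<infinity>l::int ^ 'd. bracket2 l powr (- real CARD('d)))"
  define K where "K = real C * (1 + real CARD('d)) ^ (m + CARD('d)) * S"
  have bound: "norm (gauss_series \<alpha> om f) \<le> K * B"
    if f: "f \<in> test_functions" and B: "\<And>is x. length is \<le> 2 * (m + CARD('d)) ==> norm (foldr pdiff is f x) \<le> B" for f B
  proof -
    have "norm (gauss_series \<alpha> om f) \<le> (\<Sum>\<^sub>\<infinity>l. norm (T f l))"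
      unfolding gs[OF f] by (rule norm_infsum_bound[OF sm[OF f]])
    also have "\<dots> \<le> (\<Sum>\<^sub>\<infinity>l::int ^ 'd. real C * ((1 + real CARD('d)) ^ (m + CARD('d)) * B) * bracket2 l powr (- real CARD('d)))"
      using series_term_bound[OF C \<alpha> f B]
      by (intro infsum_mono sm f summable_on_cmult_right bracket2_summable) (auto simp: T_def)
    also have "\<dots> = K * B"
      unfolding K_def S_def by (subst infsum_cmult_right) (auto intro!: bracket2_summable)
    finally show ?thesis .
  qed
  show ?thesis
    unfolding real_distributions_def mem_Collect_eq
  proof (intro conjI ballI allI)
    show "gauss_series \<alpha> om \<in> extensional test_functions"
      by (simp add: gauss_series_def)
    fix f :: "real ^ 'd => complex" assume f: "f \<in> test_functions"
    show "gauss_series \<alpha> om (\<lambda>x. f x + g x) = gauss_series \<alpha> om f + gauss_series \<alpha> om g" if g: "g \<in> test_functions" for g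
    proof -
      have "T (\<lambda>x. f x + g x) l = T f l + T g l" for l
        unfolding T_def torus_integral_eq by (simp add: distrib_left int f g)
      then have "T (\<lambda>x. f x + g x) = (\<lambda>l. T f l + T g l)" by (rule ext)
      then show ?thesis
        unfolding gs[OF f] gs[OF g] gs[OF test_function_add[OF f g]]
        by (simp add: infsum_add[OF sm'[OF f] sm'[OF g]])
    qed
    show "gauss_series \<alpha> om (\<lambda>x. c * f x) = c * gauss_series \<alpha> om f" for c
    proof -
      have "T (\<lambda>x. c * f x) l = c * T f l" for l
        unfolding T_def torus_integral_eq by (simp add: mult.left_commute)
      then have "T (\<lambda>x. c * f x) = (\<lambda>l. c * T f l)" by (rule ext)
      then show ?thesis
        unfolding gs[OF f] gs[OF test_function_linear[OF f lin(1)]]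
        by (simp add: infsum_cmult_right[OF sm'[OF f]])
    qed
    show "gauss_series \<alpha> om (\<lambda>x. cnj (f x)) = cnj (gauss_series \<alpha> om f)"
    proof -
      have "T (\<lambda>x. cnj (f x)) l = cnj (T f (- l))" for l
        unfolding T_def torus_integral_eq
        using Bochner_Integration.integral_cnj[of torus "\<lambda>x. cnj (fourier_char l x) * f x"]
        by (simp add: gauss_coeff_uminus fourier_char_uminus)
      then have "T (\<lambda>x. cnj (f x)) = (\<lambda>l. cnj (T f (- l)))" by (rule ext)
      then have "infsum (T (\<lambda>x. cnj (f x))) UNIV = (\<Sum>\<^sub>\<infinity>l. cnj (T f (- l)))" by simp
      also have "\<dots> = (\<Sum>\<^sub>\<infinity>l. cnj (T f l))"
        by (rule infsum_reindex_bij_betw) (auto intro!: bij_betwI[of _ _ _ uminus])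
      also have "\<dots> = cnj (infsum (T f) UNIV)" by (rule infsum_cnj)
      finally show ?thesis
        unfolding gs[OF f] gs[OF test_function_linear[OF f lin(2)]] .
    qed
  next
    show "\<exists>C m. \<forall>f\<in>test_functions. \<forall>B. (\<forall>is x. length is \<le> m --> norm (foldr pdiff is f x) \<le> B) --> norm (gauss_series \<alpha> om f) \<le> C * B"
      using bound by blast
  qed
qed

lemma gauss_series_fourier_char:
  "gauss_series \<alpha> om (\<lambda>x. cnj (fourier_char l x)) = gauss_coeff om l * of_real (bracket2 l powr (- \<alpha> / 2))"
proof -
  have "gauss_series \<alpha> om (\<lambda>x. cnj (fourier_char l x)) =
      (\<Sum>\<^sub>\<infinity>m. gauss_coeff om m * of_real (bracket2 m powr (- \<alpha> / 2)) * (if m = l then 1 else 0))"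
    by (simp add: gauss_series_def torus_integral_fourier_char_mult)
  also have "\<dots> = (\<Sum>\<^sub>\<infinity>m\<in>{l}. gauss_coeff om m * of_real (bracket2 m powr (- \<alpha> / 2)) * (if m = l then 1 else 0))"
    by (rule infsum_cong_neutral) auto
  finally show ?thesis by simp
qed

text \<open>Conversely the finite-order estimate, applied to characters, bounds the coefficients polynomially.\<close>

lemma distribution_imp_tempered:
  assumes u: "gauss_series \<alpha> (om :: (int ^ 'd) \<times> bool => real) \<in> real_distributions" and \<alpha>: "\<alpha> \<ge> 0"
  shows "tempered om"
proof -
  obtain C m where C: "\<And>f B. f \<in> test_functions ==> (\<And>is x. length is \<le> m ==> norm (foldr pdiff is f x) \<le> B) ==>
      norm (gauss_series \<alpha> om f) \<le> C * B"
    using u unfolding real_distributions_def by blast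
  define r where "r = nat \<lceil>\<alpha>\<rceil>"
  define C' where "C' = nat \<lceil>\<bar>C\<bar> * 8 ^ m\<rceil>"
  have "norm (gauss_coeff om l) \<le> real C' * bracket2 l ^ (m + r)" for l :: "int ^ 'd"
  proof -
    let ?x = "norm (rvec l)"
    have x: "1 + 2 * pi * ?x \<le> 8 * bracket2 l"
    proof -
      have "0 \<le> (?x - 1)\<^sup>2" by simp
      then have "2 * ?x \<le> bracket2 l" by (simp add: bracket2_def power2_diff)
      moreover have "2 * pi * ?x \<le> 2 * 4 * ?x" using pi_less_4 by (intro mult_right_mono) auto
      ultimately show ?thesis using bracket2_ge_1[of l] by linarith
    qed
    have "norm (gauss_series \<alpha> om (\<lambda>x. cnj (fourier_char l x))) \<le> C * (1 + 2 * pi * ?x) ^ m"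
    proof (rule C)
      fix "is" :: "'d list" and x assume len: "length is \<le> m"
      obtain c' where c': "foldr pdiff is (\<lambda>x. 1 * fourier_char (- l) x) = (\<lambda>x. c' * fourier_char (- l) x)"
        "norm c' \<le> norm (1::complex) * (2 * pi * norm (rvec (- l))) ^ length is"
        using foldr_pdiff_fourier_char by blast
      have "norm (foldr pdiff is (\<lambda>x. cnj (fourier_char l x)) x) \<le> (2 * pi * ?x) ^ length is"
        using c' by (simp add: fourier_char_uminus norm_mult fun_eq_iff)
      also have "\<dots> \<le> (1 + 2 * pi * ?x) ^ length is" by (intro power_mono) auto
      also have "\<dots> \<le> (1 + 2 * pi * ?x) ^ m" by (intro power_increasing len) simp
      finally show "norm (foldr pdiff is (\<lambda>x. cnj (fourier_char l x)) x) \<le> (1 + 2 * pi * ?x) ^ m" .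
    qed simp
    also have "\<dots> \<le> \<bar>C\<bar> * (8 * bracket2 l) ^ m"
      using x by (intro mult_mono power_mono) auto
    finally have 1: "norm (gauss_coeff om l) * bracket2 l powr (- \<alpha> / 2) \<le> \<bar>C\<bar> * (8 * bracket2 l) ^ m"
      by (simp add: gauss_series_fourier_char norm_mult)
    have "bracket2 l powr (\<alpha> / 2) \<le> bracket2 l powr real r"
    proof (rule powr_mono)
      show "\<alpha> / 2 \<le> real r" using \<alpha> real_nat_ceiling_ge[of \<alpha>] unfolding r_def by linarith
    qed (rule bracket2_ge_1)
    then have 2: "bracket2 l powr (\<alpha> / 2) \<le> bracket2 l ^ r" by (simp add: powr_realpow)
    have "norm (gauss_coeff om l) = norm (gauss_coeff om l) * bracket2 l powr (- \<alpha> / 2) * bracket2 l powr (\<alpha> / 2)"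
      by (simp add: mult.assoc flip: powr_add)
    also have "\<dots> \<le> (\<bar>C\<bar> * (8 * bracket2 l) ^ m) * bracket2 l ^ r"
      by (intro mult_mono 1 2) auto
    also have "\<dots> = (\<bar>C\<bar> * 8 ^ m) * bracket2 l ^ (m + r)"
      by (simp add: power_mult_distrib power_add)
    also have "\<dots> \<le> real C' * bracket2 l ^ (m + r)"
      by (intro mult_right_mono) (auto simp: C'_def real_nat_ceiling_ge)
    finally show ?thesis .
  qed
  then show ?thesis unfolding tempered_def by blast
qed

lemma random_distribution_eq:
  assumes "\<alpha> \<ge> 0"
  shows "random_distribution \<alpha> om = (if tempered om then gauss_series \<alpha> om else (\<lambda>f\<in>test_functions. 0))"
  unfolding random_distribution_def
  using gauss_series_distribution[OF _ assms] distribution_imp_tempered[OF _ assms] by auto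

lemma zero_distribution: "(\<lambda>f\<in>test_functions. 0) \<in> real_distributions"
  unfolding real_distributions_def mem_Collect_eq
  by (auto simp: test_function_add test_function_linear[OF _ bounded_linear_mult_right]
    test_function_linear[OF _ bounded_linear_cnj] intro!: exI[of _ 0])

lemma gauss_coeff_measurable [measurable]: "(\<lambda>om. gauss_coeff om l) \<in> borel_measurable gauss"
  unfolding gauss_coeff_def Complex_eq by measurable

lemma tempered_measurable [measurable]: "Measurable.pred gauss (tempered :: ((int ^ 'd) \<times> bool => real) => bool)"
  unfolding tempered_def[abs_def] by measurable

lemma lattice_ball_finite_subsets: "filterlim lattice_ball (finite_subsets_at_top UNIV) sequentially"
  unfolding filterlim_finite_subsets_at_top
proof (intro allI impI)
  fix F :: "(int ^ 'd) set" assume "finite F \<and> F \<subseteq> UNIV"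
  then obtain N where N: "F \<subseteq> lattice_ball N" using finite_subset_lattice_ball by blast
  show "\<forall>\<^sub>F N in sequentially. finite (lattice_ball N :: (int ^ 'd) set) \<and> F \<subseteq> lattice_ball N \<and> lattice_ball N \<subseteq> (UNIV :: (int ^ 'd) set)"
    using eventually_ge_at_top[of N]
  proof eventually_elim
    case (elim n)
    from order_trans[OF N lattice_ball_mono[OF this]] show ?case
      by (simp add: finite_lattice_ball)
  qed
qed

text \<open>Evaluations at test functions are limits of finite Fourier sums, which generate the product structure.\<close>

lemma random_distribution_measurable:
  assumes \<alpha>: "\<alpha> \<ge> 0"
  shows "random_distribution \<alpha> \<in> measurable gauss (distribution_space :: 'd::finite distribution measure)"
  unfolding distribution_space_def
proof (rule measurable_restrict_space2)
  show "(random_distribution \<alpha> :: _ => 'd distribution) \<in> space gauss \<rightarrow> (real_distributions :: 'd distribution set)"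
    by (auto simp: random_distribution_def zero_distribution)
  show "(random_distribution \<alpha> :: _ => 'd distribution) \<in> measurable gauss (PiM test_functions (\<lambda>_. borel))"
  proof (rule measurable_PiM_single')
    fix f :: "real ^ 'd => complex" assume f: "f \<in> test_functions"
    define T where "T om l = gauss_coeff om l * of_real (bracket2 l powr (- \<alpha> / 2)) *
      torus_integral (\<lambda>x. fourier_char l x * f x)" for om l
    have eq: "random_distribution \<alpha> om f = (if tempered om then infsum (T om) UNIV else 0)" for om
      using f by (simp add: random_distribution_eq[OF \<alpha>] gauss_series_def T_def[abs_def])
    show "(\<lambda>om. random_distribution \<alpha> om f) \<in> borel_measurable gauss"
    proof (rule borel_measurable_LIMSEQ_metric)
      show "(\<lambda>om. if tempered om then \<Sum>l\<in>lattice_ball N. T om l else 0) \<in> borel_measurable gauss" for N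
        unfolding T_def by measurable
      show "(\<lambda>N. if tempered om then \<Sum>l\<in>lattice_ball N. T om l else 0) \<longlonglongrightarrow> random_distribution \<alpha> om f" for om
      proof (cases "tempered om")
        case True
        have "T om summable_on UNIV"
          unfolding T_def by (rule abs_summable_summable[OF series_abs_summable[OF True \<alpha> f]])
        then have "(T om has_sum infsum (T om) UNIV) UNIV" by simp
        then have "(sum (T om) \<longlongrightarrow> infsum (T om) UNIV) (finite_subsets_at_top UNIV)"
          by (simp add: has_sum_def)
        from filterlim_compose[OF this lattice_ball_finite_subsets] show ?thesis
          by (simp add: eq True)
      qed (simp add: eq)
    qed
  qed (auto simp: random_distribution_def gauss_series_def PiE_def)
qed

lemma AE_tempered: "AE om in gauss. tempered (om :: (int ^ 'd) \<times> bool => real)"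
proof -
  let ?w = "\<lambda>l :: int ^ 'd. bracket2 l powr (- real CARD('d))"
  define T where "T N om = (\<Sum>l\<in>lattice_ball N. ?w l * ((om (l, True))\<^sup>2 + (om (l, False))\<^sup>2))" for N om
  obtain C where C: "\<And>F :: (int ^ 'd) set. finite F ==> (\<Sum>l\<in>F. ?w l) \<le> C"
    using sum_bracket2_bounded[where 'd='d and s = "real CARD('d)"] by auto
  have sq: "integrable gauss (\<lambda>om. (om i)\<^sup>2)" "(\<integral>om. (om i)\<^sup>2 \<partial>gauss) = 1" for i :: "(int ^ 'd) \<times> bool"
    using has_bochner_integral_gauss1_power[of 2] integral_gauss_component[of "\<lambda>z. z\<^sup>2" i]
    by (auto simp: has_bochner_integral_iff gmoment_def)
  have T0: "0 \<le> T N om" for N om by (auto simp: T_def intro!: sum_nonneg)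
  have int: "integrable gauss (T N)" for N
    unfolding T_def by (intro Bochner_Integration.integrable_sum integrable_mult_right Bochner_Integration.integrable_add sq)
  have "(\<integral>om. T N om \<partial>gauss) = (\<Sum>l\<in>lattice_ball N. ?w l * 2)" for N
    unfolding T_def by (simp add: sq)
  then have ET: "(\<integral>om. T N om \<partial>gauss) \<le> 2 * C" for N
    using C[OF finite_lattice_ball[of N]] by (simp flip: sum_distrib_right)
  have "(\<integral>\<^sup>+om. (SUP N. ennreal (T N om)) \<partial>gauss) = (SUP N. \<integral>\<^sup>+om. ennreal (T N om) \<partial>gauss)"
  proof (rule nn_integral_monotone_convergence_SUP)
    show "incseq (\<lambda>N om. ennreal (T N om))"
      unfolding T_def by (intro incseq_SucI le_funI ennreal_leI sum_mono2 finite_lattice_ball lattice_ball_mono) auto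
    show "(\<lambda>om. ennreal (T N om)) \<in> borel_measurable gauss" for N using int[of N] by simp
  qed
  also have "\<dots> \<le> ennreal (2 * C)"
    by (rule SUP_least) (simp add: nn_integral_eq_integral[OF int] T0 ET ennreal_leI)
  finally have "(\<integral>\<^sup>+om. (SUP N. ennreal (T N om)) \<partial>gauss) ~= \<infinity>"
    by (auto simp: top_unique)
  moreover have "(\<lambda>om. SUP N. ennreal (T N om)) \<in> borel_measurable gauss"
    using int by (intro borel_measurable_SUP) auto
  ultimately have "AE om in gauss. (SUP N. ennreal (T N om)) ~= \<infinity>"
    by (intro nn_integral_PInf_AE)
  then show ?thesis
  proof eventually_elim
    case (elim om)
    define K where "K = enn2real (SUP N. ennreal (T N om))"
    have "(SUP N. ennreal (T N om)) < top"
      using elim by (simp only: infinity_ennreal_def top.not_eq_extremum)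
    from ennreal_enn2real[OF this] have K: "K \<ge> 0" "(SUP N. ennreal (T N om)) = ennreal K"
      by (simp_all only: K_def enn2real_nonneg)
    have TK: "T N om \<le> K" for N
    proof -
      have "ennreal (T N om) \<le> ennreal K"
        unfolding K(2)[symmetric] by (rule SUP_upper) simp
      then show ?thesis using K(1) by (simp only: ennreal_le_iff)
    qed
    have sq_le: "(om (l, b))\<^sup>2 \<le> (1 + K) * bracket2 l ^ CARD('d)" for l b
    proof -
      obtain N where "{l} \<subseteq> lattice_ball N" using finite_subset_lattice_ball[of "{l}"] by auto
      then have "?w l * ((om (l, True))\<^sup>2 + (om (l, False))\<^sup>2) \<le> T N om"
        unfolding T_def by (intro member_le_sum finite_lattice_ball) auto
      then have le: "?w l * ((om (l, True))\<^sup>2 + (om (l, False))\<^sup>2) \<le> K"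
        using TK[of N] by linarith
      have "(om (l, b))\<^sup>2 \<le> (om (l, True))\<^sup>2 + (om (l, False))\<^sup>2"
        by (cases b) auto
      also have "\<dots> = bracket2 l ^ CARD('d) * (?w l * ((om (l, True))\<^sup>2 + (om (l, False))\<^sup>2))"
        by (simp add: powr_minus powr_realpow)
      also have "\<dots> \<le> bracket2 l ^ CARD('d) * (1 + K)"
        using le by (intro mult_left_mono) auto
      finally show ?thesis by (simp only: mult.commute)
    qed
    have abs_le: "\<bar>om (l, b)\<bar> \<le> (1 + K) * bracket2 l ^ CARD('d)" for l b
    proof (rule power2_le_imp_le)
      let ?X = "(1 + K) * bracket2 l ^ CARD('d)"
      have "1 * 1 \<le> ?X" using K one_le_power[OF bracket2_ge_1] by (intro mult_mono) auto
      then have "?X * 1 \<le> ?X * ?X" by (intro mult_left_mono) auto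
      then show "\<bar>om (l, b)\<bar>\<^sup>2 \<le> ?X\<^sup>2" using sq_le[of l b] by (simp add: power2_eq_square)
      show "0 \<le> ?X" using K by (auto intro!: mult_nonneg_nonneg less_imp_le)
    qed
    have "norm (gauss_coeff om l) \<le> real (nat \<lceil>2 * (1 + K)\<rceil>) * bracket2 l ^ CARD('d)" for l
    proof -
      let ?X = "(1 + K) * bracket2 l ^ CARD('d)"
      have "norm (gauss_coeff om l) \<le> \<bar>(om (l, True) + om (- l, True)) / 2\<bar> + \<bar>(om (l, False) - om (- l, False)) / 2\<bar>"
        using cmod_le[of "gauss_coeff om l"] by (simp only: gauss_coeff_def complex.sel)
      also have "\<dots> \<le> 2 * ?X"
      proof -
        have half: "\<bar>(a + b) / 2\<bar> \<le> X" "\<bar>(a - b) / 2\<bar> \<le> X" if "\<bar>a\<bar> \<le> X" "\<bar>b\<bar> \<le> X" for a b X :: real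
          using that by (auto simp: abs_le_iff)
        have "\<bar>om (- l, b)\<bar> \<le> ?X" for b using abs_le[of "- l" b] by simp
        then show ?thesis
          using half(1)[OF abs_le[of l True], of "om (- l, True)"] half(2)[OF abs_le[of l False], of "om (- l, False)"] by simp
      qed
      also have "\<dots> \<le> real (nat \<lceil>2 * (1 + K)\<rceil>) * bracket2 l ^ CARD('d)"
        unfolding mult.assoc[symmetric] by (intro mult_right_mono real_nat_ceiling_ge) auto
      finally show ?thesis .
    qed
    then show ?case unfolding tempered_def by blast
  qed
qed

text \<open>
  In real coordinates the truncated field is a linear form in independent standard Gaussians
  \<open>om (l, b)\<close>: the two real modes of frequency \<open>l\<close> are multiples of cosine and sine.
\<close>

definition mode :: "real => (int ^ 'd) \<times> bool => real ^ 'd => real" where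
  "mode \<alpha> j x = bracket2 (fst j) powr (- \<alpha> / 2) *
    (if snd j then Re (fourier_char (fst j) x) else - Im (fourier_char (fst j) x))"

abbreviation modes :: "nat => ((int ^ 'd) \<times> bool) set" where
  "modes N \<equiv> lattice_ball N \<times> UNIV"

lemma finite_modes [simp]: "finite (modes N)"
  by (simp add: finite_lattice_ball)

definition field :: "real => nat => ((int ^ 'd) \<times> bool => real) => real ^ 'd => real" where
  "field \<alpha> N om x = (\<Sum>j\<in>modes N. mode \<alpha> j x * om j)"

lemma sum_modes: "(\<Sum>j\<in>modes N. f j) = (\<Sum>l\<in>lattice_ball N. f (l, True) + f (l, False))"
proof -
  have "(\<Sum>j\<in>modes N. f j) = (\<Sum>l\<in>lattice_ball N. \<Sum>b\<in>UNIV. f (l, b))"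
    by (simp add: sum.cartesian_product)
  then show ?thesis by (simp add: UNIV_bool add.commute)
qed

lemma sum_lattice_ball_uminus: "(\<Sum>l\<in>lattice_ball N. f (- l)) = (\<Sum>l\<in>lattice_ball N. f l)"
  by (rule sum.reindex_bij_witness[of _ uminus uminus]) auto

lemma fourier_trunc_random_distribution:
  assumes "tempered om" "\<alpha> \<ge> 0"
  shows "Re (fourier_trunc N (random_distribution \<alpha> om) x) = field \<alpha> N om x"
proof -
  let ?c = "\<lambda>l. bracket2 l powr (- \<alpha> / 2)"
  let ?R = "\<lambda>l. Re (fourier_char l x)" and ?I = "\<lambda>l. Im (fourier_char l x)"
  have "fourier_coeff (random_distribution \<alpha> om) l = gauss_coeff om l * of_real (?c l)" for l
    using assms by (simp add: random_distribution_eq fourier_coeff_def gauss_series_fourier_char)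
  then have "Re (fourier_trunc N (random_distribution \<alpha> om) x) =
      (\<Sum>l\<in>lattice_ball N. ?c l * ((om (l, True) + om (- l, True)) / 2 * ?R l - (om (l, False) - om (- l, False)) / 2 * ?I l))"
    by (simp add: fourier_trunc_def gauss_coeff_def algebra_simps)
  also have "\<dots> = (\<Sum>l\<in>lattice_ball N. (?c l * (om (l, True) * ?R l - om (l, False) * ?I l)) / 2) +
      (\<Sum>l\<in>lattice_ball N. (?c l * (om (- l, True) * ?R l + om (- l, False) * ?I l)) / 2)"
    unfolding sum.distrib[symmetric] by (intro sum.cong refl) (simp add: field_simps)
  also have "(\<Sum>l\<in>lattice_ball N. (?c l * (om (- l, True) * ?R l + om (- l, False) * ?I l)) / 2) =
      (\<Sum>l\<in>lattice_ball N. (?c l * (om (l, True) * ?R l - om (l, False) * ?I l)) / 2)"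
    by (subst sum_lattice_ball_uminus[symmetric]) (simp add: fourier_char_uminus)
  also have "(\<Sum>l\<in>lattice_ball N. (?c l * (om (l, True) * ?R l - om (l, False) * ?I l)) / 2) +
      (\<Sum>l\<in>lattice_ball N. (?c l * (om (l, True) * ?R l - om (l, False) * ?I l)) / 2) =
      (\<Sum>l\<in>lattice_ball N. ?c l * (om (l, True) * ?R l - om (l, False) * ?I l))"
    unfolding sum.distrib[symmetric] by (intro sum.cong refl) (simp only: field_sum_of_halves)
  also have "\<dots> = field \<alpha> N om x"
    unfolding field_def sum_modes by (intro sum.cong refl) (simp add: mode_def algebra_simps)
  finally show ?thesis .
qed

subsection \<open>Transfer to independent Gaussians\<close>

type_synonym 'd index = "nat \<times> (int ^ 'd) \<times> bool"

definition sample :: "real => nat => ('d::finite index => real) => nat => 'd distribution" where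
  "sample \<alpha> n om = (\<lambda>i\<in>{1..n}. random_distribution \<alpha> (\<lambda>j. om (i, j)))"

lemma block_measurable [measurable]:
  "(\<lambda>om j. om (i, j)) \<in> measurable (gauss :: ('a \<times> 'b => real) measure) (gauss :: ('b => real) measure)"
  by (rule measurable_PiM_single') (auto simp: PiE_UNIV_domain)

lemma distr_block:
  "distr gauss gauss (\<lambda>om j. om (i, j)) = (gauss :: ('b => real) measure)"
  using distr_PiM_reindex[of "UNIV :: ('a \<times> 'b) set" "\<lambda>_. gauss1" "Pair i" "UNIV :: 'b set"]
  by (simp add: prob_space_gauss1 inj_on_def restrict_UNIV)

text \<open>Distinct components use disjoint blocks of coordinates, so the fields are independent.\<close>

lemma emeasure_blocks:
  fixes B :: "'a => ('b => real) set"
  assumes "finite I" "\<And>i. i \<in> I ==> B i \<in> sets gauss"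
  shows "emeasure gauss {om :: 'a \<times> 'b => real. \<forall>i\<in>I. (\<lambda>j. om (i, j)) \<in> B i} = (\<Prod>i\<in>I. emeasure gauss (B i))"
  using assms
proof (induction I rule: finite_induct)
  case empty
  show ?case using gauss.P.emeasure_space_1 by simp
next
  case (insert i I)
  let ?S = "\<lambda>I. {om :: 'a \<times> 'b => real. \<forall>i\<in>I. (\<lambda>j. om (i, j)) \<in> B i}"
  have meas: "?S K \<in> sets gauss" if "K \<subseteq> insert i I" for K
  proof -
    have fin: "finite K" using that insert.hyps by (meson finite_insert finite_subset)
    have "?S K = {om \<in> space gauss. \<forall>i\<in>K. (\<lambda>j. om (i, j)) \<in> B i}" by simp
    also have "\<dots> \<in> sets gauss"
    proof (rule sets.sets_Collect_finite_All[OF _ fin])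
      fix k assume "k \<in> K"
      then have [measurable]: "B k \<in> sets gauss" using that insert.prems by auto
      show "{om \<in> space gauss. (\<lambda>j. om (k, j)) \<in> B k} \<in> sets gauss" by measurable
    qed
    finally show ?thesis .
  qed
  have one: "emeasure gauss (?S {i}) = emeasure gauss (B i)"
  proof -
    have "emeasure gauss (B i) = emeasure (distr (gauss :: ('a \<times> 'b => real) measure) gauss (\<lambda>om j. om (i, j))) (B i)"
      by (simp add: distr_block)
    also have "\<dots> = emeasure gauss (?S {i})"
      using insert.prems by (subst emeasure_distr) (auto intro!: arg_cong[of _ _ "emeasure gauss"])
    finally show ?thesis by simp
  qed
  have "emeasure gauss (?S (insert i I)) = (\<integral>\<^sup>+om. indicator (?S {i}) om * indicator (?S I) om \<partial>gauss)"
    by (subst nn_integral_indicator[OF meas[OF order_refl], symmetric]) (auto intro!: nn_integral_cong simp: indicator_def)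
  also have "\<dots> = (\<integral>\<^sup>+om. \<integral>\<^sup>+om'. indicator (?S {i}) (splice ({i} \<times> UNIV) om om') *
      indicator (?S I) (splice ({i} \<times> UNIV) om om') \<partial>gauss \<partial>gauss)"
    by (intro gauss_splice_nn_integral borel_measurable_times_ennreal borel_measurable_indicator meas) auto
  also have "\<dots> = (\<integral>\<^sup>+om. \<integral>\<^sup>+om'. indicator (?S {i}) om' * indicator (?S I) om \<partial>gauss \<partial>gauss)"
  proof -
    have "indicator (?S {i}) (splice ({i} \<times> UNIV) om om') = (indicator (?S {i}) om' :: ennreal)" for om om'
      by (simp add: indicator_def splice_def)
    moreover have "indicator (?S I) (splice ({i} \<times> UNIV) om om') = (indicator (?S I) om :: ennreal)" for om om'
    proof -
      have "(\<lambda>j. splice ({i} \<times> UNIV) om om' (k, j)) = (\<lambda>j. om (k, j))" if "k \<in> I" for k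
        using that insert.hyps by (auto simp: splice_def)
      then show ?thesis by (simp add: indicator_def)
    qed
    ultimately show ?thesis by simp
  qed
  also have "\<dots> = emeasure gauss (?S {i}) * emeasure gauss (?S I)"
  proof -
    have "(\<integral>\<^sup>+om. \<integral>\<^sup>+om'. indicator X om' * indicator Y om \<partial>gauss \<partial>gauss) = emeasure gauss X * emeasure gauss Y"
      if "X \<in> sets gauss" "Y \<in> sets gauss" for X Y :: "('a \<times> 'b => real) set"
      using that by (simp add: nn_integral_multc nn_integral_cmult)
    then show ?thesis using meas[of "{i}"] meas[of I] by blast
  qed
  finally show ?case
    using insert one by simp
qed

lemma prob_space_gauss_measure:
  assumes "\<alpha> \<ge> 0"
  shows "prob_space (gauss_measure \<alpha> :: 'd::finite distribution measure)"
  unfolding gauss_measure_def normal_family_eq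
  by (rule prob_space.prob_space_distr[OF gauss.P.prob_space_axioms random_distribution_measurable[OF assms]])

lemma sets_gauss_measure: "sets (gauss_measure \<alpha>) = sets distribution_space"
  by (simp add: gauss_measure_def)

lemma sample_measurable:
  assumes "\<alpha> \<ge> 0"
  shows "sample \<alpha> n \<in> measurable gauss (gauss_measure_prod \<alpha> n)"
  unfolding gauss_measure_prod_def sample_def
proof (rule measurable_restrict)
  fix i
  have "(\<lambda>om. random_distribution \<alpha> (\<lambda>j. om (i, j))) \<in> measurable gauss distribution_space"
    using measurable_compose[OF block_measurable random_distribution_measurable[OF assms]] .
  then show "(\<lambda>om. random_distribution \<alpha> (\<lambda>j. om (i, j))) \<in> measurable gauss (gauss_measure \<alpha>)"
    by (simp only: measurable_cong_sets[OF refl sets_gauss_measure])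
qed

lemma distr_sample:
  assumes \<alpha>: "\<alpha> \<ge> 0"
  shows "distr gauss (gauss_measure_prod \<alpha> n) (sample \<alpha> n) = (gauss_measure_prod \<alpha> n :: (nat => 'd::finite distribution) measure)"
proof -
  interpret P: product_prob_space "\<lambda>_ :: nat. gauss_measure \<alpha> :: 'd distribution measure" "{1..n}"
    by (intro product_prob_spaceI prob_space_gauss_measure \<alpha>)
  show ?thesis
    unfolding gauss_measure_prod_def
  proof (rule P.PiM_eqI)
    fix A :: "nat => 'd distribution set"
    assume A: "\<And>i. i \<in> {1..n} ==> A i \<in> sets (gauss_measure \<alpha>)"
    let ?B = "\<lambda>i. random_distribution \<alpha> -` A i \<inter> space gauss"
    have m: "random_distribution \<alpha> \<in> measurable gauss (gauss_measure \<alpha> :: 'd distribution measure)"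
      using random_distribution_measurable[OF \<alpha>] by (simp only: measurable_cong_sets[OF refl sets_gauss_measure])
    have B: "?B i \<in> sets gauss" if "i \<in> {1..n}" for i
      using m A[OF that] by (rule measurable_sets)
    have sm: "sample \<alpha> n \<in> measurable gauss (PiM {1..n} (\<lambda>_. gauss_measure \<alpha> :: 'd distribution measure))"
      using sample_measurable[OF \<alpha>] by (simp add: gauss_measure_prod_def)
    have "emeasure (distr gauss (PiM {1..n} (\<lambda>_. gauss_measure \<alpha>)) (sample \<alpha> n)) (Pi\<^sub>E {1..n} A) =
        emeasure gauss (sample \<alpha> n -` Pi\<^sub>E {1..n} A \<inter> space gauss)"
      using A by (intro emeasure_distr sm sets_PiM_I_finite) auto
    also have "sample \<alpha> n -` Pi\<^sub>E {1..n} A \<inter> space gauss = {om. \<forall>i\<in>{1..n}. (\<lambda>j. om (i, j)) \<in> ?B i}"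
      by (auto simp: sample_def PiE_iff)
    also have "emeasure gauss \<dots> = (\<Prod>i\<in>{1..n}. emeasure gauss (?B i))"
      by (intro emeasure_blocks B) auto
    also have "\<dots> = (\<Prod>i\<in>{1..n}. emeasure (gauss_measure \<alpha>) (A i))"
      using A by (intro prod.cong refl)
        (simp add: gauss_measure_def normal_family_eq emeasure_distr random_distribution_measurable \<alpha>)
    finally show "emeasure (distr gauss (PiM {1..n} (\<lambda>_. gauss_measure \<alpha>)) (sample \<alpha> n)) (Pi\<^sub>E {1..n} A) =
        (\<Prod>i\<in>{1..n}. emeasure (gauss_measure \<alpha>) (A i))" .
  qed auto
qed

lemma nn_integral_gauss_measure_prod:
  assumes "\<alpha> \<ge> 0" "F \<in> borel_measurable (gauss_measure_prod \<alpha> n)"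
  shows "(\<integral>\<^sup>+\<Phi>. F \<Phi> \<partial>gauss_measure_prod \<alpha> n) = (\<integral>\<^sup>+om. F (sample \<alpha> n om) \<partial>gauss)"
  by (subst distr_sample[OF assms(1), symmetric])
    (simp add: nn_integral_distr sample_measurable assms)

lemma fourier_coeff_measurable:
  "(\<lambda>u. fourier_coeff u l) \<in> borel_measurable (distribution_space :: 'd::finite distribution measure)"
  unfolding fourier_coeff_def distribution_space_def
  by (intro measurable_restrict_space1 measurable_component_singleton) simp

lemma hermite_multi_measurable:
  "(\<lambda>\<Phi>. torus_integral (\<lambda>x. hermite_multi n \<beta> (\<lambda>i. Re (fourier_trunc N (\<Phi> i) x)) \<sigma>))
    \<in> borel_measurable (gauss_measure_prod \<alpha> n :: (nat => 'd::finite distribution) measure)"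
proof -
  let ?M = "gauss_measure_prod \<alpha> n :: (nat => 'd distribution) measure"
  have c: "(\<lambda>p. fourier_coeff (fst p i) l) \<in> borel_measurable (?M \<Otimes>\<^sub>M (lborel :: (real ^ 'd) measure))" if "i \<in> {1..n}" for i l
  proof -
    have "(\<lambda>\<Phi>. \<Phi> i) \<in> measurable ?M (gauss_measure \<alpha>)"
      unfolding gauss_measure_prod_def using that by (rule measurable_component_singleton)
    then have "(\<lambda>\<Phi>. \<Phi> i) \<in> measurable ?M distribution_space"
      by (simp only: measurable_cong_sets[OF refl sets_gauss_measure])
    from measurable_compose[OF measurable_compose[OF measurable_fst this] fourier_coeff_measurable]
    show ?thesis .
  qed
  have ch: "(\<lambda>p. fourier_char l (snd p)) \<in> borel_measurable (?M \<Otimes>\<^sub>M (lborel :: (real ^ 'd) measure))" for l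
    by measurable
  have t: "(\<lambda>p. Re (fourier_trunc N (fst p i) (snd p))) \<in> borel_measurable (?M \<Otimes>\<^sub>M lborel)" if "i \<in> {1..n}" for i
  proof -
    note c[OF that, measurable] ch[measurable]
    show ?thesis unfolding fourier_trunc_def by measurable
  qed
  have "(\<lambda>p. hermite_multi n \<beta> (\<lambda>i. Re (fourier_trunc N (fst p i) (snd p))) \<sigma>) \<in> borel_measurable (?M \<Otimes>\<^sub>M lborel)"
    unfolding hermite_multi_def
    by (intro borel_measurable_prod measurable_compose[OF t borel_measurable_hermite])
  moreover have "(\<lambda>p. indicator (cbox 0 1) (snd p) :: real) \<in> borel_measurable (?M \<Otimes>\<^sub>M (lborel :: (real ^ 'd) measure))"
    by measurable
  ultimately have "(\<lambda>(\<Phi>, x). indicator (cbox 0 1) x *\<^sub>R hermite_multi n \<beta> (\<lambda>i. Re (fourier_trunc N (\<Phi> i) x)) \<sigma>)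
      \<in> borel_measurable (?M \<Otimes>\<^sub>M lborel)"
    unfolding split_beta' by (intro borel_measurable_scaleR)
  then show ?thesis
    unfolding torus_integral_def set_lebesgue_integral_def
    by (rule lborel.borel_measurable_lebesgue_integral)
qed

lemma wick_integral_measurable:
  "wick_integral \<alpha>' n \<beta> \<in> borel_measurable (gauss_measure_prod \<alpha> n :: (nat => 'd::finite distribution) measure)"
  unfolding wick_integral_def[abs_def] by (intro borel_measurable_lim_metric hermite_multi_measurable)

section \<open>Wick integrals as Gaussian polynomials\<close>

text \<open>Fubini in a single coordinate \<open>p\<close>.\<close>

lemma gauss_resample:
  fixes f :: "('i => real) => real"
  assumes f: "integrable gauss f" and m: "\<And>om. (\<lambda>z. f (fun_upd om p z)) \<in> borel_measurable borel"
  shows "integral\<^sup>L gauss f = (\<integral>om. \<integral>z. f (fun_upd om p z) \<partial>gauss1 \<partial>gauss)"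
proof -
  have "splice {p} om om' = (fun_upd om p (om' p))" for om om' :: "'i => real"
    by (auto simp: splice_def)
  then have "integral\<^sup>L gauss f = (\<integral>om. \<integral>om'. f ((fun_upd om p (om' p))) \<partial>gauss \<partial>gauss)"
    using gauss_splice_integral[OF f, of "{p}"] by simp
  then show ?thesis
    using integral_gauss_component(1)[where s = p, OF m] by simp
qed

lemma borel_measurable_poly [measurable]: "(\<lambda>z :: real. poly q z) \<in> borel_measurable borel"
  by (intro borel_measurable_continuous_onI continuous_intros)

lemma gauss_by_parts:
  fixes G G' :: "('i => real) => real"
  assumes G: "all_moments G" and G': "all_moments G'"
    and q: "\<And>om z. G (fun_upd om p z) = poly (q om) z" "\<And>om z. G' (fun_upd om p z) = poly (pderiv (q om)) z"
  shows "(\<integral>om. om p * G om \<partial>gauss) = (\<integral>om. G' om \<partial>gauss)"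
proof -
  have "(\<integral>om. om p * G om \<partial>gauss) = (\<integral>om. \<integral>z. z * poly (q om) z \<partial>gauss1 \<partial>gauss)"
    by (subst gauss_resample[where p = p]) (auto simp: q intro!: all_moments_integrable all_moments_mult G)
  also have "\<dots> = (\<integral>om. \<integral>z. G' (fun_upd om p z) \<partial>gauss1 \<partial>gauss)"
    by (simp add: gauss1_by_parts q)
  also have "\<dots> = (\<integral>om. G' om \<partial>gauss)"
    by (rule gauss_resample[symmetric]) (auto simp: q intro!: all_moments_integrable G')
  finally show ?thesis .
qed

subsection \<open>Families of polynomials over the torus\<close>

inductive gfam :: "'i set => nat => (real ^ 'd => ('i => real) => real) => bool" for S :: "'i set" where
  const: "continuous_on UNIV c ==> gfam S 0 (\<lambda>x _. c x)"
| var: "gfam S k f ==> i \<in> S ==> gfam S (Suc k) (\<lambda>x om. om i * f x om)"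
| add: "gfam S k f ==> gfam S k g ==> gfam S k (\<lambda>x om. f x om + g x om)"
| Suc: "gfam S k f ==> gfam S (Suc k) f"

lemma gfam_mono:
  assumes "gfam S k f" "k \<le> m"
  shows "gfam S m f"
  using assms(2) by (induction rule: dec_induct) (auto intro: assms gfam.Suc)

lemma gfam_const: "continuous_on UNIV c ==> gfam S k (\<lambda>x _. c x)"
  by (rule gfam_mono[OF gfam.const]) auto

lemma gfam_cmult: "gfam S k f ==> continuous_on UNIV c ==> gfam S k (\<lambda>x om. c x * f x om)"
proof (induction rule: gfam.induct)
  case (const c')
  then show ?case by (intro gfam.const continuous_intros)
next
  case (var k f i)
  then show ?case using gfam.var[of S k "\<lambda>x om. c x * f x om" i] by (simp add: mult.left_commute)
qed (auto simp: distrib_left intro: gfam.intros)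

lemma gfam_mult: "gfam S k f ==> gfam S m g ==> gfam S (k + m) (\<lambda>x om. f x om * g x om)"
proof (induction rule: gfam.induct)
  case (const c)
  then show ?case using gfam_cmult by auto
next
  case (var k f i)
  then show ?case using gfam.var[of S "k + m" "\<lambda>x om. f x om * g x om" i] by (simp add: mult.assoc)
qed (auto simp: distrib_right intro: gfam.intros)

lemma gfam_diff: "gfam S k f ==> gfam S k g ==> gfam S k (\<lambda>x om. f x om - g x om)"
  using gfam.add[of S k f "\<lambda>x om. - 1 * g x om"] gfam_cmult[of S k g "\<lambda>_. -1"] by simp

lemma gfam_sum: "(\<And>i. i \<in> I ==> gfam S k (f i)) ==> gfam S k (\<lambda>x om. \<Sum>i\<in>I. f i x om)"
  by (induction I rule: infinite_finite_induct) (auto intro: gfam.add gfam_const)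

lemma gfam_prod: "(\<And>i. i \<in> I ==> gfam S (k i) (f i)) ==> gfam S (\<Sum>i\<in>I. k i) (\<lambda>x om. \<Prod>i\<in>I. f i x om)"
  by (induction I rule: infinite_finite_induct) (auto intro: gfam_mult gfam_const)

lemma gfam_hermite:
  assumes "gfam S 1 f" "continuous_on UNIV v"
  shows "gfam S k (\<lambda>x om. hermite k (f x om) (v x))"
proof (induction k rule: less_induct)
  case (less k)
  show ?case
  proof (cases k)
    case 0
    then show ?thesis by (simp add: gfam_const)
  next
    case (Suc j)
    have "gfam S (1 + j) (\<lambda>x om. f x om * hermite j (f x om) (v x))"
      by (rule gfam_mult[OF assms(1) less]) (simp add: Suc)
    moreover have "gfam S (Suc j) (\<lambda>x om. (real j * v x) * hermite (j - 1) (f x om) (v x))"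
      by (intro gfam_mono[OF gfam_cmult[OF less]] continuous_intros assms) (auto simp: Suc)
    ultimately show ?thesis
      using gfam_diff by (fastforce simp: Suc hermite_Suc)
  qed
qed

lemma gpoly_gfam: "gfam S k f ==> gpoly S k (f x)"
  by (induction rule: gfam.induct) (auto intro: gpoly.intros)

lemma gfam_continuous: "gfam S k f ==> continuous_on UNIV (\<lambda>x. f x om)"
  by (induction rule: gfam.induct) (auto intro!: continuous_intros)

lemma gfam_integrable: "gfam S k f ==> integrable torus (\<lambda>x. f x om)"
  by (rule continuous_imp_integrable_torus[OF gfam_continuous])

lemma gpoly_integral: "gfam S k f ==> gpoly S k (\<lambda>om. \<integral>x. f x om \<partial>torus)"
proof (induction rule: gfam.induct)
  case (var k f i)
  then show ?case by (auto intro: gpoly.var)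
next
  case (add k f g)
  then show ?case by (auto simp: gfam_integrable intro: gpoly.add)
qed (auto intro: gpoly.Suc)

text \<open>
  The torus integral of a family can be interchanged with the expectation. For polynomials this is a
  finite computation, which avoids joint integrability on the product space.
\<close>

lemma gfam_Fubini:
  fixes f :: "real ^ 'd => ('i => real) => real"
  assumes "gfam S k f" "all_moments g"
  shows "continuous_on UNIV (\<lambda>x. \<integral>om. f x om * g om \<partial>gauss)"
    and "(\<integral>om. (\<integral>x. f x om \<partial>torus) * g om \<partial>gauss) = (\<integral>x. (\<integral>om. f x om * g om \<partial>gauss) \<partial>torus)"
proof -
  have "continuous_on UNIV (\<lambda>x. \<integral>om. f x om * g om \<partial>gauss) \<and>
    (\<integral>om. (\<integral>x. f x om \<partial>torus) * g om \<partial>gauss) = (\<integral>x. (\<integral>om. f x om * g om \<partial>gauss) \<partial>torus)"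
    using assms
  proof (induction arbitrary: g rule: gfam.induct)
    case (const c)
    then show ?case by (auto intro!: continuous_intros)
  next
    case (var k f i)
    have "all_moments (\<lambda>om. om i * g om)" using var.prems by auto
    from var.IH[OF this] show ?case by (simp add: mult_ac)
  next
    case (add k f h)
    have 1: "integrable gauss (\<lambda>om. f x om * g om)" "integrable gauss (\<lambda>om. h x om * g om)" for x
      using add by (auto intro!: all_moments_integrable all_moments_mult intro: all_moments_gpoly gpoly_gfam)
    have 2: "integrable gauss (\<lambda>om. (\<integral>x. f x om \<partial>torus) * g om)" "integrable gauss (\<lambda>om. (\<integral>x. h x om \<partial>torus) * g om)"
      using add by (auto intro!: all_moments_integrable all_moments_mult intro: all_moments_gpoly gpoly_integral)
    have f: "continuous_on UNIV (\<lambda>x. \<integral>om. f x om * g om \<partial>gauss)"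
      "(\<integral>om. (\<integral>x. f x om \<partial>torus) * g om \<partial>gauss) = (\<integral>x. (\<integral>om. f x om * g om \<partial>gauss) \<partial>torus)"
      using add.IH(1)[OF add.prems] by auto
    have h: "continuous_on UNIV (\<lambda>x. \<integral>om. h x om * g om \<partial>gauss)"
      "(\<integral>om. (\<integral>x. h x om \<partial>torus) * g om \<partial>gauss) = (\<integral>x. (\<integral>om. h x om * g om \<partial>gauss) \<partial>torus)"
      using add.IH(2)[OF add.prems] by auto
    have "(\<integral>om. (\<integral>x. f x om + h x om \<partial>torus) * g om \<partial>gauss) =
        (\<integral>om. (\<integral>x. f x om \<partial>torus) * g om + (\<integral>x. h x om \<partial>torus) * g om \<partial>gauss)"
      using add.hyps by (simp add: gfam_integrable distrib_right)
    also have "\<dots> = (\<integral>x. (\<integral>om. f x om * g om \<partial>gauss) \<partial>torus) + (\<integral>x. (\<integral>om. h x om * g om \<partial>gauss) \<partial>torus)"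
      using 2 f(2) h(2) by simp
    also have "\<dots> = (\<integral>x. (\<integral>om. f x om * g om \<partial>gauss) + (\<integral>om. h x om * g om \<partial>gauss) \<partial>torus)"
      by (rule Bochner_Integration.integral_add[symmetric]) (intro continuous_imp_integrable_torus f h)+
    finally show ?case
      using 1 f(1) h(1) by (auto simp: distrib_right intro: continuous_on_add)
  qed (auto)
  then show "continuous_on UNIV (\<lambda>x. \<integral>om. f x om * g om \<partial>gauss)"
    "(\<integral>om. (\<integral>x. f x om \<partial>torus) * g om \<partial>gauss) = (\<integral>x. (\<integral>om. f x om * g om \<partial>gauss) \<partial>torus)"
    by auto
qed

subsection \<open>Wick powers\<close>

text \<open>
  For a finite set \<open>S\<close> of variables, \<open>lin\<close> is the part of the \<open>i\<close>-th field carried by \<open>S\<close>,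
  \<open>vari\<close> its variance, and \<open>wick\<close> the Wick monomial of these fields.
\<close>

definition lin :: "real => 'd::finite index set => nat => ('d index => real) => real ^ 'd => real" where
  "lin \<alpha> S i om x = (\<Sum>p\<in>{p \<in> S. fst p = i}. mode \<alpha> (snd p) x * om p)"

definition covar :: "real => 'd::finite index set => nat => real ^ 'd => real ^ 'd => real" where
  "covar \<alpha> S i x y = (\<Sum>p\<in>{p \<in> S. fst p = i}. mode \<alpha> (snd p) x * mode \<alpha> (snd p) y)"

definition wick :: "real => nat => (nat => nat) => 'd::finite index set => real ^ 'd => ('d index => real) => real" where
  "wick \<alpha> n \<beta> S x om = (\<Prod>i=1..n. hermite (\<beta> i) (lin \<alpha> S i om x) (covar \<alpha> S i x x))"

lemma continuous_mode: "continuous_on UNIV (mode \<alpha> j)"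
  unfolding mode_def[abs_def] by (cases "snd j") (auto intro!: continuous_intros continuous_fourier_char)

lemma gfam_lin:
  assumes "finite S" "S \<subseteq> T"
  shows "gfam T 1 (\<lambda>x om. lin \<alpha> S i om x)"
  unfolding lin_def
proof (rule gfam_sum)
  fix p assume "p \<in> {p \<in> S. fst p = i}"
  then have p: "p \<in> T" using assms by auto
  show "gfam T 1 (\<lambda>x om. mode \<alpha> (snd p) x * om p)"
    using gfam.var[OF gfam.const[OF continuous_mode[of \<alpha> "snd p"]] p] by (simp add: mult.commute)
qed

lemma gfam_wick:
  assumes "finite S" "S \<subseteq> T"
  shows "gfam T (\<Sum>i=1..n. \<beta> i) (wick \<alpha> n \<beta> S)"
  unfolding wick_def[abs_def]
  by (intro gfam_prod gfam_hermite gfam_lin assms) (auto simp: covar_def intro!: continuous_intros continuous_mode)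

lemma all_moments_lin: "finite S ==> all_moments (\<lambda>om. lin \<alpha> S i om x)"
  using all_moments_gpoly[OF gpoly_gfam[OF gfam_lin[OF _ order_refl]]] by blast

lemma all_moments_wick: "finite S ==> all_moments (wick \<alpha> n \<beta> S x)"
  using all_moments_gpoly[OF gpoly_gfam[OF gfam_wick[OF _ order_refl]]] by blast

lemma lin_insert:
  assumes "finite S" "p \<notin> S"
  shows "lin \<alpha> (insert p S) i (fun_upd om p z) x =
    (if i = fst p then lin \<alpha> S i om x + mode \<alpha> (snd p) x * z else lin \<alpha> S i om x)"
proof -
  have "{q \<in> insert p S. fst q = i} = (if i = fst p then insert p {q \<in> S. fst q = i} else {q \<in> S. fst q = i})"
    by auto
  then have "lin \<alpha> (insert p S) i (fun_upd om p z) x =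
      (if i = fst p then mode \<alpha> (snd p) x * z + (\<Sum>q\<in>{q \<in> S. fst q = i}. mode \<alpha> (snd q) x * (fun_upd om p z) q)
       else (\<Sum>q\<in>{q \<in> S. fst q = i}. mode \<alpha> (snd q) x * (fun_upd om p z) q))"
    unfolding lin_def using assms by auto
  also have "(\<Sum>q\<in>{q \<in> S. fst q = i}. mode \<alpha> (snd q) x * (fun_upd om p z) q) = lin \<alpha> S i om x"
    unfolding lin_def using assms by (intro sum.cong) auto
  finally show ?thesis by (simp only: add.commute)
qed

lemma covar_insert:
  assumes "finite S" "p \<notin> S"
  shows "covar \<alpha> (insert p S) i x y =
    (if i = fst p then covar \<alpha> S i x y + mode \<alpha> (snd p) x * mode \<alpha> (snd p) y else covar \<alpha> S i x y)"
proof -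
  have "{q \<in> insert p S. fst q = i} = (if i = fst p then insert p {q \<in> S. fst q = i} else {q \<in> S. fst q = i})"
    by auto
  then show ?thesis using assms by (simp add: covar_def)
qed

text \<open>Averaging a Hermite polynomial over an independent Gaussian summand removes the variance of that summand.\<close>

lemma wick_martingale_step:
  fixes g :: "('d::finite index => real) => real"
  assumes S: "finite S" "p \<notin> S" and g: "dep_on (- {p}) g" "all_moments g"
  shows "(\<integral>om. wick \<alpha> n \<beta> (insert p S) x om * g om \<partial>gauss) = (\<integral>om. wick \<alpha> n \<beta> S x om * g om \<partial>gauss)"
proof (cases "fst p \<in> {1..n}")
  case False
  have "{q \<in> insert p S. fst q = i} = {q \<in> S. fst q = i}" if "i \<in> {1..n}" for i
    using False that by auto
  then have "wick \<alpha> n \<beta> (insert p S) x om = wick \<alpha> n \<beta> S x om" for om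
    unfolding wick_def lin_def covar_def by (intro prod.cong refl) simp
  then show ?thesis by simp
next
  case True
  define i where "i = fst p"
  define R where "R om = (\<Prod>k\<in>{1..n} - {i}. hermite (\<beta> k) (lin \<alpha> S k om x) (covar \<alpha> S k x x))" for om
  have gz: "g (fun_upd om p z) = g om" for om z
    by (rule dep_onD[OF g(1)]) auto
  have W: "wick \<alpha> n \<beta> (insert p S) x (fun_upd om p z) =
      hermite (\<beta> i) (lin \<alpha> S i om x + mode \<alpha> (snd p) x * z) (covar \<alpha> S i x x + (mode \<alpha> (snd p) x)\<^sup>2) * R om" for om z
    unfolding wick_def R_def using True
    by (subst prod.remove[of _ i]) (auto simp: i_def lin_insert[OF S] covar_insert[OF S] power2_eq_square intro!: prod.cong)
  have W0: "wick \<alpha> n \<beta> S x om = hermite (\<beta> i) (lin \<alpha> S i om x) (covar \<alpha> S i x x) * R om" for om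
    unfolding wick_def R_def using True by (subst prod.remove[of _ i]) (auto simp: i_def)
  have "(\<integral>om. wick \<alpha> n \<beta> (insert p S) x om * g om \<partial>gauss) =
      (\<integral>om. \<integral>z. hermite (\<beta> i) (lin \<alpha> S i om x + mode \<alpha> (snd p) x * z) (covar \<alpha> S i x x + (mode \<alpha> (snd p) x)\<^sup>2) * (R om * g om) \<partial>gauss1 \<partial>gauss)"
    by (subst gauss_resample[where p = p])
      (auto simp: W gz mult.assoc intro!: all_moments_integrable all_moments_mult all_moments_wick S g)
  also have "\<dots> = (\<integral>om. wick \<alpha> n \<beta> S x om * g om \<partial>gauss)"
    by (simp add: gauss1_hermite_shift W0 mult.assoc)
  finally show ?thesis .
qed

lemma wick_martingale:
  fixes g :: "('d::finite index => real) => real"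
  assumes "finite T" "finite S" "S \<inter> T = {}" and g: "dep_on (- T) g" "all_moments g"
  shows "(\<integral>om. wick \<alpha> n \<beta> (S \<union> T) x om * g om \<partial>gauss) = (\<integral>om. wick \<alpha> n \<beta> S x om * g om \<partial>gauss)"
  using assms(1,3) g(1)
proof (induction T rule: finite_induct)
  case (insert p T)
  have "(\<integral>om. wick \<alpha> n \<beta> (insert p (S \<union> T)) x om * g om \<partial>gauss) = (\<integral>om. wick \<alpha> n \<beta> (S \<union> T) x om * g om \<partial>gauss)"
    by (rule wick_martingale_step) (use insert assms(2) g(2) in \<open>auto intro: dep_on_mono\<close>)
  then show ?case
    using insert by (auto intro: dep_on_mono)
qed simp

text \<open>One application of Gaussian integration by parts to each variable of the \<open>i\<close>-th field.\<close>

lemma wick_pairing_Suc: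
  fixes \<alpha> :: real and R :: "('d::finite index => real) => real"
  assumes S: "finite S" and R: "dep_on {p. fst p ~= i} R" "all_moments R"
  defines "H \<equiv> \<lambda>k x om. hermite k (lin \<alpha> S i om x) (covar \<alpha> S i x x)"
  shows "(\<integral>om. H (Suc k) x om * H (Suc k) y om * R om \<partial>gauss) =
    real (Suc k) * covar \<alpha> S i x y * (\<integral>om. H k x om * H k y om * R om \<partial>gauss)"
proof -
  let ?S = "{p \<in> S. fst p = i}"
  define m where "m p = mode \<alpha> (snd p)" for p :: "'d index"
  have amH: "all_moments (H k x)" for k x
    unfolding H_def by (intro all_moments_hermite all_moments_lin S)
  note am = amH R(2) all_moments_mult all_moments_add all_moments_const all_moments_var
  define G where "G om = H k x om * H (Suc k) y om * R om" for om
  define A where "A = (\<integral>om. H (k - 1) x om * H (Suc k) y om * R om \<partial>gauss)"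
  define B where "B = (\<integral>om. H k x om * H k y om * R om \<partial>gauss)"
  have parts: "(\<integral>om. om p * G om \<partial>gauss) = m p x * real k * A + m p y * real (Suc k) * B" if p: "p \<in> ?S" for p
  proof -
    define G' where "G' om = (m p x * real k) * (H (k - 1) x om * H (Suc k) y om * R om) +
      (m p y * real (Suc k)) * (H k x om * H k y om * R om)" for om
    define c where "c om x = lin \<alpha> S i om x - m p x * om p" for om x
    have lin: "lin \<alpha> S i (fun_upd om p z) x = c om x + m p x * z" for om z x
    proof -
      have "lin \<alpha> S i om' x = m p x * om' p + (\<Sum>q\<in>?S - {p}. mode \<alpha> (snd q) x * om' q)" for om'
        unfolding lin_def m_def using p S by (subst sum.remove[of _ p]) auto
      from this[of "(fun_upd om p z)"] this[of om] show ?thesis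
        by (simp add: c_def)
    qed
    have Rz: "R (fun_upd om p z) = R om" for om z
      using p by (intro dep_onD[OF R(1)]) auto
    define h where "h k x om = hpoly k (covar \<alpha> S i x x) \<circ>\<^sub>p [:c om x, m p x:]" for k x om
    have h: "H k x (fun_upd om p z) = poly (h k x om) z" for k x om z
      by (simp add: H_def lin h_def poly_pcompose poly_hpoly mult.commute)
    have h': "pderiv (h k x om) = smult (m p x * real k) (h (k - 1) x om)" for k x om
      by (simp add: h_def pderiv_pcompose pderiv_hpoly pderiv_pCons pcompose_smult mult.commute)
    have "(\<integral>om. om p * G om \<partial>gauss) = (\<integral>om. G' om \<partial>gauss)"
    proof (rule gauss_by_parts[where q = "\<lambda>om. h k x om * h (Suc k) y om * [:R om:]"])
      show "all_moments G" "all_moments G'"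
        unfolding G_def[abs_def] G'_def[abs_def] by (intro am)+
      show "G (fun_upd om p z) = poly (h k x om * h (Suc k) y om * [:R om:]) z" for om z
        by (simp add: G_def h Rz)
      show "G' (fun_upd om p z) = poly (pderiv (h k x om * h (Suc k) y om * [:R om:])) z" for om z
        by (simp add: G'_def h Rz pderiv_mult pderiv_smult h' pderiv_pCons algebra_simps)
    qed
    also have "\<dots> = m p x * real k * A + m p y * real (Suc k) * B"
      unfolding G'_def A_def B_def
      by (subst Bochner_Integration.integral_add) (auto intro!: all_moments_integrable am simp del: of_nat_Suc)
    finally show ?thesis .
  qed
  have "H (Suc k) x om * H (Suc k) y om * R om = (\<Sum>p\<in>?S. m p x * (om p * G om)) -
      (real k * covar \<alpha> S i x x) * (H (k - 1) x om * H (Suc k) y om * R om)" for om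
  proof -
    have "(\<Sum>p\<in>?S. m p x * (om p * G om)) = lin \<alpha> S i om x * G om"
      by (simp add: lin_def m_def sum_distrib_right mult.assoc)
    moreover have Hx: "H (Suc k) x om = lin \<alpha> S i om x * H k x om - real k * covar \<alpha> S i x x * H (k - 1) x om"
      by (simp add: H_def hermite_Suc)
    moreover have "H (Suc k) x om * H (Suc k) y om * R om = lin \<alpha> S i om x * G om -
        (real k * covar \<alpha> S i x x) * (H (k - 1) x om * H (Suc k) y om * R om)"
      unfolding Hx G_def by (simp only: left_diff_distrib right_diff_distrib mult_ac)
    ultimately show ?thesis by (simp only:)
  qed
  then have "(\<integral>om. H (Suc k) x om * H (Suc k) y om * R om \<partial>gauss) =
      (\<integral>om. (\<Sum>p\<in>?S. m p x * (om p * G om)) - (real k * covar \<alpha> S i x x) * (H (k - 1) x om * H (Suc k) y om * R om) \<partial>gauss)"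
    by simp
  also have "\<dots> = (\<Sum>p\<in>?S. m p x * (\<integral>om. om p * G om \<partial>gauss)) - (real k * covar \<alpha> S i x x) * A"
  proof (subst Bochner_Integration.integral_diff)
    show "integrable gauss (\<lambda>om. \<Sum>p\<in>?S. m p x * (om p * G om))"
      unfolding G_def by (intro all_moments_integrable all_moments_sum am)
    show "integrable gauss (\<lambda>om. (real k * covar \<alpha> S i x x) * (H (k - 1) x om * H (Suc k) y om * R om))"
      by (intro all_moments_integrable am)
    have "(\<integral>om. (\<Sum>p\<in>?S. m p x * (om p * G om)) \<partial>gauss) = (\<Sum>p\<in>?S. m p x * (\<integral>om. om p * G om \<partial>gauss))"
      by (subst Bochner_Integration.integral_sum) (auto intro!: all_moments_integrable am simp: G_def)
    then show "(\<integral>om. (\<Sum>p\<in>?S. m p x * (om p * G om)) \<partial>gauss) -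
        (\<integral>om. (real k * covar \<alpha> S i x x) * (H (k - 1) x om * H (Suc k) y om * R om) \<partial>gauss) =
        (\<Sum>p\<in>?S. m p x * (\<integral>om. om p * G om \<partial>gauss)) - (real k * covar \<alpha> S i x x) * A"
      by (simp add: A_def)
  qed
  also have "(\<Sum>p\<in>?S. m p x * (\<integral>om. om p * G om \<partial>gauss)) = (\<Sum>p\<in>?S. m p x * (m p x * real k * A + m p y * real (Suc k) * B))"
    by (intro sum.cong refl) (simp only: parts)
  also have "\<dots> = covar \<alpha> S i x x * (real k * A) + covar \<alpha> S i x y * (real (Suc k) * B)"
    unfolding covar_def m_def sum_distrib_right sum.distrib[symmetric]
    by (intro sum.cong refl) (simp only: distrib_left mult_ac)
  finally show ?thesis by (simp add: B_def)
qed

lemma wick_pairing: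
  fixes R :: "('d::finite index => real) => real"
  assumes S: "finite S" and R: "dep_on {p. fst p ~= i} R" "all_moments R"
  shows "(\<integral>om. hermite k (lin \<alpha> S i om x) (covar \<alpha> S i x x) * hermite k (lin \<alpha> S i om y) (covar \<alpha> S i y y) * R om \<partial>gauss) =
    fact k * covar \<alpha> S i x y ^ k * (\<integral>om. R om \<partial>gauss)"
proof (induction k)
  case (Suc k)
  show ?case unfolding wick_pairing_Suc[OF S R] Suc by simp
qed simp

text \<open>Repeated integration by parts contracts the fields of the two Wick powers in pairs.\<close>

lemma wick_covariance:
  assumes S: "finite (S :: 'd::finite index set)"
  shows "(\<integral>om. wick \<alpha> n \<beta> S x om * wick \<alpha> n \<beta> S y om \<partial>gauss) = (\<Prod>i=1..n. fact (\<beta> i) * covar \<alpha> S i x y ^ \<beta> i)"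
proof -
  define h where "h i x om = hermite (\<beta> i) (lin \<alpha> S i om x) (covar \<alpha> S i x x)" for i x om
  have am: "all_moments (h i x)" for i x
    unfolding h_def[abs_def] by (intro all_moments_hermite all_moments_lin S)
  have dep: "dep_on {p. fst p = i} (h i x)" for i x
  proof -
    have "lin \<alpha> S i om x = lin \<alpha> S i om' x" if "\<forall>p\<in>{p. fst p = i}. om p = om' p" for om om'
      unfolding lin_def using that by (intro sum.cong) auto
    then show ?thesis unfolding dep_on_def h_def by metis
  qed
  have "(\<integral>om. (\<Prod>i\<in>I. h i x om * h i y om) \<partial>gauss) = (\<Prod>i\<in>I. fact (\<beta> i) * covar \<alpha> S i x y ^ \<beta> i)" if "finite I" for I
    using that
  proof (induction I rule: finite_induct)
    case (insert i I)
    have "dep_on {p. fst p ~= i} (\<lambda>om. \<Prod>i\<in>I. h i x om * h i y om)"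
      unfolding dep_on_def
    proof (intro allI impI prod.cong refl)
      fix om om' :: "'d index => real" and k assume eq: "\<forall>p\<in>{p. fst p ~= i}. om p = om' p" and "k \<in> I"
      then have "k ~= i" using insert.hyps by auto
      then have "om p = om' p" if "fst p = k" for p using bspec[OF eq, of p] that by simp
      then have "h k x om = h k x om'" "h k y om = h k y om'"
        by (auto intro!: dep_onD[OF dep])
      then show "h k x om * h k y om = h k x om' * h k y om'" by simp
    qed
    moreover have "all_moments (\<lambda>om. \<Prod>i\<in>I. h i x om * h i y om)"
      by (intro all_moments_prod all_moments_mult am)
    ultimately show ?case
      using wick_pairing[OF S, of i "\<lambda>om. \<Prod>i\<in>I. h i x om * h i y om" "\<beta> i" \<alpha> x y] insert
      by (simp add: h_def)
  qed simp
  from this[of "{1..n}"] show ?thesis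
    by (simp add: wick_def h_def prod.distrib)
qed

subsection \<open>Truncated Wick integrals and their second moments\<close>

definition vars :: "nat => nat => 'd::finite index set" where
  "vars n N = {1..n} \<times> modes N"

definition wickX :: "real => nat => (nat => nat) => nat => ('d::finite index => real) => real" where
  "wickX \<alpha> n \<beta> N om = (\<integral>x. wick \<alpha> n \<beta> (vars n N) x om \<partial>torus)"

lemma finite_vars [simp]: "finite (vars n N)"
  by (simp add: vars_def)

lemma vars_mono: "N \<le> L ==> vars n N \<subseteq> vars n L"
  using lattice_ball_mono[of N L] by (auto simp: vars_def)

lemma vars_component: "i \<in> {1..n} ==> {p \<in> vars n N. fst p = i} = Pair i ` modes N"
  by (auto simp: vars_def)

lemma lin_vars:
  assumes "i \<in> {1..n}"
  shows "lin \<alpha> (vars n N) i om x = field \<alpha> N (\<lambda>j. om (i, j)) x"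
  unfolding lin_def field_def vars_component[OF assms] by (simp add: sum.reindex inj_on_def)

lemma covar_vars:
  assumes "i \<in> {1..n}"
  shows "covar \<alpha> (vars n N) i x y =
    (\<Sum>l\<in>lattice_ball N. bracket2 l powr (- \<alpha>) * Re (fourier_char l x * cnj (fourier_char l y)))"
proof -
  have "covar \<alpha> (vars n N) i x y = (\<Sum>j\<in>modes N. mode \<alpha> j x * mode \<alpha> j y)"
    unfolding covar_def vars_component[OF assms] by (simp add: sum.reindex inj_on_def)
  also have "\<dots> = (\<Sum>l\<in>lattice_ball N. bracket2 l powr (- \<alpha>) * Re (fourier_char l x * cnj (fourier_char l y)))"
    unfolding sum_modes
  proof (intro sum.cong refl)
    fix l :: "int ^ 'a"
    have "bracket2 l powr (- \<alpha> / 2) * bracket2 l powr (- \<alpha> / 2) = bracket2 l powr (- \<alpha>)"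
      by (simp flip: powr_add)
    then show "mode \<alpha> (l, True) x * mode \<alpha> (l, True) y + mode \<alpha> (l, False) x * mode \<alpha> (l, False) y =
        bracket2 l powr (- \<alpha>) * Re (fourier_char l x * cnj (fourier_char l y))"
      by (simp add: mode_def algebra_simps)
  qed
  finally show ?thesis .
qed

lemma covar_vars_diag:
  assumes "i \<in> {1..n}"
  shows "covar \<alpha> (vars n N :: 'd::finite index set) i x x = wick_var TYPE('d) \<alpha> N"
proof -
  have "fourier_char l x * cnj (fourier_char l x) = 1" for l
    by (simp add: complex_norm_square[symmetric] flip: of_real_power)
  then show ?thesis unfolding covar_vars[OF assms] wick_var_def by simp
qed

lemma wick_vars:
  fixes om :: "'d::finite index => real"
  shows "wick \<alpha> n \<beta> (vars n N) x om =
    hermite_multi n \<beta> (\<lambda>i. field \<alpha> N (\<lambda>j. om (i, j)) x) (wick_var TYPE('d) \<alpha> N)"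
  unfolding wick_def hermite_multi_def by (intro prod.cong refl) (simp add: lin_vars covar_vars_diag)

lemma gpoly_wickX: "gpoly (vars n N) (\<Sum>i=1..n. \<beta> i) (wickX \<alpha> n \<beta> N)"
  unfolding wickX_def[abs_def] by (rule gpoly_integral[OF gfam_wick]) auto

lemma all_moments_wickX: "all_moments (wickX \<alpha> n \<beta> N)"
  by (rule all_moments_gpoly[OF gpoly_wickX])

lemma wickX_martingale:
  fixes g :: "('d::finite index => real) => real"
  assumes "N \<le> L" and g: "dep_on (vars n N) g" "all_moments g"
  shows "(\<integral>om. wickX \<alpha> n \<beta> L om * g om \<partial>gauss) = (\<integral>om. wickX \<alpha> n \<beta> N om * g om \<partial>gauss)"
proof -
  have F: "(\<integral>om. wickX \<alpha> n \<beta> M om * g om \<partial>gauss) = (\<integral>x. (\<integral>om. wick \<alpha> n \<beta> (vars n M) x om * g om \<partial>gauss) \<partial>torus)" for M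
    unfolding wickX_def by (rule gfam_Fubini(2)[OF gfam_wick[OF finite_vars order_refl] g(2)])
  have "(\<integral>om. wick \<alpha> n \<beta> (vars n L) x om * g om \<partial>gauss) = (\<integral>om. wick \<alpha> n \<beta> (vars n N) x om * g om \<partial>gauss)" for x
  proof -
    have "vars n L = vars n N \<union> (vars n L - vars n N :: 'd index set)"
      using vars_mono[OF assms(1)] by auto
    then show ?thesis
      using wick_martingale[of "vars n L - vars n N" "vars n N" g \<alpha> n \<beta> x] g
      by (auto intro: dep_on_mono)
  qed
  then show ?thesis by (simp add: F)
qed

text \<open>The covariance is a power of the two-point function, so its integral counts frequency tuples with zero sum.\<close>

lemma wickX_second_moment:
  fixes \<alpha> :: real and n N :: nat and \<beta> :: "nat => nat"
  defines "k \<equiv> \<Sum>i=1..n. \<beta> i"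
  shows "(\<integral>om. (wickX \<alpha> n \<beta> N (om :: 'd::finite index => real))\<^sup>2 \<partial>gauss) =
    (\<Prod>i=1..n. fact (\<beta> i)) * (\<Sum>s\<in>zero_sum k (lattice_ball N :: (int ^ 'd) set). \<Prod>i<k. bracket2 (s i) powr (- \<alpha>))"
proof -
  let ?V = "vars n N :: 'd index set"
  let ?B = "lattice_ball N :: (int ^ 'd) set"
  let ?P = "PiE {..<k} (\<lambda>_. ?B)"
  let ?w = "\<lambda>s. \<Prod>i<k. bracket2 (s i :: int ^ 'd) powr (- \<alpha>)"
  define G where "G x y = (\<Sum>l\<in>?B. bracket2 l powr (- \<alpha>) * Re (fourier_char l x * cnj (fourier_char l y)))" for x y
  have amX: "all_moments (wickX \<alpha> n \<beta> N :: ('d index => real) => real)" by (rule all_moments_wickX)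
  have gf: "gfam ?V (\<Sum>i=1..n. \<beta> i) (wick \<alpha> n \<beta> ?V)"
    by (rule gfam_wick) auto
  have "(\<integral>om. (wickX \<alpha> n \<beta> N (om :: 'd index => real))\<^sup>2 \<partial>gauss) =
      (\<integral>om. (\<integral>x. wick \<alpha> n \<beta> ?V x (om :: 'd index => real) \<partial>torus) * wickX \<alpha> n \<beta> N om \<partial>gauss)"
    by (simp add: wickX_def power2_eq_square)
  also have "\<dots> = (\<integral>x. (\<integral>om. wick \<alpha> n \<beta> ?V x om * wickX \<alpha> n \<beta> N om \<partial>gauss) \<partial>torus)"
    by (rule gfam_Fubini(2)[OF gf amX])
  also have "\<dots> = (\<integral>x. (\<integral>y. (\<integral>om. wick \<alpha> n \<beta> ?V y om * wick \<alpha> n \<beta> ?V x om \<partial>gauss) \<partial>torus) \<partial>torus)"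
  proof (intro Bochner_Integration.integral_cong refl)
    fix x
    show "(\<integral>om. wick \<alpha> n \<beta> ?V x om * wickX \<alpha> n \<beta> N om \<partial>gauss) =
        (\<integral>y. (\<integral>om. wick \<alpha> n \<beta> ?V y om * wick \<alpha> n \<beta> ?V x om \<partial>gauss) \<partial>torus)"
      using gfam_Fubini(2)[OF gf all_moments_wick[OF finite_vars, of \<alpha> n \<beta> n N x]]
      by (simp add: wickX_def mult.commute)
  qed
  also have "\<dots> = (\<integral>x. (\<integral>y. (\<Prod>i=1..n. fact (\<beta> i)) * G y x ^ k \<partial>torus) \<partial>torus)"
  proof (intro Bochner_Integration.integral_cong refl)
    fix x y
    show "(\<integral>om. wick \<alpha> n \<beta> ?V y om * wick \<alpha> n \<beta> ?V x om \<partial>gauss) = (\<Prod>i=1..n. fact (\<beta> i)) * G y x ^ k"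
      unfolding wick_covariance[OF finite_vars] k_def power_sum prod.distrib[symmetric]
      by (intro prod.cong refl) (simp add: covar_vars G_def)
  qed
  also have "\<dots> = (\<Prod>i=1..n. fact (\<beta> i)) * (\<integral>x. (\<integral>y. G y x ^ k \<partial>torus) \<partial>torus)"
    by simp
  also have "(\<integral>x. (\<integral>y. G y x ^ k \<partial>torus) \<partial>torus) = (\<Sum>s\<in>zero_sum k ?B. ?w s)"
  proof -
    have G: "complex_of_real (G y x) = (\<Sum>l\<in>?B. of_real (bracket2 l powr (- \<alpha>)) * (fourier_char l y * cnj (fourier_char l x)))" for x y
    proof -
      have "Im (\<Sum>l\<in>?B. of_real (bracket2 l powr (- \<alpha>)) * (fourier_char l y * cnj (fourier_char l x))) =
          (\<Sum>l\<in>?B. bracket2 l powr (- \<alpha>) * Im (fourier_char l y * cnj (fourier_char l x)))" (is "?L = (\<Sum>l\<in>?B. ?f l)")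
        by simp
      moreover have "(\<Sum>l\<in>?B. ?f l) = - (\<Sum>l\<in>?B. ?f l)"
        by (subst sum_lattice_ball_uminus[symmetric]) (simp add: fourier_char_uminus sum_negf[symmetric] algebra_simps)
      ultimately have "?L = 0" by linarith
      then show ?thesis
        by (simp add: complex_eq_iff G_def)
    qed
    have Gk: "complex_of_real (G y x ^ k) = (\<Sum>s\<in>?P. of_real (?w s) * (fourier_char (\<Sum>i<k. s i) y * cnj (fourier_char (\<Sum>i<k. s i) x)))" for x y
    proof -
      have "complex_of_real (G y x ^ k) = (\<Prod>i<k. \<Sum>l\<in>?B. of_real (bracket2 l powr (- \<alpha>)) * (fourier_char l y * cnj (fourier_char l x)))"
        by (simp add: G)
      also have "\<dots> = (\<Sum>s\<in>?P. \<Prod>i<k. of_real (bracket2 (s i) powr (- \<alpha>)) * (fourier_char (s i) y * cnj (fourier_char (s i) x)))"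
        by (rule prod_sum_PiE) (auto simp: finite_lattice_ball)
      finally show ?thesis
        by (simp add: prod.distrib fourier_char_sum)
    qed
    have int1: "(\<integral>y. complex_of_real (?w s) * (fourier_char m y * c) \<partial>torus) = (if m = 0 then of_real (?w s) * c else 0)" for s m c
      using torus_integral_fourier_char[of m] by (simp add: torus_integral_eq)
    have fin: "finite ?P" by (intro finite_PiE) (auto simp: finite_lattice_ball)
    have intg: "integrable torus (\<lambda>y. complex_of_real (?w s) * (fourier_char m y * c))" for s m c
      by (intro continuous_imp_integrable_torus continuous_intros)
    have "complex_of_real (\<integral>x. (\<integral>y. G y x ^ k \<partial>torus) \<partial>torus) = (\<integral>x. (\<integral>y. complex_of_real (G y x ^ k) \<partial>torus) \<partial>torus)"
      by (simp only: integral_complex_of_real)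
    also have "\<dots> = (\<integral>x. (\<Sum>s\<in>?P. if (\<Sum>i<k. s i) = 0 then of_real (?w s) * cnj (fourier_char (\<Sum>i<k. s i) x) else 0) \<partial>(torus :: (real ^ 'd) measure))"
      unfolding Gk by (subst Bochner_Integration.integral_sum) (auto simp only: int1 intg)
    also have "\<dots> = (\<integral>x. (\<Sum>s\<in>?P. if (\<Sum>i<k. s i) = 0 then of_real (?w s) else 0) \<partial>(torus :: (real ^ 'd) measure))"
      by (intro Bochner_Integration.integral_cong refl sum.cong) auto
    also have "\<dots> = (\<Sum>s\<in>?P. if (\<Sum>i<k. s i) = 0 then of_real (?w s) else 0)"
      by simp
    also have "\<dots> = (\<Sum>s\<in>zero_sum k ?B. of_real (?w s))"
      unfolding zero_sum_def by (rule sum.mono_neutral_cong_right) (use fin in auto)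
    finally have "complex_of_real (\<integral>x. (\<integral>y. G y x ^ k \<partial>torus) \<partial>torus) = complex_of_real (\<Sum>s\<in>zero_sum k ?B. ?w s)"
      by simp
    then show ?thesis by (simp only: of_real_eq_iff)
  qed
  finally show ?thesis .
qed

text \<open>Martingale increments are orthogonal to the earlier truncation.\<close>

lemma wickX_increment:
  assumes "N \<le> L"
  shows "(\<integral>om. (wickX \<alpha> n \<beta> L om - wickX \<alpha> n \<beta> N (om :: 'd::finite index => real))\<^sup>2 \<partial>gauss) =
    (\<integral>om. (wickX \<alpha> n \<beta> L (om :: 'd index => real))\<^sup>2 \<partial>gauss) - (\<integral>om. (wickX \<alpha> n \<beta> N (om :: 'd index => real))\<^sup>2 \<partial>gauss)"
proof -
  let ?X = "\<lambda>N. wickX \<alpha> n \<beta> N :: ('d index => real) => real"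
  have am: "integrable gauss (\<lambda>om. ?X L om * ?X N om)" for L N
    by (intro all_moments_integrable all_moments_mult all_moments_wickX)
  have cross: "(\<integral>om. ?X L om * ?X N om \<partial>gauss) = (\<integral>om. ?X N om * ?X N om \<partial>gauss)"
    by (rule wickX_martingale[OF assms dep_on_gpoly[OF gpoly_wickX] all_moments_wickX])
  have "(\<integral>om. (?X L om - ?X N om)\<^sup>2 \<partial>gauss) = (\<integral>om. ?X L om * ?X L om - 2 * (?X L om * ?X N om) + ?X N om * ?X N om \<partial>gauss)"
    by (simp add: power2_eq_square algebra_simps)
  also have "\<dots> = (\<integral>om. ?X L om * ?X L om \<partial>gauss) - 2 * (\<integral>om. ?X L om * ?X N om \<partial>gauss) + (\<integral>om. ?X N om * ?X N om \<partial>gauss)"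
    by (simp add: am)
  finally show ?thesis unfolding cross by (simp add: power2_eq_square)
qed

text \<open>
  A frequency above \<open>N\<close> costs a factor \<open>N\<^sup>-\<^sup>2\<^sup>\<epsilon>\<close>, at the price of slightly weaker decay
  in the other frequencies, which the discrete Young inequality can afford.
\<close>

lemma wickX_rate:
  fixes n :: nat and \<beta> :: "nat => nat"
  defines "k \<equiv> \<Sum>i=1..n. \<beta> i"
  assumes k: "k \<ge> 2" and \<alpha>: "\<alpha> = real CARD('d) / 2"
  shows "\<exists>C \<epsilon>. C \<ge> 0 \<and> \<epsilon> > 0 \<and> (\<forall>N L. N \<le> L -->
    (\<integral>om. (wickX \<alpha> n \<beta> L om - wickX \<alpha> n \<beta> N (om :: 'd::finite index => real))\<^sup>2 \<partial>gauss) \<le> C * (1 + (real N)\<^sup>2) powr (- \<epsilon>))"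
proof -
  have \<alpha>0: "\<alpha> > 0" unfolding \<alpha> by simp
  define \<epsilon> where "\<epsilon> = \<alpha> / (2 * real k)"
  have \<epsilon>: "\<epsilon> > 0" using \<alpha>0 k by (simp add: \<epsilon>_def)
  define p where "p = real k / real (k - 1)"
  have s: "(\<alpha> - \<epsilon>) * p > real CARD('d) / 2"
  proof -
    have "(\<alpha> - \<epsilon>) * p = \<alpha> * ((real k - 1 / 2) / (real k - 1))"
      using k by (simp add: \<epsilon>_def p_def field_simps of_nat_diff)
    moreover have "(real k - 1 / 2) / (real k - 1) > 1" using k by (simp add: field_simps)
    ultimately have "\<alpha> * 1 < (\<alpha> - \<epsilon>) * p"
      using \<alpha>0 by (simp only: mult_strict_left_mono)
    then show ?thesis by (simp only: \<alpha>[symmetric] mult_1_right)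
  qed
  obtain C0 where C0: "\<And>F :: (int ^ 'd) set. finite F ==> (\<Sum>l\<in>F. bracket2 l powr (- ((\<alpha> - \<epsilon>) * p))) \<le> C0"
    using sum_bracket2_bounded[OF s] by blast
  define C where "C = (\<Prod>i=1..n. fact (\<beta> i)) * (real k * C0 ^ (k - 1))"
  have C0_nonneg: "C0 \<ge> 0" using C0[of "{}"] by simp
  have "(\<integral>om. (wickX \<alpha> n \<beta> L om - wickX \<alpha> n \<beta> N (om :: 'd index => real))\<^sup>2 \<partial>gauss) \<le> C * (1 + (real N)\<^sup>2) powr (- \<epsilon>)"
    if NL: "N \<le> L" for N L
  proof -
    let ?Z = "\<lambda>N. zero_sum k (lattice_ball N :: (int ^ 'd) set)"
    let ?w = "\<lambda>s. \<Prod>i<k. bracket2 (s i :: int ^ 'd) powr (- \<alpha>)"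
    let ?v = "\<lambda>s. \<Prod>i<k. bracket2 (s i :: int ^ 'd) powr (- (\<alpha> - \<epsilon>))"
    let ?D = "(1 + (real N)\<^sup>2) powr (- \<epsilon>)"
    have sub: "?Z N \<subseteq> ?Z L"
      using lattice_ball_mono[OF NL] by (auto simp: zero_sum_def PiE_iff)
    have fin: "finite (?Z M)" for M by (intro finite_zero_sum finite_lattice_ball)
    have le: "?w s \<le> ?D * ?v s" if s: "s \<in> ?Z L - ?Z N" for s
    proof -
      obtain j where j: "j < k" "s j \<notin> lattice_ball N"
        using s by (auto simp: zero_sum_def PiE_iff)
      then have "real N < norm (rvec (s j))" by (simp add: lattice_ball_def)
      then have "(real N)\<^sup>2 \<le> (norm (rvec (s j)))\<^sup>2" by (intro power_mono) auto
      then have br: "1 + (real N)\<^sup>2 \<le> bracket2 (s j)" by (simp add: bracket2_def)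
      have "(\<Prod>i<k. bracket2 (s i) powr (- \<epsilon>)) \<le> ?D"
      proof -
        have "(\<Prod>i<k. bracket2 (s i) powr (- \<epsilon>)) = bracket2 (s j) powr (- \<epsilon>) * (\<Prod>i\<in>{..<k} - {j}. bracket2 (s i) powr (- \<epsilon>))"
          using j by (intro prod.remove) auto
        also have "\<dots> \<le> bracket2 (s j) powr (- \<epsilon>) * 1"
        proof (intro mult_left_mono prod_le_1 conjI)
          fix i
          show "bracket2 (s i) powr (- \<epsilon>) \<le> 1"
            using powr_mono[of "- \<epsilon>" 0 "bracket2 (s i)"] \<epsilon> bracket2_ge_1[of "s i"] by simp
        qed auto
        also have "bracket2 (s j) powr (- \<epsilon>) \<le> ?D"
          using \<epsilon> br by (intro powr_mono2') (auto simp: add_pos_nonneg)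
        finally show ?thesis by simp
      qed
      then have "?v s * (\<Prod>i<k. bracket2 (s i) powr (- \<epsilon>)) \<le> ?v s * ?D"
        by (intro mult_left_mono) (auto intro: prod_nonneg)
      moreover have "?v s * (\<Prod>i<k. bracket2 (s i) powr (- \<epsilon>)) = ?w s"
        unfolding prod.distrib[symmetric] by (intro prod.cong refl) (simp flip: powr_add)
      ultimately show ?thesis by (simp only: mult.commute)
    qed
    have "(\<Sum>s\<in>?Z L. ?w s) - (\<Sum>s\<in>?Z N. ?w s) = (\<Sum>s\<in>?Z L - ?Z N. ?w s)"
      using sum.subset_diff[OF sub fin, of ?w] by simp
    also have "\<dots> \<le> (\<Sum>s\<in>?Z L - ?Z N. ?D * ?v s)"
      by (intro sum_mono le)
    also have "\<dots> = ?D * (\<Sum>s\<in>?Z L - ?Z N. ?v s)"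
      by (simp only: sum_distrib_left)
    also have "\<dots> \<le> ?D * (\<Sum>s\<in>?Z L. ?v s)"
      by (intro mult_left_mono sum_mono2 fin) (auto intro: prod_nonneg)
    also have "\<dots> \<le> ?D * (real k * (\<Sum>l\<in>(lattice_ball L :: (int ^ 'd) set). (bracket2 l powr (- (\<alpha> - \<epsilon>))) powr (real k / real (k - 1))) ^ (k - 1))"
      using sum_zero_sum_le[OF k finite_lattice_ball, where a = "\<lambda>l. bracket2 l powr (- (\<alpha> - \<epsilon>))"]
      by (intro mult_left_mono) auto
    also have "(\<lambda>l :: int ^ 'd. (bracket2 l powr (- (\<alpha> - \<epsilon>))) powr (real k / real (k - 1))) = (\<lambda>l. bracket2 l powr (- ((\<alpha> - \<epsilon>) * p)))"
      unfolding p_def powr_powr mult_minus_left ..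
    also have "?D * (real k * (\<Sum>l\<in>(lattice_ball L :: (int ^ 'd) set). bracket2 l powr (- ((\<alpha> - \<epsilon>) * p))) ^ (k - 1)) \<le> ?D * (real k * C0 ^ (k - 1))"
      by (intro mult_left_mono power_mono C0 finite_lattice_ball sum_nonneg) auto
    finally have "(\<Prod>i=1..n. fact (\<beta> i)) * ((\<Sum>s\<in>?Z L. ?w s) - (\<Sum>s\<in>?Z N. ?w s)) \<le> (\<Prod>i=1..n. fact (\<beta> i)) * (?D * (real k * C0 ^ (k - 1)))"
      by (intro mult_left_mono) (auto intro: prod_nonneg)
    then show ?thesis
      unfolding wickX_increment[OF NL] wickX_second_moment k_def[symmetric] right_diff_distrib[symmetric]
      by (simp only: C_def mult_ac)
  qed
  moreover have "C \<ge> 0" using C0_nonneg by (auto simp: C_def intro!: mult_nonneg_nonneg prod_nonneg)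
  ultimately show ?thesis using \<epsilon> by blast
qed

subsection \<open>Almost sure limits\<close>

lemma AE_summable_of_nn_integral:
  fixes f :: "nat => 'a => real"
  assumes m: "\<And>j. f j \<in> borel_measurable M" and nn: "\<And>j x. 0 \<le> f j x"
    and b: "\<And>j. (\<integral>\<^sup>+x. ennreal (f j x) \<partial>M) \<le> ennreal (c j)" and c: "summable c" "\<And>j. 0 \<le> c j"
  shows "AE x in M. summable (\<lambda>j. f j x)"
proof -
  have "(\<integral>\<^sup>+x. (\<Sum>j. ennreal (f j x)) \<partial>M) = (\<Sum>j. \<integral>\<^sup>+x. ennreal (f j x) \<partial>M)"
    using m by (intro nn_integral_suminf) auto
  also have "\<dots> \<le> (\<Sum>j. ennreal (c j))" by (intro suminf_le b) auto
  also have "\<dots> = ennreal (suminf c)" using c by (intro suminf_ennreal2) auto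
  finally have "(\<integral>\<^sup>+x. (\<Sum>j. ennreal (f j x)) \<partial>M) ~= \<infinity>" by (auto simp: top_unique)
  then have "AE x in M. (\<Sum>j. ennreal (f j x)) ~= \<infinity>"
    using m by (intro nn_integral_PInf_AE) auto
  then show ?thesis
  proof eventually_elim
    case (elim x)
    then show ?case by (intro summable_suminf_not_top nn) simp
  qed
qed

lemma (in prob_space) abs_moment_le:
  assumes [measurable]: "f \<in> borel_measurable M" and "integrable M (\<lambda>x. (f x)\<^sup>2)"
  shows "integrable M (\<lambda>x. \<bar>f x\<bar>)" "(\<integral>x. \<bar>f x\<bar> \<partial>M) \<le> sqrt (\<integral>x. (f x)\<^sup>2 \<partial>M)"
proof -
  have le: "\<bar>f x\<bar> \<le> 1 + (f x)\<^sup>2" for x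
    using zero_le_power2[of "\<bar>f x\<bar> - 1"] zero_le_power2[of "f x"] by (simp add: power2_diff)
  have "integrable M (\<lambda>x. 1 + (f x)\<^sup>2)"
    using assms by (intro Bochner_Integration.integrable_add) auto
  then show int: "integrable M (\<lambda>x. \<bar>f x\<bar>)"
    by (rule Bochner_Integration.integrable_bound) (use le in \<open>simp_all add: le\<close>)
  have "(\<integral>x. \<bar>f x\<bar> * 1 \<partial>M)\<^sup>2 \<le> (\<integral>x. \<bar>f x\<bar>\<^sup>2 \<partial>M) * (\<integral>x. 1\<^sup>2 \<partial>M)"
    by (rule integral_mult_square_le) (use assms int in simp_all)
  then have "(\<integral>x. \<bar>f x\<bar> \<partial>M)\<^sup>2 \<le> (\<integral>x. (f x)\<^sup>2 \<partial>M)"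
    by (simp add: prob_space)
  then show "(\<integral>x. \<bar>f x\<bar> \<partial>M) \<le> sqrt (\<integral>x. (f x)\<^sup>2 \<partial>M)"
    by (rule real_le_rsqrt)
qed

text \<open>
  A sequence of polynomials of bounded degree that is Cauchy in mean square at a polynomial rate
  converges almost surely: a sparse subsequence does, and by hypercontractivity some high moment of
  the distance to its limit is summable.
\<close>

locale chaos_sequence =
  fixes X :: "nat => ('i => real) => real" and S :: "nat => 'i set" and k :: nat and C \<epsilon> :: real
  assumes finS: "\<And>N. finite (S N)" and monoS: "\<And>N L. N \<le> L ==> S N \<subseteq> S L"
    and poly: "\<And>N. gpoly (S N) k (X N)"
    and C: "C \<ge> 0" and \<epsilon>: "\<epsilon> > 0"
    and rate: "\<And>N L. N \<le> L ==> (\<integral>om. (X L om - X N om)\<^sup>2 \<partial>gauss) \<le> C * (1 + (real N)\<^sup>2) powr (- \<epsilon>)"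
begin

definition Y :: "('i => real) => real" where
  "Y om = lim (\<lambda>N. X N om)"

definition D :: "nat => real" where
  "D N = C * (1 + (real N)\<^sup>2) powr (- \<epsilon>)"

lemma D_nonneg: "D N \<ge> 0"
  using C by (simp add: D_def)

lemma X_moments: "all_moments (X N)"
  by (rule all_moments_gpoly[OF poly])

lemma X_measurable [measurable]: "X N \<in> borel_measurable gauss"
  by (rule all_moments_measurable[OF X_moments])

lemma Y_measurable [measurable]: "Y \<in> borel_measurable gauss"
  unfolding Y_def by (rule borel_measurable_lim_metric) simp

text \<open>Hypercontractivity upgrades the second-moment rate.\<close>

lemma increment_moment:
  assumes "N \<le> L"
  shows "(\<integral>\<^sup>+om. ennreal ((X L om - X N om) ^ (2 * 2 ^ r)) \<partial>gauss) \<le> ennreal ((16 ^ (k * r) * D N) ^ (2 ^ r))"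
proof -
  have p: "gpoly (S L) k (\<lambda>om. X L om - X N om)"
    by (intro gpoly_diff poly gpoly_subset[OF poly[of N] monoS[OF assms]])
  have "(\<integral>om. (X L om - X N om) ^ (2 * 2 ^ r) \<partial>gauss) \<le> (16 ^ (k * r) * (\<integral>om. (X L om - X N om)\<^sup>2 \<partial>gauss)) ^ (2 ^ r)"
    by (rule gpoly_hypercontractive[OF finS p])
  also have "\<dots> \<le> (16 ^ (k * r) * D N) ^ (2 ^ r)"
    using rate[OF assms] by (intro power_mono mult_left_mono) (auto simp: D_def)
  finally have le: "(\<integral>om. (X L om - X N om) ^ (2 * 2 ^ r) \<partial>gauss) \<le> (16 ^ (k * r) * D N) ^ (2 ^ r)" .
  have "integrable gauss (\<lambda>om. (X L om - X N om) ^ (2 * 2 ^ r))"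
    by (intro all_moments_integrable all_moments_power all_moments_diff X_moments)
  then have "(\<integral>\<^sup>+om. ennreal ((X L om - X N om) ^ (2 * 2 ^ r)) \<partial>gauss) = ennreal (\<integral>om. (X L om - X N om) ^ (2 * 2 ^ r) \<partial>gauss)"
    by (rule nn_integral_eq_integral) auto
  also have "\<dots> \<le> ennreal ((16 ^ (k * r) * D N) ^ (2 ^ r))"
    by (rule ennreal_leI[OF le])
  finally show ?thesis .
qed

text \<open>Along dyadic truncations the increments are summable in mean.\<close>

lemma AE_subsequence: "AE om in gauss. convergent (\<lambda>j. X (2 ^ j) om)"
proof -
  define q where "q = (4 :: real) powr (- \<epsilon> / 2)"
  have q: "0 \<le> q" "q < 1"
    unfolding q_def using \<epsilon> powr_less_mono[of "- \<epsilon> / 2" 0 4] by auto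
  have sqD: "sqrt (D (2 ^ j)) \<le> sqrt C * q ^ j" for j
  proof (rule real_le_lsqrt)
    have "(1 + (real (2 ^ j))\<^sup>2) powr (- \<epsilon>) \<le> ((4::real) ^ j) powr (- \<epsilon>)"
    proof (rule powr_mono2')
      have "(4 :: real) ^ j = (real (2 ^ j))\<^sup>2"
        using power_mult[of "2::real" 2 j] by (simp add: power_mult[symmetric] mult.commute)
      then show "(4 :: real) ^ j \<le> 1 + (real (2 ^ j))\<^sup>2" by linarith
    qed (use \<epsilon> in auto)
    also have "((4::real) ^ j) powr (- \<epsilon>) = (q ^ j)\<^sup>2"
    proof -
      have "(q ^ j)\<^sup>2 = (q\<^sup>2) ^ j" by (simp add: power_mult[symmetric] mult.commute)
      also have "q\<^sup>2 = 4 powr (- \<epsilon>)"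
        by (simp add: q_def power2_eq_square powr_add[symmetric])
      also have "(4 powr (- \<epsilon>)) ^ j = ((4::real) ^ j) powr (- \<epsilon>)"
        by (simp add: powr_realpow[symmetric] powr_powr mult.commute)
      finally show ?thesis by simp
    qed
    finally show "D (2 ^ j) \<le> (sqrt C * q ^ j)\<^sup>2"
      using C by (simp add: D_def power_mult_distrib mult_left_mono)
  qed (use C q in auto)
  have "AE om in gauss. summable (\<lambda>j. \<bar>X (2 ^ Suc j) om - X (2 ^ j) om\<bar>)"
  proof (rule AE_summable_of_nn_integral)
    show "summable (\<lambda>j. sqrt C * q ^ j)"
      using q by (intro summable_mult summable_geometric) auto
    fix j
    have am: "all_moments (\<lambda>om. X (2 ^ Suc j) om - X (2 ^ j) om)" by (intro all_moments_diff X_moments)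
    have int2: "integrable gauss (\<lambda>om. (X (2 ^ Suc j) om - X (2 ^ j) om)\<^sup>2)"
      by (intro all_moments_integrable all_moments_power am)
    note ab = gauss.P.abs_moment_le[OF all_moments_measurable[OF am] int2]
    have "(\<integral>om. (X (2 ^ Suc j) om - X (2 ^ j) om)\<^sup>2 \<partial>gauss) \<le> D (2 ^ j)"
      unfolding D_def by (rule rate) simp
    then have "(\<integral>om. \<bar>X (2 ^ Suc j) om - X (2 ^ j) om\<bar> \<partial>gauss) \<le> sqrt C * q ^ j"
      using order_trans[OF ab(2) order_trans[OF real_sqrt_le_mono sqD[of j]]] by simp
    then show "(\<integral>\<^sup>+om. ennreal \<bar>X (2 ^ Suc j) om - X (2 ^ j) om\<bar> \<partial>gauss) \<le> ennreal (sqrt C * q ^ j)"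
      by (subst nn_integral_eq_integral[OF ab(1)]) (auto intro: ennreal_leI)
    show "0 \<le> sqrt C * q ^ j" using C q by auto
  qed auto
  then show ?thesis
  proof eventually_elim
    case (elim om)
    then have "summable (\<lambda>j. X (2 ^ Suc j) om - X (2 ^ j) om)"
      by (rule summable_rabs_cancel)
    then have "convergent (\<lambda>j. \<Sum>i<j. X (2 ^ Suc i) om - X (2 ^ i) om)"
      by (simp add: summable_iff_convergent)
    then have "convergent (\<lambda>j. X (2 ^ j) om - X (2 ^ 0) om)"
      by (simp only: sum_lessThan_telescope[of "\<lambda>i. X (2 ^ i) om"])
    then have "convergent (\<lambda>j. X (2 ^ j) om - X (2 ^ 0) om + X (2 ^ 0) om)"
      by (intro convergent_add convergent_const)
    then show ?case by simp
  qed
qed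

lemma subsequence_moment:
  "(\<integral>\<^sup>+om. ennreal ((lim (\<lambda>j. X (2 ^ j) om) - X N om) ^ (2 * 2 ^ r)) \<partial>gauss) \<le> ennreal ((16 ^ (k * r) * D N) ^ (2 ^ r))"
proof -
  have "(\<integral>\<^sup>+om. ennreal ((lim (\<lambda>j. X (2 ^ j) om) - X N om) ^ (2 * 2 ^ r)) \<partial>gauss) =
      (\<integral>\<^sup>+om. liminf (\<lambda>j. ennreal ((X (2 ^ j) om - X N om) ^ (2 * 2 ^ r))) \<partial>gauss)"
  proof (rule nn_integral_cong_AE, use AE_subsequence in eventually_elim)
    case (elim om)
    have "(\<lambda>j. ennreal ((X (2 ^ j) om - X N om) ^ (2 * 2 ^ r))) \<longlonglongrightarrow> ennreal ((lim (\<lambda>j. X (2 ^ j) om) - X N om) ^ (2 * 2 ^ r))"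
      using elim by (intro tendsto_ennrealI tendsto_intros) (simp add: convergent_LIMSEQ_iff)
    then show ?case by (intro lim_imp_Liminf[symmetric]) auto
  qed
  also have "\<dots> \<le> liminf (\<lambda>j. \<integral>\<^sup>+om. ennreal ((X (2 ^ j) om - X N om) ^ (2 * 2 ^ r)) \<partial>gauss)"
    by (rule nn_integral_liminf) simp
  also have "\<dots> \<le> liminf (\<lambda>j. ennreal ((16 ^ (k * r) * D N) ^ (2 ^ r)))"
  proof (rule Liminf_mono)
    show "\<forall>\<^sub>F j in sequentially. (\<integral>\<^sup>+om. ennreal ((X (2 ^ j) om - X N om) ^ (2 * 2 ^ r)) \<partial>gauss) \<le> ennreal ((16 ^ (k * r) * D N) ^ (2 ^ r))"
      using eventually_ge_at_top[of N]
    proof eventually_elim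
      case (elim j)
      have "N \<le> 2 ^ j" using elim less_exp[of j] by linarith
      then show ?case by (rule increment_moment)
    qed
  qed
  finally show ?thesis by (simp add: Liminf_const)
qed

text \<open>Along all truncations a high moment is needed: its rate is summable over \<open>N\<close>.\<close>

lemma AE_limit: "AE om in gauss. (\<lambda>N. X N om) \<longlonglongrightarrow> Y om"
proof -
  define Z where "Z om = lim (\<lambda>j. X (2 ^ j) om)" for om
  have [measurable]: "Z \<in> borel_measurable gauss"
    unfolding Z_def by (rule borel_measurable_lim_metric) simp
  obtain r :: nat where "1 / \<epsilon> < 2 ^ r" using real_arch_pow[of 2 "1 / \<epsilon>"] by auto
  then have r: "1 \<le> \<epsilon> * 2 ^ r" using \<epsilon> by (simp add: field_simps)
  define c where "c N = (16 ^ (k * r) * C) ^ (2 ^ r) * (1 / (real (Suc N))\<^sup>2 * 2)" for N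
  have c: "(16 ^ (k * r) * D N) ^ (2 ^ r) \<le> c N" for N
  proof -
    have "(16 ^ (k * r) * D N) ^ (2 ^ r) = (16 ^ (k * r) * C) ^ (2 ^ r) * ((1 + (real N)\<^sup>2) powr (- \<epsilon>)) ^ (2 ^ r)"
      by (simp add: D_def power_mult_distrib)
    also have "((1 + (real N)\<^sup>2) powr (- \<epsilon>)) ^ (2 ^ r) = (1 + (real N)\<^sup>2) powr (- (\<epsilon> * 2 ^ r))"
    proof -
      have "0 < 1 + (real N)\<^sup>2" by (simp add: add_pos_nonneg)
      then have "(1 + (real N)\<^sup>2) powr (- \<epsilon>) > 0" by simp
      from powr_realpow[OF this, of "2 ^ r"] show ?thesis by (simp add: powr_powr)
    qed
    also have "\<dots> \<le> (1 + (real N)\<^sup>2) powr (- 1)"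
      using r by (intro powr_mono) auto
    also have "\<dots> = 1 / (1 + (real N)\<^sup>2)"
      by (simp add: powr_minus_divide add_pos_nonneg)
    also have "\<dots> \<le> 1 / (real (Suc N))\<^sup>2 * 2"
    proof -
      have "(real (Suc N))\<^sup>2 \<le> 2 * (1 + (real N)\<^sup>2)"
        using zero_le_power2[of "real N - 1"] by (simp add: power2_eq_square algebra_simps)
      then show ?thesis by (simp add: field_simps add_pos_nonneg)
    qed
    finally show ?thesis using C by (simp add: c_def mult_left_mono)
  qed
  have "AE om in gauss. summable (\<lambda>N. (Z om - X N om) ^ (2 * 2 ^ r))"
  proof (rule AE_summable_of_nn_integral)
    show "summable c"
      unfolding c_def using inverse_squares_sums[THEN sums_summable]
      by (intro summable_mult summable_mult2) (simp add: field_simps)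
    show "(\<integral>\<^sup>+om. ennreal ((Z om - X N om) ^ (2 * 2 ^ r)) \<partial>gauss) \<le> ennreal (c N)" for N
      unfolding Z_def by (rule order_trans[OF subsequence_moment ennreal_leI[OF c]])
    show "0 \<le> c N" for N using C by (simp add: c_def)
  qed auto
  then show ?thesis
  proof eventually_elim
    case (elim om)
    then have "(\<lambda>N. (Z om - X N om) ^ (2 * 2 ^ r)) \<longlonglongrightarrow> 0" by (rule summable_LIMSEQ_zero)
    then have "(\<lambda>N. root (2 * 2 ^ r) (\<bar>Z om - X N om\<bar> ^ (2 * 2 ^ r))) \<longlonglongrightarrow> root (2 * 2 ^ r) 0"
      by (intro tendsto_real_root) (simp add: power_even_abs)
    then have "(\<lambda>N. \<bar>Z om - X N om\<bar>) \<longlonglongrightarrow> 0"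
      by (simp add: real_root_power_cancel)
    then have "(\<lambda>N. Z om - X N om) \<longlonglongrightarrow> 0"
      by (rule tendsto_rabs_zero_cancel)
    then have "(\<lambda>N. Z om - (Z om - X N om)) \<longlonglongrightarrow> Z om - 0"
      by (intro tendsto_intros)
    then have "(\<lambda>N. X N om) \<longlonglongrightarrow> Z om" by simp
    then show ?case unfolding Y_def by (simp add: limI)
  qed
qed

lemma limit_moment:
  "(\<integral>\<^sup>+om. ennreal ((Y om - X N om) ^ (2 * 2 ^ r)) \<partial>gauss) \<le> ennreal ((16 ^ (k * r) * D N) ^ (2 ^ r))"
proof -
  have "(\<integral>\<^sup>+om. ennreal ((Y om - X N om) ^ (2 * 2 ^ r)) \<partial>gauss) =
      (\<integral>\<^sup>+om. ennreal ((lim (\<lambda>j. X (2 ^ j) om) - X N om) ^ (2 * 2 ^ r)) \<partial>gauss)"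
  proof (rule nn_integral_cong_AE, use AE_limit in eventually_elim)
    case (elim om)
    have "strict_mono (\<lambda>j :: nat. 2 ^ j :: nat)" by (simp add: strict_mono_def)
    from LIMSEQ_subseq_LIMSEQ[OF elim this] have "lim (\<lambda>j. X (2 ^ j) om) = Y om"
      by (intro limI) (simp add: o_def)
    then show ?case by simp
  qed
  then show ?thesis using subsequence_moment by simp
qed

lemma limit_square_integrable:
  "integrable gauss (\<lambda>om. (Y om - X N om)\<^sup>2)" "(\<integral>om. (Y om - X N om)\<^sup>2 \<partial>gauss) \<le> D N"
proof -
  have le: "(\<integral>\<^sup>+om. ennreal ((Y om - X N om)\<^sup>2) \<partial>gauss) \<le> ennreal (D N)"
    using limit_moment[of N 0] by simp
  then show int: "integrable gauss (\<lambda>om. (Y om - X N om)\<^sup>2)"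
    by (intro integrableI_nonneg) (auto intro: le_less_trans)
  have "ennreal (\<integral>om. (Y om - X N om)\<^sup>2 \<partial>gauss) = (\<integral>\<^sup>+om. ennreal ((Y om - X N om)\<^sup>2) \<partial>gauss)"
    by (rule nn_integral_eq_integral[OF int, symmetric]) auto
  then show "(\<integral>om. (Y om - X N om)\<^sup>2 \<partial>gauss) \<le> D N"
    using le by (simp only: ennreal_le_iff[OF D_nonneg, symmetric])
qed

lemma D_tendsto: "D \<longlonglongrightarrow> 0"
proof -
  have "filterlim (\<lambda>N. 1 + (real N)\<^sup>2) at_top sequentially"
    by (intro filterlim_tendsto_add_at_top[OF tendsto_const] filterlim_pow_at_top filterlim_real_sequentially) simp
  then have "(\<lambda>N. (1 + (real N)\<^sup>2) powr (- \<epsilon>)) \<longlonglongrightarrow> 0"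
    using \<epsilon> by (intro tendsto_neg_powr) auto
  then show ?thesis unfolding D_def by (rule tendsto_mult_right_zero)
qed

text \<open>The limit inherits the martingale property.\<close>

lemma limit_expectation:
  assumes g [measurable]: "g \<in> borel_measurable gauss" and g1: "\<And>om. \<bar>g om\<bar> \<le> 1"
    and mart: "\<And>L. N \<le> L ==> (\<integral>om. X L om * g om \<partial>gauss) = (\<integral>om. X N om * g om \<partial>gauss)"
  shows "integrable gauss (\<lambda>om. Y om * g om)" "(\<integral>om. Y om * g om \<partial>gauss) = (\<integral>om. X N om * g om \<partial>gauss)"
proof -
  have bound: "\<bar>y * g om\<bar> \<le> \<bar>y\<bar>" for y om
    using mult_left_mono[OF g1[of om], of "\<bar>y\<bar>"] by (simp add: abs_mult)
  have ab: "integrable gauss (\<lambda>om. \<bar>Y om - X L om\<bar>)" "(\<integral>om. \<bar>Y om - X L om\<bar> \<partial>gauss) \<le> sqrt (D L)" for L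
    using gauss.P.abs_moment_le[OF _ limit_square_integrable(1)[of L]]
      order_trans[OF gauss.P.abs_moment_le(2)[OF _ limit_square_integrable(1)[of L]]
        real_sqrt_le_mono[OF limit_square_integrable(2)[of L]]]
    by simp_all
  have iD: "integrable gauss (\<lambda>om. (Y om - X L om) * g om)" for L
    by (rule Bochner_Integration.integrable_bound[OF ab(1)[of L]]) (use bound in auto)
  have iX: "integrable gauss (\<lambda>om. X L om * g om)" for L
    by (intro all_moments_integrable all_moments_mult X_moments all_moments_bounded[OF g g1])
  have split: "Y om * g om = (Y om - X L om) * g om + X L om * g om" for om L
    by (simp add: algebra_simps)
  show "integrable gauss (\<lambda>om. Y om * g om)"
    unfolding split[of _ N] by (intro Bochner_Integration.integrable_add iD iX)
  have "\<bar>(\<integral>om. Y om * g om \<partial>gauss) - (\<integral>om. X N om * g om \<partial>gauss)\<bar> \<le> sqrt (D L)" if "N \<le> L" for L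
  proof -
    have "(\<integral>om. Y om * g om \<partial>gauss) = (\<integral>om. (Y om - X L om) * g om \<partial>gauss) + (\<integral>om. X L om * g om \<partial>gauss)"
      unfolding split[of _ L] by (rule Bochner_Integration.integral_add[OF iD iX])
    then have "\<bar>(\<integral>om. Y om * g om \<partial>gauss) - (\<integral>om. X N om * g om \<partial>gauss)\<bar> = \<bar>\<integral>om. (Y om - X L om) * g om \<partial>gauss\<bar>"
      by (simp add: mart[OF that])
    also have "\<dots> \<le> (\<integral>om. \<bar>(Y om - X L om) * g om\<bar> \<partial>gauss)" by (rule integral_abs_bound)
    also have "\<dots> \<le> (\<integral>om. \<bar>Y om - X L om\<bar> \<partial>gauss)"
      by (intro integral_mono integrable_abs iD ab bound)
    finally show ?thesis using ab(2)[of L] by linarith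
  qed
  then have "\<bar>(\<integral>om. Y om * g om \<partial>gauss) - (\<integral>om. X N om * g om \<partial>gauss)\<bar> \<le> sqrt 0"
    by (intro tendsto_lowerbound[OF tendsto_real_sqrt[OF D_tendsto]])
      (auto intro: eventually_sequentiallyI[of N])
  then show "(\<integral>om. Y om * g om \<partial>gauss) = (\<integral>om. X N om * g om \<partial>gauss)" by simp
qed

end

section \<open>Wick integrals and Wick mass as random variables on the Gaussian space\<close>

definition two_at :: "nat => nat => nat" where
  "two_at i = (\<lambda>k. if k = i then 2 else 0)"

definition massM :: "real => nat => nat => ('d::finite index => real) => real" where
  "massM \<alpha> n N om = (\<Sum>i=1..n. wickX \<alpha> n (two_at i) N om)"

definition limX :: "real => nat => (nat => nat) => ('d::finite index => real) => real" where
  "limX \<alpha> n \<beta> om = lim (\<lambda>N. wickX \<alpha> n \<beta> N om)"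

definition limM :: "real => nat => ('d::finite index => real) => real" where
  "limM \<alpha> n om = lim (\<lambda>N. massM \<alpha> n N om)"

abbreviation comp_field :: "real => nat => ('d::finite index => real) => nat => real ^ 'd => real" where
  "comp_field \<alpha> N om i x \<equiv> field \<alpha> N (\<lambda>j. om (i, j)) x"

lemma sum_two_at: "i \<in> {1..n} ==> (\<Sum>k=1..n. two_at i k) = 2"
  unfolding two_at_def by (subst sum.delta) auto

lemma hermite_multi_two_at:
  assumes "i \<in> {1..n}"
  shows "hermite_multi n (two_at i) x \<sigma> = hermite 2 (x i) \<sigma>"
proof -
  have "hermite_multi n (two_at i) x \<sigma> = (\<Prod>k=1..n. if k = i then hermite 2 (x i) \<sigma> else 1)"
    unfolding hermite_multi_def two_at_def by (intro prod.cong refl) auto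
  then show ?thesis using assms by (simp add: prod.delta)
qed

lemma continuous_field: "continuous_on UNIV (field \<alpha> N om)"
  unfolding field_def by (intro continuous_intros continuous_mode)

lemma integrable_torus_continuous_power:
  fixes f :: "real ^ 'd => real"
  shows "continuous_on UNIV f ==> integrable torus (\<lambda>x. f x ^ k)"
  by (intro continuous_imp_integrable_torus continuous_intros)

lemma massM_eq:
  "massM \<alpha> n N om = (\<Sum>i=1..n. \<integral>x. (comp_field \<alpha> N om i x)\<^sup>2 \<partial>torus) - real n * wick_var TYPE('d) \<alpha> N"
  for om :: "'d::finite index => real"
proof -
  have "wickX \<alpha> n (two_at i) N om = (\<integral>x. (comp_field \<alpha> N om i x)\<^sup>2 \<partial>torus) - wick_var TYPE('d) \<alpha> N"
    if "i \<in> {1..n}" for i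
    unfolding wickX_def wick_vars hermite_multi_two_at[OF that] hermite_2
    by (subst Bochner_Integration.integral_diff) (auto intro: integrable_torus_continuous_power continuous_field)
  then show ?thesis by (simp add: massM_def sum_subtractf)
qed

lemma gpoly_massM: "gpoly (vars n N) 2 (massM \<alpha> n N)"
  unfolding massM_def[abs_def]
proof (rule gpoly_sum)
  fix i assume "i \<in> {1..n}"
  then show "gpoly (vars n N) 2 (wickX \<alpha> n (two_at i) N)"
    using gpoly_wickX[of n N "two_at i" \<alpha>] by (simp only: sum_two_at)
qed

lemma wick_chaos:
  fixes n :: nat and \<beta> :: "nat => nat"
  assumes "(\<Sum>i=1..n. \<beta> i) \<ge> 2" "\<alpha> = real CARD('d) / 2"
  shows "\<exists>C \<epsilon>. chaos_sequence (wickX \<alpha> n \<beta> :: nat => ('d::finite index => real) => real) (vars n) (\<Sum>i=1..n. \<beta> i) C \<epsilon>"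
proof -
  obtain C \<epsilon> where "C \<ge> 0" "\<epsilon> > 0" "\<And>N L. N \<le> L ==>
    (\<integral>om. (wickX \<alpha> n \<beta> L om - wickX \<alpha> n \<beta> N (om :: 'd::finite index => real))\<^sup>2 \<partial>gauss) \<le> C * (1 + (real N)\<^sup>2) powr (- \<epsilon>)"
    using wickX_rate[OF assms] by blast
  then have "chaos_sequence (wickX \<alpha> n \<beta> :: nat => ('d::finite index => real) => real) (vars n) (\<Sum>i=1..n. \<beta> i) C \<epsilon>"
    by unfold_locales (use gpoly_wickX[of n _ \<beta> \<alpha>] in \<open>auto simp: vars_mono\<close>)
  then show ?thesis by blast
qed

lemma mass_chaos:
  assumes \<alpha>: "\<alpha> = real CARD('d) / 2" and n: "n \<ge> 1"
  shows "\<exists>C \<epsilon>. chaos_sequence (massM \<alpha> n :: nat => ('d::finite index => real) => real) (vars n) 2 C \<epsilon>"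
proof -
  let ?X = "\<lambda>i. wickX \<alpha> n (two_at i) :: nat => ('d index => real) => real"
  define P where "P i C \<epsilon> \<longleftrightarrow> C \<ge> 0 \<and> \<epsilon> > 0 \<and> (\<forall>N L. N \<le> L -->
    (\<integral>om. (?X i L om - ?X i N om)\<^sup>2 \<partial>gauss) \<le> C * (1 + (real N)\<^sup>2) powr (- \<epsilon>))" for i C \<epsilon>
  have "\<exists>C \<epsilon>. P i C \<epsilon>" if "i \<in> {1..n}" for i
    unfolding P_def by (rule wickX_rate[OF _ \<alpha>]) (simp only: sum_two_at[OF that] order_refl)
  then have "\<forall>i\<in>{1..n}. \<exists>p. P i (fst p) (snd p)" by simp
  from bchoice[OF this] obtain p where "\<forall>i\<in>{1..n}. P i (fst (p i)) (snd (p i))" by blast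
  then obtain C \<epsilon> where p: "\<And>i. i \<in> {1..n} ==> P i (C i) (\<epsilon> i)"
    by (intro that[of "\<lambda>i. fst (p i)" "\<lambda>i. snd (p i)"]) blast
  have C: "C i \<ge> 0" and \<epsilon>: "\<epsilon> i > 0"
    and rate: "\<And>N L. N \<le> L ==> (\<integral>om. (?X i L om - ?X i N om)\<^sup>2 \<partial>gauss) \<le> C i * (1 + (real N)\<^sup>2) powr (- \<epsilon> i)"
    if "i \<in> {1..n}" for i
    using p[OF that] unfolding P_def by blast+
  define e where "e = Min (\<epsilon> ` {1..n})"
  have e: "e > 0" "\<And>i. i \<in> {1..n} ==> e \<le> \<epsilon> i"
    using \<epsilon> n by (auto simp: e_def)
  define C' where "C' = real n * (\<Sum>i=1..n. C i)"
  have "(\<integral>om. (massM \<alpha> n L om - massM \<alpha> n N (om :: 'd index => real))\<^sup>2 \<partial>gauss) \<le> C' * (1 + (real N)\<^sup>2) powr (- e)"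
    if NL: "N \<le> L" for N L
  proof -
    have am: "all_moments (\<lambda>om. ?X i L om - ?X i N om)" for i
      by (intro all_moments_diff all_moments_wickX)
    have pt: "(massM \<alpha> n L om - massM \<alpha> n N om)\<^sup>2 \<le> real n * (\<Sum>i=1..n. (?X i L om - ?X i N om)\<^sup>2)" for om :: "'d index => real"
      using Cauchy_Schwarz_ineq_sum[of "\<lambda>_. 1" "\<lambda>i. ?X i L om - ?X i N om" "{1..n}"]
      by (simp add: massM_def sum_subtractf)
    have "(\<integral>om. (massM \<alpha> n L om - massM \<alpha> n N (om :: 'd index => real))\<^sup>2 \<partial>gauss) \<le>
        (\<integral>om. real n * (\<Sum>i=1..n. (?X i L om - ?X i N om)\<^sup>2) \<partial>gauss)"
      by (intro integral_mono pt all_moments_integrable all_moments_power all_moments_mult all_moments_sum am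
        all_moments_const all_moments_diff all_moments_gpoly[OF gpoly_massM])
    also have "\<dots> = real n * (\<Sum>i=1..n. \<integral>om. (?X i L om - ?X i N om)\<^sup>2 \<partial>gauss)"
      by (simp add: all_moments_integrable all_moments_power am)
    also have "\<dots> \<le> real n * (\<Sum>i=1..n. C i * (1 + (real N)\<^sup>2) powr (- e))"
    proof (intro mult_left_mono sum_mono)
      fix i assume i: "i \<in> {1..n}"
      have "(\<integral>om. (?X i L om - ?X i N om)\<^sup>2 \<partial>gauss) \<le> C i * (1 + (real N)\<^sup>2) powr (- \<epsilon> i)"
        by (rule rate[OF i NL])
      also have "\<dots> \<le> C i * (1 + (real N)\<^sup>2) powr (- e)"
        using e(2)[OF i] by (intro mult_left_mono powr_mono C i) auto
      finally show "(\<integral>om. (?X i L om - ?X i N om)\<^sup>2 \<partial>gauss) \<le> C i * (1 + (real N)\<^sup>2) powr (- e)" .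
    qed simp
    also have "\<dots> = C' * (1 + (real N)\<^sup>2) powr (- e)"
      by (simp add: C'_def sum_distrib_right)
    finally show ?thesis .
  qed
  moreover have "C' \<ge> 0" using C by (auto simp: C'_def intro!: mult_nonneg_nonneg sum_nonneg)
  ultimately have "chaos_sequence (massM \<alpha> n :: nat => ('d::finite index => real) => real) (vars n) 2 C' e"
    using e by unfold_locales (auto simp: vars_mono gpoly_massM)
  then show ?thesis by blast
qed

subsection \<open>Transfer to the Gaussian measure on distributions\<close>

lemma AE_components_tempered:
  "AE om in (gauss :: ('d::finite index => real) measure). \<forall>i\<in>{1..n}. tempered (\<lambda>j. om (i, j))"
proof (rule AE_finite_allI)
  fix i :: nat
  have "AE om in distr (gauss :: ('d index => real) measure) gauss (\<lambda>om j. om (i, j)). tempered om"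
    unfolding distr_block by (rule AE_tempered)
  then show "AE om in (gauss :: ('d index => real) measure). tempered (\<lambda>j. om (i, j))"
    by (rule AE_distrD[OF block_measurable])
qed simp

lemma truncated_integral_sample:
  fixes om :: "'d::finite index => real"
  assumes t: "\<forall>i\<in>{1..n}. tempered (\<lambda>j. om (i, j))" and \<alpha>: "\<alpha> \<ge> 0"
  shows "torus_integral (\<lambda>x. hermite_multi n \<beta> (\<lambda>i. Re (fourier_trunc N (sample \<alpha> n om i) x)) (wick_var TYPE('d) \<alpha> N)) =
    wickX \<alpha> n \<beta> N om"
proof -
  have "Re (fourier_trunc N (sample \<alpha> n om i) x) = comp_field \<alpha> N om i x" if "i \<in> {1..n}" for i x
    using that t \<alpha> by (simp add: sample_def fourier_trunc_random_distribution)
  then have "hermite_multi n \<beta> (\<lambda>i. Re (fourier_trunc N (sample \<alpha> n om i) x)) \<sigma> =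
      hermite_multi n \<beta> (\<lambda>i. comp_field \<alpha> N om i x) \<sigma>" for x \<sigma>
    unfolding hermite_multi_def by (intro prod.cong refl) simp
  then show ?thesis
    unfolding wickX_def wick_vars torus_integral_eq by simp
qed

lemma wick_integral_sample:
  fixes om :: "'d::finite index => real"
  assumes "\<forall>i\<in>{1..n}. tempered (\<lambda>j. om (i, j))" "\<alpha> \<ge> 0"
  shows "wick_integral \<alpha> n \<beta> (sample \<alpha> n om) = limX \<alpha> n \<beta> om"
  unfolding wick_integral_def limX_def truncated_integral_sample[OF assms] ..

lemma wick_mass_eq:
  "wick_mass \<alpha> n (\<Phi> :: nat => 'd::finite distribution) = lim (\<lambda>N. \<Sum>i=1..n. torus_integral (\<lambda>x.
    hermite_multi n (two_at i) (\<lambda>i. Re (fourier_trunc N (\<Phi> i) x)) (wick_var TYPE('d) \<alpha> N)))"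
  unfolding wick_mass_def by (intro arg_cong[of _ _ lim] ext sum.cong refl) (simp only: hermite_multi_two_at)

lemma wick_mass_sample:
  fixes om :: "'d::finite index => real"
  assumes "\<forall>i\<in>{1..n}. tempered (\<lambda>j. om (i, j))" "\<alpha> \<ge> 0"
  shows "wick_mass \<alpha> n (sample \<alpha> n om) = limM \<alpha> n om"
  unfolding wick_mass_eq limM_def massM_def truncated_integral_sample[OF assms] ..

lemma wick_mass_measurable:
  "wick_mass \<alpha>' n \<in> borel_measurable (gauss_measure_prod \<alpha> n :: (nat => 'd::finite distribution) measure)"
  unfolding wick_mass_eq[abs_def] by (intro borel_measurable_lim_metric borel_measurable_sum hermite_multi_measurable)

text \<open>The random distributions have the independent Gaussians as their Fourier coefficients, up to a null set.\<close>

lemma transfer_integral: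
  assumes \<alpha>: "\<alpha> \<ge> 0"
  shows "(\<integral>\<^sup>+\<Phi>. ennreal (exp (a * wick_integral \<alpha> n \<beta> \<Phi> - K * \<bar>wick_mass \<alpha> n \<Phi>\<bar> powr b))
      \<partial>(gauss_measure_prod \<alpha> n :: (nat => 'd::finite distribution) measure)) =
    (\<integral>\<^sup>+om. ennreal (exp (a * limX \<alpha> n \<beta> om - K * \<bar>limM \<alpha> n om\<bar> powr b)) \<partial>(gauss :: ('d index => real) measure))"
proof -
  note [measurable] = wick_integral_measurable wick_mass_measurable
  have "(\<integral>\<^sup>+\<Phi>. ennreal (exp (a * wick_integral \<alpha> n \<beta> \<Phi> - K * \<bar>wick_mass \<alpha> n \<Phi>\<bar> powr b))
      \<partial>(gauss_measure_prod \<alpha> n :: (nat => 'd::finite distribution) measure)) =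
    (\<integral>\<^sup>+om. ennreal (exp (a * wick_integral \<alpha> n \<beta> (sample \<alpha> n om) - K * \<bar>wick_mass \<alpha> n (sample \<alpha> n om)\<bar> powr b))
      \<partial>(gauss :: ('d index => real) measure))"
    by (rule nn_integral_gauss_measure_prod[OF \<alpha>]) measurable
  also have "\<dots> = (\<integral>\<^sup>+om. ennreal (exp (a * limX \<alpha> n \<beta> om - K * \<bar>limM \<alpha> n om\<bar> powr b)) \<partial>(gauss :: ('d index => real) measure))"
  proof (rule nn_integral_cong_AE, use AE_components_tempered[of n] in eventually_elim)
    case (elim om)
    then show ?case by (simp only: wick_integral_sample[OF elim \<alpha>] wick_mass_sample[OF elim \<alpha>])
  qed
  finally show ?thesis .
qed

subsection \<open>Growth of the variance\<close>

lemma wick_var_ge_1: "wick_var TYPE('d::finite) \<alpha> N \<ge> 1"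
proof -
  have "bracket2 (0 :: int ^ 'd) powr (- \<alpha>) \<le> wick_var TYPE('d) \<alpha> N"
    unfolding wick_var_def by (rule member_le_sum) (auto simp: finite_lattice_ball)
  then show ?thesis by simp
qed

lemma wick_var_le_power:
  assumes \<alpha>: "\<alpha> = real CARD('d::finite) / 2" and \<delta>: "\<delta> > 0"
  shows "\<exists>C\<ge>0. \<forall>N. wick_var TYPE('d) \<alpha> N \<le> C * (1 + (real N)\<^sup>2) powr \<delta>"
proof -
  obtain C where C: "\<And>F :: (int ^ 'd) set. finite F ==> (\<Sum>l\<in>F. bracket2 l powr (- (\<alpha> + \<delta>))) \<le> C"
    using sum_bracket2_bounded[where 'd='d and s = "\<alpha> + \<delta>"] \<alpha> \<delta> by auto
  have "wick_var TYPE('d) \<alpha> N \<le> C * (1 + (real N)\<^sup>2) powr \<delta>" for N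
  proof -
    have "wick_var TYPE('d) \<alpha> N \<le> (\<Sum>l\<in>(lattice_ball N :: (int ^ 'd) set). bracket2 l powr (- (\<alpha> + \<delta>)) * (1 + (real N)\<^sup>2) powr \<delta>)"
      unfolding wick_var_def
    proof (intro sum_mono)
      fix l :: "int ^ 'd" assume "l \<in> lattice_ball N"
      then have "(norm (rvec l))\<^sup>2 \<le> (real N)\<^sup>2" by (intro power_mono) (auto simp: lattice_ball_def)
      then have "bracket2 l powr \<delta> \<le> (1 + (real N)\<^sup>2) powr \<delta>"
        using \<delta> by (intro powr_mono2) (auto simp: bracket2_def)
      then have "bracket2 l powr (- (\<alpha> + \<delta>)) * bracket2 l powr \<delta> \<le> bracket2 l powr (- (\<alpha> + \<delta>)) * (1 + (real N)\<^sup>2) powr \<delta>"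
        by (intro mult_left_mono) auto
      then show "bracket2 l powr (- \<alpha>) \<le> bracket2 l powr (- (\<alpha> + \<delta>)) * (1 + (real N)\<^sup>2) powr \<delta>"
        by (simp flip: powr_add)
    qed
    also have "\<dots> \<le> C * (1 + (real N)\<^sup>2) powr \<delta>"
      unfolding sum_distrib_right[symmetric] by (intro mult_right_mono C finite_lattice_ball) auto
    finally show ?thesis .
  qed
  moreover have "C \<ge> 0" using C[of "{}"] by simp
  ultimately show ?thesis by blast
qed

text \<open>
  Every dyadic cube \<open>[2\<^sup>j, 2\<^sup>j\<^sup>+\<^sup>1)\<^sup>d\<close> contributes a fixed amount, so the variance diverges
  logarithmically.
\<close>

lemma wick_var_ge_log:
  assumes \<alpha>: "\<alpha> = real CARD('d::finite) / 2"
  shows "\<exists>c>0. \<forall>J. c * real J \<le> wick_var TYPE('d) \<alpha> (CARD('d) * 2 ^ J)"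
proof -
  let ?d = "CARD('d)"
  define c where "c = (4 * (1 + real ?d)) powr (- \<alpha>)"
  define Q where "Q j = {l :: int ^ 'd. \<forall>i. l $ i \<in> {2 ^ j..<2 ^ Suc j}}" for j :: nat
  have bij: "bij_betw vec_nth (Q j) (PiE UNIV (\<lambda>_. {2 ^ j..<2 ^ Suc j}))" for j
    unfolding bij_betw_def
  proof
    show "inj_on vec_nth (Q j)" by (auto simp: inj_on_def vec_nth_inject)
    show "vec_nth ` Q j = PiE UNIV (\<lambda>_. {2 ^ j..<2 ^ Suc j})"
    proof (intro equalityI subsetI)
      fix f :: "'d => int" assume "f \<in> PiE UNIV (\<lambda>_. {2 ^ j..<2 ^ Suc j})"
      then have "vec_lambda f \<in> Q j" by (auto simp: Q_def PiE_UNIV_domain)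
      then show "f \<in> vec_nth ` Q j" by (intro image_eqI[of _ _ "vec_lambda f"]) auto
    qed (auto simp: Q_def PiE_UNIV_domain)
  qed
  have cardQ: "card (Q j) = (2 ^ j) ^ ?d" for j
    unfolding bij_betw_same_card[OF bij] by (subst card_PiE) (auto simp: nat_power_eq)
  have finQ: "finite (Q j)" for j
    using bij_betw_finite[OF bij, of j] by (simp add: finite_PiE)
  have sub: "Q j \<subseteq> lattice_ball (?d * 2 ^ J)" if "j < J" for j J
  proof
    fix l assume l: "l \<in> Q j"
    have "norm (rvec l) \<le> (\<Sum>i\<in>UNIV. \<bar>rvec l $ i\<bar>)" by (rule norm_le_l1_cart)
    also have "\<dots> \<le> (\<Sum>i\<in>(UNIV :: 'd set). 2 ^ J)"
    proof (intro sum_mono)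
      fix i
      have "0 \<le> l $ i" "l $ i < 2 ^ Suc j" using l by (auto simp: Q_def intro: order_trans[of 0 "2 ^ j"])
      moreover have "(2 :: int) ^ Suc j \<le> 2 ^ J" using that by (intro power_increasing) auto
      ultimately have "real_of_int \<bar>l $ i\<bar> \<le> real_of_int (2 ^ J)" by (simp only: of_int_le_iff)
      then show "\<bar>rvec l $ i\<bar> \<le> 2 ^ J" by (simp add: rvec_def)
    qed
    finally show "l \<in> lattice_ball (?d * 2 ^ J)" by (simp add: lattice_ball_def)
  qed
  have low: "c \<le> (\<Sum>l\<in>Q j. bracket2 l powr (- \<alpha>))" for j
  proof -
    have br: "bracket2 l \<le> 4 * (1 + real ?d) * (2 ^ j)\<^sup>2" if l: "l \<in> Q j" for l
    proof -
      have "(norm (rvec l))\<^sup>2 \<le> (\<Sum>i\<in>(UNIV :: 'd set). (2 * 2 ^ j)\<^sup>2)"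
        unfolding norm_rvec_square
      proof (intro sum_mono power_mono)
        fix i
        have "0 \<le> l $ i" "l $ i < 2 ^ Suc j" using l by (auto simp: Q_def intro: order_trans[of 0 "2 ^ j"])
        then have "real_of_int (l $ i) \<le> real_of_int (2 ^ Suc j)" "0 \<le> real_of_int (l $ i)" by (simp_all only: of_int_le_iff of_int_0_le_iff)
        then show "real_of_int (l $ i) \<le> 2 * 2 ^ j" "0 \<le> real_of_int (l $ i)" by simp_all
      qed
      moreover have "(1::real) \<le> 4 * (2 ^ j)\<^sup>2"
      proof -
        have "(1::real) \<le> (2 ^ j)\<^sup>2" by (intro one_le_power) simp
        then show ?thesis by linarith
      qed
      ultimately show ?thesis by (simp add: bracket2_def power_mult_distrib algebra_simps)
    qed
    have "c = (\<Sum>l\<in>Q j. (4 * (1 + real ?d) * (2 ^ j)\<^sup>2) powr (- \<alpha>))"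
    proof -
      have "((2 ^ j)\<^sup>2) powr (- \<alpha>) = ((2::real) ^ j) powr (- real ?d)"
        by (simp add: \<alpha> powr_powr flip: powr_numeral)
      then show ?thesis
        by (simp add: cardQ c_def powr_mult powr_minus powr_realpow)
    qed
    also have "\<dots> \<le> (\<Sum>l\<in>Q j. bracket2 l powr (- \<alpha>))"
      using \<alpha> by (intro sum_mono powr_mono2' br) auto
    finally show ?thesis .
  qed
  have "c * real J \<le> wick_var TYPE('d) \<alpha> (?d * 2 ^ J)" for J
  proof -
    have disj: "Q i \<inter> Q j = {}" if "i ~= j" for i j
    proof -
      have *: "Q i \<inter> Q j = {}" if "i < j" for i j
      proof -
        have "(2 :: int) ^ Suc i \<le> 2 ^ j" using that by (intro power_increasing) auto
        have False if l: "l \<in> Q i" "l \<in> Q j" for l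
        proof -
          have "l $ undefined < 2 ^ Suc i" "2 ^ j \<le> l $ undefined" using l by (simp_all add: Q_def)
          with \<open>(2 :: int) ^ Suc i \<le> 2 ^ j\<close> show False by linarith
        qed
        then show ?thesis by blast
      qed
      show ?thesis using *[of i j] *[of j i] that by (cases i j rule: linorder_cases) auto
    qed
    have "c * real J = (\<Sum>j<J. c)" by simp
    also have "\<dots> \<le> (\<Sum>j<J. \<Sum>l\<in>Q j. bracket2 l powr (- \<alpha>))" by (intro sum_mono low)
    also have "\<dots> = (\<Sum>l\<in>(\<Union>j<J. Q j). bracket2 l powr (- \<alpha>))"
      by (rule sum.UNION_disjoint[symmetric]) (auto simp: finQ disj)
    also have "\<dots> \<le> wick_var TYPE('d) \<alpha> (?d * 2 ^ J)"
      unfolding wick_var_def by (rule sum_mono2) (use sub in \<open>auto simp: finite_lattice_ball\<close>)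
    finally show ?thesis .
  qed
  moreover have "c > 0" by (simp add: c_def)
  ultimately show ?thesis by blast
qed

section \<open>Integrability with the mass cutoff\<close>

text \<open>Tails of the remainder at a truncation level that is polynomial in the size \<open>t\<close> of the deviation.\<close>

lemma (in chaos_sequence) remainder_tail:
  assumes A: "2 * real A * \<epsilon> \<ge> 4 * real k + 1"
  shows "\<exists>t1\<ge>1. \<forall>t\<ge>t1. \<forall>N. t ^ A \<le> real N -->
    emeasure gauss {om. 1 \<le> \<bar>Y om - X N om\<bar>} \<le> ennreal (exp (- 2 * t))"
proof -
  define t1 where "t1 = max 1 (C * 2 ^ (4 * k) * exp 2)"
  have "emeasure gauss {om. 1 \<le> \<bar>Y om - X N om\<bar>} \<le> ennreal (exp (- 2 * t))"
    if t: "t \<ge> t1" and N: "t ^ A \<le> real N" for t N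
  proof -
    have t_1: "t \<ge> 1" and t_C: "C * 2 ^ (4 * k) * exp 2 \<le> t" using t by (auto simp: t1_def)
    define K where "K = nat \<lfloor>t\<rfloor>"
    have K: "1 \<le> K" "real K \<le> t" "t < real K + 1" using t_1 unfolding K_def by linarith+
    obtain n where n: "2 ^ n \<le> K" "K < 2 ^ (n + 1)" using ex_power_ivl1[of 2 K] K(1) by auto
    define r where "r = n + 1"
    have r1: "t \<le> 2 ^ r"
    proof -
      have "real (K + 1) \<le> real (2 ^ r)" using n(2) unfolding r_def of_nat_le_iff by simp
      then show ?thesis using K(3) by simp
    qed
    have r2: "2 ^ r \<le> 2 * t"
    proof -
      have "real (2 ^ r) \<le> real (2 * K)" using n(1) unfolding r_def of_nat_le_iff by simp
      then show ?thesis using K(2) by simp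
    qed
    have q: "16 ^ (k * r) * D N \<le> exp (- 2)"
    proof -
      have "(16 :: real) ^ (k * r) = (2 ^ r) ^ (4 * k)"
        using power_mult[of "2::real" 4 "k * r"] by (simp add: power_mult[symmetric] mult_ac)
      also have "\<dots> \<le> (2 * t) ^ (4 * k)" using r2 by (intro power_mono) auto
      finally have 1: "(16 :: real) ^ (k * r) \<le> 2 ^ (4 * k) * t ^ (4 * k)" by (simp add: power_mult_distrib)
      have "(1 + (real N)\<^sup>2) powr (- \<epsilon>) \<le> (t ^ (2 * A)) powr (- \<epsilon>)"
      proof (rule powr_mono2')
        have "(t ^ A)\<^sup>2 \<le> (real N)\<^sup>2" using N t_1 by (intro power_mono) auto
        then show "t ^ (2 * A) \<le> 1 + (real N)\<^sup>2" by (simp add: power_mult[symmetric] mult.commute)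
      qed (use \<epsilon> t_1 in auto)
      also have "\<dots> = t powr (- (2 * real A * \<epsilon>))"
        using t_1 by (simp add: powr_powr flip: powr_realpow)
      also have "\<dots> \<le> t powr (- (4 * real k + 1))"
        using t_1 A by (intro powr_mono) auto
      also have "\<dots> = 1 / t ^ (4 * k + 1)"
        proof -
        have "t powr (4 * real k + 1) = t ^ (4 * k + 1)"
          using t_1 powr_realpow[of t "4 * k + 1"] by (simp only: of_nat_add of_nat_mult) simp
        then show ?thesis by (simp only: powr_minus_divide)
      qed
      finally have 2: "D N \<le> C * (1 / t ^ (4 * k + 1))"
        unfolding D_def using C by (intro mult_left_mono) auto
      have "16 ^ (k * r) * D N \<le> (2 ^ (4 * k) * t ^ (4 * k)) * (C * (1 / t ^ (4 * k + 1)))"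
        using t_1 C by (intro mult_mono 1 2 D_nonneg) auto
      also have "\<dots> = C * 2 ^ (4 * k) / t" using t_1 by (simp add: field_simps)
      also have "\<dots> \<le> exp (- 2)" using t_C t_1 by (simp add: exp_minus field_simps)
      finally show ?thesis .
    qed
    have "emeasure gauss {om. 1 \<le> \<bar>Y om - X N om\<bar>} = (\<integral>\<^sup>+om. indicator {om. 1 \<le> \<bar>Y om - X N om\<bar>} om \<partial>gauss)"
    proof (rule nn_integral_indicator[symmetric])
      have "{om \<in> space gauss. 1 \<le> \<bar>Y om - X N om\<bar>} \<in> sets gauss" by measurable
      then show "{om. 1 \<le> \<bar>Y om - X N om\<bar>} \<in> sets gauss" by simp
    qed
    also have "\<dots> \<le> (\<integral>\<^sup>+om. ennreal ((Y om - X N om) ^ (2 * 2 ^ r)) \<partial>gauss)"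
    proof (intro nn_integral_mono)
      fix om
      have "1 \<le> (Y om - X N om) ^ (2 * 2 ^ r)" if "1 \<le> \<bar>Y om - X N om\<bar>"
        using one_le_power[OF that, of "2 * 2 ^ r"] by (simp add: power_even_abs)
      then show "indicator {om. 1 \<le> \<bar>Y om - X N om\<bar>} om \<le> ennreal ((Y om - X N om) ^ (2 * 2 ^ r))"
        by (auto simp: indicator_def)
    qed
    also have "\<dots> \<le> ennreal ((16 ^ (k * r) * D N) ^ (2 ^ r))" by (rule limit_moment)
    also have "\<dots> \<le> ennreal (exp (- 2 * t))"
    proof (rule ennreal_leI)
      have "(16 ^ (k * r) * D N) ^ (2 ^ r) \<le> (exp (- 2)) ^ (2 ^ r)"
        using D_nonneg by (intro power_mono q) auto
      also have "\<dots> = exp (- 2 * 2 ^ r)" by (simp add: exp_of_nat_mult[symmetric] mult.commute)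
      also have "\<dots> \<le> exp (- 2 * t)" using r1 by simp
      finally show "(16 ^ (k * r) * D N) ^ (2 ^ r) \<le> exp (- 2 * t)" .
    qed
    finally show ?thesis .
  qed
  moreover have "t1 \<ge> 1" by (simp add: t1_def)
  ultimately show ?thesis by blast
qed

text \<open>The variance at truncation \<open>t ^ A\<close> is below every power of \<open>t\<close>, which is why a polynomial truncation is affordable.\<close>

lemma wick_var_power_scale:
  assumes \<alpha>: "\<alpha> = real CARD('d::finite) / 2" and A: "A \<ge> 1"
  shows "\<exists>c\<ge>0. \<forall>t\<ge>1. (wick_var TYPE('d) \<alpha> (nat \<lceil>t ^ A\<rceil>)) ^ 3 \<le> c * sqrt t"
proof -
  define \<delta> where "\<delta> = 1 / (12 * real A)"
  have \<delta>: "\<delta> > 0" "3 * \<delta> \<le> 1" using A by (auto simp: \<delta>_def field_simps)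
  obtain C where C: "C \<ge> 0" "\<And>N. wick_var TYPE('d) \<alpha> N \<le> C * (1 + (real N)\<^sup>2) powr \<delta>"
    using wick_var_le_power[OF \<alpha> \<delta>(1)] by blast
  have "(wick_var TYPE('d) \<alpha> (nat \<lceil>t ^ A\<rceil>)) ^ 3 \<le> (C ^ 3 * 5) * sqrt t" if t: "t \<ge> 1" for t
  proof -
    define N where "N = nat \<lceil>t ^ A\<rceil>"
    have tA: "1 \<le> t ^ A" using t by simp
    have "real N \<le> t ^ A + 1" unfolding N_def using tA by linarith
    then have "real N \<le> 2 * t ^ A" using tA by linarith
    then have "(real N)\<^sup>2 \<le> (2 * t ^ A)\<^sup>2" by (rule power_mono[OF _ of_nat_0_le_iff])
    moreover have "1 \<le> (t ^ A)\<^sup>2" using tA by (rule one_le_power)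
    ultimately have N5: "1 + (real N)\<^sup>2 \<le> 5 * t ^ (2 * A)"
      by (simp add: power_mult_distrib power_mult[symmetric] mult.commute)
    have "(wick_var TYPE('d) \<alpha> N) ^ 3 \<le> (C * (1 + (real N)\<^sup>2) powr \<delta>) ^ 3"
      using wick_var_ge_1[where 'd='d, of \<alpha> N] by (intro power_mono C) auto
    also have "\<dots> = C ^ 3 * (1 + (real N)\<^sup>2) powr (3 * \<delta>)"
    proof -
      have "((1 + (real N)\<^sup>2) powr \<delta>) ^ 3 = ((1 + (real N)\<^sup>2) powr \<delta>) powr 3"
        by (subst powr_numeral) (auto simp: add_pos_nonneg)
      then show ?thesis by (simp add: power_mult_distrib powr_powr mult.commute)
    qed
    also have "\<dots> \<le> C ^ 3 * (5 * t ^ (2 * A)) powr (3 * \<delta>)"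
      using C \<delta> N5 by (intro mult_left_mono powr_mono2) (auto simp: add_pos_nonneg)
    also have "(5 * t ^ (2 * A)) powr (3 * \<delta>) = 5 powr (3 * \<delta>) * (t ^ (2 * A)) powr (3 * \<delta>)"
      by (rule powr_mult)
    also have "(t ^ (2 * A)) powr (3 * \<delta>) = sqrt t"
    proof -
      have "(t ^ (2 * A)) powr (3 * \<delta>) = t powr (real (2 * A) * (3 * \<delta>))"
        using t by (simp only: powr_realpow[symmetric] powr_powr)
      also have "real (2 * A) * (3 * \<delta>) = 1 / 2" using A by (simp add: \<delta>_def)
      finally show ?thesis using t by (simp add: powr_half_sqrt)
    qed
    also have "C ^ 3 * (5 powr (3 * \<delta>) * sqrt t) \<le> C ^ 3 * (5 * sqrt t)"
      using powr_mono[OF \<delta>(2), of 5] C t by (intro mult_left_mono mult_right_mono) auto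
    finally show ?thesis by (simp add: N_def mult.assoc)
  qed
  then show ?thesis using C(1) by (intro exI[of _ "C ^ 3 * 5"]) auto
qed

text \<open>
  Splitting \<open>limX\<close> and \<open>limM\<close> at a level polynomial in \<open>t\<close>, where the variance is still
  \<open>t\<^sup>o\<^sup>(\<^sup>1\<^sup>)\<close>, reduces the tail estimate to the truncated variables.
\<close>

lemma tail_of_head:
  fixes n :: nat and \<beta> :: "nat => nat" and a c0 \<alpha> :: real
  defines "\<sigma> \<equiv> wick_var TYPE('d::finite) \<alpha>"
  assumes \<alpha>: "\<alpha> = real CARD('d) / 2" and n: "n \<ge> 1" and k: "(\<Sum>i=1..n. \<beta> i) \<ge> 2" and c0: "c0 \<ge> 0"
    and head: "\<And>N m t. 1 \<le> m ==> c0 * \<sigma> N ^ 3 * m\<^sup>2 \<le> t ==> 1 \<le> t ==>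
      emeasure gauss {om :: 'd index => real. t / 2 \<le> a * wickX \<alpha> n \<beta> N om \<and> \<bar>massM \<alpha> n N om\<bar> \<le> m + 1} \<le> ennreal (exp (- 2 * t))"
  shows "\<exists>C\<ge>1. \<forall>m\<ge>1. \<forall>t\<ge>C * m ^ 4.
    emeasure gauss {om :: 'd index => real. t \<le> a * limX \<alpha> n \<beta> om \<and> \<bar>limM \<alpha> n om\<bar> \<le> m} \<le> 3 * ennreal (exp (- 2 * t))"
proof -
  obtain CX eX where X: "chaos_sequence (wickX \<alpha> n \<beta> :: nat => ('d index => real) => real) (vars n) (\<Sum>i=1..n. \<beta> i) CX eX"
    using wick_chaos[OF k \<alpha>] by blast
  obtain CM eM where M: "chaos_sequence (massM \<alpha> n :: nat => ('d index => real) => real) (vars n) 2 CM eM"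
    using mass_chaos[OF \<alpha> n] by blast
  interpret X: chaos_sequence "wickX \<alpha> n \<beta> :: nat => ('d index => real) => real" "vars n" "\<Sum>i=1..n. \<beta> i" CX eX by (rule X)
  interpret M: chaos_sequence "massM \<alpha> n :: nat => ('d index => real) => real" "vars n" 2 CM eM by (rule M)
  have Xlim: "limX \<alpha> n \<beta> om = X.Y om" and Mlim: "limM \<alpha> n om = M.Y om" for om
    by (simp_all add: limX_def limM_def X.Y_def M.Y_def)
  define K where "K = (\<Sum>i=1..n. \<beta> i)"
  obtain AX :: nat where AX: "(4 * real K + 1) / (2 * eX) \<le> real AX" using real_arch_simple by blast
  obtain AM :: nat where AM: "(4 * real 2 + 1) / (2 * eM) \<le> real AM" using real_arch_simple by blast
  define A where "A = max 1 (max AX AM)"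
  have A1: "A \<ge> 1" by (simp add: A_def)
  have AX': "2 * real A * eX \<ge> 4 * real K + 1"
  proof -
    have "(4 * real K + 1) / (2 * eX) \<le> real A" using AX by (simp add: A_def)
    then show ?thesis using X.\<epsilon> by (simp add: field_simps)
  qed
  have AM': "2 * real A * eM \<ge> 4 * real 2 + 1"
  proof -
    have "(4 * real 2 + 1) / (2 * eM) \<le> real A" using AM by (simp add: A_def)
    then show ?thesis using M.\<epsilon> by (simp add: field_simps)
  qed
  obtain tX where tX: "tX \<ge> 1" "\<And>t N. t \<ge> tX ==> t ^ A \<le> real N ==>
      emeasure gauss {om. 1 \<le> \<bar>X.Y om - wickX \<alpha> n \<beta> N om\<bar>} \<le> ennreal (exp (- 2 * t))"
    using X.remainder_tail[OF AX'[unfolded K_def]] by blast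
  obtain tM where tM: "tM \<ge> 1" "\<And>t N. t \<ge> tM ==> t ^ A \<le> real N ==>
      emeasure gauss {om. 1 \<le> \<bar>M.Y om - massM \<alpha> n N om\<bar>} \<le> ennreal (exp (- 2 * t))"
    using M.remainder_tail[OF AM'] by blast
  obtain c3 where c3: "c3 \<ge> 0" "\<And>t. t \<ge> 1 ==> \<sigma> (nat \<lceil>t ^ A\<rceil>) ^ 3 \<le> c3 * sqrt t"
    using wick_var_power_scale[OF \<alpha> A1] unfolding \<sigma>_def by blast
  define C where "C = tX + tM + 2 * \<bar>a\<bar> + (c0 * c3)\<^sup>2"
  have C1: "C \<ge> 1"
    unfolding C_def using tX(1) tM(1) zero_le_power2[of "c0 * c3"] abs_ge_zero[of a] by linarith
  have "emeasure gauss {om :: 'd index => real. t \<le> a * limX \<alpha> n \<beta> om \<and> \<bar>limM \<alpha> n om\<bar> \<le> m} \<le> 3 * ennreal (exp (- 2 * t))"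
    if m: "m \<ge> 1" and t: "t \<ge> C * m ^ 4" for m t
  proof -
    have m4: "1 \<le> m ^ 4" using m by (rule one_le_power)
    have "C * 1 \<le> C * m ^ 4" using C1 m4 by (intro mult_left_mono) auto
    then have tC: "t \<ge> C" using t by linarith
    have t': "t \<ge> tX" "t \<ge> tM" "t \<ge> 2 * \<bar>a\<bar>" "t \<ge> 1"
      using tC tX(1) tM(1) zero_le_power2[of "c0 * c3"] unfolding C_def by linarith+
    have "(c0 * c3)\<^sup>2 * m ^ 4 \<le> C * m ^ 4"
      using tX(1) tM(1) m4 by (intro mult_right_mono) (auto simp: C_def)
    then have "(c0 * c3 * m\<^sup>2)\<^sup>2 \<le> t" using t by (simp add: power_mult_distrib flip: power_mult)
    then have sq: "c0 * c3 * m\<^sup>2 \<le> sqrt t" by (rule real_le_rsqrt)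
    define N where "N = nat \<lceil>t ^ A\<rceil>"
    have N: "t ^ A \<le> real N" unfolding N_def by (rule real_nat_ceiling_ge)
    have hd: "c0 * \<sigma> N ^ 3 * m\<^sup>2 \<le> t"
    proof -
      have "c0 * \<sigma> N ^ 3 * m\<^sup>2 \<le> c0 * (c3 * sqrt t) * m\<^sup>2"
        using c3(2)[OF t'(4)] c0 by (intro mult_right_mono mult_left_mono) (auto simp: N_def)
      also have "\<dots> = (c0 * c3 * m\<^sup>2) * sqrt t" by simp
      also have "\<dots> \<le> sqrt t * sqrt t" using t' by (intro mult_right_mono sq) auto
      finally show ?thesis using t' by simp
    qed
    let ?A = "{om :: 'd index => real. t / 2 \<le> a * wickX \<alpha> n \<beta> N om \<and> \<bar>massM \<alpha> n N om\<bar> \<le> m + 1}"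
    let ?B = "{om :: 'd index => real. 1 \<le> \<bar>X.Y om - wickX \<alpha> n \<beta> N om\<bar>}"
    let ?C = "{om :: 'd index => real. 1 \<le> \<bar>M.Y om - massM \<alpha> n N om\<bar>}"
    have "{om \<in> space gauss. t / 2 \<le> a * wickX \<alpha> n \<beta> N om \<and> \<bar>massM \<alpha> n N om\<bar> \<le> m + 1} \<in> sets (gauss :: ('d index => real) measure)"
      "{om \<in> space gauss. 1 \<le> \<bar>X.Y om - wickX \<alpha> n \<beta> N om\<bar>} \<in> sets (gauss :: ('d index => real) measure)"
      "{om \<in> space gauss. 1 \<le> \<bar>M.Y om - massM \<alpha> n N om\<bar>} \<in> sets (gauss :: ('d index => real) measure)"
      by measurable
    then have sets: "?A \<in> sets gauss" "?B \<in> sets gauss" "?C \<in> sets gauss" by simp_all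
    have sub: "{om :: 'd index => real. t \<le> a * limX \<alpha> n \<beta> om \<and> \<bar>limM \<alpha> n om\<bar> \<le> m} \<subseteq> ?A \<union> (?B \<union> ?C)"
    proof
      fix om :: "'d index => real" assume "om \<in> {om. t \<le> a * limX \<alpha> n \<beta> om \<and> \<bar>limM \<alpha> n om\<bar> \<le> m}"
      then have h: "t \<le> a * X.Y om" "\<bar>M.Y om\<bar> \<le> m" by (simp_all add: Xlim Mlim)
      show "om \<in> ?A \<union> (?B \<union> ?C)"
      proof (cases "om \<in> ?B \<union> ?C")
        case False
        then have f: "\<bar>X.Y om - wickX \<alpha> n \<beta> N om\<bar> < 1" "\<bar>M.Y om - massM \<alpha> n N om\<bar> < 1" by auto
        have "\<bar>a * (X.Y om - wickX \<alpha> n \<beta> N om)\<bar> \<le> \<bar>a\<bar> * 1"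
          unfolding abs_mult using f by (intro mult_left_mono) auto
        then have "a * X.Y om - a * wickX \<alpha> n \<beta> N om \<le> \<bar>a\<bar>" by (simp add: right_diff_distrib abs_le_iff)
        then have "t / 2 \<le> a * wickX \<alpha> n \<beta> N om" using h(1) t'(3) by linarith
        moreover have "\<bar>massM \<alpha> n N om\<bar> \<le> m + 1" using h(2) f(2) by linarith
        ultimately show ?thesis by blast
      qed simp
    qed
    have "emeasure gauss {om :: 'd index => real. t \<le> a * limX \<alpha> n \<beta> om \<and> \<bar>limM \<alpha> n om\<bar> \<le> m} \<le> emeasure gauss (?A \<union> (?B \<union> ?C))"
      by (rule emeasure_mono[OF sub]) (use sets in auto)
    also have "\<dots> \<le> emeasure gauss ?A + emeasure gauss (?B \<union> ?C)"
      by (rule emeasure_subadditive) (use sets in auto)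
    also have "\<dots> \<le> emeasure gauss ?A + (emeasure gauss ?B + emeasure gauss ?C)"
      by (intro add_left_mono emeasure_subadditive sets)
    also have "\<dots> \<le> ennreal (exp (- 2 * t)) + (ennreal (exp (- 2 * t)) + ennreal (exp (- 2 * t)))"
      by (intro add_mono head[OF m hd t'(4)] tX(2)[OF t'(1) N] tM(2)[OF t'(2) N])
    also have "\<dots> = 3 * ennreal (exp (- 2 * t))"
      by (simp flip: ennreal_plus ennreal_numeral ennreal_mult)
    finally show ?thesis .
  qed
  then show ?thesis using C1 by blast
qed

text \<open>Layer-cake summation over the unit layers of the exponent and of the mass.\<close>

lemma integrable_of_tail:
  fixes x y :: "('i => real) => real"
  assumes [measurable]: "x \<in> borel_measurable gauss" "y \<in> borel_measurable gauss"
    and C: "C \<ge> 1"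
    and tail: "\<And>m t. m \<ge> 1 ==> t \<ge> C * m ^ 4 ==> emeasure gauss {om. t \<le> x om \<and> \<bar>y om\<bar> \<le> m} \<le> 3 * ennreal (exp (- 2 * t))"
  shows "(\<integral>\<^sup>+om. ennreal (exp (x om - 16 * C * \<bar>y om\<bar> powr 4)) \<partial>gauss) < \<infinity>"
proof -
  obtain J :: nat where J: "C \<le> real J" using real_arch_simple by blast
  define T where "T j m = real (j + J) + 16 * C * real m ^ 4" for j m :: nat
  define E where "E j m = {om. T j m \<le> x om \<and> \<bar>y om\<bar> \<le> real m + 1}" for j m
  have E: "E j m \<in> sets gauss" for j m
  proof -
    have "{om \<in> space gauss. T j m \<le> x om \<and> \<bar>y om\<bar> \<le> real m + 1} \<in> sets gauss" by measurable
    then show ?thesis by (simp add: E_def)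
  qed
  have PE: "emeasure gauss (E j m) \<le> ennreal (3 * exp (- 2 * real (j + J)) * exp (- 2 * real m))" for j m
  proof -
    have "C * (real m + 1) ^ 4 \<le> T j m"
    proof (cases "m = 0")
      case True
      then show ?thesis using J by (simp add: T_def)
    next
      case False
      then have "(real m + 1) ^ 4 \<le> (2 * real m) ^ 4" by (intro power_mono) auto
      also have "\<dots> = 16 * real m ^ 4" by (simp add: power_mult_distrib)
      finally have "C * (real m + 1) ^ 4 \<le> C * (16 * real m ^ 4)" using C by (intro mult_left_mono) auto
      then show ?thesis by (simp add: T_def mult_ac)
    qed
    then have "emeasure gauss (E j m) \<le> 3 * ennreal (exp (- 2 * T j m))"
      unfolding E_def by (intro tail) auto
    also have "\<dots> = ennreal (3 * exp (- 2 * T j m))"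
      by (simp flip: ennreal_numeral ennreal_mult)
    also have "\<dots> \<le> ennreal (3 * exp (- 2 * real (j + J)) * exp (- 2 * real m))"
    proof (rule ennreal_leI)
      have "real m \<le> 16 * C * real m ^ 4"
      proof -
        have "real m * 1 \<le> real m * real m ^ 3" by (cases "m = 0") (auto intro!: mult_left_mono one_le_power)
        also have "\<dots> = 1 * real m ^ 4" by (simp add: power4_eq_xxxx power3_eq_cube)
        also have "\<dots> \<le> (16 * C) * real m ^ 4" using C by (intro mult_right_mono) auto
        finally show ?thesis by simp
      qed
      then have "exp (- 2 * T j m) \<le> exp (- 2 * real (j + J) + (- 2 * real m))"
        by (simp add: T_def)
      also have "\<dots> = exp (- 2 * real (j + J)) * exp (- 2 * real m)" by (rule exp_add)
      finally show "3 * exp (- 2 * T j m) \<le> 3 * exp (- 2 * real (j + J)) * exp (- 2 * real m)"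
        unfolding mult.assoc by (intro mult_left_mono) simp_all
    qed
    finally show ?thesis .
  qed
  define w where "w j = exp (real (j + J) + 1)" for j :: nat
  have pt: "ennreal (exp (x om - 16 * C * \<bar>y om\<bar> powr 4)) \<le>
      ennreal (exp (real J)) + (\<Sum>j. \<Sum>m. ennreal (w j) * indicator (E j m) om)" for om
  proof -
    define F where "F = x om - 16 * C * \<bar>y om\<bar> powr 4"
    show ?thesis unfolding F_def[symmetric]
    proof (cases "F \<le> real J")
      case True
      then have "ennreal (exp F) \<le> ennreal (exp (real J))" by (intro ennreal_leI) simp
      then show "ennreal (exp F) \<le> ennreal (exp (real J)) + (\<Sum>j. \<Sum>m. ennreal (w j) * indicator (E j m) om)"
        by (rule order_trans) simp
    next
      case False
      define j where "j = nat \<lfloor>F - real J\<rfloor>"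
      define m where "m = nat \<lfloor>\<bar>y om\<bar>\<rfloor>"
      have j: "real (j + J) \<le> F" "F \<le> real (j + J) + 1" using False unfolding j_def by linarith+
      have m: "real m \<le> \<bar>y om\<bar>" "\<bar>y om\<bar> \<le> real m + 1" unfolding m_def by linarith+
      have "real m ^ 4 \<le> \<bar>y om\<bar> ^ 4" by (rule power_mono[OF m(1)]) simp
      also have "\<bar>y om\<bar> ^ 4 = \<bar>y om\<bar> powr 4" by (cases "y om = 0") auto
      finally have "16 * C * real m ^ 4 \<le> 16 * C * \<bar>y om\<bar> powr 4" using C by (intro mult_left_mono) auto
      then have "T j m \<le> x om" using j(1) by (simp add: T_def F_def)
      then have "om \<in> E j m" using m(2) by (simp add: E_def)
      then have "ennreal (exp F) \<le> ennreal (w j) * indicator (E j m) om"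
        using j(2) by (simp add: w_def ennreal_leI)
      also have "\<dots> = (\<Sum>m'\<in>{m}. ennreal (w j) * indicator (E j m') om)" by (subst sum.insert) simp_all
      also have "\<dots> \<le> (\<Sum>m. ennreal (w j) * indicator (E j m) om)" by (rule sum_le_suminf) auto
      also have "\<dots> = (\<Sum>j'\<in>{j}. \<Sum>m. ennreal (w j') * indicator (E j' m) om)" by (subst sum.insert) simp_all
      also have "\<dots> \<le> (\<Sum>j. \<Sum>m. ennreal (w j) * indicator (E j m) om)" by (rule sum_le_suminf) auto
      finally show "ennreal (exp F) \<le> ennreal (exp (real J)) + (\<Sum>j. \<Sum>m. ennreal (w j) * indicator (E j m) om)"
        by (rule order_trans) simp
    qed
  qed
  define q where "q = exp (- 1 :: real)"
  have q: "0 \<le> q" "q < 1" by (auto simp: q_def)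
  have layer: "ennreal (w j) * emeasure gauss (E j m) \<le> ennreal ((3 * exp 1 * q ^ j) * q ^ m)" for j m
  proof -
    have "ennreal (w j) * emeasure gauss (E j m) \<le> ennreal (w j) * ennreal (3 * exp (- 2 * real (j + J)) * exp (- 2 * real m))"
      by (intro mult_left_mono PE) auto
    also have "\<dots> = ennreal (w j * (3 * exp (- 2 * real (j + J)) * exp (- 2 * real m)))"
      by (simp add: w_def flip: ennreal_mult)
    also have "\<dots> \<le> ennreal ((3 * exp 1 * q ^ j) * q ^ m)"
    proof (rule ennreal_leI)
      have "w j * (3 * exp (- 2 * real (j + J)) * exp (- 2 * real m)) = 3 * exp (real (j + J) + 1 + (- 2 * real (j + J)) + (- 2 * real m))"
        by (simp only: w_def exp_add mult_ac)
      also have "\<dots> \<le> 3 * exp (1 + (real j * - 1) + (real m * - 1))" by simp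
      also have "\<dots> = (3 * exp 1 * q ^ j) * q ^ m"
        by (simp only: exp_add q_def exp_of_nat_mult mult.assoc)
      finally show "w j * (3 * exp (- 2 * real (j + J)) * exp (- 2 * real m)) \<le> (3 * exp 1 * q ^ j) * q ^ m" .
    qed
    finally show ?thesis .
  qed
  have geo: "(\<Sum>m. ennreal (c * q ^ m)) = ennreal (c / (1 - q))" if "c \<ge> 0" for c
    using that q by (subst suminf_ennreal2) (auto simp: suminf_mult suminf_geometric summable_geometric)
  have "(\<integral>\<^sup>+om. ennreal (exp (x om - 16 * C * \<bar>y om\<bar> powr 4)) \<partial>gauss) \<le>
      (\<integral>\<^sup>+om. ennreal (exp (real J)) + (\<Sum>j. \<Sum>m. ennreal (w j) * indicator (E j m) om) \<partial>gauss)"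
    by (intro nn_integral_mono pt)
  also have "\<dots> = ennreal (exp (real J)) + (\<integral>\<^sup>+om. (\<Sum>j. \<Sum>m. ennreal (w j) * indicator (E j m) om) \<partial>gauss)"
  proof -
    have "emeasure (gauss :: ('i => real) measure) UNIV = 1" using gauss.P.emeasure_space_1 by simp
    then show ?thesis using E by (subst nn_integral_add) auto
  qed
  also have "(\<integral>\<^sup>+om. (\<Sum>j. \<Sum>m. ennreal (w j) * indicator (E j m) om) \<partial>gauss) = (\<Sum>j. \<Sum>m. ennreal (w j) * emeasure gauss (E j m))"
    using E by (simp add: nn_integral_suminf nn_integral_cmult_indicator del: ennreal_suminf_cmult)
  also have "\<dots> \<le> (\<Sum>j. \<Sum>m. ennreal ((3 * exp 1 * q ^ j) * q ^ m))"
    by (intro suminf_le layer) auto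
  also have "\<dots> = (\<Sum>j. ennreal ((3 * exp 1 / (1 - q)) * q ^ j))"
    using q by (subst geo) auto
  also have "\<dots> = ennreal ((3 * exp 1 / (1 - q)) / (1 - q))"
    using q by (subst geo) auto
  finally show ?thesis
    by (rule le_less_trans)
      (auto simp only: infinity_ennreal_def ennreal_add_less_top ennreal_less_top simp_thms intro: add_left_mono)
qed

subsection \<open>The cubic case and the sign-definite quartic case\<close>

lemma emeasure_gauss_UNIV [simp]: "emeasure (gauss :: ('i => real) measure) UNIV = 1"
  using gauss.P.emeasure_space_1 by simp

lemma nn_integral_gauss1_exp: "(\<integral>\<^sup>+z. ennreal (exp (c * z)) \<partial>gauss1) = ennreal (exp (c\<^sup>2 / 2))"
proof -
  have "(\<integral>\<^sup>+z. ennreal (exp (c * z)) \<partial>gauss1) = (\<integral>\<^sup>+z. ennreal (std_normal_density z) * ennreal (exp (c * z)) \<partial>lborel)"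
    unfolding gauss1_def by (subst nn_integral_density) auto
  also have "\<dots> = (\<integral>\<^sup>+z. ennreal (exp (c\<^sup>2 / 2)) * ennreal (normal_density c 1 z) \<partial>lborel)"
  proof (intro nn_integral_cong)
    fix z :: real
    have "std_normal_density z * exp (c * z) = exp (c\<^sup>2 / 2) * normal_density c 1 z"
    proof -
      have "exp (- (z\<^sup>2 / 2)) * exp (c * z) = exp (c\<^sup>2 / 2) * exp (- ((z - c)\<^sup>2 / 2))"
        unfolding exp_add[symmetric] by (simp add: power2_eq_square field_simps)
      then show ?thesis by (simp add: normal_density_def field_simps)
    qed
    then show "ennreal (std_normal_density z) * ennreal (exp (c * z)) = ennreal (exp (c\<^sup>2 / 2)) * ennreal (normal_density c 1 z)"
      by (simp flip: ennreal_mult)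
  qed
  also have "\<dots> = ennreal (exp (c\<^sup>2 / 2)) * (\<integral>\<^sup>+z. ennreal (normal_density c 1 z) \<partial>lborel)"
    by (rule nn_integral_cmult) simp
  also have "(\<integral>\<^sup>+z. ennreal (normal_density c 1 z) \<partial>lborel) = 1"
  proof -
    interpret N: prob_space "density lborel (normal_density c 1)" by (rule prob_space_normal_density) simp
    show ?thesis using N.emeasure_space_1 by (simp add: emeasure_density)
  qed
  finally show ?thesis by simp
qed

text \<open>Completing the square, one coordinate at a time.\<close>

lemma nn_integral_gauss_exp_linear:
  fixes c :: "'i => real"
  assumes "finite F"
  shows "(\<integral>\<^sup>+om. ennreal (exp (\<Sum>p\<in>F. c p * om p)) \<partial>gauss) = ennreal (exp (\<Sum>p\<in>F. (c p)\<^sup>2 / 2))"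
  using assms
proof (induction F)
  case empty
  then show ?case by simp
next
  case (insert q F)
  have e: "ennreal (exp (\<Sum>p\<in>insert q F. c p * splice {q} om om' p)) =
      ennreal (exp (\<Sum>p\<in>F. c p * om p)) * ennreal (exp (c q * om' q))" for om om' :: "'i => real"
  proof -
    have "(\<Sum>p\<in>F. c p * splice {q} om om' p) = (\<Sum>p\<in>F. c p * om p)"
      using insert.hyps by (intro sum.cong) (auto simp: splice_def)
    then show ?thesis using insert.hyps by (simp add: splice_def exp_add mult.commute flip: ennreal_mult)
  qed
  have one: "(\<integral>\<^sup>+om'. ennreal (exp (c q * om' q)) \<partial>gauss) = ennreal (exp ((c q)\<^sup>2 / 2))"
  proof -
    have "(\<integral>\<^sup>+om'. ennreal (exp (c q * om' q)) \<partial>gauss) = (\<integral>\<^sup>+z. ennreal (exp (c q * z)) \<partial>distr gauss gauss1 (\<lambda>om. om q))"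
      by (subst nn_integral_distr) auto
    then show ?thesis by (simp only: distr_gauss_component nn_integral_gauss1_exp)
  qed
  have "(\<integral>\<^sup>+om. ennreal (exp (\<Sum>p\<in>insert q F. c p * om p)) \<partial>gauss) =
      (\<integral>\<^sup>+om. \<integral>\<^sup>+om'. ennreal (exp (\<Sum>p\<in>F. c p * om p)) * ennreal (exp (c q * om' q)) \<partial>gauss \<partial>gauss)"
    by (subst gauss_splice_nn_integral[of _ "{q}"]) (simp_all only: e, measurable)
  also have "\<dots> = (\<integral>\<^sup>+om. ennreal (exp (\<Sum>p\<in>F. c p * om p)) * ennreal (exp ((c q)\<^sup>2 / 2)) \<partial>gauss)"
    by (subst nn_integral_cmult) (auto simp: one)
  also have "\<dots> = ennreal (exp (\<Sum>p\<in>F. (c p)\<^sup>2 / 2)) * ennreal (exp ((c q)\<^sup>2 / 2))"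
    by (subst nn_integral_multc) (auto simp: insert.IH)
  also have "\<dots> = ennreal (exp (\<Sum>p\<in>insert q F. (c p)\<^sup>2 / 2))"
    using insert.hyps by (simp add: exp_add mult.commute flip: ennreal_mult)
  finally show ?case .
qed

lemma abs_mode_le: "\<bar>mode \<alpha> j x\<bar> \<le> bracket2 (fst j) powr (- \<alpha> / 2)"
proof -
  have "\<bar>Re (fourier_char (fst j) x)\<bar> \<le> 1" "\<bar>- Im (fourier_char (fst j) x)\<bar> \<le> 1"
    using abs_Re_le_cmod[of "fourier_char (fst j) x"] abs_Im_le_cmod[of "fourier_char (fst j) x"]
    by (simp_all add: norm_fourier_char)
  then have "\<bar>if snd j then Re (fourier_char (fst j) x) else - Im (fourier_char (fst j) x)\<bar> \<le> 1" by auto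
  then show ?thesis unfolding mode_def abs_mult by (simp add: mult_left_le)
qed

text \<open>Every mode is bounded by its weight, and the squared weights sum to the variance.\<close>

lemma sum_mode_coefficients:
  fixes W :: "real ^ 'd::finite => real"
  assumes W: "continuous_on UNIV W" and V: "(\<integral>x. \<bar>W x\<bar> \<partial>torus) \<le> V"
  shows "(\<Sum>j\<in>modes N. (\<integral>x. mode \<alpha> j x * W x \<partial>torus)\<^sup>2) \<le> 2 * wick_var TYPE('d) \<alpha> N * V\<^sup>2"
proof -
  have W0: "0 \<le> (\<integral>x. \<bar>W x\<bar> \<partial>torus)" by simp
  then have V0: "0 \<le> V" using V by linarith
  have "(\<integral>x. mode \<alpha> j x * W x \<partial>torus)\<^sup>2 \<le> bracket2 (fst j) powr (- \<alpha>) * V\<^sup>2" for j :: "(int ^ 'd) \<times> bool"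
  proof -
    have "\<bar>\<integral>x. mode \<alpha> j x * W x \<partial>torus\<bar> \<le> (\<integral>x. \<bar>mode \<alpha> j x * W x\<bar> \<partial>torus)" by (rule integral_abs_bound)
    also have "\<dots> \<le> (\<integral>x. bracket2 (fst j) powr (- \<alpha> / 2) * \<bar>W x\<bar> \<partial>torus)"
      unfolding abs_mult
      by (intro integral_mono continuous_imp_integrable_torus continuous_intros continuous_mode W mult_right_mono abs_mode_le) auto
    also have "\<dots> = bracket2 (fst j) powr (- \<alpha> / 2) * (\<integral>x. \<bar>W x\<bar> \<partial>torus)" by simp
    also have "\<dots> \<le> bracket2 (fst j) powr (- \<alpha> / 2) * V" using V by (intro mult_left_mono) auto
    finally have "\<bar>\<integral>x. mode \<alpha> j x * W x \<partial>torus\<bar>\<^sup>2 \<le> (bracket2 (fst j) powr (- \<alpha> / 2) * V)\<^sup>2"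
      by (rule power_mono) simp
    also have "\<dots> = bracket2 (fst j) powr (- \<alpha>) * V\<^sup>2"
      unfolding power_mult_distrib by (simp add: power2_eq_square flip: powr_add)
    finally show ?thesis by simp
  qed
  then have "(\<Sum>j\<in>modes N. (\<integral>x. mode \<alpha> j x * W x \<partial>torus)\<^sup>2) \<le> (\<Sum>j\<in>(modes N :: ((int ^ 'd) \<times> bool) set). bracket2 (fst j) powr (- \<alpha>) * V\<^sup>2)"
    by (rule sum_mono)
  also have "\<dots> = 2 * wick_var TYPE('d) \<alpha> N * V\<^sup>2"
    unfolding sum_modes wick_var_def by (simp add: sum_distrib_right sum_distrib_left mult_ac)
  finally show ?thesis .
qed

text \<open>Total degree two leaves either one factor \<open>x\<^sup>2 - \<sigma>\<close> or a product of two distinct variables.\<close>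

lemma abs_quadratic_hermite_le:
  fixes x :: "nat => real"
  assumes I: "finite I" and two: "sum \<beta> I = 2" and \<sigma>: "\<sigma> \<ge> 0"
  shows "\<bar>\<Prod>i\<in>I. hermite (\<beta> i) (x i) \<sigma>\<bar> \<le> (\<Sum>i\<in>I. (x i)\<^sup>2) + \<sigma>"
proof -
  obtain i where i: "i \<in> I" "\<beta> i ~= 0" 
  proof -
    have "\<not> (\<forall>i\<in>I. \<beta> i = 0)" using two sum.neutral[of I \<beta>] by linarith
    then show thesis using that by blast
  qed
  have r: "sum \<beta> (I - {i}) = 2 - \<beta> i" "\<beta> i \<le> 2" using sum.remove[OF I i(1), of \<beta>] two by linarith+
  have s: "(\<Sum>i\<in>I. (x i)\<^sup>2) = (x i)\<^sup>2 + (\<Sum>i\<in>I - {i}. (x i)\<^sup>2)" by (rule sum.remove[OF I i(1)])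
  have p: "(\<Prod>i\<in>I. hermite (\<beta> i) (x i) \<sigma>) = hermite (\<beta> i) (x i) \<sigma> * (\<Prod>i\<in>I - {i}. hermite (\<beta> i) (x i) \<sigma>)"
    by (rule prod.remove[OF I i(1)])
  consider "\<beta> i = 2" | "\<beta> i = 1" using i(2) r(2) by linarith
  then show ?thesis
  proof cases
    case 1
    then have "\<beta> k = 0" if "k \<in> I - {i}" for k using r(1) I that by auto
    then have "(\<Prod>i\<in>I - {i}. hermite (\<beta> i) (x i) \<sigma>) = 1" by (intro prod.neutral) (simp add: hermite_0)
    then show ?thesis
      using p 1 s \<sigma> sum_nonneg[of "I - {i}" "\<lambda>i. (x i)\<^sup>2"] by (simp add: hermite_2 abs_le_iff)
  next
    case 2
    then have "sum \<beta> (I - {i}) = 1" using r(1) by simp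
    then obtain k where k: "k \<in> I - {i}" "\<beta> k = 1" "\<forall>y\<in>I - {i}. k ~= y --> \<beta> y = 0"
      using iffD1[OF sum_eq_1_iff[OF finite_Diff[OF I]] \<open>sum \<beta> (I - {i}) = 1\<close>] by blast
    have "(\<Prod>i\<in>I - {i}. hermite (\<beta> i) (x i) \<sigma>) = hermite (\<beta> k) (x k) \<sigma> * (\<Prod>i\<in>I - {i} - {k}. hermite (\<beta> i) (x i) \<sigma>)"
      using I k(1) by (intro prod.remove) auto
    also have "(\<Prod>i\<in>I - {i} - {k}. hermite (\<beta> i) (x i) \<sigma>) = 1" using k(3) by (intro prod.neutral) (auto simp: hermite_0)
    finally have "(\<Prod>i\<in>I. hermite (\<beta> i) (x i) \<sigma>) = x i * x k" using p 2 k by (simp add: hermite_1)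
    moreover have "\<bar>x i * x k\<bar> \<le> (x i)\<^sup>2 + (x k)\<^sup>2"
    proof -
      have "2 * \<bar>x i * x k\<bar> \<le> (x i)\<^sup>2 + (x k)\<^sup>2"
        using sum_squares_bound[of "\<bar>x i\<bar>" "\<bar>x k\<bar>"] by (simp only: abs_mult power2_abs mult.assoc)
      then show ?thesis using abs_ge_zero[of "x i * x k"] by linarith
    qed
    moreover have "(x k)\<^sup>2 \<le> (\<Sum>i\<in>I - {i}. (x i)\<^sup>2)" using k I by (intro member_le_sum) auto
    ultimately show ?thesis using s \<sigma> by simp
  qed
qed

text \<open>
  In the cubic case some component enters linearly. Given the other components, the truncated
  Wick integral is a centred Gaussian, whose variance is controlled by the Wick mass.
\<close>

lemma cubic_head:
  fixes n N :: nat and \<beta> :: "nat => nat"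
  assumes three: "(\<Sum>i=1..n. \<beta> i) = 3" and i0: "i0 \<in> {1..n}" "\<beta> i0 = 1" and a: "a ~= 0"
    and m: "m \<ge> 1" and t: "32 * a\<^sup>2 * (real n + 3)\<^sup>2 * wick_var TYPE('d) \<alpha> N ^ 3 * m\<^sup>2 \<le> t"
  shows "emeasure gauss {om :: 'd::finite index => real. t / 2 \<le> a * wickX \<alpha> n \<beta> N om \<and> \<bar>massM \<alpha> n N om\<bar> \<le> m + 1}
    \<le> ennreal (exp (- 2 * t))"
proof -
  define \<sigma> where "\<sigma> = wick_var TYPE('d) \<alpha> N"
  have \<sigma>: "\<sigma> \<ge> 1" unfolding \<sigma>_def by (rule wick_var_ge_1)
  define I where "I = {1..n} - {i0}"
  define A where "A = {p :: 'd index. fst p = i0}"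
  define Q where "Q om = (\<Sum>i\<in>I. \<integral>x. (comp_field \<alpha> N om i x)\<^sup>2 \<partial>torus)" for om :: "'d index => real"
  define W where "W om x = (\<Prod>i\<in>I. hermite (\<beta> i) (comp_field \<alpha> N om i x) \<sigma>)" for om :: "'d index => real" and x
  define b where "b om j = (\<integral>x. mode \<alpha> j x * W om x \<partial>torus)" for om and j :: "(int ^ 'd) \<times> bool"
  define V where "V = (real n + 3) * \<sigma> * m"
  have V: "V > 0" unfolding V_def using \<sigma> m by (intro mult_pos_pos) auto
  have cW: "continuous_on UNIV (W om)" for om
    unfolding W_def by (intro continuous_on_prod continuous_on_compose2[OF continuous_hermite continuous_field]) auto
  have X: "wickX \<alpha> n \<beta> N om = (\<Sum>j\<in>modes N. b om j * om (i0, j))" for om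
  proof -
    have "wickX \<alpha> n \<beta> N om = (\<integral>x. comp_field \<alpha> N om i0 x * W om x \<partial>torus)"
      unfolding wickX_def wick_vars hermite_multi_def W_def I_def \<sigma>_def
      by (subst prod.remove[OF _ i0(1)]) (auto simp: i0(2) hermite_1)
    also have "\<dots> = (\<integral>x. (\<Sum>j\<in>modes N. om (i0, j) * (mode \<alpha> j x * W om x)) \<partial>torus)"
      unfolding field_def by (simp add: sum_distrib_left sum_distrib_right mult_ac)
    also have "\<dots> = (\<Sum>j\<in>modes N. \<integral>x. om (i0, j) * (mode \<alpha> j x * W om x) \<partial>torus)"
      by (intro Bochner_Integration.integral_sum continuous_imp_integrable_torus continuous_intros continuous_mode cW)
    finally show ?thesis by (simp add: b_def mult.commute)
  qed
  have Qm [measurable]: "Q \<in> borel_measurable gauss"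
  proof -
    have "Q om = (\<Sum>i\<in>I. wickX \<alpha> n (two_at i) N om + \<sigma>)" for om
      unfolding Q_def
    proof (rule sum.cong)
      fix i assume "i \<in> I"
      then have i: "i \<in> {1..n}" by (simp add: I_def)
      show "(\<integral>x. (comp_field \<alpha> N om i x)\<^sup>2 \<partial>torus) = wickX \<alpha> n (two_at i) N om + \<sigma>"
        unfolding wickX_def wick_vars hermite_multi_two_at[OF i] hermite_2 \<sigma>_def
        by (subst Bochner_Integration.integral_diff) (auto intro: integrable_torus_continuous_power continuous_field)
    qed simp
    then have "Q = (\<lambda>om. \<Sum>i\<in>I. wickX \<alpha> n (two_at i) N om + \<sigma>)" by (rule ext)
    then show ?thesis
      by (simp only:) (intro borel_measurable_sum borel_measurable_add borel_measurable_const all_moments_measurable[OF all_moments_wickX])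
  qed
  have Xm [measurable]: "wickX \<alpha> n \<beta> N \<in> borel_measurable gauss"
    by (rule all_moments_measurable[OF all_moments_wickX])
  define V0 where "V0 = m + 1 + real n * \<sigma>"
  have QV: "Q om \<le> V0" if "\<bar>massM \<alpha> n N om\<bar> \<le> m + 1" for om
  proof -
    have "Q om \<le> (\<Sum>i=1..n. \<integral>x. (comp_field \<alpha> N om i x)\<^sup>2 \<partial>torus)"
      unfolding Q_def I_def by (intro sum_mono2) auto
    then show ?thesis using that massM_eq[of \<alpha> n N om] unfolding V0_def \<sigma>_def by linarith
  qed
  have W1: "(\<integral>x. \<bar>W om x\<bar> \<partial>torus) \<le> V" if "Q om \<le> V0" for om
  proof -
    have s2: "sum \<beta> I = 2" using three sum.remove[OF _ i0(1), of \<beta>] i0(2) by (simp add: I_def)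
    have "(\<integral>x. \<bar>W om x\<bar> \<partial>torus) \<le> (\<integral>x. (\<Sum>i\<in>I. (comp_field \<alpha> N om i x)\<^sup>2) + \<sigma> \<partial>torus)"
    proof (rule integral_mono)
      show "\<bar>W om x\<bar> \<le> (\<Sum>i\<in>I. (comp_field \<alpha> N om i x)\<^sup>2) + \<sigma>" for x
        unfolding W_def using \<sigma> s2 by (intro abs_quadratic_hermite_le) (auto simp: I_def)
    qed (intro continuous_imp_integrable_torus continuous_intros continuous_field cW)+
    also have "\<dots> = Q om + \<sigma>"
      unfolding Q_def
      by (subst Bochner_Integration.integral_add; (subst Bochner_Integration.integral_sum)?)
        (auto intro!: integrable_torus_continuous_power continuous_field Bochner_Integration.integrable_sum simp: torus.prob_space)
    also have "\<dots> \<le> V0 + \<sigma>" using that by simp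
    also have "\<dots> \<le> V"
    proof -
      have "1 \<le> \<sigma> * m" using mult_mono[OF \<sigma> m] \<sigma> by simp
      moreover have "m \<le> \<sigma> * m" using mult_right_mono[OF \<sigma>, of m] m by simp
      moreover have "\<sigma> \<le> \<sigma> * m" using mult_left_mono[OF m, of \<sigma>] \<sigma> by simp
      moreover have "real n * \<sigma> \<le> real n * (\<sigma> * m)" using calculation(3) by (rule mult_left_mono) simp
      moreover have "V = real n * (\<sigma> * m) + 3 * (\<sigma> * m)" by (simp add: V_def algebra_simps)
      ultimately show ?thesis unfolding V0_def by linarith
    qed
    finally show ?thesis .
  qed
  define S where "S = a\<^sup>2 * \<sigma> * V\<^sup>2"
  have S: "S > 0" unfolding S_def using a \<sigma> V by (intro mult_pos_pos) auto
  have tS: "32 * S \<le> t" using t by (simp add: S_def V_def \<sigma>_def power_mult_distrib power3_eq_cube power2_eq_square mult_ac)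
  then have t0: "t > 0" using S by linarith
  define k where "k = t / (4 * S)"
  have k0: "k > 0" using t0 S by (simp add: k_def)
  define f where "f om = indicator {om. Q om \<le> V0} om * ennreal (exp (k * a * wickX \<alpha> n \<beta> N om))" for om
  have Q0: "{om. Q om \<le> V0} \<in> sets gauss"
  proof -
    have "{om \<in> space gauss. Q om \<le> V0} \<in> sets gauss" by measurable
    then show ?thesis by simp
  qed
  then have fm: "f \<in> borel_measurable gauss" unfolding f_def by measurable
  have inv: "comp_field \<alpha> N (splice A om om') i x = comp_field \<alpha> N om i x" if "i \<in> I" for om om' i x
    using that by (simp add: splice_def A_def I_def)
  have Wi: "W (splice A om om') = W om" and Qi: "Q (splice A om om') = Q om" for om om'
    unfolding W_def[abs_def] Q_def by (auto intro!: ext prod.cong sum.cong simp: inv)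
  have bi: "b (splice A om om') = b om" for om om' unfolding b_def[abs_def] Wi ..
  have inner: "(\<integral>\<^sup>+om'. f (splice A om om') \<partial>gauss) \<le> ennreal (exp (k\<^sup>2 * S))" for om
  proof (cases "Q om \<le> V0")
    case True
    have "f (splice A om om') = ennreal (exp (\<Sum>p\<in>Pair i0 ` modes N. (k * a * b om (snd p)) * om' p))" for om'
    proof -
      have "k * a * wickX \<alpha> n \<beta> N (splice A om om') = (\<Sum>j\<in>modes N. (k * a * b om j) * om' (i0, j))"
        unfolding X bi by (simp add: splice_def A_def sum_distrib_left mult.assoc)
      then show ?thesis using True by (simp add: f_def Qi sum.reindex inj_on_def)
    qed
    then have "(\<integral>\<^sup>+om'. f (splice A om om') \<partial>gauss) = ennreal (exp (\<Sum>p\<in>Pair i0 ` modes N. (k * a * b om (snd p))\<^sup>2 / 2))"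
      using nn_integral_gauss_exp_linear[where F = "Pair i0 ` modes N" and c = "\<lambda>p. k * a * b om (snd p)"] by simp
    also have "(\<Sum>p\<in>Pair i0 ` modes N. (k * a * b om (snd p))\<^sup>2 / 2) = (k\<^sup>2 * a\<^sup>2 / 2) * (\<Sum>j\<in>modes N. (b om j)\<^sup>2)"
      by (simp add: sum.reindex inj_on_def power_mult_distrib sum_distrib_left)
    also have "ennreal (exp \<dots>) \<le> ennreal (exp ((k\<^sup>2 * a\<^sup>2 / 2) * (2 * \<sigma> * V\<^sup>2)))"
    proof (intro ennreal_leI, unfold exp_le_cancel_iff, rule mult_left_mono)
      show "(\<Sum>j\<in>modes N. (b om j)\<^sup>2) \<le> 2 * \<sigma> * V\<^sup>2"
        unfolding b_def \<sigma>_def by (rule sum_mode_coefficients[OF cW W1[OF True]])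
    qed simp
    also have "(k\<^sup>2 * a\<^sup>2 / 2) * (2 * \<sigma> * V\<^sup>2) = k\<^sup>2 * S" by (simp add: S_def)
    finally show ?thesis .
  qed (simp add: f_def Qi)
  let ?B = "{om :: 'd index => real. t / 2 \<le> a * wickX \<alpha> n \<beta> N om \<and> \<bar>massM \<alpha> n N om\<bar> \<le> m + 1}"
  have Bs: "?B \<in> sets gauss"
  proof -
    have [measurable]: "massM \<alpha> n N \<in> borel_measurable (gauss :: ('d index => real) measure)"
      by (rule all_moments_measurable[OF all_moments_gpoly[OF gpoly_massM]])
    have "{om \<in> space gauss. t / 2 \<le> a * wickX \<alpha> n \<beta> N om \<and> \<bar>massM \<alpha> n N om\<bar> \<le> m + 1} \<in> sets (gauss :: ('d index => real) measure)"
      by measurable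
    then show ?thesis by simp
  qed
  have pt: "indicator ?B om \<le> ennreal (exp (- (k * t / 2))) * f om" for om
  proof (cases "om \<in> ?B")
    case True
    then have h: "t / 2 \<le> a * wickX \<alpha> n \<beta> N om" "Q om \<le> V0" using QV by auto
    have "k * (t / 2) \<le> k * (a * wickX \<alpha> n \<beta> N om)" using h(1) k0 by (intro mult_left_mono) auto
    then have "1 \<le> exp (- (k * t / 2)) * exp (k * a * wickX \<alpha> n \<beta> N om)"
      unfolding exp_add[symmetric] by (simp add: mult.assoc)
    then show ?thesis using True h by (simp add: f_def flip: ennreal_mult)
  qed simp
  have "emeasure gauss ?B = (\<integral>\<^sup>+om. indicator ?B om \<partial>gauss)" using Bs by simp
  also have "\<dots> \<le> (\<integral>\<^sup>+om. ennreal (exp (- (k * t / 2))) * f om \<partial>gauss)" by (intro nn_integral_mono pt)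
  also have "\<dots> = ennreal (exp (- (k * t / 2))) * (\<integral>\<^sup>+om. \<integral>\<^sup>+om'. f (splice A om om') \<partial>gauss \<partial>gauss)"
    by (simp add: nn_integral_cmult[OF fm] gauss_splice_nn_integral[OF fm, of A])
  also have "\<dots> \<le> ennreal (exp (- (k * t / 2))) * (\<integral>\<^sup>+om. ennreal (exp (k\<^sup>2 * S)) \<partial>(gauss :: ('d index => real) measure))"
    by (intro mult_left_mono nn_integral_mono inner) auto
  also have "\<dots> = ennreal (exp (- (k * t / 2)) * exp (k\<^sup>2 * S))"
    by (simp flip: ennreal_mult)
  also have "\<dots> \<le> ennreal (exp (- 2 * t))"
  proof (rule ennreal_leI)
    have "k * S = t / 4" using S by (simp add: k_def)
    then have "k\<^sup>2 * S = k * t / 4" by (simp add: power2_eq_square)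
    moreover have "8 \<le> k" using tS S by (simp add: k_def field_simps)
    then have "8 * t \<le> k * t" using t0 by (intro mult_right_mono) auto
    ultimately have "- (k * t / 2) + k\<^sup>2 * S \<le> - 2 * t" by simp
    then show "exp (- (k * t / 2)) * exp (k\<^sup>2 * S) \<le> exp (- 2 * t)"
      unfolding exp_add[symmetric] exp_le_cancel_iff .
  qed
  finally show ?thesis .
qed

text \<open>
  For a negative coupling and \<open>\<beta> = (2, 2, 0, \<dots>)\<close>, the density
  \<open>(\<phi>\<^sub>1\<^sup>2 - \<sigma>) (\<phi>\<^sub>2\<^sup>2 - \<sigma>)\<close> is at least \<open>- \<sigma> (\<phi>\<^sub>1\<^sup>2 + \<phi>\<^sub>2\<^sup>2)\<close>, so a bounded Wick mass bounds the
  exponent from above.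
\<close>

lemma quartic_head:
  fixes n N :: nat and \<beta> :: "nat => nat"
  assumes n: "n \<ge> 2" and \<beta>: "\<beta> 1 = 2" "\<beta> 2 = 2" "\<forall>i\<in>{3..n}. \<beta> i = 0" and a: "a < 0"
    and m: "m \<ge> 1" and t: "4 * \<bar>a\<bar> * (real n + 3) * wick_var TYPE('d) \<alpha> N ^ 3 * m\<^sup>2 \<le> t"
  shows "emeasure gauss {om :: 'd::finite index => real. t / 2 \<le> a * wickX \<alpha> n \<beta> N om \<and> \<bar>massM \<alpha> n N om\<bar> \<le> m + 1}
    \<le> ennreal (exp (- 2 * t))"
proof -
  define \<sigma> where "\<sigma> = wick_var TYPE('d) \<alpha> N"
  have \<sigma>: "\<sigma> \<ge> 1" unfolding \<sigma>_def by (rule wick_var_ge_1)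
  have split: "{1..n} = {1, 2} \<union> {3..n}" using n by auto
  have "\<not> t / 2 \<le> a * wickX \<alpha> n \<beta> N om" if M: "\<bar>massM \<alpha> n N om\<bar> \<le> m + 1" for om :: "'d index => real"
  proof -
    let ?\<phi> = "\<lambda>i x. comp_field \<alpha> N om i x"
    have H: "hermite_multi n \<beta> (\<lambda>i. ?\<phi> i x) \<sigma> = ((?\<phi> 1 x)\<^sup>2 - \<sigma>) * ((?\<phi> 2 x)\<^sup>2 - \<sigma>)" for x
    proof -
      have "(\<Prod>i\<in>{3..n}. hermite (\<beta> i) (?\<phi> i x) \<sigma>) = 1" using \<beta>(3) by (intro prod.neutral) (simp add: hermite_0)
      then show ?thesis
        unfolding hermite_multi_def split by (subst prod.union_disjoint) (auto simp: \<beta>(2) \<beta>(1)[unfolded One_nat_def] hermite_2)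
    qed
    have pt: "- (\<sigma> * ((?\<phi> 1 x)\<^sup>2 + (?\<phi> 2 x)\<^sup>2)) \<le> hermite_multi n \<beta> (\<lambda>i. ?\<phi> i x) \<sigma>" for x
      unfolding H using mult_nonneg_nonneg[OF zero_le_power2[of "?\<phi> 1 x"] zero_le_power2[of "?\<phi> 2 x"]]
        zero_le_power2[of \<sigma>] by (simp add: algebra_simps power2_eq_square)
    have int: "integrable torus (\<lambda>x. (?\<phi> i x)\<^sup>2)" for i
      by (intro integrable_torus_continuous_power continuous_field)
    have "- (\<sigma> * ((\<integral>x. (?\<phi> 1 x)\<^sup>2 \<partial>torus) + (\<integral>x. (?\<phi> 2 x)\<^sup>2 \<partial>torus))) = (\<integral>x. - (\<sigma> * ((?\<phi> 1 x)\<^sup>2 + (?\<phi> 2 x)\<^sup>2)) \<partial>torus)"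
      using int by simp
    also have "\<dots> \<le> (\<integral>x. hermite_multi n \<beta> (\<lambda>i. ?\<phi> i x) \<sigma> \<partial>torus)"
    proof (rule integral_mono)
      show "integrable torus (\<lambda>x. hermite_multi n \<beta> (\<lambda>i. ?\<phi> i x) \<sigma>)"
        unfolding H by (intro continuous_imp_integrable_torus continuous_intros continuous_field)
    qed (use int pt in auto)
    also have "\<dots> = wickX \<alpha> n \<beta> N om" unfolding wickX_def wick_vars \<sigma>_def ..
    finally have X: "- (\<sigma> * ((\<integral>x. (?\<phi> 1 x)\<^sup>2 \<partial>torus) + (\<integral>x. (?\<phi> 2 x)\<^sup>2 \<partial>torus))) \<le> wickX \<alpha> n \<beta> N om" .
    have "(\<Sum>i=1..n. \<integral>x. (?\<phi> i x)\<^sup>2 \<partial>torus) = (\<integral>x. (?\<phi> 1 x)\<^sup>2 \<partial>torus) + (\<integral>x. (?\<phi> 2 x)\<^sup>2 \<partial>torus) + (\<Sum>i\<in>{3..n}. \<integral>x. (?\<phi> i x)\<^sup>2 \<partial>torus)"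
      unfolding split by (subst sum.union_disjoint) auto
    moreover have "0 \<le> (\<Sum>i\<in>{3..n}. \<integral>x. (?\<phi> i x)\<^sup>2 \<partial>torus)" by (intro sum_nonneg) simp
    ultimately have "(\<integral>x. (?\<phi> 1 x)\<^sup>2 \<partial>torus) + (\<integral>x. (?\<phi> 2 x)\<^sup>2 \<partial>torus) \<le> m + 1 + real n * \<sigma>"
      using M massM_eq[of \<alpha> n N om] unfolding \<sigma>_def by linarith
    also have "m + 1 + real n * \<sigma> < (real n + 3) * (\<sigma> * m)"
    proof -
      have "1 \<le> \<sigma> * m" using mult_mono[OF \<sigma> m] \<sigma> by simp
      moreover have "m \<le> \<sigma> * m" using mult_right_mono[OF \<sigma>, of m] m by simp
      moreover have "\<sigma> \<le> \<sigma> * m" using mult_left_mono[OF m, of \<sigma>] \<sigma> by simp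
      moreover have "real n * \<sigma> \<le> real n * (\<sigma> * m)" using calculation(3) by (rule mult_left_mono) simp
      moreover have "(real n + 3) * (\<sigma> * m) = real n * (\<sigma> * m) + 3 * (\<sigma> * m)" by (simp add: algebra_simps)
      ultimately show ?thesis by linarith
    qed
    finally have "\<sigma> * ((\<integral>x. (?\<phi> 1 x)\<^sup>2 \<partial>torus) + (\<integral>x. (?\<phi> 2 x)\<^sup>2 \<partial>torus)) < \<sigma> * ((real n + 3) * (\<sigma> * m))"
      using \<sigma> by (intro mult_strict_left_mono) auto
    then have "a * wickX \<alpha> n \<beta> N om < a * (- (\<sigma> * ((real n + 3) * (\<sigma> * m))))"
      using X a by (intro mult_strict_left_mono_neg) auto
    also have "\<dots> = \<bar>a\<bar> * (real n + 3) * (\<sigma>\<^sup>2 * m)" using a by (simp add: power2_eq_square)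
    also have "\<dots> \<le> \<bar>a\<bar> * (real n + 3) * (\<sigma> ^ 3 * m\<^sup>2)"
      using \<sigma> m by (intro mult_left_mono mult_mono) (auto simp: power_increasing self_le_power)
    also have "\<dots> \<le> t / 2"
    proof -
      have "0 \<le> \<bar>a\<bar> * (real n + 3) * (\<sigma> ^ 3 * m\<^sup>2)" using \<sigma> by simp
      then show ?thesis using t by (simp add: \<sigma>_def mult.assoc)
    qed
    finally show ?thesis by simp
  qed
  then have "{om :: 'd index => real. t / 2 \<le> a * wickX \<alpha> n \<beta> N om \<and> \<bar>massM \<alpha> n N om\<bar> \<le> m + 1} = {}" by blast
  then show ?thesis by (simp only: emeasure_empty zero_le)
qed

section \<open>Lower bounds from boxes in frequency space\<close>

definition box_set :: "nat => nat => ('d::finite index => real) => real => ('d index => real) set" where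
  "box_set n N f \<eta> = {om. \<forall>p\<in>vars n N. \<bar>om p - f p\<bar> \<le> \<eta>}"

text \<open>The factor 2 of the length of the interval absorbs the normalization of the density.\<close>

lemma gauss1_interval:
  assumes \<eta>: "0 < \<eta>" "\<eta> \<le> 1"
  shows "ennreal (\<eta> * exp (- (f\<^sup>2 + 2))) \<le> emeasure gauss1 {f - \<eta>..f + \<eta>}"
proof -
  have "\<eta> * exp (- (f\<^sup>2 + 2)) \<le> 2 * \<eta> * (exp (- (f\<^sup>2 + 1)) / sqrt (2 * pi))"
  proof -
    have "sqrt (2 * pi) \<le> 4" using pi_less_4 by (intro real_le_lsqrt) auto
    moreover have "2 \<le> exp (1::real)" using exp_ge_add_one_self[of 1] by simp
    ultimately have "sqrt (2 * pi) * exp (- 1) \<le> 4 * (1 / 2)"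
      by (intro mult_mono) (auto simp: exp_minus field_simps)
    then have "exp (- 1) \<le> 2 / sqrt (2 * pi)" by (simp add: field_simps)
    then have le: "\<eta> * exp (- (f\<^sup>2 + 1)) * exp (- 1) \<le> \<eta> * exp (- (f\<^sup>2 + 1)) * (2 / sqrt (2 * pi))"
      using \<eta> by (intro mult_left_mono) auto
    have "\<eta> * exp (- (f\<^sup>2 + 2)) = \<eta> * exp (- (f\<^sup>2 + 1)) * exp (- 1)"
      unfolding mult.assoc exp_add[symmetric] by simp
    also note le
    also have "\<eta> * exp (- (f\<^sup>2 + 1)) * (2 / sqrt (2 * pi)) = 2 * \<eta> * (exp (- (f\<^sup>2 + 1)) / sqrt (2 * pi))" by simp
    finally show ?thesis .
  qed
  then have "ennreal (\<eta> * exp (- (f\<^sup>2 + 2))) \<le> ennreal (exp (- (f\<^sup>2 + 1)) / sqrt (2 * pi)) * ennreal (2 * \<eta>)"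
    using \<eta> by (simp add: mult_ac ennreal_leI flip: ennreal_mult)
  also have "\<dots> = (\<integral>\<^sup>+z. ennreal (exp (- (f\<^sup>2 + 1)) / sqrt (2 * pi)) * indicator {f - \<eta>..f + \<eta>} z \<partial>lborel)"
    using \<eta> by (subst nn_integral_cmult_indicator) auto
  also have "\<dots> \<le> (\<integral>\<^sup>+z. ennreal (std_normal_density z) * indicator {f - \<eta>..f + \<eta>} z \<partial>lborel)"
  proof (intro nn_integral_mono)
    fix z
    have "exp (- (f\<^sup>2 + 1)) / sqrt (2 * pi) \<le> std_normal_density z" if "z \<in> {f - \<eta>..f + \<eta>}"
    proof -
      have "\<bar>z - f\<bar> \<le> \<eta>" using that by (simp add: abs_le_iff)
      then have "\<bar>z - f\<bar> \<le> 1" using \<eta> by linarith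
      then have "(z - f)\<^sup>2 \<le> 1" by (simp add: abs_square_le_1)
      moreover have "2 * f\<^sup>2 + 2 * (z - f)\<^sup>2 - z\<^sup>2 = (2 * f - z)\<^sup>2"
        by (simp add: power2_eq_square algebra_simps)
      ultimately have "z\<^sup>2 / 2 \<le> f\<^sup>2 + 1" using zero_le_power2[of "2 * f - z"] by linarith
      then show ?thesis by (simp add: std_normal_density_def divide_right_mono)
    qed
    then show "ennreal (exp (- (f\<^sup>2 + 1)) / sqrt (2 * pi)) * indicator {f - \<eta>..f + \<eta>} z \<le> ennreal (std_normal_density z) * indicator {f - \<eta>..f + \<eta>} z"
      by (auto simp: indicator_def intro: ennreal_leI)
  qed
  also have "\<dots> = emeasure gauss1 {f - \<eta>..f + \<eta>}"
    unfolding gauss1_def by (subst emeasure_density) auto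
  finally show ?thesis .
qed

lemma box_set_sets: "box_set n N f \<eta> \<in> sets gauss"
proof -
  have "{om \<in> space gauss. \<forall>p\<in>vars n N. \<bar>om p - f p\<bar> \<le> \<eta>} \<in> sets gauss" by measurable
  then show ?thesis by (simp add: box_set_def)
qed

lemma box_set_prob:
  fixes f :: "'d::finite index => real"
  assumes \<eta>: "0 < \<eta>" "\<eta> \<le> 1"
  shows "\<eta> ^ card (vars n N :: 'd index set) * exp (- (\<Sum>p\<in>vars n N. (f p)\<^sup>2) - 2 * real (card (vars n N :: 'd index set)))
    \<le> measure gauss (box_set n N f \<eta>)"
proof -
  let ?V = "vars n N :: 'd index set"
  have "ennreal (\<eta> ^ card ?V * exp (- (\<Sum>p\<in>?V. (f p)\<^sup>2) - 2 * real (card ?V))) = (\<Prod>p\<in>?V. ennreal (\<eta> * exp (- ((f p)\<^sup>2 + 2))))"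
  proof -
    have "\<eta> ^ card ?V * exp (- (\<Sum>p\<in>?V. (f p)\<^sup>2) - 2 * real (card ?V)) = (\<Prod>p\<in>?V. \<eta> * exp (- ((f p)\<^sup>2 + 2)))"
      unfolding prod.distrib prod_constant by (simp add: exp_sum[symmetric] sum_negf sum.distrib sum_subtractf)
    then show ?thesis using \<eta> by (simp add: prod_ennreal)
  qed
  also have "\<dots> \<le> (\<Prod>p\<in>?V. emeasure gauss1 {f p - \<eta>..f p + \<eta>})"
    proof -
    have "(\<Prod>p\<in>V. ennreal (\<eta> * exp (- ((f p)\<^sup>2 + 2)))) \<le> (\<Prod>p\<in>V. emeasure gauss1 {f p - \<eta>..f p + \<eta>})" if "finite V" for V
      using that by (induction V) (auto intro!: mult_mono gauss1_interval[OF \<eta>, simplified] gauss1_interval \<eta>)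
    then show ?thesis by simp
  qed
  also have "\<dots> = emeasure gauss {om \<in> space gauss. \<forall>p\<in>?V. om p \<in> {f p - \<eta>..f p + \<eta>}}"
    by (subst gauss.emeasure_PiM_Collect) (auto simp: gauss1_def)
  also have "{om \<in> space gauss. \<forall>p\<in>?V. om p \<in> {f p - \<eta>..f p + \<eta>}} = box_set n N f \<eta>"
    by (auto simp: box_set_def abs_le_iff algebra_simps)
  finally show ?thesis by (simp add: gauss.P.emeasure_eq_measure ennreal_le_iff)
qed

lemma dep_on_box: "dep_on (vars n N) (\<lambda>om. indicator (box_set n N f \<eta>) om :: real)"
  by (auto simp: dep_on_def box_set_def indicator_def)

text \<open>
  The martingale property turns the box average of the limit into the average of a truncation,
  and Jensen's inequality in the box does the rest.
\<close>

lemma box_lower_bound: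
  fixes f :: "'d::finite index => real" and \<beta> :: "nat => nat"
  assumes \<alpha>: "\<alpha> = real CARD('d) / 2" and k: "(\<Sum>i=1..n. \<beta> i) \<ge> 2"
    and G [measurable]: "G \<in> borel_measurable gauss"
    and Gi: "integrable gauss (\<lambda>om. G om * indicator (box_set n N f \<eta>) om)"
    and Gc: "(\<integral>om. G om * indicator (box_set n N f \<eta>) om \<partial>gauss) \<le> c * measure gauss (box_set n N f \<eta>)"
    and g: "\<And>om. om \<in> box_set n N f \<eta> ==> g \<le> a * wickX \<alpha> n \<beta> N om"
  shows "ennreal (exp (g - c) * measure gauss (box_set n N f \<eta>)) \<le> (\<integral>\<^sup>+om. ennreal (exp (a * limX \<alpha> n \<beta> om - G om)) \<partial>gauss)"
proof -
  let ?A = "box_set n N f \<eta>" and ?p = "measure gauss (box_set n N f \<eta>)"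
  note A [measurable] = box_set_sets[of n N f \<eta>]
  let ?I = "\<lambda>om. indicator ?A om :: real"
  obtain C \<epsilon> where ch: "chaos_sequence (wickX \<alpha> n \<beta> :: nat => ('d index => real) => real) (vars n) (\<Sum>i=1..n. \<beta> i) C \<epsilon>"
    using wick_chaos[OF k \<alpha>] by blast
  interpret X: chaos_sequence "wickX \<alpha> n \<beta> :: nat => ('d index => real) => real" "vars n" "\<Sum>i=1..n. \<beta> i" C \<epsilon>
    by (rule ch)
  have lim: "limX \<alpha> n \<beta> = X.Y" by (simp add: limX_def X.Y_def fun_eq_iff)
  have am: "all_moments ?I" by (rule all_moments_bounded[where C = 1]) (auto simp: indicator_def)
  note mart = wickX_martingale[OF _ dep_on_box am]
  have L: "integrable gauss (\<lambda>om. X.Y om * ?I om)" "(\<integral>om. X.Y om * ?I om \<partial>gauss) = (\<integral>om. wickX \<alpha> n \<beta> N om * ?I om \<partial>gauss)"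
    by (rule X.limit_expectation; (rule mart)?; simp add: indicator_def)+
  have Ii: "integrable gauss ?I" and Ip: "integral\<^sup>L gauss ?I = ?p" using all_moments_integrable[OF am] by simp_all
  define F where "F om = a * X.Y om - G om" for om
  define m where "m = g - c"
  have "g * ?p = (\<integral>om. g * ?I om \<partial>gauss)" using Ip by simp
  also have "\<dots> \<le> (\<integral>om. a * (wickX \<alpha> n \<beta> N om * ?I om) \<partial>gauss)"
  proof (rule integral_mono)
    show "integrable gauss (\<lambda>om. a * (wickX \<alpha> n \<beta> N om * ?I om))"
      by (intro integrable_mult_right all_moments_integrable all_moments_mult am all_moments_wickX)
    show "g * ?I om \<le> a * (wickX \<alpha> n \<beta> N om * ?I om)" for om
      using g[of om] by (auto simp: indicator_def)
  qed (use Ii in simp)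
  also have "\<dots> = a * (\<integral>om. X.Y om * ?I om \<partial>gauss)" by (simp add: L)
  finally have gp: "g * ?p \<le> a * (\<integral>om. X.Y om * ?I om \<partial>gauss)" .
  define h where "h om = exp m * ((1 - m) * ?I om + a * (X.Y om * ?I om) - G om * ?I om)" for om
  have hi: "integrable gauss h" unfolding h_def by (intro integrable_mult_right Bochner_Integration.integrable_diff Bochner_Integration.integrable_add Ii L Gi)
  have "exp m * ?p \<le> exp m * ((1 - m) * ?p + a * (\<integral>om. X.Y om * ?I om \<partial>gauss) - (\<integral>om. G om * ?I om \<partial>gauss))"
    using gp Gc by (intro mult_left_mono) (auto simp: m_def algebra_simps)
  also have "\<dots> = integral\<^sup>L gauss h"
    unfolding h_def using Ii L(1) Gi Ip by simp
  also have "\<dots> \<le> (\<integral>om. max 0 (h om) \<partial>gauss)" by (intro integral_mono integrable_max hi) auto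
  finally have "ennreal (exp m * ?p) \<le> ennreal (\<integral>om. max 0 (h om) \<partial>gauss)" by (rule ennreal_leI)
  also have "\<dots> = (\<integral>\<^sup>+om. ennreal (max 0 (h om)) \<partial>gauss)"
    by (intro nn_integral_eq_integral[symmetric] integrable_max hi) auto
  also have "\<dots> \<le> (\<integral>\<^sup>+om. ennreal (exp (a * limX \<alpha> n \<beta> om - G om)) \<partial>gauss)"
  proof (intro nn_integral_mono ennreal_leI)
    fix om
    have "h om \<le> exp (F om)"
    proof (cases "om \<in> ?A")
      case True
      then have "h om = exp m * (1 + (F om - m))" by (simp add: h_def F_def algebra_simps)
      also have "\<dots> \<le> exp m * exp (F om - m)" by (intro mult_left_mono exp_ge_add_one_self) auto
      finally show ?thesis by (simp add: exp_add[symmetric])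
    qed (simp add: h_def)
    then show "max 0 (h om) \<le> exp (a * limX \<alpha> n \<beta> om - G om)" by (simp add: F_def lim)
  qed
  finally show ?thesis unfolding m_def .
qed

subsection \<open>The Wick mass in a box\<close>

lemma torus_integral_Re_char:
  assumes "l ~= 0"
  shows "(\<integral>x. Re (c * fourier_char l x) \<partial>torus) = 0"
proof -
  have i: "integrable torus (\<lambda>x. c * fourier_char l x)"
    by (intro continuous_imp_integrable_torus continuous_intros)
  have "(\<integral>x. Re (c * fourier_char l x) \<partial>torus) = Re (\<integral>x. c * fourier_char l x \<partial>torus)"
    by (rule integral_Re[OF i])
  also have "(\<integral>x. c * fourier_char l x \<partial>torus) = 0"
    using assms torus_integral_fourier_char[of l] by (simp add: torus_integral_eq)
  finally show ?thesis by simp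
qed

text \<open>A product of two modes is a combination of characters of the sum and the difference of their frequencies.\<close>

lemma mode_orthogonal:
  assumes "fst j ~= fst k" "fst j ~= - fst k"
  shows "(\<integral>x. mode \<alpha> j x * mode \<alpha> k x \<partial>torus) = 0"
proof -
  define e where "e b = (if b then 1 else \<i>)" for b
  define c where "c = bracket2 (fst j) powr (- \<alpha> / 2) * bracket2 (fst k) powr (- \<alpha> / 2) / 2"
  have m: "mode \<alpha> j x = bracket2 (fst j) powr (- \<alpha> / 2) * Re (e (snd j) * fourier_char (fst j) x)" for j :: "(int ^ 'd) \<times> bool" and x
    by (simp add: mode_def e_def)
  have rr: "Re u * Re v = (Re (u * v) + Re (u * cnj v)) / 2" for u v :: complex by simp
  have pt: "mode \<alpha> j x * mode \<alpha> k x = c * (Re (e (snd j) * e (snd k) * fourier_char (fst j + fst k) x) +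
      Re (e (snd j) * cnj (e (snd k)) * fourier_char (fst j + - fst k) x))" for x
    unfolding m fourier_char_add fourier_char_uminus c_def
    using rr[of "e (snd j) * fourier_char (fst j) x" "e (snd k) * fourier_char (fst k) x"]
    by (simp add: mult_ac)
  have "(\<integral>x. mode \<alpha> j x * mode \<alpha> k x \<partial>torus) =
      c * ((\<integral>x. Re (e (snd j) * e (snd k) * fourier_char (fst j + fst k) x) \<partial>torus) +
      (\<integral>x. Re (e (snd j) * cnj (e (snd k)) * fourier_char (fst j + - fst k) x) \<partial>torus))"
    unfolding pt integral_mult_right_zero
    by (subst Bochner_Integration.integral_add) (auto intro!: continuous_imp_integrable_torus continuous_intros)
  also have "\<dots> = 0"
    using assms by (subst (1 2) torus_integral_Re_char) (auto simp: eq_neg_iff_add_eq_0)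
  finally show ?thesis .
qed

text \<open>The mass is quadratic, and the cross terms between old and new modes vanish by orthogonality.\<close>

lemma massM_increment_dep_on:
  assumes "N \<le> L"
  shows "dep_on (vars n L - vars n N) (\<lambda>om. massM \<alpha> n L om - massM \<alpha> n N (om :: 'd::finite index => real))"
proof -
  define R :: "((int ^ 'd) \<times> bool) set" where "R = modes L - modes N"
  have fR: "finite R" by (simp add: R_def)
  have sub: "modes N \<subseteq> (modes L :: ((int ^ 'd) \<times> bool) set)" using lattice_ball_mono[OF assms] by auto
  define \<psi> where "\<psi> om i x = (\<Sum>j\<in>R. mode \<alpha> j x * om (i, j))" for om :: "'d index => real" and i x
  have c\<psi>: "continuous_on UNIV (\<psi> om i)" for om i
    unfolding \<psi>_def by (intro continuous_intros continuous_mode)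
  have split: "comp_field \<alpha> L om i x = comp_field \<alpha> N om i x + \<psi> om i x" for om i x
    unfolding field_def \<psi>_def R_def using sum.subset_diff[OF sub finite_modes] by (simp add: add.commute)
  have orth: "(\<integral>x. comp_field \<alpha> N om i x * \<psi> om i x \<partial>torus) = 0" for om i
  proof -
    have "(\<integral>x. comp_field \<alpha> N om i x * \<psi> om i x \<partial>torus) =
        (\<integral>x. (\<Sum>j\<in>modes N. \<Sum>k\<in>R. (om (i, j) * om (i, k)) * (mode \<alpha> j x * mode \<alpha> k x)) \<partial>torus)"
      unfolding field_def \<psi>_def sum_product by (simp add: mult_ac)
    also have "\<dots> = (\<Sum>j\<in>modes N. \<Sum>k\<in>R. \<integral>x. (om (i, j) * om (i, k)) * (mode \<alpha> j x * mode \<alpha> k x) \<partial>torus)"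
      by (subst Bochner_Integration.integral_sum, intro continuous_imp_integrable_torus continuous_intros continuous_mode)
        (intro sum.cong refl Bochner_Integration.integral_sum continuous_imp_integrable_torus continuous_intros continuous_mode)
    also have "\<dots> = 0"
    proof (intro sum.neutral ballI)
      fix j k :: "(int ^ 'd) \<times> bool" assume j: "j \<in> modes N" and k: "k \<in> R"
      then have "fst j ~= fst k" "fst j ~= - fst k" by (auto simp: R_def)
      then show "(\<integral>x. (om (i, j) * om (i, k)) * (mode \<alpha> j x * mode \<alpha> k x) \<partial>torus) = 0"
        by (simp add: mode_orthogonal)
    qed
    finally show ?thesis .
  qed
  have sq: "(\<integral>x. (comp_field \<alpha> L om i x)\<^sup>2 \<partial>torus) = (\<integral>x. (comp_field \<alpha> N om i x)\<^sup>2 \<partial>torus) + (\<integral>x. (\<psi> om i x)\<^sup>2 \<partial>torus)" for om i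
  proof -
    have "(\<integral>x. (comp_field \<alpha> L om i x)\<^sup>2 \<partial>torus) =
        (\<integral>x. ((comp_field \<alpha> N om i x)\<^sup>2 + (\<psi> om i x)\<^sup>2) + 2 * (comp_field \<alpha> N om i x * \<psi> om i x) \<partial>torus)"
      unfolding split by (simp add: power2_sum mult.assoc)
    also have "\<dots> = (\<integral>x. (comp_field \<alpha> N om i x)\<^sup>2 + (\<psi> om i x)\<^sup>2 \<partial>torus) + (\<integral>x. 2 * (comp_field \<alpha> N om i x * \<psi> om i x) \<partial>torus)"
      by (rule Bochner_Integration.integral_add)
        (intro continuous_imp_integrable_torus continuous_intros continuous_field c\<psi>)+
    also have "(\<integral>x. (comp_field \<alpha> N om i x)\<^sup>2 + (\<psi> om i x)\<^sup>2 \<partial>torus) = (\<integral>x. (comp_field \<alpha> N om i x)\<^sup>2 \<partial>torus) + (\<integral>x. (\<psi> om i x)\<^sup>2 \<partial>torus)"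
      by (rule Bochner_Integration.integral_add)
        (intro continuous_imp_integrable_torus continuous_intros continuous_field c\<psi>)+
    finally show ?thesis by (simp add: orth)
  qed
  have eq: "massM \<alpha> n L om - massM \<alpha> n N om =
      (\<Sum>i=1..n. \<integral>x. (\<psi> om i x)\<^sup>2 \<partial>torus) - real n * wick_var TYPE('d) \<alpha> L + real n * wick_var TYPE('d) \<alpha> N" for om
    unfolding massM_eq sq by (simp add: sum.distrib)
  show ?thesis unfolding dep_on_def eq
  proof (intro allI impI)
    fix om om' :: "'d index => real" assume "\<forall>p\<in>vars n L - vars n N. om p = om' p"
    then have "\<psi> om i = \<psi> om' i" if "i \<in> {1..n}" for i
      using that unfolding \<psi>_def by (intro ext sum.cong) (auto simp: R_def vars_def)
    then have "(\<Sum>i=1..n. \<integral>x. (\<psi> om i x)\<^sup>2 \<partial>torus) = (\<Sum>i=1..n. \<integral>x. (\<psi> om' i x)\<^sup>2 \<partial>torus)"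
      by (intro sum.cong) auto
    then show "(\<Sum>i=1..n. \<integral>x. (\<psi> om i x)\<^sup>2 \<partial>torus) - real n * wick_var TYPE('d) \<alpha> L + real n * wick_var TYPE('d) \<alpha> N =
      (\<Sum>i=1..n. \<integral>x. (\<psi> om' i x)\<^sup>2 \<partial>torus) - real n * wick_var TYPE('d) \<alpha> L + real n * wick_var TYPE('d) \<alpha> N" by simp
  qed
qed

text \<open>
  Inside a box on which the truncated mass is bounded, the full mass has bounded moments: the
  remaining increment is independent of the box.
\<close>

lemma box_mass_moment:
  assumes \<alpha>: "\<alpha> = real CARD('d::finite) / 2" and n: "n \<ge> 1" and b: "b > 0"
  shows "\<exists>c\<ge>0. \<forall>N \<eta> (f :: 'd index => real). (\<forall>om\<in>box_set n N f \<eta>. \<bar>massM \<alpha> n N om\<bar> \<le> m0) -->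
    integrable gauss (\<lambda>om. \<bar>limM \<alpha> n om\<bar> powr b * indicator (box_set n N f \<eta>) om) \<and>
    (\<integral>om. \<bar>limM \<alpha> n om\<bar> powr b * indicator (box_set n N f \<eta>) om \<partial>gauss) \<le> c * measure gauss (box_set n N f \<eta>)"
proof -
  obtain C \<epsilon> where ch: "chaos_sequence (massM \<alpha> n :: nat => ('d index => real) => real) (vars n) 2 C \<epsilon>"
    using mass_chaos[OF \<alpha> n] by blast
  interpret M: chaos_sequence "massM \<alpha> n :: nat => ('d index => real) => real" "vars n" 2 C \<epsilon>
    by (rule ch)
  have lim: "limM \<alpha> n = M.Y" by (simp add: limM_def M.Y_def fun_eq_iff)
  obtain r :: nat where "b < 2 ^ r" using real_arch_pow[of 2 b] by auto
  define q :: nat where "q = 2 * 2 ^ r"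
  define B where "B = (16 ^ (2 * r) * C) ^ (2 ^ r)"
  define c where "c = 1 + 2 ^ q * (\<bar>m0\<bar> ^ q + B)"
  have C0: "C \<ge> 0" by (rule M.C)
  have B0: "B \<ge> 0" using C0 by (simp add: B_def)
  have qb: "b \<le> real q"
  proof -
    have "real q = 2 * 2 ^ r" by (simp add: q_def)
    then show ?thesis using \<open>b < 2 ^ r\<close> b by linarith
  qed
  have DC: "M.D N \<le> C" for N
  proof -
    have "(1 + (real N)\<^sup>2) powr (- \<epsilon>) \<le> 1 powr (- \<epsilon>)" using M.\<epsilon> by (intro powr_mono2') auto
    then show ?thesis unfolding M.D_def using C0 by (simp add: mult_left_le)
  qed
  have "integrable gauss (\<lambda>om. \<bar>limM \<alpha> n om\<bar> powr b * indicator (box_set n N f \<eta>) om) \<and>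
    (\<integral>om. \<bar>limM \<alpha> n om\<bar> powr b * indicator (box_set n N f \<eta>) om \<partial>gauss) \<le> c * measure gauss (box_set n N f \<eta>)"
    if box: "\<forall>om\<in>box_set n N f \<eta>. \<bar>massM \<alpha> n N om\<bar> \<le> m0" for N \<eta> and f :: "'d index => real"
  proof -
    let ?A = "box_set n N f \<eta>" and ?p = "measure gauss (box_set n N f \<eta>)"
    note A [measurable] = box_set_sets[of n N f \<eta>]
    have [measurable]: "massM \<alpha> n L \<in> borel_measurable (gauss :: ('d index => real) measure)" for L
      by (rule M.X_measurable)
    have [measurable]: "M.Y \<in> borel_measurable gauss" by (rule M.Y_measurable)
    let ?I = "\<lambda>om. indicator ?A om :: real"
    have am: "all_moments ?I" by (rule all_moments_bounded[where C = 1]) (auto simp: indicator_def)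
    have Ip: "integral\<^sup>L gauss ?I = ?p" by simp
    have fin: "(\<integral>\<^sup>+om. ennreal ((massM \<alpha> n L om - massM \<alpha> n N om) ^ q * ?I om) \<partial>gauss) \<le> ennreal (B * ?p)" if "N \<le> L" for L
    proof -
      let ?d = "\<lambda>om. massM \<alpha> n L om - massM \<alpha> n N (om :: 'd index => real)"
      have amd: "all_moments (\<lambda>om. ?d om ^ q)" by (intro all_moments_power all_moments_diff M.X_moments)
      have dep: "dep_on (vars n L - vars n N) (\<lambda>om. ?d om ^ q)"
        using massM_increment_dep_on[OF that, of n \<alpha>] unfolding dep_on_def by metis
      have ii: "integrable gauss (\<lambda>om. ?d om ^ q * ?I om)"
        by (rule all_moments_integrable[OF all_moments_mult[OF amd am]])
      have E: "(\<integral>om. ?d om ^ q * ?I om \<partial>gauss) = (\<integral>om. ?d om ^ q \<partial>gauss) * ?p"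
        unfolding Ip[symmetric]
        by (rule gauss_indep_mult[OF dep dep_on_box]) (use all_moments_integrable[OF amd] all_moments_integrable[OF am] ii in auto)
      have "ennreal (\<integral>om. ?d om ^ q \<partial>gauss) = (\<integral>\<^sup>+om. ennreal (?d om ^ q) \<partial>gauss)"
        by (rule nn_integral_eq_integral[OF all_moments_integrable[OF amd], symmetric]) (simp add: q_def)
      also have "\<dots> \<le> ennreal ((16 ^ (2 * r) * M.D N) ^ (2 ^ r))" unfolding q_def by (rule M.increment_moment[OF that])
      also have "\<dots> \<le> ennreal B"
        unfolding B_def using M.D_nonneg by (intro ennreal_leI power_mono mult_left_mono DC) auto
      finally have "(\<integral>om. ?d om ^ q \<partial>gauss) \<le> B" using B0 by (simp add: ennreal_le_iff)
      then have "(\<integral>om. ?d om ^ q * ?I om \<partial>gauss) \<le> B * ?p" unfolding E by (intro mult_right_mono) auto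
      then show ?thesis
        by (subst nn_integral_eq_integral[OF ii]) (auto intro!: ennreal_leI simp: q_def)
    qed
    have "(\<integral>\<^sup>+om. ennreal ((M.Y om - massM \<alpha> n N om) ^ q * ?I om) \<partial>gauss) =
        (\<integral>\<^sup>+om. liminf (\<lambda>L. ennreal ((massM \<alpha> n L om - massM \<alpha> n N om) ^ q * ?I om)) \<partial>gauss)"
    proof (rule nn_integral_cong_AE, use M.AE_limit in eventually_elim)
      case (elim om)
      have "(\<lambda>L. ennreal ((massM \<alpha> n L om - massM \<alpha> n N om) ^ q * ?I om)) \<longlonglongrightarrow> ennreal ((M.Y om - massM \<alpha> n N om) ^ q * ?I om)"
        by (intro tendsto_ennrealI tendsto_intros elim)
      then show ?case by (intro lim_imp_Liminf[symmetric]) auto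
    qed
    also have "\<dots> \<le> liminf (\<lambda>L. \<integral>\<^sup>+om. ennreal ((massM \<alpha> n L om - massM \<alpha> n N om) ^ q * ?I om) \<partial>gauss)"
      by (rule nn_integral_liminf) simp
    also have "\<dots> \<le> liminf (\<lambda>L. ennreal (B * ?p))"
      by (rule Liminf_mono) (auto intro: eventually_mono[OF eventually_ge_at_top[of N]] fin)
    finally have lm: "(\<integral>\<^sup>+om. ennreal ((M.Y om - massM \<alpha> n N om) ^ q * ?I om) \<partial>gauss) \<le> ennreal (B * ?p)"
      by (simp add: Liminf_const)
    have pt: "\<bar>M.Y om\<bar> powr b * ?I om \<le> (1 + 2 ^ q * \<bar>m0\<bar> ^ q) * ?I om + 2 ^ q * ((M.Y om - massM \<alpha> n N om) ^ q * ?I om)" for om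
    proof (cases "om \<in> ?A")
      case True
      define d where "d = M.Y om - massM \<alpha> n N om"
      have dq: "d ^ q = \<bar>d\<bar> ^ q" by (simp add: q_def power_even_abs)
      have "\<bar>M.Y om\<bar> powr b \<le> 1 + \<bar>M.Y om\<bar> ^ q"
      proof (cases "\<bar>M.Y om\<bar> \<le> 1")
        case True
        then have "\<bar>M.Y om\<bar> powr b \<le> 1 powr b" using b by (intro powr_mono2) auto
        then show ?thesis by (simp add: add_increasing2)
      next
        case False
        then have "\<bar>M.Y om\<bar> powr b \<le> \<bar>M.Y om\<bar> powr real q" using qb by (intro powr_mono) auto
        then show ?thesis using False by (simp add: powr_realpow)
      qed
      also have "\<bar>M.Y om\<bar> ^ q \<le> (2 * max \<bar>m0\<bar> \<bar>d\<bar>) ^ q"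
      proof (rule power_mono)
        have "\<bar>M.Y om\<bar> \<le> m0 + \<bar>d\<bar>" using box True unfolding d_def by force
        then show "\<bar>M.Y om\<bar> \<le> 2 * max \<bar>m0\<bar> \<bar>d\<bar>" by linarith
      qed simp
      also have "\<dots> \<le> 2 ^ q * (\<bar>m0\<bar> ^ q + \<bar>d\<bar> ^ q)"
        unfolding power_mult_distrib by (intro mult_left_mono) (auto simp: max_def)
      finally show ?thesis using True by (simp add: dq[unfolded d_def] d_def algebra_simps)
    qed simp
    have "(\<integral>\<^sup>+om. ennreal (\<bar>M.Y om\<bar> powr b * ?I om) \<partial>gauss) \<le>
        (\<integral>\<^sup>+om. ennreal (1 + 2 ^ q * \<bar>m0\<bar> ^ q) * ennreal (?I om) + ennreal (2 ^ q) * ennreal ((M.Y om - massM \<alpha> n N om) ^ q * ?I om) \<partial>gauss)"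
    proof (intro nn_integral_mono)
      fix om
      have nn: "0 \<le> 1 + 2 ^ q * \<bar>m0\<bar> ^ q" "0 \<le> (2::real) ^ q" "0 \<le> ?I om" "0 \<le> (M.Y om - massM \<alpha> n N om) ^ q * ?I om"
        by (auto simp: q_def add_nonneg_nonneg)
      show "ennreal (\<bar>M.Y om\<bar> powr b * ?I om) \<le> ennreal (1 + 2 ^ q * \<bar>m0\<bar> ^ q) * ennreal (?I om) + ennreal (2 ^ q) * ennreal ((M.Y om - massM \<alpha> n N om) ^ q * ?I om)"
        unfolding ennreal_mult[OF nn(1,3), symmetric] ennreal_mult[OF nn(2,4), symmetric]
          ennreal_plus[OF mult_nonneg_nonneg[OF nn(1,3)] mult_nonneg_nonneg[OF nn(2,4)], symmetric]
        by (rule ennreal_leI[OF pt])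
    qed
    also have "\<dots> = ennreal (1 + 2 ^ q * \<bar>m0\<bar> ^ q) * ennreal ?p +
        ennreal (2 ^ q) * (\<integral>\<^sup>+om. ennreal ((M.Y om - massM \<alpha> n N om) ^ q * ?I om) \<partial>gauss)"
      by (subst nn_integral_add; (subst nn_integral_cmult)?)
        (auto simp: ennreal_indicator nn_integral_cmult gauss.P.emeasure_eq_measure)
    also have "\<dots> \<le> ennreal (1 + 2 ^ q * \<bar>m0\<bar> ^ q) * ennreal ?p + ennreal (2 ^ q) * ennreal (B * ?p)"
      by (intro add_left_mono mult_left_mono lm) auto
    also have "\<dots> = ennreal ((1 + 2 ^ q * \<bar>m0\<bar> ^ q) * ?p + 2 ^ q * (B * ?p))"
      using B0 by (subst ennreal_plus; (subst ennreal_mult)?; (subst ennreal_mult)?) (auto simp: add_nonneg_nonneg)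
    also have "(1 + 2 ^ q * \<bar>m0\<bar> ^ q) * ?p + 2 ^ q * (B * ?p) = c * ?p" by (simp add: c_def algebra_simps)
    finally have fin: "(\<integral>\<^sup>+om. ennreal (\<bar>M.Y om\<bar> powr b * ?I om) \<partial>gauss) \<le> ennreal (c * ?p)" .
    have int: "integrable gauss (\<lambda>om. \<bar>M.Y om\<bar> powr b * ?I om)"
      using fin by (intro integrableI_nonneg) (auto intro: le_less_trans)
    have "ennreal (\<integral>om. \<bar>M.Y om\<bar> powr b * ?I om \<partial>gauss) \<le> ennreal (c * ?p)"
      using fin by (subst nn_integral_eq_integral[OF int, symmetric]) auto
    moreover have "0 \<le> c * ?p" using B0 by (simp add: c_def)
    ultimately show ?thesis using int by (simp add: ennreal_le_iff lim)
  qed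
  moreover have "c \<ge> 0" using B0 by (simp add: c_def add_nonneg_nonneg)
  ultimately show ?thesis by blast
qed

section \<open>Directions of growth of the Hermite product\<close>

lemma hermite_uminus: "He k (- y) = (- 1) ^ k * He k y"
proof (induction k rule: less_induct)
  case (less k)
  show ?case
  proof (cases k)
    case 0
    then show ?thesis by (simp add: hermite_0)
  next
    case (Suc m)
    show ?thesis
    proof (cases m)
      case 0
      then show ?thesis using Suc by (simp add: hermite_Suc hermite_0)
    next
      case (Suc m')
      then have k: "k = Suc (Suc m')" using \<open>k = Suc m\<close> by simp
      have e: "He (Suc (Suc m')) z = z * He (Suc m') z - real (Suc m') * He m' z" for z
        by (simp add: hermite_Suc[of "Suc m'"])
      have IH: "He (Suc m') (- y) = (- 1) ^ Suc m' * He (Suc m') y" "He m' (- y) = (- 1) ^ m' * He m' y"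
        by (rule less; simp add: k)+
      show ?thesis unfolding k e IH by (simp add: algebra_simps)
    qed
  qed
qed

text \<open>For \<open>y\<close> beyond twice the degree, the recursion gives \<open>He (k + 1) y \<ge> (y / 2) He k y\<close>.\<close>

lemma He_ge_power:
  assumes "y \<ge> 2 * real K" "k \<le> K"
  shows "(y / 2) ^ k \<le> He k y"
proof -
  have y: "y \<ge> 0" using assms(1) of_nat_0_le_iff[of K] by linarith
  have "(y / 2) ^ k \<le> He k y \<and> (Suc k \<le> K --> y / 2 * He k y \<le> He (Suc k) y)" if "k \<le> K" for k
    using that
  proof (induction k)
    case 0
    then show ?case using y by (simp add: hermite_0 hermite_Suc)
  next
    case (Suc k)
    then have IH: "(y / 2) ^ k \<le> He k y" "y / 2 * He k y \<le> He (Suc k) y" by auto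
    have "(y / 2) ^ Suc k \<le> y / 2 * He k y" using mult_left_mono[OF IH(1), of "y / 2"] y by simp
    then have 1: "(y / 2) ^ Suc k \<le> He (Suc k) y" using IH(2) by linarith
    then have pos: "0 \<le> He (Suc k) y" using y by (meson divide_nonneg_nonneg order_trans zero_le_numeral zero_le_power)
    have 2: "y / 2 * He (Suc k) y \<le> He (Suc (Suc k)) y" if "Suc (Suc k) \<le> K"
    proof -
      have "2 * real (Suc k) \<le> 2 * real K" using that by (intro mult_left_mono) auto
      then have ky: "2 * real (Suc k) \<le> y" using assms(1) by (rule order_trans)
      have y2: "1 \<le> y / 2" using ky by simp
      have "real (Suc k) * He k y \<le> y / 2 * He k y"
        using ky order_trans[OF zero_le_power IH(1)] y by (intro mult_right_mono) auto
      also have "\<dots> \<le> 1 * He (Suc k) y" using IH(2) by simp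
      also have "\<dots> \<le> y / 2 * He (Suc k) y" using y2 pos by (intro mult_right_mono) auto
      finally have "real (Suc k) * He k y \<le> y / 2 * He (Suc k) y" .
      moreover have "He (Suc (Suc k)) y = y * He (Suc k) y - real (Suc k) * He k y"
        by (simp add: hermite_Suc[of "Suc k"])
      moreover have "y * He (Suc k) y = y / 2 * He (Suc k) y + y / 2 * He (Suc k) y" by simp
      ultimately show ?thesis by linarith
    qed
    show ?case using 1 2 by blast
  qed
  then show ?thesis using assms(2) by blast
qed

lemma He_growth:
  assumes u: "u = 1 \<or> u = - 1" and \<tau>: "\<tau> \<ge> 2 * real k + 2" and \<delta>: "\<bar>\<delta>\<bar> \<le> 1"
  shows "(1 / 4) ^ k * \<tau> ^ k \<le> u ^ k * He k (u * \<tau> + \<delta>)"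
proof -
  have *: "(1 / 4) ^ k * \<tau> ^ k \<le> He k (\<tau> + d)" if "\<bar>d\<bar> \<le> 1" for d
  proof -
    have t2: "\<tau> \<ge> 2" using \<tau> of_nat_0_le_iff[of k, where 'a = real] by linarith
    have d1: "- 1 \<le> d" using that by (simp add: abs_le_iff)
    have "(1 / 4) ^ k * \<tau> ^ k = (\<tau> / 4) ^ k" by (simp add: power_divide)
    also have "\<dots> \<le> ((\<tau> + d) / 2) ^ k" using t2 d1 by (intro power_mono) (simp_all add: field_simps)
    also have "\<dots> \<le> He k (\<tau> + d)" by (rule He_ge_power[of k]) (use d1 \<tau> in auto)
    finally show ?thesis .
  qed
  show ?thesis
  proof (cases "u = 1")
    case True
    then show ?thesis using *[OF \<delta>] by simp
  next
    case False
    then have u: "u = - 1" using u by blast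
    have "He k (u * \<tau> + \<delta>) = He k (- (\<tau> + - \<delta>))" by (simp add: u)
    also have "\<dots> = (- 1) ^ k * He k (\<tau> + - \<delta>)" by (rule hermite_uminus)
    finally have "u ^ k * He k (u * \<tau> + \<delta>) = He k (\<tau> + - \<delta>)"
      by (simp add: u mult.assoc[symmetric] flip: power_mult_distrib)
    then show ?thesis using *[of "- \<delta>"] \<delta> by simp
  qed
qed

lemma He_bounded: "\<exists>B. \<forall>y. \<bar>y\<bar> \<le> R --> \<bar>He k y\<bar> \<le> B"
proof -
  have "compact ((\<lambda>y. He k y) ` {- R..R})" by (intro compact_continuous_image continuous_hermite) simp
  then have "bounded ((\<lambda>y. He k y) ` {- R..R})" by (rule compact_imp_bounded)
  then obtain B where "\<forall>z\<in>(\<lambda>y. He k y) ` {- R..R}. norm z \<le> B" unfolding bounded_iff by blast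
  then have "\<bar>y\<bar> \<le> R --> \<bar>He k y\<bar> \<le> B" for y by (auto simp: abs_le_iff)
  then show ?thesis by blast
qed

text \<open>Growth and signs multiply over the components; bounded values of the parameter are absorbed into the constant.\<close>

lemma product_growth:
  fixes h :: "nat => real => real => real" and s :: "nat => real"
  assumes I: "finite I" and a: "a ~= 0"
    and grow: "\<And>i. i \<in> I ==> \<exists>T \<epsilon> c. \<epsilon> > 0 \<and> c > 0 \<and> (\<forall>\<tau>\<ge>T. \<forall>\<delta>. \<bar>\<delta>\<bar> \<le> \<epsilon> --> c * \<tau> ^ e i \<le> s i * h i \<tau> \<delta>)"
    and bdd: "\<And>i T. i \<in> I ==> \<exists>B. \<forall>\<tau> \<delta>. 0 \<le> \<tau> --> \<tau> \<le> T --> \<bar>\<delta>\<bar> \<le> 1 --> \<bar>h i \<tau> \<delta>\<bar> \<le> B"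
    and s: "\<And>i. i \<in> I ==> s i * s i = 1" "a * (\<Prod>i\<in>I. s i) = \<bar>a\<bar>" and p: "p \<le> (\<Sum>i\<in>I. e i)"
  shows "\<exists>\<epsilon> c C. \<epsilon> > 0 \<and> c > 0 \<and> (\<forall>\<tau>\<ge>0. \<forall>\<delta>. (\<forall>i\<in>I. \<bar>\<delta> i\<bar> \<le> \<epsilon>) --> c * \<tau> ^ p - C \<le> a * (\<Prod>i\<in>I. h i \<tau> (\<delta> i)))"
proof -
  define P where "P i T \<epsilon> c \<longleftrightarrow> \<epsilon> > 0 \<and> c > 0 \<and> (\<forall>\<tau>\<ge>T. \<forall>\<delta>. \<bar>\<delta>\<bar> \<le> \<epsilon> --> c * \<tau> ^ e i \<le> s i * h i \<tau> \<delta>)" for i T \<epsilon> c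
  have "\<forall>i\<in>I. \<exists>q. P i (fst q) (fst (snd q)) (snd (snd q))" using grow by (simp add: P_def)
  from bchoice[OF this] obtain q where q: "\<And>i. i \<in> I ==> P i (fst (q i)) (fst (snd (q i))) (snd (snd (q i)))" by blast
  define T where "T = Max (insert 1 ((\<lambda>i. fst (q i)) ` I))"
  define \<epsilon> where "\<epsilon> = Min (insert 1 ((\<lambda>i. fst (snd (q i))) ` I))"
  define c0 where "c0 i = snd (snd (q i))" for i
  have T: "T \<ge> 1" "\<And>i. i \<in> I ==> fst (q i) \<le> T" using I by (auto simp: T_def)
  have \<epsilon>: "\<epsilon> > 0" "\<epsilon> \<le> 1" "\<And>i. i \<in> I ==> \<epsilon> \<le> fst (snd (q i))" using I q by (auto simp: \<epsilon>_def P_def)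
  have c0: "c0 i > 0" if "i \<in> I" for i using q[OF that] by (simp add: c0_def P_def)
  have "\<forall>i\<in>I. \<exists>B. \<forall>\<tau> \<delta>. 0 \<le> \<tau> --> \<tau> \<le> T --> \<bar>\<delta>\<bar> \<le> 1 --> \<bar>h i \<tau> \<delta>\<bar> \<le> B" using bdd by blast
  from bchoice[OF this] obtain B where B: "\<And>i \<tau> \<delta>. i \<in> I ==> 0 \<le> \<tau> ==> \<tau> \<le> T ==> \<bar>\<delta>\<bar> \<le> 1 ==> \<bar>h i \<tau> \<delta>\<bar> \<le> B i" by blast
  define c where "c = \<bar>a\<bar> * (\<Prod>i\<in>I. c0 i)"
  have c: "c > 0" unfolding c_def using a c0 by (intro mult_pos_pos prod_pos) auto
  define C1 where "C1 = \<bar>a\<bar> * (\<Prod>i\<in>I. B i)"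
  define C where "C = \<bar>C1\<bar> + c * T ^ p"
  have "c * \<tau> ^ p - C \<le> a * (\<Prod>i\<in>I. h i \<tau> (\<delta> i))" if \<tau>: "\<tau> \<ge> 0" and \<delta>: "\<forall>i\<in>I. \<bar>\<delta> i\<bar> \<le> \<epsilon>" for \<tau> \<delta>
  proof (cases "\<tau> \<le> T")
    case True
    have "\<bar>a * (\<Prod>i\<in>I. h i \<tau> (\<delta> i))\<bar> = \<bar>a\<bar> * (\<Prod>i\<in>I. \<bar>h i \<tau> (\<delta> i)\<bar>)" by (simp add: abs_mult abs_prod)
    also have "\<dots> \<le> C1" unfolding C1_def using \<delta> \<epsilon>(2) True \<tau>
      by (intro mult_left_mono prod_mono conjI B) force+
    finally have "- \<bar>C1\<bar> \<le> a * (\<Prod>i\<in>I. h i \<tau> (\<delta> i))" by linarith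
    moreover have "c * \<tau> ^ p \<le> c * T ^ p" using c True \<tau> by (intro mult_left_mono power_mono) auto
    ultimately show ?thesis unfolding C_def by linarith
  next
    case False
    have "a * (\<Prod>i\<in>I. h i \<tau> (\<delta> i)) = \<bar>a\<bar> * (\<Prod>i\<in>I. s i * h i \<tau> (\<delta> i))"
    proof -
      have "(\<Prod>i\<in>I. s i) * (\<Prod>i\<in>I. s i) = 1" using s(1) by (simp flip: prod.distrib)
      then have "a = \<bar>a\<bar> * (\<Prod>i\<in>I. s i)" unfolding s(2)[symmetric] by (simp add: mult.assoc)
      then show ?thesis by (simp add: prod.distrib)
    qed
    moreover have "(\<Prod>i\<in>I. c0 i * \<tau> ^ e i) \<le> (\<Prod>i\<in>I. s i * h i \<tau> (\<delta> i))"
    proof (rule prod_mono, intro conjI)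
      fix i assume i: "i \<in> I"
      show "0 \<le> c0 i * \<tau> ^ e i" using c0[OF i] \<tau> by simp
      have "fst (q i) \<le> \<tau>" "\<bar>\<delta> i\<bar> \<le> fst (snd (q i))" using T(2)[OF i] False \<epsilon>(3)[OF i] \<delta> i by force+
      then show "c0 i * \<tau> ^ e i \<le> s i * h i \<tau> (\<delta> i)" using q[OF i] unfolding P_def c0_def by blast
    qed
    moreover have "(\<Prod>i\<in>I. c0 i * \<tau> ^ e i) = (\<Prod>i\<in>I. c0 i) * \<tau> ^ (\<Sum>i\<in>I. e i)" by (simp add: prod.distrib power_sum)
    ultimately have "\<bar>a\<bar> * ((\<Prod>i\<in>I. c0 i) * \<tau> ^ (\<Sum>i\<in>I. e i)) \<le> a * (\<Prod>i\<in>I. h i \<tau> (\<delta> i))"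
      by (simp add: mult_left_mono)
    moreover have "c * \<tau> ^ p \<le> c * \<tau> ^ (\<Sum>i\<in>I. e i)"
      using c False T(1) p by (intro mult_left_mono power_increasing) auto
    moreover have "0 \<le> C" using c T(1) by (simp add: C_def)
    ultimately show ?thesis by (simp add: c_def mult.assoc)
  qed
  then show ?thesis using \<epsilon>(1) c by blast
qed

text \<open>
  In the direction \<open>u\<close> with offset \<open>v\<close>, the sign of the leading coefficient is made equal to
  that of \<open>a\<close>. A negative coupling needs a sign change when all exponents are even: one component is then kept at a point
  where its Hermite polynomial is negative, and the degree drops by its exponent.
\<close>

lemma growth_direction:
  fixes n p :: nat and \<beta> :: "nat => nat"
  assumes n: "n \<ge> 2" and a: "a ~= 0" and \<beta>: "\<beta> 1 ~= 0" "\<beta> 2 ~= 0" "(\<Sum>i=1..n. \<beta> i) \<ge> 3"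
    and p: "p = 2 \<or> p = 4 \<and> (\<Sum>i=1..n. \<beta> i) \<ge> 4 \<and> \<not> (a < 0 \<and> \<beta> 1 = 2 \<and> \<beta> 2 = 2 \<and> (\<forall>i\<in>{3..n}. \<beta> i = 0))"
  shows "\<exists>u v :: nat => real. \<exists>\<epsilon> c C. \<epsilon> > 0 \<and> c > 0 \<and> (\<Sum>i=1..n. (u i)\<^sup>2) > 0 \<and> (\<Sum>i=1..n. u i * v i) = 0 \<and> (\<Sum>i=1..n. (v i)\<^sup>2) < n \<and>
    (\<forall>\<tau>\<ge>0. \<forall>\<delta>. (\<forall>i\<in>{1..n}. \<bar>\<delta> i\<bar> \<le> \<epsilon>) --> c * \<tau> ^ p - C \<le> a * (\<Prod>i=1..n. He (\<beta> i) (u i * \<tau> + v i + \<delta> i)))"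
proof -
  let ?h = "\<lambda>u v i \<tau> \<delta>. He (\<beta> i) (u i * \<tau> + v i + \<delta>)"
  have bdd: "\<exists>B. \<forall>\<tau> \<delta>. 0 \<le> \<tau> --> \<tau> \<le> T --> \<bar>\<delta>\<bar> \<le> 1 --> \<bar>?h u v i \<tau> \<delta>\<bar> \<le> B" for T u v and i :: nat
  proof -
    obtain B where B: "\<forall>y. \<bar>y\<bar> \<le> \<bar>u i\<bar> * T + \<bar>v i\<bar> + 1 --> \<bar>He (\<beta> i) y\<bar> \<le> B" using He_bounded by blast
    have "\<bar>?h u v i \<tau> \<delta>\<bar> \<le> B" if "0 \<le> \<tau>" "\<tau> \<le> T" "\<bar>\<delta>\<bar> \<le> 1" for \<tau> \<delta>
    proof -
      have "\<bar>u i * \<tau>\<bar> \<le> \<bar>u i\<bar> * T" unfolding abs_mult using that by (intro mult_left_mono) auto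
      then have "\<bar>u i * \<tau> + v i + \<delta>\<bar> \<le> \<bar>u i\<bar> * T + \<bar>v i\<bar> + 1" using that by linarith
      then show ?thesis using B by blast
    qed
    then show ?thesis by blast
  qed
  have sign: "\<exists>T \<epsilon> c. \<epsilon> > 0 \<and> c > 0 \<and> (\<forall>\<tau>\<ge>T. \<forall>\<delta>. \<bar>\<delta>\<bar> \<le> \<epsilon> --> c * \<tau> ^ \<beta> i \<le> u i ^ \<beta> i * ?h u v i \<tau> \<delta>)"
    if "u i = 1 \<or> u i = - 1" "v i = 0" for u v and i :: nat
    using He_growth[OF that(1), of "\<beta> i"] that(2)
    by (intro exI[of _ "2 * real (\<beta> i) + 2"] exI[of _ 1] exI[of _ "(1 / 4) ^ \<beta> i"]) auto
  have one_in: "1 \<in> {1..n}" "2 \<in> {1..n}" using n by auto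
  show ?thesis
  proof (cases "a > 0 \<or> (\<exists>i\<in>{1..n}. odd (\<beta> i))")
    case True
    obtain u :: "nat => real" where u: "\<And>i. u i = 1 \<or> u i = - 1" and prod: "a * (\<Prod>i=1..n. u i ^ \<beta> i) = \<bar>a\<bar>"
    proof (cases "a > 0")
      case True
      then show ?thesis by (intro that[of "\<lambda>_. 1"]) auto
    next
      case False
      then obtain i where i: "i \<in> {1..n}" "odd (\<beta> i)" using \<open>a > 0 \<or> _\<close> by blast
      have "(\<Prod>k=1..n. (if k = i then - 1 else 1 :: real) ^ \<beta> k) = (\<Prod>k=1..n. if k = i then - 1 else 1)"
        using i by (intro prod.cong) auto
      also have "\<dots> = - 1" using i by (subst prod.delta) auto
      finally show ?thesis using False a by (intro that[of "\<lambda>k. if k = i then - 1 else 1"]) auto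
    qed
    have "\<exists>\<epsilon> c C. \<epsilon> > 0 \<and> c > 0 \<and> (\<forall>\<tau>\<ge>0. \<forall>\<delta>. (\<forall>i\<in>{1..n}. \<bar>\<delta> i\<bar> \<le> \<epsilon>) -->
        c * \<tau> ^ p - C \<le> a * (\<Prod>i\<in>{1..n}. ?h u (\<lambda>_. 0) i \<tau> (\<delta> i)))"
    proof (rule product_growth[where s = "\<lambda>i. u i ^ \<beta> i" and e = \<beta>])
      show "u i ^ \<beta> i * u i ^ \<beta> i = 1" for i using u[of i] by (auto simp flip: power_mult_distrib)
      show "p \<le> (\<Sum>i\<in>{1..n}. \<beta> i)" using p \<beta>(3) by linarith
      show "\<exists>T \<epsilon> c. \<epsilon> > 0 \<and> c > 0 \<and> (\<forall>\<tau>\<ge>T. \<forall>\<delta>. \<bar>\<delta>\<bar> \<le> \<epsilon> --> c * \<tau> ^ \<beta> i \<le> u i ^ \<beta> i * ?h u (\<lambda>_. 0) i \<tau> \<delta>)" for i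
        by (rule sign[OF u refl])
      show "\<exists>B. \<forall>\<tau> \<delta>. 0 \<le> \<tau> --> \<tau> \<le> T --> \<bar>\<delta>\<bar> \<le> 1 --> \<bar>?h u (\<lambda>_. 0) i \<tau> \<delta>\<bar> \<le> B" for i T by (rule bdd)
    qed (use a prod in auto)
    then obtain \<epsilon> c C where "\<epsilon> > 0" "c > 0" "\<forall>\<tau>\<ge>0. \<forall>\<delta>. (\<forall>i\<in>{1..n}. \<bar>\<delta> i\<bar> \<le> \<epsilon>) -->
        c * \<tau> ^ p - C \<le> a * (\<Prod>i\<in>{1..n}. ?h u (\<lambda>_. 0) i \<tau> (\<delta> i))" by blast
    moreover have "(\<Sum>i=1..n. (u i)\<^sup>2) > 0"
    proof -
      have "(u i)\<^sup>2 = 1" for i using u[of i] by auto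
      then show ?thesis using n by simp
    qed
    ultimately show ?thesis
      using n by (intro exI[of _ u] exI[of _ "\<lambda>_. 0"] exI[of _ \<epsilon>] exI[of _ c] exI[of _ C]) simp
  next
    case False
    then have an: "a < 0" and ev: "\<And>i. i \<in> {1..n} ==> even (\<beta> i)" using a by auto
    have ge2: "\<beta> 1 \<ge> 2" "\<beta> 2 \<ge> 2" using ev[OF one_in(1)] ev[OF one_in(2)] \<beta> by presburger+
    define r :: nat where "r = (if \<beta> 1 \<le> \<beta> 2 then 1 else 2)"
    define t :: nat where "t = (if \<beta> 1 \<le> \<beta> 2 then 2 else 1)"
    have rt: "r \<in> {1..n}" "t \<in> {1..n} - {r}" "\<beta> r \<le> \<beta> t" "\<beta> r \<ge> 2" "\<beta> t \<ge> 2" "{r, t} = {1, 2}" using one_in ge2 by (auto simp: r_def t_def)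
    obtain \<xi> where \<xi>: "\<xi> \<ge> 0" "\<xi> \<le> 1" "He (\<beta> r) \<xi> < 0"
      using hermite_even_neg[OF ev[OF rt(1)] rt(4)] by auto
    define u where "u i = (if i = r then 0 else 1 :: real)" for i
    define v where "v i = (if i = r then \<xi> else 0)" for i
    define e where "e i = (if i = r then 0 else \<beta> i)" for i
    define s where "s i = (if i = r then - 1 else 1 :: real)" for i
    have sum_e: "(\<Sum>i=1..n. e i) = (\<Sum>i\<in>{1..n} - {r}. \<beta> i)"
      unfolding e_def by (subst sum.remove[OF _ rt(1)]) auto
    have sum_t: "(\<Sum>i\<in>{1..n} - {r}. \<beta> i) = \<beta> t + (\<Sum>i\<in>{1..n} - {r} - {t}. \<beta> i)"
      using rt(2) by (intro sum.remove) auto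
    have p_e: "p \<le> (\<Sum>i=1..n. e i)"
    proof (rule ccontr)
      assume small: "\<not> p \<le> (\<Sum>i=1..n. e i)"
      then have p4: "p = 4" using p sum_e sum_t rt(5) by linarith
      then have not22: "\<not> (\<beta> 1 = 2 \<and> \<beta> 2 = 2 \<and> (\<forall>i\<in>{3..n}. \<beta> i = 0))" using p an by auto
      have lt4: "\<beta> t + (\<Sum>i\<in>{1..n} - {r} - {t}. \<beta> i) < 4" using small p4 sum_e sum_t by linarith
      have "even (\<beta> t)" using ev rt(2) by blast
      then have bt: "\<beta> t = 2" using lt4 rt(5) by presburger
      have z: "\<beta> i = 0" if i: "i \<in> {1..n} - {r} - {t}" for i
      proof -
        have "\<beta> i \<le> (\<Sum>i\<in>{1..n} - {r} - {t}. \<beta> i)" using i by (intro member_le_sum) auto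
        then have "\<beta> i < 2" using lt4 bt by linarith
        then show ?thesis using ev[of i] i by (metis DiffD1 One_nat_def less_2_cases odd_one)
      qed
      have "\<beta> r = 2" using rt(3,4) bt by linarith
      then have "\<beta> 1 = 2" "\<beta> 2 = 2" using bt rt(6) by (metis insertCI insertE singletonD)+
      moreover have "\<beta> i = 0" if "i \<in> {3..n}" for i
        using that rt(6) by (intro z) (auto simp: r_def t_def)
      ultimately show False using not22 by blast
    qed
    have "\<exists>\<epsilon> c C. \<epsilon> > 0 \<and> c > 0 \<and> (\<forall>\<tau>\<ge>0. \<forall>\<delta>. (\<forall>i\<in>{1..n}. \<bar>\<delta> i\<bar> \<le> \<epsilon>) -->
        c * \<tau> ^ p - C \<le> a * (\<Prod>i\<in>{1..n}. ?h u v i \<tau> (\<delta> i)))"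
    proof (rule product_growth[where s = s and e = e])
      fix i assume i: "i \<in> {1..n}"
      show "\<exists>T \<epsilon> c. \<epsilon> > 0 \<and> c > 0 \<and> (\<forall>\<tau>\<ge>T. \<forall>\<delta>. \<bar>\<delta>\<bar> \<le> \<epsilon> --> c * \<tau> ^ e i \<le> s i * ?h u v i \<tau> \<delta>)"
      proof (cases "i = r")
        case False
        then show ?thesis using sign[of u i v] by (simp add: u_def v_def s_def e_def)
      next
        case True
        have "isCont (\<lambda>y. He (\<beta> r) y) \<xi>" using continuous_hermite[of UNIV "\<beta> r" 1] by (simp add: continuous_on_eq_continuous_at)
        then obtain d where d: "d > 0" "\<And>y. \<bar>y - \<xi>\<bar> < d ==> \<bar>He (\<beta> r) y - He (\<beta> r) \<xi>\<bar> < - He (\<beta> r) \<xi> / 2"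
          using \<xi>(3) unfolding continuous_at_eps_delta dist_real_def by (meson half_gt_zero_iff neg_0_less_iff_less)
        have "- He (\<beta> r) \<xi> / 2 \<le> - He (\<beta> r) (\<xi> + \<delta>)" if "\<bar>\<delta>\<bar> \<le> d / 2" for \<delta>
          using d(2)[of "\<xi> + \<delta>"] that d(1) by linarith
        then show ?thesis using d(1) \<xi>(3) True
          by (intro exI[of _ 0] exI[of _ "d / 2"] exI[of _ "- He (\<beta> r) \<xi> / 2"]) (simp add: u_def v_def s_def e_def)
      qed
      show "s i * s i = 1" by (simp add: s_def)
    next
      have "(\<Prod>i\<in>{1..n}. s i) = - 1" unfolding s_def using rt(1) by (subst prod.delta) auto
      then show "a * (\<Prod>i\<in>{1..n}. s i) = \<bar>a\<bar>" using an by simp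
    qed (use a p_e bdd in auto)
    then obtain \<epsilon> c C where "\<epsilon> > 0" "c > 0" "\<forall>\<tau>\<ge>0. \<forall>\<delta>. (\<forall>i\<in>{1..n}. \<bar>\<delta> i\<bar> \<le> \<epsilon>) -->
        c * \<tau> ^ p - C \<le> a * (\<Prod>i\<in>{1..n}. ?h u v i \<tau> (\<delta> i))" by blast
    moreover have "(\<Sum>i=1..n. (u i)\<^sup>2) > 0"
      using rt(2) by (intro sum_pos2[of _ t]) (auto simp: u_def)
    moreover have "(\<Sum>i=1..n. u i * v i) = 0" by (intro sum.neutral) (auto simp: u_def v_def)
    moreover have "(\<Sum>i=1..n. (v i)\<^sup>2) < n"
    proof -
      have "(\<Sum>i=1..n. (v i)\<^sup>2) = (\<Sum>i=1..n. if i = r then \<xi>\<^sup>2 else 0)" by (intro sum.cong) (auto simp: v_def)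
      also have "\<dots> = \<xi>\<^sup>2" using rt(1) by (subst sum.delta) auto
      also have "\<dots> \<le> 1" using \<xi> by (simp add: power_le_one)
      finally show ?thesis using n by linarith
    qed
    ultimately show ?thesis
      by (intro exI[of _ u] exI[of _ v] exI[of _ \<epsilon>] exI[of _ c] exI[of _ C]) simp
  qed
qed

section \<open>Divergence without the mass cutoff\<close>

lemma bracket2_powr_le_1: "\<alpha> \<ge> 0 ==> bracket2 l powr (- \<alpha> / 2) \<le> 1"
  using powr_mono2'[of "- \<alpha> / 2" 1 "bracket2 l"] bracket2_ge_1[of l] by simp

text \<open>A box of width \<open>\<eta>\<close> moves the field by at most \<open>\<eta>\<close> per mode, uniformly on the torus.\<close>

lemma field_box:
  fixes om f :: "'d::finite index => real"
  assumes "\<alpha> \<ge> 0" "om \<in> box_set n N f \<eta>" "i \<in> {1..n}"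
  shows "\<bar>comp_field \<alpha> N om i x - comp_field \<alpha> N f i x\<bar> \<le> real (card (modes N :: ((int ^ 'd) \<times> bool) set)) * \<eta>"
proof -
  have "\<bar>comp_field \<alpha> N om i x - comp_field \<alpha> N f i x\<bar> = \<bar>\<Sum>j\<in>modes N. mode \<alpha> j x * (om (i, j) - f (i, j))\<bar>"
    unfolding field_def by (simp add: sum_subtractf right_diff_distrib)
  also have "\<dots> \<le> (\<Sum>j\<in>modes N. \<bar>mode \<alpha> j x * (om (i, j) - f (i, j))\<bar>)" by (rule sum_abs)
  also have "\<dots> \<le> (\<Sum>j\<in>(modes N :: ((int ^ 'd) \<times> bool) set). 1 * \<eta>)"
  proof (rule sum_mono)
    fix j :: "(int ^ 'd) \<times> bool" assume j: "j \<in> modes N"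
    then have "(i, j) \<in> vars n N" using assms(3) by (simp add: vars_def)
    then have "\<bar>om (i, j) - f (i, j)\<bar> \<le> \<eta>" using assms(2) by (simp add: box_set_def)
    then show "\<bar>mode \<alpha> j x * (om (i, j) - f (i, j))\<bar> \<le> 1 * \<eta>"
      unfolding abs_mult using order_trans[OF abs_mode_le bracket2_powr_le_1[OF assms(1)], of j x]
      by (intro mult_mono) auto
  qed
  finally show ?thesis by simp
qed

text \<open>The pointwise growth of the Hermite product, transported to a box around a field profile.\<close>

lemma box_gain:
  fixes f :: "'d::finite index => real" and u v :: "nat => real"
  assumes \<alpha>: "\<alpha> \<ge> 0"
    and growth: "\<forall>\<tau>\<ge>0. \<forall>\<delta>. (\<forall>i\<in>{1..n}. \<bar>\<delta> i\<bar> \<le> \<epsilon>) --> c * \<tau> ^ p - C \<le> a * (\<Prod>i=1..n. He (\<beta> i) (u i * \<tau> + v i + \<delta> i))"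
    and f: "\<And>i x. i \<in> {1..n} ==> comp_field \<alpha> N f i x = sqrt (wick_var TYPE('d) \<alpha> N) * (u i * \<tau> x + v i)"
    and \<tau>: "continuous_on UNIV \<tau>" "\<And>x. \<tau> x \<ge> 0"
    and \<eta>: "real (card (modes N :: ((int ^ 'd) \<times> bool) set)) * \<eta> \<le> \<epsilon>" and om: "om \<in> box_set n N f \<eta>"
  shows "sqrt (wick_var TYPE('d) \<alpha> N) ^ (\<Sum>i=1..n. \<beta> i) * (c * (\<integral>x. \<tau> x ^ p \<partial>torus) - C) \<le> a * wickX \<alpha> n \<beta> N om"
proof -
  define s where "s = sqrt (wick_var TYPE('d) \<alpha> N)"
  have s1: "s \<ge> 1" unfolding s_def using wick_var_ge_1[where 'd='d, of \<alpha> N] by simp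
  have ss: "wick_var TYPE('d) \<alpha> N = s\<^sup>2" unfolding s_def using wick_var_ge_1[where 'd='d, of \<alpha> N] by simp
  let ?k = "\<Sum>i=1..n. \<beta> i"
  let ?H = "\<lambda>x. hermite_multi n \<beta> (\<lambda>i. comp_field \<alpha> N om i x) (s\<^sup>2)"
  have cH: "continuous_on UNIV ?H"
    unfolding hermite_multi_def
    by (intro continuous_on_prod continuous_on_compose2[OF continuous_hermite continuous_field]) auto
  have pt: "s ^ ?k * (c * \<tau> x ^ p - C) \<le> a * ?H x" for x
  proof -
    define \<delta> where "\<delta> i = comp_field \<alpha> N om i x / s - (u i * \<tau> x + v i)" for i
    have "\<bar>\<delta> i\<bar> \<le> \<epsilon>" if i: "i \<in> {1..n}" for i
    proof -
      have "s * \<delta> i = comp_field \<alpha> N om i x - comp_field \<alpha> N f i x"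
        using s1 by (simp add: \<delta>_def f[OF i] s_def[symmetric] field_simps)
      then have "s * \<bar>\<delta> i\<bar> \<le> \<epsilon>" using field_box[OF \<alpha> om i, of x] \<eta> s1 by (simp add: abs_mult flip: \<open>s * \<delta> i = _\<close>)
      moreover have "1 * \<bar>\<delta> i\<bar> \<le> s * \<bar>\<delta> i\<bar>" using s1 by (intro mult_right_mono) auto
      ultimately show ?thesis by simp
    qed
    then have "c * \<tau> x ^ p - C \<le> a * (\<Prod>i=1..n. He (\<beta> i) (u i * \<tau> x + v i + \<delta> i))" using growth \<tau>(2) by blast
    then have "s ^ ?k * (c * \<tau> x ^ p - C) \<le> s ^ ?k * (a * (\<Prod>i=1..n. He (\<beta> i) (u i * \<tau> x + v i + \<delta> i)))"
      using s1 by (intro mult_left_mono) auto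
    also have "\<dots> = a * (\<Prod>i=1..n. s ^ \<beta> i * He (\<beta> i) (u i * \<tau> x + v i + \<delta> i))"
      by (simp add: prod.distrib power_sum)
    also have "(\<Prod>i=1..n. s ^ \<beta> i * He (\<beta> i) (u i * \<tau> x + v i + \<delta> i)) = ?H x"
      unfolding hermite_multi_def
    proof (intro prod.cong refl)
      fix i
      have "s * (u i * \<tau> x + v i + \<delta> i) = comp_field \<alpha> N om i x" using s1 by (simp add: \<delta>_def)
      then show "s ^ \<beta> i * He (\<beta> i) (u i * \<tau> x + v i + \<delta> i) = hermite (\<beta> i) (comp_field \<alpha> N om i x) (s\<^sup>2)"
        using hermite_scale[of "\<beta> i" s "u i * \<tau> x + v i + \<delta> i"] by simp
    qed
    finally show ?thesis .
  qed
  have \<tau>p: "integrable torus (\<lambda>x. \<tau> x ^ p)" by (rule integrable_torus_continuous_power[OF \<tau>(1)])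
  have "s ^ ?k * (c * (\<integral>x. \<tau> x ^ p \<partial>torus) - C) = (\<integral>x. s ^ ?k * (c * \<tau> x ^ p - C) \<partial>torus)"
    using \<tau>p by (simp add: torus.prob_space)
  also have "\<dots> \<le> (\<integral>x. a * ?H x \<partial>torus)"
    by (intro integral_mono pt continuous_imp_integrable_torus continuous_intros \<tau> cH)
  also have "\<dots> = a * wickX \<alpha> n \<beta> N om"
    unfolding wickX_def wick_vars ss by simp
  finally show ?thesis by (simp add: s_def)
qed

lemma ennreal_infinite_if_unbounded:
  assumes "\<And>B :: real. ennreal B \<le> X"
  shows "X = \<infinity>"
proof (rule ccontr)
  assume "X ~= \<infinity>"
  then obtain r where r: "X = ennreal r" "r \<ge> 0" by (cases X) auto
  then have "ennreal (r + 1) \<le> ennreal r" using assms by metis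
  then show False using r(2) by (simp add: ennreal_le_iff)
qed

text \<open>
  Moving only the zero modes by a large multiple \<open>T\<close> of the direction of growth gains
  \<open>\<sigma>\<^sup>k\<^sup>/\<^sup>2 T\<^sup>2\<close> and costs \<open>\<sigma> T\<^sup>2\<close>; the gain wins at a high enough fixed truncation because the variance
  \<open>\<sigma>\<close> is unbounded.
\<close>

lemma exp_wick_not_integrable:
  fixes \<beta> :: "nat => nat"
  assumes \<alpha>: "\<alpha> = real CARD('d::finite) / 2" and n: "n \<ge> 2" and a: "a ~= 0"
    and \<beta>: "\<beta> 1 ~= 0" "\<beta> 2 ~= 0" "(\<Sum>i=1..n. \<beta> i) \<ge> 3"
  shows "(\<integral>\<^sup>+om. ennreal (exp (a * limX \<alpha> n \<beta> om)) \<partial>(gauss :: ('d index => real) measure)) = \<infinity>"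
proof (rule ennreal_infinite_if_unbounded)
  fix B :: real
  have \<alpha>0: "\<alpha> \<ge> 0" by (simp add: \<alpha>)
  let ?k = "\<Sum>i=1..n. \<beta> i"
  obtain u v :: "nat => real" and \<epsilon> c C where e: "\<epsilon> > 0" "c > 0" and u: "(\<Sum>i=1..n. (u i)\<^sup>2) > 0" and uv: "(\<Sum>i=1..n. u i * v i) = 0"
    and growth: "\<forall>\<tau>\<ge>0. \<forall>\<delta>. (\<forall>i\<in>{1..n}. \<bar>\<delta> i\<bar> \<le> \<epsilon>) --> c * \<tau> ^ 2 - C \<le> a * (\<Prod>i=1..n. He (\<beta> i) (u i * \<tau> + v i + \<delta> i))"
    using growth_direction[OF n a \<beta> disjI1[OF refl]] by (elim exE conjE) (rule that; assumption)
  define U where "U = (\<Sum>i=1..n. (u i)\<^sup>2)"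
  obtain c1 where c1: "c1 > 0" "\<And>J. c1 * real J \<le> wick_var TYPE('d) \<alpha> (CARD('d) * 2 ^ J)"
    using wick_var_ge_log[where 'd='d, OF \<alpha>] by blast
  obtain J :: nat where "((U + 1) / c)\<^sup>2 / c1 \<le> real J" using real_arch_simple by blast
  then have hJ: "((U + 1) / c)\<^sup>2 \<le> c1 * real J"
    unfolding mult.commute[of c1] by (rule iffD1[OF pos_divide_le_eq[OF c1(1)]])
  define N where "N = CARD('d) * 2 ^ J"
  define \<sigma> where "\<sigma> = wick_var TYPE('d) \<alpha> N"
  define s where "s = sqrt \<sigma>"
  have \<sigma>1: "\<sigma> \<ge> 1" unfolding \<sigma>_def by (rule wick_var_ge_1)
  have s1: "s \<ge> 1" and s2: "s\<^sup>2 = \<sigma>" using \<sigma>1 by (simp_all add: s_def)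
  have "((U + 1) / c)\<^sup>2 \<le> s\<^sup>2" unfolding s2 \<sigma>_def N_def by (rule order_trans[OF hJ c1(2)])
  then have "(U + 1) / c \<le> s" by (rule power2_le_imp_le) (use s1 in linarith)
  then have cs: "U + 1 \<le> c * s"
    unfolding mult.commute[of c] by (rule iffD1[OF pos_divide_le_eq[OF e(2)]])
  let ?M = "modes N :: ((int ^ 'd) \<times> bool) set"
  have M1: "card ?M \<ge> 1"
    using card_mono[OF finite_modes, of "{(0 :: int ^ 'd, True)}" N] by simp
  define \<eta> where "\<eta> = min \<epsilon> 1 / real (card ?M)"
  have \<eta>: "\<eta> > 0" "\<eta> \<le> 1" "real (card ?M) * \<eta> \<le> \<epsilon>"
    using e M1 by (auto simp: \<eta>_def field_simps)
  define q where "q = card (vars n N :: 'd index set)"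
  define E where "E = s ^ ?k * \<bar>C\<bar> + \<sigma> * (\<Sum>i=1..n. (v i)\<^sup>2) + 2 * real q - real q * ln \<eta>"
  define T where "T = \<bar>E\<bar> + \<bar>B\<bar> + 1"
  have T: "T \<ge> 1" "E + B \<le> T" by (auto simp: T_def)
  define f :: "'d index => real" where "f p = (if snd p = (0, True) then s * (u (fst p) * T + v (fst p)) else 0)" for p
  have m0: "mode \<alpha> (0, True) x = 1" for x :: "real ^ 'd" by (simp add: mode_def)
  have z: "(0, True) \<in> ?M" by simp
  have ff: "comp_field \<alpha> N f i x = s * (u i * T + v i)" for i and x :: "real ^ 'd"
    unfolding field_def by (subst sum.remove[OF finite_modes z]) (simp add: f_def m0)
  have cost: "(\<Sum>p\<in>vars n N. (f p)\<^sup>2) = \<sigma> * (U * T\<^sup>2 + (\<Sum>i=1..n. (v i)\<^sup>2))"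
  proof -
    have "(\<Sum>p\<in>vars n N. (f p)\<^sup>2) = (\<Sum>i=1..n. \<Sum>j\<in>?M. (f (i, j))\<^sup>2)"
      unfolding vars_def by (simp add: sum.cartesian_product)
    also have "\<dots> = (\<Sum>i=1..n. (s * (u i * T + v i))\<^sup>2)"
      by (intro sum.cong refl, subst sum.remove[OF finite_modes z]) (simp add: f_def)
    also have "\<dots> = (\<Sum>i=1..n. \<sigma> * ((u i)\<^sup>2 * T\<^sup>2 + (v i)\<^sup>2 + 2 * T * (u i * v i)))"
      by (intro sum.cong refl) (simp add: s2[symmetric] power2_eq_square algebra_simps)
    also have "\<dots> = \<sigma> * (U * T\<^sup>2 + (\<Sum>i=1..n. (v i)\<^sup>2) + 2 * T * (\<Sum>i=1..n. u i * v i))"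
      by (simp only: sum_distrib_left[symmetric] sum.distrib U_def sum_distrib_right)
    finally show ?thesis unfolding uv by simp
  qed
  define g where "g = s ^ ?k * (c * T\<^sup>2 - C)"
  have gain: "g \<le> a * wickX \<alpha> n \<beta> N om" if "om \<in> box_set n N f \<eta>" for om
    using box_gain[OF \<alpha>0 growth, of N f "\<lambda>_. T" \<eta> om] that ff \<eta>(3) T(1)
    by (simp add: g_def s_def \<sigma>_def torus.prob_space)
  have key: "ennreal (exp (g - 0) * measure gauss (box_set n N f \<eta>)) \<le> (\<integral>\<^sup>+om. ennreal (exp (a * limX \<alpha> n \<beta> om - 0)) \<partial>(gauss :: ('d index => real) measure))"
    by (rule box_lower_bound[where G = "\<lambda>_. 0", OF \<alpha> _ _ _ _ gain]) (use \<beta>(3) in auto)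
  have "B \<le> exp (g - 0) * measure gauss (box_set n N f \<eta>)"
  proof -
    have sk: "\<sigma> * s \<le> s ^ ?k"
    proof -
      have "\<sigma> * s = s ^ 3" by (simp add: s2[symmetric] power2_eq_square power3_eq_cube)
      also have "\<dots> \<le> s ^ ?k" using s1 \<beta>(3) by (intro power_increasing) auto
      finally show ?thesis .
    qed
    have "\<sigma> * (U + 1) * T\<^sup>2 \<le> \<sigma> * (c * s) * T\<^sup>2" using cs \<sigma>1 by (intro mult_right_mono mult_left_mono) auto
    also have "\<dots> = (\<sigma> * s) * (c * T\<^sup>2)" by simp
    also have "\<dots> \<le> s ^ ?k * (c * T\<^sup>2)" using e by (intro mult_right_mono sk) auto
    finally have 1: "\<sigma> * (U + 1) * T\<^sup>2 \<le> s ^ ?k * (c * T\<^sup>2)" .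
    have 2: "s ^ ?k * C \<le> s ^ ?k * \<bar>C\<bar>" using s1 by (intro mult_left_mono) auto
    have 3: "1 * T\<^sup>2 \<le> \<sigma> * T\<^sup>2" using \<sigma>1 by (intro mult_right_mono) auto
    have 4: "1 * T \<le> T\<^sup>2" unfolding power2_eq_square using T(1) by (intro mult_right_mono) auto
    have g': "g = s ^ ?k * (c * T\<^sup>2) - s ^ ?k * C" unfolding g_def by (simp only: right_diff_distrib)
    have c': "(\<Sum>p\<in>vars n N. (f p)\<^sup>2) = \<sigma> * (U + 1) * T\<^sup>2 - \<sigma> * T\<^sup>2 + \<sigma> * (\<Sum>i=1..n. (v i)\<^sup>2)"
      unfolding cost by (simp add: algebra_simps)
    have "B \<le> T - E" using T(2) by linarith
    also have "\<dots> \<le> g - (\<Sum>p\<in>vars n N. (f p)\<^sup>2) - 2 * real q + real q * ln \<eta>"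
      using 1 2 3 4 g' c' unfolding E_def by linarith
    also have "\<dots> \<le> exp \<dots>" using exp_ge_add_one_self[of "g - (\<Sum>p\<in>vars n N. (f p)\<^sup>2) - 2 * real q + real q * ln \<eta>"] by linarith
    also have "\<dots> = exp g * (\<eta> ^ q * exp (- (\<Sum>p\<in>vars n N. (f p)\<^sup>2) - 2 * real q))"
    proof -
      have "\<eta> ^ q = exp (real q * ln \<eta>)" using \<eta>(1) by (simp add: exp_of_nat_mult)
      then show ?thesis by (simp add: exp_add[symmetric])
    qed
    also have "\<dots> \<le> exp g * measure gauss (box_set n N f \<eta>)"
      unfolding q_def by (intro mult_left_mono box_set_prob \<eta>) auto
    finally show ?thesis by simp
  qed
  then show "ennreal B \<le> (\<integral>\<^sup>+om. ennreal (exp (a * limX \<alpha> n \<beta> om)) \<partial>(gauss :: ('d index => real) measure))"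
    using key by (simp add: order_trans[OF ennreal_leI])
qed

section \<open>Concentrated profiles\<close>

lemma lattice_cube_subset_ball: "lattice_cube m \<subseteq> (lattice_ball (CARD('d) * m) :: (int ^ 'd::finite) set)"
proof
  fix l :: "int ^ 'd" assume l: "l \<in> lattice_cube m"
  have "norm (rvec l) \<le> (\<Sum>i\<in>UNIV. \<bar>rvec l $ i\<bar>)" by (rule norm_le_l1_cart)
  also have "\<dots> \<le> (\<Sum>i\<in>(UNIV :: 'd set). real m)"
  proof (rule sum_mono)
    fix i
    have "- int m \<le> l $ i" "l $ i \<le> int m" using l by (auto simp: lattice_cube_def)
    then show "\<bar>rvec l $ i\<bar> \<le> real m" by (auto simp: rvec_def abs_le_iff)
  qed
  finally show "l \<in> lattice_ball (CARD('d) * m)" by (simp add: lattice_ball_def)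
qed

text \<open>Parseval for finite sums of characters.\<close>

lemma trigonometric_sum_integrals:
  fixes F :: "real ^ 'd => real" and A :: "int ^ 'd => real"
  assumes L: "finite L" and F: "\<And>x. of_real (F x) = (\<Sum>l\<in>L. of_real (A l) * fourier_char l x)"
  shows "(\<integral>x. F x \<partial>torus) = (if 0 \<in> L then A 0 else 0)" "(\<integral>x. (F x)\<^sup>2 \<partial>torus) = (\<Sum>l\<in>L. (A l)\<^sup>2)"
proof -
  have i: "integrable torus (\<lambda>x. c * fourier_char l x)" for l :: "int ^ 'd" and c
    by (intro continuous_imp_integrable_torus continuous_intros)
  have "complex_of_real (\<integral>x. F x \<partial>torus) = (\<integral>x. (\<Sum>l\<in>L. of_real (A l) * fourier_char l x) \<partial>torus)"
    unfolding F[symmetric] by simp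
  also have "\<dots> = (\<Sum>l\<in>L. of_real (A l) * (\<integral>x. fourier_char l x \<partial>torus))"
    by (subst Bochner_Integration.integral_sum) (auto intro: i)
  also have "\<dots> = (\<Sum>l\<in>L. if l = 0 then of_real (A 0) else 0)"
    by (intro sum.cong refl) (simp add: torus_integral_fourier_char[unfolded torus_integral_eq])
  also have "\<dots> = of_real (if 0 \<in> L then A 0 else 0)" using L by (simp add: sum.delta)
  finally show "(\<integral>x. F x \<partial>torus) = (if 0 \<in> L then A 0 else 0)" by (simp only: of_real_eq_iff)
  have i2: "integrable torus (\<lambda>x. c * (fourier_char l x * cnj (fourier_char k x)))" for l k :: "int ^ 'd" and c
    by (intro continuous_imp_integrable_torus continuous_intros)
  have "complex_of_real (\<integral>x. (F x)\<^sup>2 \<partial>torus) = (\<integral>x. of_real (F x) * cnj (of_real (F x)) \<partial>torus)"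
    by (simp add: power2_eq_square flip: integral_complex_of_real)
  also have "\<dots> = (\<integral>x. (\<Sum>l\<in>L. \<Sum>k\<in>L. of_real (A l * A k) * (fourier_char l x * cnj (fourier_char k x))) \<partial>torus)"
    unfolding F cnj_sum sum_product by (simp add: mult_ac)
  also have "\<dots> = (\<Sum>l\<in>L. \<Sum>k\<in>L. of_real (A l * A k) * (\<integral>x. fourier_char l x * cnj (fourier_char k x) \<partial>torus))"
    by (subst Bochner_Integration.integral_sum, intro Bochner_Integration.integrable_sum i2, intro sum.cong refl,
      subst Bochner_Integration.integral_sum) (auto intro: i2)
  also have "\<dots> = (\<Sum>l\<in>L. \<Sum>k\<in>L. if l = k then of_real (A l * A l) else 0)"
    by (intro sum.cong refl) (simp add: torus_integral_fourier_char_mult[unfolded torus_integral_eq])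
  also have "\<dots> = of_real (\<Sum>l\<in>L. (A l)\<^sup>2)" using L by (simp add: power2_eq_square)
  finally show "(\<integral>x. (F x)\<^sup>2 \<partial>torus) = (\<Sum>l\<in>L. (A l)\<^sup>2)" by (simp only: of_real_eq_iff)
qed

text \<open>
  The square of the normalized Dirichlet kernel of the cube of side \<open>2 m + 1\<close> lives on a set of
  measure about \<open>m\<^sup>-\<^sup>d\<close>, where it is of order one: its first, second and fourth moments
  have the same size. The fourth moment is bounded below by \<open>F (F - \<theta>)\<^sup>2 (F + 2 \<theta>) \<ge> 0\<close> from the lower bound on
  the second, which is the Cauchy-Schwarz inequality for the Fourier coefficients.
\<close>

lemma fejer_profile:
  fixes m :: nat
  defines "M \<equiv> real ((2 * m + 1) ^ CARD('d::finite))" and "N \<equiv> CARD('d) * (2 * m)"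
  shows "\<exists>(F :: real ^ 'd => real) A. continuous_on UNIV F \<and> (\<forall>x. F x \<ge> 0) \<and>
    (\<forall>x. of_real (F x) = (\<Sum>l\<in>lattice_ball N. of_real (A l) * fourier_char l x)) \<and>
    (\<integral>x. (F x)\<^sup>2 \<partial>torus) > 0 \<and> (\<integral>x. (F x)\<^sup>2 \<partial>torus) \<le> 1 / M \<and> (1 / 2 ^ CARD('d)) ^ 3 / M \<le> (\<integral>x. F x ^ 4 \<partial>torus)"
proof -
  define Q where "Q = (lattice_cube m :: (int ^ 'd) set)"
  define L where "L = (lattice_ball N :: (int ^ 'd) set)"
  define L2 where "L2 = (lattice_cube (2 * m) :: (int ^ 'd) set)"
  have fin: "finite Q" "finite L" "finite L2" by (simp_all add: Q_def L_def L2_def finite_lattice_cube finite_lattice_ball)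
  have cardQ: "real (card Q) = M" unfolding Q_def M_def card_lattice_cube ..
  have M: "M > 0" by (simp add: M_def)
  have sub: "L2 \<subseteq> L" unfolding L2_def L_def N_def by (rule lattice_cube_subset_ball)
  define S where "S x = (\<Sum>q\<in>Q. fourier_char q x)" for x :: "real ^ 'd"
  define F where "F x = (cmod (S x))\<^sup>2 / M\<^sup>2" for x
  define A where "A l = real (card {p \<in> Q \<times> Q. fst p - snd p = l}) / M\<^sup>2" for l
  have diff: "(\<lambda>p. fst p - snd p) ` (Q \<times> Q) \<subseteq> L2"
  proof (rule image_subsetI)
    fix p :: "(int ^ 'd) \<times> (int ^ 'd)" assume p: "p \<in> Q \<times> Q"
    have "(fst p - snd p) $ i \<in> {- int (2 * m)..int (2 * m)}" for i
    proof -
      have "fst p $ i \<in> {- int m..int m}" "snd p $ i \<in> {- int m..int m}"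
        using p by (auto simp: Q_def lattice_cube_def)
      then show ?thesis by auto
    qed
    then show "fst p - snd p \<in> L2" by (simp add: L2_def lattice_cube_def)
  qed
  have rep: "of_real (F x) = (\<Sum>l\<in>L. of_real (A l) * fourier_char l x)" for x
  proof -
    have "of_real ((cmod (S x))\<^sup>2) = S x * cnj (S x)" by (rule complex_norm_square)
    also have "\<dots> = (\<Sum>q\<in>Q. \<Sum>q'\<in>Q. fourier_char (q - q') x)"
      unfolding S_def cnj_sum sum_product
      by (simp add: fourier_char_add[of _ "- _", unfolded fourier_char_uminus, simplified])
    also have "\<dots> = (\<Sum>p\<in>Q \<times> Q. fourier_char (fst p - snd p) x)" by (simp add: sum.cartesian_product split_beta)
    also have "\<dots> = (\<Sum>l\<in>L. \<Sum>p\<in>{p \<in> Q \<times> Q. fst p - snd p = l}. fourier_char (fst p - snd p) x)"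
      using fin diff sub by (intro sum.group[symmetric]) auto
    also have "\<dots> = (\<Sum>l\<in>L. of_nat (card {p \<in> Q \<times> Q. fst p - snd p = l}) * fourier_char l x)"
      by (intro sum.cong refl) simp
    finally have "of_real (F x) = (\<Sum>l\<in>L. of_nat (card {p \<in> Q \<times> Q. fst p - snd p = l}) * fourier_char l x) / of_real (M\<^sup>2)"
      by (simp add: F_def)
    also have "\<dots> = (\<Sum>l\<in>L. of_real (A l) * fourier_char l x)"
      by (simp add: sum_divide_distrib A_def)
    finally show ?thesis .
  qed
  have cF: "continuous_on UNIV F" unfolding F_def S_def using M by (intro continuous_intros) auto
  have F0: "F x \<ge> 0" for x by (simp add: F_def)
  have F1: "F x \<le> 1" for x
  proof -
    have "cmod (S x) \<le> M" unfolding S_def cardQ[symmetric] by (rule order_trans[OF norm_sum]) simp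
    then have "(cmod (S x))\<^sup>2 \<le> M\<^sup>2" by (intro power_mono) auto
    then show ?thesis using M by (simp add: F_def)
  qed
  note ints = trigonometric_sum_integrals[OF fin(2) rep]
  have IF: "(\<integral>x. F x \<partial>torus) = 1 / M"
  proof -
    have "{p \<in> Q \<times> Q. fst p - snd p = 0} = (\<lambda>q. (q, q)) ` Q" by auto
    then have "card {p \<in> Q \<times> Q. fst p - snd p = 0} = card Q" by (simp add: card_image inj_on_def)
    then have "A 0 = 1 / M" using M by (simp add: A_def cardQ power2_eq_square)
    then show ?thesis using ints(1) by (simp add: L_def zero_in_lattice_ball)
  qed
  have iF: "integrable torus (\<lambda>x. F x ^ j)" for j by (rule integrable_torus_continuous_power[OF cF])
  have I2u: "(\<integral>x. (F x)\<^sup>2 \<partial>torus) \<le> 1 / M"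
  proof -
    have "(\<integral>x. (F x)\<^sup>2 \<partial>torus) \<le> (\<integral>x. F x \<partial>torus)"
      using iF[of 1] iF[of 2] F0 F1 by (intro integral_mono) (auto simp: power2_eq_square mult_left_le)
    then show ?thesis by (simp add: IF)
  qed
  have I2l: "1 / (2 ^ CARD('d) * M) \<le> (\<integral>x. (F x)\<^sup>2 \<partial>torus)"
  proof -
    have F00: "F 0 = 1" using M by (simp add: F_def S_def cardQ fourier_char_def)
    have "complex_of_real 1 = of_real (\<Sum>l\<in>L. A l)" using rep[of 0] unfolding F00 by (simp add: fourier_char_def)
    then have "1 = (\<Sum>l\<in>L. A l)" by (simp only: of_real_eq_iff)
    also have "\<dots> = (\<Sum>l\<in>L2. A l)"
    proof (rule sum.mono_neutral_right[OF fin(2) sub], intro ballI)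
      fix l assume "l \<in> L - L2"
      then have "{p \<in> Q \<times> Q. fst p - snd p = l} = {}" using diff by blast
      then show "A l = 0" by (simp only: A_def card.empty of_nat_0 div_0)
    qed
    finally have sA: "(\<Sum>l\<in>L2. A l) = 1" by simp
    have "1 \<le> real (card L2) * (\<Sum>l\<in>L2. (A l)\<^sup>2)"
      using Cauchy_Schwarz_ineq_sum[of "\<lambda>_. 1" A L2] by (simp add: sA)
    also have "\<dots> \<le> (2 ^ CARD('d) * M) * (\<Sum>l\<in>L. (A l)\<^sup>2)"
    proof (rule mult_mono)
      have "real (card L2) \<le> real ((2 * (2 * m + 1)) ^ CARD('d))"
        unfolding L2_def card_lattice_cube of_nat_le_iff by (intro power_mono) auto
      then show "real (card L2) \<le> 2 ^ CARD('d) * M"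
        unfolding M_def by (simp add: power_mult_distrib[symmetric] algebra_simps)
    qed (use M fin sub in \<open>auto intro!: sum_mono2 sum_nonneg\<close>)
    finally show ?thesis using M by (simp add: ints(2) field_simps)
  qed
  have I4: "(1 / 2 ^ CARD('d)) ^ 3 / M \<le> (\<integral>x. F x ^ 4 \<partial>torus)"
  proof -
    define \<theta> where "\<theta> = (1 / 2 :: real) ^ CARD('d)"
    have \<theta>: "\<theta> \<ge> 0" by (simp add: \<theta>_def)
    have pt: "3 * \<theta>\<^sup>2 * (F x)\<^sup>2 - 2 * \<theta> ^ 3 * F x \<le> F x ^ 4" for x
    proof -
      have "F x ^ 4 - (3 * \<theta>\<^sup>2 * (F x)\<^sup>2 - 2 * \<theta> ^ 3 * F x) = F x * (F x - \<theta>)\<^sup>2 * (F x + 2 * \<theta>)"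
        by (simp add: power2_eq_square power3_eq_cube power4_eq_xxxx algebra_simps)
      moreover have "0 \<le> F x * (F x - \<theta>)\<^sup>2 * (F x + 2 * \<theta>)" using F0[of x] \<theta> by simp
      ultimately show ?thesis by linarith
    qed
    have "\<theta> / M \<le> (\<integral>x. (F x)\<^sup>2 \<partial>torus)" using I2l by (simp add: \<theta>_def power_divide)
    then have "3 * \<theta>\<^sup>2 * (\<theta> / M) \<le> 3 * \<theta>\<^sup>2 * (\<integral>x. (F x)\<^sup>2 \<partial>torus)" by (intro mult_left_mono) auto
    then have "\<theta> ^ 3 / M \<le> 3 * \<theta>\<^sup>2 * (\<integral>x. (F x)\<^sup>2 \<partial>torus) - 2 * \<theta> ^ 3 * (1 / M)"
      by (simp add: power2_eq_square power3_eq_cube)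
    also have "\<dots> = (\<integral>x. 3 * \<theta>\<^sup>2 * (F x)\<^sup>2 - 2 * \<theta> ^ 3 * F x \<partial>torus)"
      using iF[of 1] iF[of 2] by (subst Bochner_Integration.integral_diff) (simp_all add: IF)
    also have "\<dots> \<le> (\<integral>x. F x ^ 4 \<partial>torus)"
      using iF[of 1] iF[of 2] iF[of 4] by (intro integral_mono pt Bochner_Integration.integrable_diff integrable_mult_right) simp_all
    finally show ?thesis by (simp add: \<theta>_def power_divide)
  qed
  have "(\<integral>x. (F x)\<^sup>2 \<partial>torus) > 0" by (rule less_le_trans[OF _ I2l]) (use M in simp)
  then show ?thesis using cF F0 rep I2u I4 unfolding L_def by (intro exI[of _ F] exI[of _ A]) simp
qed

section \<open>Divergence despite the mass cutoff\<close>

text \<open>Around a profile of vanishing Wick mass, the truncated Wick mass stays bounded by one.\<close>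

lemma box_mass_bound:
  fixes om f :: "'d::finite index => real"
  assumes \<alpha>: "\<alpha> \<ge> 0" and om: "om \<in> box_set n N f \<eta>" and n: "n \<ge> 1" and \<eta>: "\<eta> \<ge> 0"
    and d: "real (card (modes N :: ((int ^ 'd) \<times> bool) set)) * \<eta> \<le> 1 / (3 * real n * wick_var TYPE('d) \<alpha> N)"
    and f: "(\<Sum>i=1..n. \<integral>x. (comp_field \<alpha> N f i x)\<^sup>2 \<partial>torus) = real n * wick_var TYPE('d) \<alpha> N"
  shows "\<bar>massM \<alpha> n N om\<bar> \<le> 1"
proof -
  define \<sigma> where "\<sigma> = wick_var TYPE('d) \<alpha> N"
  have \<sigma>: "\<sigma> \<ge> 1" unfolding \<sigma>_def by (rule wick_var_ge_1)
  define e where "e = real (card (modes N :: ((int ^ 'd) \<times> bool) set)) * \<eta>"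
  have n1: "1 \<le> real n" using n by simp
  have n\<sigma>: "1 \<le> real n * \<sigma>" using mult_mono[OF n1 \<sigma>] n1 by simp
  have e0: "0 \<le> e" using \<eta> by (simp add: e_def)
  have de: "e * (3 * (real n * \<sigma>)) \<le> 1"
    using d n\<sigma> by (simp add: e_def[symmetric] \<sigma>_def[symmetric] pos_le_divide_eq mult.assoc)
  have e1: "e \<le> 1"
  proof -
    have "e * 1 \<le> e * (3 * (real n * \<sigma>))" using n\<sigma> e0 by (intro mult_left_mono) auto
    then show ?thesis using de by linarith
  qed
  let ?\<phi> = "\<lambda>i x. comp_field \<alpha> N om i x" and ?\<psi> = "\<lambda>i x. comp_field \<alpha> N f i x"
  have one: "\<bar>(\<integral>x. (?\<phi> i x)\<^sup>2 \<partial>torus) - (\<integral>x. (?\<psi> i x)\<^sup>2 \<partial>torus)\<bar> \<le> e * (2 + (\<integral>x. (?\<psi> i x)\<^sup>2 \<partial>torus))"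
    if i: "i \<in> {1..n}" for i
  proof -
    have int: "integrable torus (\<lambda>x. (?\<phi> i x)\<^sup>2)" "integrable torus (\<lambda>x. (?\<psi> i x)\<^sup>2)"
      by (intro integrable_torus_continuous_power continuous_field)+
    have pt: "\<bar>(?\<phi> i x)\<^sup>2 - (?\<psi> i x)\<^sup>2\<bar> \<le> e * (2 + (?\<psi> i x)\<^sup>2)" for x
    proof -
      have d: "\<bar>?\<phi> i x - ?\<psi> i x\<bar> \<le> e" unfolding e_def by (rule field_box[OF \<alpha> om i])
      have "\<bar>?\<phi> i x + ?\<psi> i x\<bar> \<le> e + 2 * \<bar>?\<psi> i x\<bar>" using d by linarith
      also have "\<dots> \<le> 2 + (?\<psi> i x)\<^sup>2"
      proof -
        have "2 * \<bar>?\<psi> i x\<bar> \<le> 1 + (?\<psi> i x)\<^sup>2" using zero_le_power2[of "\<bar>?\<psi> i x\<bar> - 1"] by (simp add: power2_diff)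
        then show ?thesis using e1 by linarith
      qed
      finally have s: "\<bar>?\<phi> i x + ?\<psi> i x\<bar> \<le> 2 + (?\<psi> i x)\<^sup>2" .
      have "\<bar>(?\<phi> i x)\<^sup>2 - (?\<psi> i x)\<^sup>2\<bar> = \<bar>?\<phi> i x - ?\<psi> i x\<bar> * \<bar>?\<phi> i x + ?\<psi> i x\<bar>"
        by (simp add: abs_mult[symmetric] power2_eq_square algebra_simps)
      then show ?thesis using mult_mono[OF d s] e0 by simp
    qed
    have "\<bar>(\<integral>x. (?\<phi> i x)\<^sup>2 \<partial>torus) - (\<integral>x. (?\<psi> i x)\<^sup>2 \<partial>torus)\<bar> = \<bar>\<integral>x. (?\<phi> i x)\<^sup>2 - (?\<psi> i x)\<^sup>2 \<partial>torus\<bar>"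
      using int by simp
    also have "\<dots> \<le> (\<integral>x. \<bar>(?\<phi> i x)\<^sup>2 - (?\<psi> i x)\<^sup>2\<bar> \<partial>torus)" by (rule integral_abs_bound)
    also have "\<dots> \<le> (\<integral>x. e * (2 + (?\<psi> i x)\<^sup>2) \<partial>torus)"
      using int by (intro integral_mono pt integrable_abs Bochner_Integration.integrable_diff integrable_mult_right) auto
    also have "\<dots> = e * (2 + (\<integral>x. (?\<psi> i x)\<^sup>2 \<partial>torus))"
      using int by (simp add: torus.prob_space)
    finally show ?thesis .
  qed
  have "massM \<alpha> n N om = (\<Sum>i=1..n. (\<integral>x. (?\<phi> i x)\<^sup>2 \<partial>torus) - (\<integral>x. (?\<psi> i x)\<^sup>2 \<partial>torus))"
    unfolding massM_eq sum_subtractf f ..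
  then have "\<bar>massM \<alpha> n N om\<bar> \<le> (\<Sum>i=1..n. \<bar>(\<integral>x. (?\<phi> i x)\<^sup>2 \<partial>torus) - (\<integral>x. (?\<psi> i x)\<^sup>2 \<partial>torus)\<bar>)"
    by (simp only: sum_abs)
  also have "\<dots> \<le> (\<Sum>i=1..n. e * (2 + (\<integral>x. (?\<psi> i x)\<^sup>2 \<partial>torus)))" by (rule sum_mono[OF one])
  also have "\<dots> = e * (2 * real n + real n * \<sigma>)"
    unfolding sum_distrib_left[symmetric] sum.distrib f \<sigma>_def by simp
  also have "\<dots> \<le> e * (3 * (real n * \<sigma>))"
  proof (rule mult_left_mono[OF _ e0])
    have "real n * 1 \<le> real n * \<sigma>" using \<sigma> by (intro mult_left_mono) auto
    then show "2 * real n + real n * \<sigma> \<le> 3 * (real n * \<sigma>)" by linarith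
  qed
  also have "\<dots> \<le> 1" by (rule de)
  finally show ?thesis .
qed

text \<open>
  Dividing the Fourier coefficients of \<open>F\<close> by the weights of the modes prescribes the field. Parseval then
  gives both its mass and its cost; the cross terms drop out because \<open>u\<close> and \<open>v\<close> are orthogonal.
\<close>

lemma concentrated_field:
  fixes F :: "real ^ 'd::finite => real" and A :: "int ^ 'd => real" and u v :: "nat => real"
  assumes \<alpha>: "\<alpha> \<ge> 0"
    and F: "\<And>x. of_real (F x) = (\<Sum>l\<in>lattice_ball N. of_real (A l) * fourier_char l x)"
    and uv: "(\<Sum>i=1..n. u i * v i) = 0"
  shows "\<exists>f :: 'd index => real. (\<forall>i x. comp_field \<alpha> N f i x = u i * F x + v i) \<and>
    (\<Sum>i=1..n. \<integral>x. (comp_field \<alpha> N f i x)\<^sup>2 \<partial>torus) = (\<Sum>i=1..n. (u i)\<^sup>2) * (\<integral>x. (F x)\<^sup>2 \<partial>torus) + (\<Sum>i=1..n. (v i)\<^sup>2) \<and>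
    (\<Sum>p\<in>vars n N. (f p)\<^sup>2) \<le> (1 + (real N)\<^sup>2) powr \<alpha> * ((\<Sum>i=1..n. (u i)\<^sup>2) * (\<integral>x. (F x)\<^sup>2 \<partial>torus) + (\<Sum>i=1..n. (v i)\<^sup>2))"
proof -
  let ?L = "lattice_ball N :: (int ^ 'd) set"
  define B where "B i l = u i * A l + (if l = 0 then v i else 0)" for i and l :: "int ^ 'd"
  define f :: "'d index => real" where "f p = (if snd (snd p) then bracket2 (fst (snd p)) powr (\<alpha> / 2) * B (fst p) (fst (snd p)) else 0)" for p
  have G: "of_real (u i * F x + v i) = (\<Sum>l\<in>?L. of_real (B i l) * fourier_char l x)" for i x
  proof -
    have "(\<Sum>l\<in>?L. of_real (B i l) * fourier_char l x) =
        of_real (u i) * (\<Sum>l\<in>?L. of_real (A l) * fourier_char l x) + (\<Sum>l\<in>?L. (if l = 0 then of_real (v i) else 0))"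
      unfolding B_def sum_distrib_left sum.distrib[symmetric]
      by (intro sum.cong refl) (auto simp: algebra_simps)
    also have "(\<Sum>l\<in>?L. (if l = 0 then complex_of_real (v i) else 0)) = of_real (v i)"
      using zero_in_lattice_ball[of N] by (simp add: sum.delta finite_lattice_ball)
    finally show ?thesis by (simp add: F)
  qed
  have ff: "comp_field \<alpha> N f i x = u i * F x + v i" for i x
  proof -
    have "comp_field \<alpha> N f i x = (\<Sum>l\<in>?L. B i l * Re (fourier_char l x))"
      unfolding field_def sum_modes
    proof (intro sum.cong refl)
      fix l :: "int ^ 'd"
      have "bracket2 l powr (- \<alpha> / 2) * bracket2 l powr (\<alpha> / 2) = 1" by (simp add: powr_add[symmetric])
      then show "mode \<alpha> (l, True) x * f (i, l, True) + mode \<alpha> (l, False) x * f (i, l, False) = B i l * Re (fourier_char l x)"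
        by (simp add: mode_def f_def mult_ac)
    qed
    also have "\<dots> = Re (\<Sum>l\<in>?L. of_real (B i l) * fourier_char l x)" by simp
    also have "\<dots> = u i * F x + v i" unfolding G[symmetric] by simp
    finally show ?thesis .
  qed
  have I: "(\<integral>x. (u i * F x + v i)\<^sup>2 \<partial>torus) = (\<Sum>l\<in>?L. (B i l)\<^sup>2)" for i
    by (rule trigonometric_sum_integrals(2)[OF finite_lattice_ball G])
  have IF: "(\<integral>x. (F x)\<^sup>2 \<partial>torus) = (\<Sum>l\<in>?L. (A l)\<^sup>2)" by (rule trigonometric_sum_integrals(2)[OF finite_lattice_ball F])
  have Bsq: "(\<Sum>l\<in>?L. (B i l)\<^sup>2) = (u i)\<^sup>2 * (\<integral>x. (F x)\<^sup>2 \<partial>torus) + (v i)\<^sup>2 + 2 * A 0 * (u i * v i)" for i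
  proof -
    have "(\<Sum>l\<in>?L. (B i l)\<^sup>2) = (\<Sum>l\<in>?L. (u i)\<^sup>2 * (A l)\<^sup>2 + (if l = 0 then (v i)\<^sup>2 + 2 * A 0 * (u i * v i) else 0))"
      by (intro sum.cong refl) (auto simp: B_def power2_eq_square algebra_simps)
    then show ?thesis
      unfolding IF
      by (simp add: sum.distrib sum.delta finite_lattice_ball sum_distrib_left)
  qed
  have tot: "(\<Sum>i=1..n. \<Sum>l\<in>?L. (B i l)\<^sup>2) = (\<Sum>i=1..n. (u i)\<^sup>2) * (\<integral>x. (F x)\<^sup>2 \<partial>torus) + (\<Sum>i=1..n. (v i)\<^sup>2)"
    unfolding Bsq sum.distrib sum_distrib_left[symmetric] sum_distrib_right[symmetric] uv by simp
  have "(\<Sum>p\<in>vars n N. (f p)\<^sup>2) = (\<Sum>i=1..n. \<Sum>j\<in>modes N. (f (i, j))\<^sup>2)"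
    unfolding vars_def by (simp add: sum.cartesian_product)
  also have "\<dots> = (\<Sum>i=1..n. \<Sum>l\<in>?L. bracket2 l powr \<alpha> * (B i l)\<^sup>2)"
    unfolding sum_modes by (intro sum.cong refl) (simp add: f_def power_mult_distrib power2_eq_square[of "_ powr _"] flip: powr_add)
  also have "\<dots> \<le> (\<Sum>i=1..n. \<Sum>l\<in>?L. (1 + (real N)\<^sup>2) powr \<alpha> * (B i l)\<^sup>2)"
  proof (intro sum_mono mult_right_mono powr_mono2)
    fix l :: "int ^ 'd" assume "l \<in> ?L"
    then have "(norm (rvec l))\<^sup>2 \<le> (real N)\<^sup>2" by (intro power_mono) (auto simp: lattice_ball_def)
    then show "bracket2 l \<le> 1 + (real N)\<^sup>2" by (simp add: bracket2_def)
  qed (use \<alpha> in auto)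
  also have "\<dots> = (1 + (real N)\<^sup>2) powr \<alpha> * ((\<Sum>i=1..n. (u i)\<^sup>2) * (\<integral>x. (F x)\<^sup>2 \<partial>torus) + (\<Sum>i=1..n. (v i)\<^sup>2))"
    unfolding tot[symmetric] by (simp add: sum_distrib_left)
  finally have cost: "(\<Sum>p\<in>vars n N. (f p)\<^sup>2) \<le> \<dots>" .
  show ?thesis using ff cost I tot by (intro exI[of _ f]) simp
qed

text \<open>
  A profile at scale \<open>1 / m\<close> whose Wick mass vanishes gains \<open>\<sigma>\<^sup>k\<^sup>/\<^sup>2 m\<^sup>d\<close> with \<open>k \<ge> 4\<close>. Its Cameron-Martin
  cost and the entropy of the box are of order \<open>\<sigma> m\<^sup>d\<close>, because the variance \<open>\<sigma>\<close> grows at least like \<open>log m\<close>.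
\<close>

lemma cutoff_not_integrable:
  fixes \<beta> :: "nat => nat"
  assumes \<alpha>: "\<alpha> = real CARD('d::finite) / 2" and n: "n \<ge> 2" and a: "a ~= 0"
    and \<beta>: "\<beta> 1 ~= 0" "\<beta> 2 ~= 0" and k4: "(\<Sum>i=1..n. \<beta> i) \<ge> 4"
    and n22: "\<not> (a < 0 \<and> \<beta> 1 = 2 \<and> \<beta> 2 = 2 \<and> (\<forall>i\<in>{3..n}. \<beta> i = 0))" and K: "K > 0" and b: "b > 0"
  shows "(\<integral>\<^sup>+om. ennreal (exp (a * limX \<alpha> n \<beta> om - K * \<bar>limM \<alpha> n om\<bar> powr b)) \<partial>(gauss :: ('d index => real) measure)) = \<infinity>"
proof (rule ennreal_infinite_if_unbounded)
  fix B :: real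
  let ?d = "CARD('d)" and ?k = "\<Sum>i=1..n. \<beta> i"
  have \<alpha>0: "\<alpha> \<ge> 0" by (simp add: \<alpha>)
  have k3: "?k \<ge> 3" using k4 by linarith
  obtain u v :: "nat => real" and \<epsilon> c C where e: "\<epsilon> > 0" "c > 0" and u: "(\<Sum>i=1..n. (u i)\<^sup>2) > 0" and uv: "(\<Sum>i=1..n. u i * v i) = 0"
    and vn: "(\<Sum>i=1..n. (v i)\<^sup>2) < n"
    and growth: "\<forall>\<tau>\<ge>0. \<forall>\<delta>. (\<forall>i\<in>{1..n}. \<bar>\<delta> i\<bar> \<le> \<epsilon>) --> c * \<tau> ^ 4 - C \<le> a * (\<Prod>i=1..n. He (\<beta> i) (u i * \<tau> + v i + \<delta> i))"
    using growth_direction[OF n a \<beta> k3 disjI2[OF conjI[OF refl conjI[OF k4 n22]]]]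
    by (elim exE conjE) (rule that; assumption)
  define U where "U = (\<Sum>i=1..n. (u i)\<^sup>2)"
  define V where "V = (\<Sum>i=1..n. (v i)\<^sup>2)"
  define \<kappa> where "\<kappa> = (real n - V) / U"
  have U: "U > 0" using u by (simp add: U_def)
  have \<kappa>: "\<kappa> > 0" "U * \<kappa> + V = real n" using vn U by (simp_all add: \<kappa>_def V_def)
  obtain Cb where Cb: "Cb \<ge> 0" "\<And>N \<eta> f :: 'd index => real. (\<forall>om\<in>box_set n N f \<eta>. \<bar>massM \<alpha> n N om\<bar> \<le> 1) ==>
    integrable gauss (\<lambda>om. \<bar>limM \<alpha> n om\<bar> powr b * indicator (box_set n N f \<eta>) om) \<and>
    (\<integral>om. \<bar>limM \<alpha> n om\<bar> powr b * indicator (box_set n N f \<eta>) om \<partial>gauss) \<le> Cb * measure gauss (box_set n N f \<eta>)"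
    using box_mass_moment[OF \<alpha> _ b, of n 1] n by auto
  obtain c1 where c1: "c1 > 0" "\<And>J. c1 * real J \<le> wick_var TYPE('d) \<alpha> (?d * 2 ^ J)"
    using wick_var_ge_log[where 'd='d, OF \<alpha>] by blast
  (* the constants below bound the gain, the Cameron-Martin cost, the dimension and the logarithm of the width of the box *)
  define c2 where "c2 = c * (\<kappa>\<^sup>2 * (1 / 2 ^ ?d) ^ 3)"
  define c3 where "c3 = (2 * real ?d) ^ ?d * real n"
  define c5 where "c5 = 2 * (3 * real ?d) ^ ?d"
  define c4 where "c4 = real n * c5"
  define c6 where "c6 = \<bar>ln (3 * real n * c5 / min \<epsilon> 1)\<bar>"
  define c8 where "c8 = c6 + 1 + real ?d * (2 + 1 / c1)"
  have c2: "c2 > 0" unfolding c2_def using e \<kappa> by (intro mult_pos_pos) auto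
  have c5: "c5 > 0" by (simp add: c5_def)
  have c48: "c3 \<ge> 0" "c4 \<ge> 0" "c8 \<ge> 0" using c1 c5 by (simp_all add: c3_def c4_def c8_def c6_def)
  define E where "E = c3 + 2 * c4 + c4 * c8 + 1"
  have E: "E \<ge> 1" unfolding E_def using c48 mult_nonneg_nonneg[OF c48(2,3)] by linarith
  obtain J :: nat where J: "2 * \<bar>C\<bar> / c2 + 2 * E / c2 / c1 + \<bar>B\<bar> + K * Cb \<le> real J" using real_arch_simple by blast
  have J': "2 * \<bar>C\<bar> / c2 \<le> real J" "2 * E / c2 / c1 \<le> real J" "\<bar>B\<bar> + K * Cb \<le> real J"
  proof -
    have "0 \<le> 2 * \<bar>C\<bar> / c2" "0 \<le> 2 * E / c2 / c1" "0 \<le> K * Cb" using c2 E c1 K Cb by simp_all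
    then show "2 * \<bar>C\<bar> / c2 \<le> real J" "2 * E / c2 / c1 \<le> real J" "\<bar>B\<bar> + K * Cb \<le> real J" using J by linarith+
  qed
  define m :: nat where "m = 2 ^ J"
  define N where "N = ?d * (2 * m)"
  define M where "M = real ((2 * m + 1) ^ ?d)"
  define \<sigma> where "\<sigma> = wick_var TYPE('d) \<alpha> N"
  define s where "s = sqrt \<sigma>"
  have \<sigma>1: "\<sigma> \<ge> 1" unfolding \<sigma>_def by (rule wick_var_ge_1)
  have s1: "s \<ge> 1" and s2: "s\<^sup>2 = \<sigma>" using \<sigma>1 by (simp_all add: s_def)
  have \<sigma>J: "c1 * real J \<le> \<sigma>"
  proof -
    have "c1 * real J \<le> c1 * real (Suc J)" using c1(1) by (intro mult_left_mono) auto
    also have "\<dots> \<le> wick_var TYPE('d) \<alpha> (?d * 2 ^ Suc J)" by (rule c1(2))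
    finally show ?thesis by (simp add: \<sigma>_def N_def m_def)
  qed
  have m1: "m \<ge> 1" by (simp add: m_def)
  have d1: "?d \<ge> 1" by (simp add: Suc_leI)
  have M1: "M \<ge> 1" and JM: "real J \<le> M"
  proof -
    have "2 * m + 1 \<le> (2 * m + 1) ^ ?d" using d1 by (intro self_le_power) auto
    then have h: "real (2 * m + 1) \<le> M" unfolding M_def of_nat_le_iff .
    then show "M \<ge> 1" by simp
    have "J < 2 ^ J" by (rule less_exp)
    then have "J \<le> 2 * m + 1" unfolding m_def by linarith
    then have "real J \<le> real (2 * m + 1)" by (simp only: of_nat_le_iff)
    then show "real J \<le> M" using h by (rule order_trans)
  qed
  obtain F :: "real ^ 'd => real" and A where FA: "continuous_on UNIV F \<and> (\<forall>x. F x \<ge> 0) \<and>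
    (\<forall>x. of_real (F x) = (\<Sum>l\<in>lattice_ball N. of_real (A l) * fourier_char l x)) \<and>
    (\<integral>x. (F x)\<^sup>2 \<partial>torus) > 0 \<and> (\<integral>x. (F x)\<^sup>2 \<partial>torus) \<le> 1 / M \<and> (1 / 2 ^ ?d) ^ 3 / M \<le> (\<integral>x. F x ^ 4 \<partial>torus)"
    using fejer_profile[of m, where 'd='d, folded M_def N_def] by (elim exE) (rule that)
  have F: "continuous_on UNIV F" "\<And>x. F x \<ge> 0"
    and rep: "\<And>x. of_real (F x) = (\<Sum>l\<in>lattice_ball N. of_real (A l) * fourier_char l x)"
    and I2: "(\<integral>x. (F x)\<^sup>2 \<partial>torus) > 0" "(\<integral>x. (F x)\<^sup>2 \<partial>torus) \<le> 1 / M"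
    and I4: "(1 / 2 ^ ?d) ^ 3 / M \<le> (\<integral>x. F x ^ 4 \<partial>torus)"
    using FA by blast+
  define I where "I = (\<integral>x. (F x)\<^sup>2 \<partial>torus)"
  define lam where "lam = sqrt (\<kappa> / I)"
  have I: "I > 0" "I \<le> 1 / M" using I2 by (simp_all add: I_def)
  have lam: "lam \<ge> 0" "lam\<^sup>2 * I = \<kappa>" using I \<kappa>(1) by (simp_all add: lam_def)
  define \<tau> where "\<tau> x = lam * F x" for x
  have \<tau>: "continuous_on UNIV \<tau>" "\<And>x. \<tau> x \<ge> 0"
    unfolding \<tau>_def using F lam by (auto intro!: continuous_intros)
  have uvs: "(\<Sum>i=1..n. (s * (u i * lam)) * (s * v i)) = 0"
  proof -
    have "(\<Sum>i=1..n. (s * (u i * lam)) * (s * v i)) = (s * s * lam) * (\<Sum>i=1..n. u i * v i)"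
      unfolding sum_distrib_left by (intro sum.cong refl) simp
    then show ?thesis unfolding uv by simp
  qed
  have U': "(\<Sum>i=1..n. (s * (u i * lam))\<^sup>2) = \<sigma> * lam\<^sup>2 * U" and V': "(\<Sum>i=1..n. (s * v i)\<^sup>2) = \<sigma> * V"
    unfolding U_def V_def sum_distrib_left s2[symmetric] by (intro sum.cong refl; simp add: power_mult_distrib)+
  have tot: "(\<Sum>i=1..n. (s * (u i * lam))\<^sup>2) * (\<integral>x. (F x)\<^sup>2 \<partial>torus) + (\<Sum>i=1..n. (s * v i)\<^sup>2) = real n * \<sigma>"
  proof -
    have "\<sigma> * lam\<^sup>2 * U * I + \<sigma> * V = \<sigma> * (U * (lam\<^sup>2 * I) + V)" by (simp add: algebra_simps)
    then show ?thesis unfolding U' V' I_def[symmetric] lam(2) \<kappa>(2) by (simp add: mult.commute)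
  qed
  obtain f :: "'d index => real" where f: "\<And>i x. comp_field \<alpha> N f i x = s * (u i * lam) * F x + s * v i"
    and fm: "(\<Sum>i=1..n. \<integral>x. (comp_field \<alpha> N f i x)\<^sup>2 \<partial>torus) = real n * \<sigma>"
    and fc: "(\<Sum>p\<in>vars n N. (f p)\<^sup>2) \<le> (1 + (real N)\<^sup>2) powr \<alpha> * (real n * \<sigma>)"
    using concentrated_field[OF \<alpha>0 rep uvs] unfolding tot by blast
  let ?M = "modes N :: ((int ^ 'd) \<times> bool) set"
  have cM1: "card ?M \<ge> 1" using card_mono[OF finite_modes, of "{(0 :: int ^ 'd, True)}" N] by simp
  have N1: "1 \<le> real N"
  proof -
    have "1 * (2 * 1) \<le> ?d * (2 * m)" using d1 m1 by (intro mult_mono) auto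
    then show ?thesis unfolding N_def by linarith
  qed
  have Nm: "2 * real N \<le> 2 * real ?d * real (2 * m + 1)" "3 * real N \<le> 3 * real ?d * real (2 * m + 1)"
    by (simp_all add: N_def algebra_simps)
  have cM: "real (card ?M) \<le> c5 * M"
  proof -
    have "card ?M = 2 * card (lattice_ball N :: (int ^ 'd) set)" by (simp add: card_cartesian_product)
    then have "real (card ?M) \<le> 2 * real ((2 * N + 1) ^ ?d)"
      using of_nat_mono[OF card_lattice_ball[of N, where 'd='d], where 'a = real] by simp
    also have "real ((2 * N + 1) ^ ?d) = (2 * real N + 1) ^ ?d"
      by (simp only: of_nat_power of_nat_add of_nat_mult of_nat_numeral of_nat_1)
    also have "(2 * real N + 1) ^ ?d \<le> (3 * real ?d * real (2 * m + 1)) ^ ?d"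
      using N1 Nm(2) by (intro power_mono) linarith+
    also have "\<dots> = (3 * real ?d) ^ ?d * M" by (simp only: power_mult_distrib M_def of_nat_power)
    finally show ?thesis by (simp add: c5_def)
  qed
  define \<eta> where "\<eta> = min \<epsilon> 1 / (3 * real n * \<sigma> * real (card ?M))"
  define w where "w = min \<epsilon> 1"
  have w: "w > 0" "w \<le> 1" "w \<le> \<epsilon>" using e by (simp_all add: w_def)
  have n\<sigma>: "1 \<le> 3 * real n * \<sigma>"
  proof -
    have "1 * 1 \<le> (3 * real n) * \<sigma>" using n \<sigma>1 by (intro mult_mono) auto
    then show ?thesis by simp
  qed
  have \<eta>M: "real (card ?M) * \<eta> = w / (3 * real n * \<sigma>)"
  proof -
    have "real (card ?M) ~= 0" using cM1 by linarith
    then show ?thesis unfolding \<eta>_def w_def[symmetric] by simp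
  qed
  have dd: "w / (3 * real n * \<sigma>) \<le> w" "w / (3 * real n * \<sigma>) \<le> 1 / (3 * real n * \<sigma>)"
  proof -
    have X: "0 < 3 * real n * \<sigma>" using n\<sigma> by linarith
    have "w * 1 \<le> w * (3 * real n * \<sigma>)" using n\<sigma> w(1) by (intro mult_left_mono) auto
    then show "w / (3 * real n * \<sigma>) \<le> w" by (intro iffD2[OF pos_divide_le_eq[OF X]]) simp
    show "w / (3 * real n * \<sigma>) \<le> 1 / (3 * real n * \<sigma>)" using w(2) X by (intro divide_right_mono) auto
  qed
  have \<eta>0: "\<eta> > 0" unfolding \<eta>_def w_def[symmetric] using w(1) cM1 n \<sigma>1 by (intro divide_pos_pos mult_pos_pos) auto
  have \<eta>1: "\<eta> \<le> 1"
  proof -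
    have "1 * \<eta> \<le> real (card ?M) * \<eta>" using \<eta>0 cM1 by (intro mult_right_mono) auto
    then show ?thesis using \<eta>M dd w by linarith
  qed
  have massb: "\<bar>massM \<alpha> n N om\<bar> \<le> 1" if "om \<in> box_set n N f \<eta>" for om
  proof (rule box_mass_bound[OF \<alpha>0 that])
    show "real (card ?M) * \<eta> \<le> 1 / (3 * real n * wick_var TYPE('d) \<alpha> N)" unfolding \<eta>M \<sigma>_def[symmetric] by (rule dd)
    show "(\<Sum>i=1..n. \<integral>x. (comp_field \<alpha> N f i x)\<^sup>2 \<partial>torus) = real n * wick_var TYPE('d) \<alpha> N" unfolding \<sigma>_def[symmetric] by (rule fm)
  qed (use n \<eta>0 in auto)
  define g where "g = s ^ ?k * (c * (\<integral>x. \<tau> x ^ 4 \<partial>torus) - C)"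
  have gain: "g \<le> a * wickX \<alpha> n \<beta> N om" if "om \<in> box_set n N f \<eta>" for om
    unfolding g_def s_def \<sigma>_def
  proof (rule box_gain[OF \<alpha>0 growth _ \<tau> _ that])
    show "comp_field \<alpha> N f i x = sqrt (wick_var TYPE('d) \<alpha> N) * (u i * \<tau> x + v i)" for i x
      unfolding f \<sigma>_def[symmetric] s_def[symmetric] \<tau>_def by (simp add: algebra_simps)
    show "real (card ?M) * \<eta> \<le> \<epsilon>" unfolding \<eta>M using dd(1) w by linarith
  qed
  have G: "(\<lambda>om. K * \<bar>limM \<alpha> n om\<bar> powr b) \<in> borel_measurable (gauss :: ('d index => real) measure)"
  proof -
    have "limM \<alpha> n \<in> borel_measurable (gauss :: ('d index => real) measure)"
      unfolding limM_def[abs_def]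
      by (intro borel_measurable_lim_metric all_moments_measurable[OF all_moments_gpoly[OF gpoly_massM]])
    then show ?thesis by measurable
  qed
  have mb: "\<forall>om\<in>box_set n N f \<eta>. \<bar>massM \<alpha> n N om\<bar> \<le> 1" using massb by blast
  let ?p = "measure gauss (box_set n N f \<eta>)"
  have key: "ennreal (exp (g - K * Cb) * ?p) \<le>
      (\<integral>\<^sup>+om. ennreal (exp (a * limX \<alpha> n \<beta> om - K * \<bar>limM \<alpha> n om\<bar> powr b)) \<partial>(gauss :: ('d index => real) measure))"
  proof (rule box_lower_bound[OF \<alpha> _ G _ _ gain])
    show "2 \<le> ?k" using k4 by linarith
    show "integrable gauss (\<lambda>om. K * \<bar>limM \<alpha> n om\<bar> powr b * indicator (box_set n N f \<eta>) om)"
      unfolding mult.assoc by (intro integrable_mult_right conjunct1[OF Cb(2)[OF mb]])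
    have "K * (\<integral>om. \<bar>limM \<alpha> n om\<bar> powr b * indicator (box_set n N f \<eta>) om \<partial>gauss) \<le> K * (Cb * ?p)"
      using K by (intro mult_left_mono conjunct2[OF Cb(2)[OF mb]]) auto
    then show "(\<integral>om. K * \<bar>limM \<alpha> n om\<bar> powr b * indicator (box_set n N f \<eta>) om \<partial>gauss) \<le> K * Cb * ?p"
      by (simp add: mult.assoc)
  qed
  define q where "q = card (vars n N :: 'd index set)"
  have q: "real q \<le> c4 * M"
  proof -
    have "real q = real n * real (card ?M)" by (simp add: q_def vars_def card_cartesian_product)
    also have "\<dots> \<le> real n * (c5 * M)" by (intro mult_left_mono cM) auto
    finally show ?thesis by (simp add: c4_def)
  qed
  have gain_g: "\<sigma>\<^sup>2 * (c2 * M / 2) \<le> g"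
  proof -
    have "c2 * M \<le> c * (\<integral>x. \<tau> x ^ 4 \<partial>torus)"
    proof -
      have "(\<integral>x. \<tau> x ^ 4 \<partial>torus) = lam ^ 4 * (\<integral>x. F x ^ 4 \<partial>torus)" by (simp add: \<tau>_def power_mult_distrib)
      moreover have "\<kappa> * M \<le> lam\<^sup>2"
      proof -
        have "\<kappa> * M = lam\<^sup>2 * (I * M)" using lam(2) by simp
        also have "\<dots> \<le> lam\<^sup>2 * 1" using I M1 by (intro mult_left_mono) (auto simp: pos_le_divide_eq)
        finally show ?thesis by simp
      qed
      then have "(\<kappa> * M)\<^sup>2 \<le> (lam\<^sup>2)\<^sup>2" using \<kappa>(1) M1 by (intro power_mono) auto
      then have l4: "\<kappa>\<^sup>2 * M\<^sup>2 \<le> lam ^ 4" by (simp add: power_mult_distrib flip: power_mult)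
      have "(\<kappa>\<^sup>2 * M\<^sup>2) * ((1 / 2 ^ ?d) ^ 3 / M) \<le> lam ^ 4 * (\<integral>x. F x ^ 4 \<partial>torus)"
        using M1 by (intro mult_mono l4 I4) auto
      moreover have "(\<kappa>\<^sup>2 * M\<^sup>2) * ((1 / 2 ^ ?d) ^ 3 / M) = \<kappa>\<^sup>2 * (1 / 2 ^ ?d) ^ 3 * M"
        using M1 by (simp add: power2_eq_square)
      ultimately have "c * (\<kappa>\<^sup>2 * (1 / 2 ^ ?d) ^ 3 * M) \<le> c * (\<integral>x. \<tau> x ^ 4 \<partial>torus)"
        using e(2) by (intro mult_left_mono) auto
      then show ?thesis by (simp add: c2_def)
    qed
    moreover have "C \<le> c2 * M / 2"
    proof -
      have "2 * \<bar>C\<bar> / c2 \<le> M" using J'(1) JM by linarith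
      then have "2 * \<bar>C\<bar> \<le> M * c2" by (rule iffD1[OF pos_divide_le_eq[OF c2]])
      then show ?thesis using abs_ge_self[of C] by (simp add: mult.commute)
    qed
    ultimately have h: "c2 * M / 2 \<le> c * (\<integral>x. \<tau> x ^ 4 \<partial>torus) - C" by linarith
    have "\<sigma>\<^sup>2 \<le> s ^ ?k"
    proof -
      have "\<sigma>\<^sup>2 = s ^ 4" unfolding s2[symmetric] by (simp flip: power_mult)
      also have "\<dots> \<le> s ^ ?k" using s1 k4 by (intro power_increasing) auto
      finally show ?thesis .
    qed
    then show ?thesis unfolding g_def using h c2 M1 s1 by (intro mult_mono) auto
  qed
  have cost: "(\<Sum>p\<in>vars n N. (f p)\<^sup>2) \<le> \<sigma> * (c3 * M)"
  proof -
    have "(1 + (real N)\<^sup>2) powr \<alpha> \<le> ((2 * real N)\<^sup>2) powr \<alpha>"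
    proof (rule powr_mono2[OF \<alpha>0])
      have "1 \<le> (real N)\<^sup>2" by (rule one_le_power[OF N1])
      then show "1 + (real N)\<^sup>2 \<le> (2 * real N)\<^sup>2" by (simp add: power_mult_distrib)
    qed simp
    also have "\<dots> = (2 * real N) ^ ?d"
    proof -
      have "((2 * real N)\<^sup>2) powr \<alpha> = ((2 * real N) powr 2) powr \<alpha>" using N1 by simp
      also have "\<dots> = (2 * real N) powr (real ?d)" unfolding powr_powr by (simp add: \<alpha>)
      also have "\<dots> = (2 * real N) ^ ?d" using N1 by (intro powr_realpow) auto
      finally show ?thesis .
    qed
    also have "\<dots> \<le> (2 * real ?d * real (2 * m + 1)) ^ ?d" using N1 Nm(1) by (intro power_mono) auto
    also have "\<dots> = (2 * real ?d) ^ ?d * M" by (simp only: power_mult_distrib M_def of_nat_power)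
    finally have "(1 + (real N)\<^sup>2) powr \<alpha> * (real n * \<sigma>) \<le> ((2 * real ?d) ^ ?d * M) * (real n * \<sigma>)"
      using \<sigma>1 by (intro mult_right_mono) auto
    then show ?thesis using fc by (simp add: c3_def mult_ac)
  qed
  have ln\<eta>: "- ln \<eta> \<le> c8 * \<sigma>"
  proof -
    have "- ln \<eta> = ln (1 / \<eta>)" using \<eta>0 by (simp add: ln_div)
    also have "1 / \<eta> = (3 * real n / w) * \<sigma> * real (card ?M)" unfolding \<eta>_def w_def[symmetric] by simp
    also have "ln \<dots> \<le> ln ((3 * real n / w) * \<sigma> * (c5 * M))"
    proof (rule ln_mono)
      have p: "0 < (3 * real n / w) * \<sigma>" using n w(1) \<sigma>1 by (intro mult_pos_pos divide_pos_pos) auto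
      then show "(3 * real n / w) * \<sigma> * real (card ?M) \<le> (3 * real n / w) * \<sigma> * (c5 * M)"
        using cM by (intro mult_left_mono) auto
      show "0 < (3 * real n / w) * \<sigma> * real (card ?M)" by (rule mult_pos_pos[OF p]) (use cM1 in linarith)
    qed
    also have "(3 * real n / w) * \<sigma> * (c5 * M) = (3 * real n * c5 / w) * (\<sigma> * M)" by simp
    also have "ln \<dots> = ln (3 * real n * c5 / w) + (ln \<sigma> + ln M)"
    proof -
      have lnm: "ln (x * y) = ln x + ln y" if "0 < x" "0 < y" for x y :: real
        using that by (simp add: ln_mult)
      have X: "0 < 3 * real n * c5 / w" using n c5 w(1) by (intro divide_pos_pos mult_pos_pos) auto
      have pos: "0 < \<sigma>" "0 < M" using \<sigma>1 M1 by linarith+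
      show ?thesis unfolding lnm[OF X mult_pos_pos[OF pos]] lnm[OF pos] ..
    qed
    also have "\<dots> \<le> c6 + (\<sigma> + real ?d * (2 + \<sigma> / c1))"
    proof -
      have "ln M = real ?d * ln (real (2 * m + 1))" unfolding M_def of_nat_power by (rule ln_realpow)
      also have "\<dots> \<le> real ?d * (2 + \<sigma> / c1)"
      proof (rule mult_left_mono)
        have "real (2 * m + 1) \<le> 3 * 2 ^ J" using one_le_power[of "2::real" J] by (simp add: m_def)
        then have "ln (real (2 * m + 1)) \<le> ln (3 * 2 ^ J)" by (intro ln_mono) auto
        also have "\<dots> = ln 3 + real J * ln 2" by (simp add: ln_mult ln_realpow)
        also have "\<dots> \<le> 2 + real J * 1"
          using ln_le_minus_one[of 3] ln_le_minus_one[of 2] by (intro add_mono mult_left_mono) auto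
        also have "real J \<le> \<sigma> / c1" using \<sigma>J c1(1) by (simp add: pos_le_divide_eq mult.commute)
        finally show "ln (real (2 * m + 1)) \<le> 2 + \<sigma> / c1" by simp
      qed simp
      finally have "ln M \<le> real ?d * (2 + \<sigma> / c1)" .
      moreover have "ln \<sigma> \<le> \<sigma>" using ln_le_minus_one[of \<sigma>] \<sigma>1 by linarith
      moreover have "ln (3 * real n * c5 / w) \<le> c6" by (simp add: c6_def w_def)
      ultimately show ?thesis by linarith
    qed
    also have "\<dots> \<le> c8 * \<sigma>"
    proof -
      have lin: "x + (z + (y + r)) \<le> x * z + z + (y * z + r)" if "0 \<le> x" "0 \<le> y" "1 \<le> z" for x y z r :: real
        using mult_left_mono[OF that(3,1)] mult_left_mono[OF that(3,2)] by linarith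
      have c8: "c8 * \<sigma> = c6 * \<sigma> + \<sigma> + (real ?d * 2 * \<sigma> + real ?d * (\<sigma> / c1))"
        by (simp add: c8_def algebra_simps)
      show ?thesis unfolding distrib_left c8 by (rule lin) (use \<sigma>1 in \<open>simp_all add: c6_def\<close>)
    qed
    finally show ?thesis .
  qed
  have "B \<le> exp (g - K * Cb) * ?p"
  proof -
    define S where "S = (\<Sum>p\<in>vars n N. (f p)\<^sup>2)"
    have entropy: "2 * real q - real q * ln \<eta> \<le> \<sigma> * M * (2 * c4 + c4 * c8)"
    proof -
      have ln0: "0 \<le> - ln \<eta>" using \<eta>0 \<eta>1 by simp
      have "real q * (- ln \<eta>) \<le> (c4 * M) * (c8 * \<sigma>)"
        using c48 M1 by (intro mult_mono q ln\<eta> ln0) auto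
      moreover have "real q \<le> (c4 * M) * \<sigma>"
      proof -
        have "(c4 * M) * 1 \<le> (c4 * M) * \<sigma>" using c48 M1 \<sigma>1 by (intro mult_left_mono) auto
        then show ?thesis using q by simp
      qed
      ultimately show ?thesis by (simp add: algebra_simps)
    qed
    have gE: "\<sigma> * M * E \<le> g"
    proof -
      have "2 * E / c2 / c1 * c1 \<le> real J * c1" using J'(2) c1(1) by (intro mult_right_mono) auto
      then have "2 * E / c2 \<le> \<sigma>" using \<sigma>J c1(1) by (simp add: mult.commute)
      then have "2 * E \<le> \<sigma> * c2" by (rule iffD1[OF pos_divide_le_eq[OF c2]])
      then have "(\<sigma> * M) * E \<le> (\<sigma> * M) * (\<sigma> * c2 / 2)" using \<sigma>1 M1 by (intro mult_left_mono) auto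
      also have "\<dots> = \<sigma>\<^sup>2 * (c2 * M / 2)" by (simp add: power2_eq_square)
      finally show ?thesis using gain_g by linarith
    qed
    have "\<sigma> * M * E = \<sigma> * (c3 * M) + \<sigma> * M * (2 * c4 + c4 * c8) + \<sigma> * M" by (simp add: E_def algebra_simps)
    then have "\<sigma> * M \<le> g - S - (2 * real q - real q * ln \<eta>)" using gE cost entropy unfolding S_def by linarith
    moreover have "1 * M \<le> \<sigma> * M" using \<sigma>1 M1 by (intro mult_right_mono) auto
    ultimately have "B \<le> g - K * Cb + (- S - 2 * real q + real q * ln \<eta>)" using J'(3) JM abs_ge_self[of B] by linarith
    also have "\<dots> \<le> exp \<dots>" using exp_ge_add_one_self[of "g - K * Cb + (- S - 2 * real q + real q * ln \<eta>)"] by linarith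
    also have "\<dots> = exp (g - K * Cb) * (\<eta> ^ q * exp (- S - 2 * real q))"
    proof -
      have "\<eta> ^ q = exp (real q * ln \<eta>)" using \<eta>0 by (simp add: exp_of_nat_mult)
      then show ?thesis by (simp add: exp_add[symmetric])
    qed
    also have "\<dots> \<le> exp (g - K * Cb) * ?p"
      unfolding q_def S_def by (intro mult_left_mono box_set_prob \<eta>0 \<eta>1) auto
    finally show ?thesis .
  qed
  then show "ennreal B \<le> (\<integral>\<^sup>+om. ennreal (exp (a * limX \<alpha> n \<beta> om - K * \<bar>limM \<alpha> n om\<bar> powr b)) \<partial>(gauss :: ('d index => real) measure))"
    by (rule order_trans[OF ennreal_leI key])
qed

section \<open>Integrability in the exceptional cases\<close>

text \<open>The two head estimates, fed into the tail bound.\<close>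

lemma cutoff_integrable:
  fixes \<beta> :: "nat => nat"
  assumes \<alpha>: "\<alpha> = real CARD('d::finite) / 2" and n: "n \<ge> 2" and a: "a ~= 0"
    and \<beta>: "\<beta> 1 ~= 0" "\<beta> 2 ~= 0"
    and cases: "(\<Sum>i=1..n. \<beta> i) = 3 \<or> (a < 0 \<and> \<beta> 1 = 2 \<and> \<beta> 2 = 2 \<and> (\<forall>i\<in>{3..n}. \<beta> i = 0))"
  shows "\<exists>K b. K > 0 \<and> b > 0 \<and>
    (\<integral>\<^sup>+om. ennreal (exp (a * limX \<alpha> n \<beta> om - K * \<bar>limM \<alpha> n om\<bar> powr b)) \<partial>(gauss :: ('d index => real) measure)) < \<infinity>"
proof -
  have n1: "n \<ge> 1" using n by linarith
  have "{1..n} = insert 1 (insert 2 {3..n})" using n by auto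
  then have sum: "(\<Sum>i=1..n. \<beta> i) = \<beta> 1 + \<beta> 2 + (\<Sum>i=3..n. \<beta> i)" by simp
  have k2: "(\<Sum>i=1..n. \<beta> i) \<ge> 2" using sum \<beta> by linarith
  have "\<exists>c0\<ge>0. \<forall>N m t. 1 \<le> m --> c0 * wick_var TYPE('d) \<alpha> N ^ 3 * m\<^sup>2 \<le> t -->
    emeasure gauss {om :: 'd index => real. t / 2 \<le> a * wickX \<alpha> n \<beta> N om \<and> \<bar>massM \<alpha> n N om\<bar> \<le> m + 1} \<le> ennreal (exp (- 2 * t))"
    using cases
  proof
    assume three: "(\<Sum>i=1..n. \<beta> i) = 3"
    then have "\<beta> 1 = 1 \<or> \<beta> 2 = 1" using sum \<beta> by linarith
    then obtain i0 where "i0 \<in> {1..n}" "\<beta> i0 = 1"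
    proof (cases "\<beta> 1 = 1")
      case True
      then show thesis using n by (intro that[of 1]) auto
    next
      case False
      then show thesis using n \<open>\<beta> 1 = 1 \<or> \<beta> 2 = 1\<close> by (intro that[of 2]) auto
    qed
    then show ?thesis
      by (intro exI[of _ "32 * a\<^sup>2 * (real n + 3)\<^sup>2"] conjI allI impI cubic_head[OF three _ _ a]) auto
  next
    assume "a < 0 \<and> \<beta> 1 = 2 \<and> \<beta> 2 = 2 \<and> (\<forall>i\<in>{3..n}. \<beta> i = 0)"
    then show ?thesis
      by (intro exI[of _ "4 * \<bar>a\<bar> * (real n + 3)"] conjI allI impI quartic_head[OF n]) (auto intro: mult_nonpos_nonneg)
  qed
  then obtain c0 where c0: "c0 \<ge> 0" "\<And>N m t. 1 \<le> m ==> c0 * wick_var TYPE('d) \<alpha> N ^ 3 * m\<^sup>2 \<le> t ==>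
    emeasure gauss {om :: 'd index => real. t / 2 \<le> a * wickX \<alpha> n \<beta> N om \<and> \<bar>massM \<alpha> n N om\<bar> \<le> m + 1} \<le> ennreal (exp (- 2 * t))"
    by blast
  obtain C where C: "C \<ge> 1" "\<And>m t. m \<ge> 1 ==> t \<ge> C * m ^ 4 ==>
    emeasure gauss {om :: 'd index => real. t \<le> a * limX \<alpha> n \<beta> om \<and> \<bar>limM \<alpha> n om\<bar> \<le> m} \<le> 3 * ennreal (exp (- 2 * t))"
    using tail_of_head[where 'd='d, OF \<alpha> n1 k2 c0(1,2)] by blast
  have mX: "(\<lambda>om. a * limX \<alpha> n \<beta> om) \<in> borel_measurable (gauss :: ('d index => real) measure)"
    unfolding limX_def
    by (intro borel_measurable_times borel_measurable_const borel_measurable_lim_metric all_moments_measurable[OF all_moments_wickX])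
  have mM: "limM \<alpha> n \<in> borel_measurable (gauss :: ('d index => real) measure)"
    unfolding limM_def[abs_def]
    by (intro borel_measurable_lim_metric all_moments_measurable[OF all_moments_gpoly[OF gpoly_massM]])
  from integrable_of_tail[OF mX mM C] show ?thesis
    using C(1) by (intro exI[of _ "16 * C"] exI[of _ 4]) auto
qed

theorem theorem2p2:
  fixes \<alpha> a :: real and n :: nat and \<beta> :: "nat \<Rightarrow> nat"
    and \<mu> :: "(nat \<Rightarrow> ('d::finite) distribution) measure"
  assumes "\<alpha> = real CARD('d) / 2"
    and "\<mu> = gauss_measure_prod \<alpha> n"
    and "a \<noteq> 0"
    and "n \<ge> 2"
    and "(\<Sum>i=1..n. \<beta> i) \<ge> 3"
    and "\<beta> 1 \<noteq> 0"
    and "\<beta> 2 \<noteq> 0"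
  shows "(\<integral>\<^sup>+\<Phi>. ennreal (exp (a * wick_integral \<alpha> n \<beta> \<Phi>)) \<partial>\<mu>) = \<infinity> \<and>
    ((\<exists>K b. K > 0 \<and> b > 0 \<and>
        (\<integral>\<^sup>+\<Phi>. ennreal (exp (a * wick_integral \<alpha> n \<beta> \<Phi>
            - K * \<bar>wick_mass \<alpha> n \<Phi>\<bar> powr b)) \<partial>\<mu>) < \<infinity>) \<longleftrightarrow>
      (\<Sum>i=1..n. \<beta> i) = 3 \<or>
      (a < 0 \<and> \<beta> 1 = 2 \<and> \<beta> 2 = 2 \<and> (\<forall>i\<in>{3..n}. \<beta> i = 0)))"
proof -
  have \<alpha>0: "\<alpha> \<ge> 0" using assms(1) by simp
  note transfer = transfer_integral[where 'd='d and a=a and n=n and \<beta>=\<beta>, OF \<alpha>0, folded assms(2)]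
  let ?good = "(\<Sum>i=1..n. \<beta> i) = 3 \<or> (a < 0 \<and> \<beta> 1 = 2 \<and> \<beta> 2 = 2 \<and> (\<forall>i\<in>{3..n}. \<beta> i = 0))"
  have i: "(\<integral>\<^sup>+\<Phi>. ennreal (exp (a * wick_integral \<alpha> n \<beta> \<Phi>)) \<partial>\<mu>) = \<infinity>"
    using transfer[where K=0 and b=1] exp_wick_not_integrable[OF assms(1,4,3,6,7,5)] by simp
  have ii: "(\<exists>K b. K > 0 \<and> b > 0 \<and>
      (\<integral>\<^sup>+\<Phi>. ennreal (exp (a * wick_integral \<alpha> n \<beta> \<Phi> - K * \<bar>wick_mass \<alpha> n \<Phi>\<bar> powr b)) \<partial>\<mu>) < \<infinity>) \<longleftrightarrow> ?good"
    (is "?L \<longleftrightarrow> _")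
  proof
    assume ?good
    then show ?L unfolding transfer by (rule cutoff_integrable[OF assms(1,4,3,6,7)])
  next
    assume ?L
    then obtain K b where K: "K > 0" "b > 0"
      "(\<integral>\<^sup>+om. ennreal (exp (a * limX \<alpha> n \<beta> om - K * \<bar>limM \<alpha> n om\<bar> powr b)) \<partial>(gauss :: ('d index => real) measure)) < \<infinity>"
      unfolding transfer by blast
    show ?good
    proof (rule ccontr)
      assume bad: "\<not> ?good"
      then have k4: "(\<Sum>i=1..n. \<beta> i) \<ge> 4" using assms(5) by linarith
      have n22: "\<not> (a < 0 \<and> \<beta> 1 = 2 \<and> \<beta> 2 = 2 \<and> (\<forall>i\<in>{3..n}. \<beta> i = 0))" using bad by blast
      show False using cutoff_not_integrable[OF assms(1,4,3,6,7) k4 n22 K(1,2)] K(3) by simp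
    qed
  qed
  show ?thesis using i ii by blast
qed

end
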